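(* Let $\alpha,\beta\in(0,\pi]$, $K\ge1$, and let $f:S_\alpha\to S_\beta=f(S_\alpha)$ be a $K$-quasiconformal homeomorphism. Then for all $x,y\in S_\alpha$, $$\frac{\beta}{c(K)^K\pi\sin(\beta/2)}\,w_{S_\alpha}(x,y)^K\le w_{S_\beta}(f(x),f(y))\le c(K)\left(\frac{\pi}{\alpha}\sin\frac{\alpha}{2}\right)^{1/K}w_{S_\alpha}(x,y)^{1/K},$$ where $c(K)=2\,\mathrm{arth}\big(\varphi_{K,2}(\mathrm{th}(1/2))\big)$.
   Context: For $\theta\in(0,2\pi)$, $S_\theta=\{z\in\mathbb{C}:0<\arg z<\theta\}$ is the open sector. For a domain $G$ and $x\in G$, $d_G(x)=\inf\{|x-z|:z\in\partial G\}$; $S^1(x,r)$ is the circle of center $x$ and radius $r$. For convex $G$, $w_G(x,y)=\frac{|x-y|}{\min\{\inf_{\tilde y\in\tilde Y}|x-\tilde y|,\ \inf_{\tilde x\in\tilde X}|y-\tilde x|\}}$ with $\tilde X=\{\tilde x\in S^{1}(x,2d_G(x)):(x+\tilde x)/2\in\partial G\}$ and $\tilde Y=\{\tilde y\in S^{1}(y,2d_G(y)):(y+\tilde y)/2\in\partial G\}$. A homeomorphism $f:G\to G'$ is $K$-quasiconformal if $\mathsf M(\Gamma)/K\le\mathsf M(f(\Gamma))\le K\mathsf M(\Gamma)$ for all curve families $\Gamma$ in $G$, $\mathsf M$ denoting conformal modulus. $\varphi_{K,2}(r)=1/\gamma_2^{-1}(K\gamma_2(1/r))$ for $0<r<1$,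 where $\gamma_2(1/r)=2\pi/\mu(r)$, $\mu(r)=\frac{\pi}{2}\frac{\mathcal K(\sqrt{1-r^2})}{\mathcal K(r)}$, $\mathcal K(r)=\int_0^1\frac{dx}{\sqrt{(1-x^2)(1-r^2x^2)}}$. *)

theory Defs
  imports "HOL-Analysis.Analysis"
begin

definition sector :: "real \<Rightarrow> complex set" where
  "sector \<theta> = {z. z \<noteq> 0 \<and> (\<exists>t. 0 < t \<and> t < \<theta> \<and> z = complex_of_real (cmod z) * cis t)}"

definition bdist :: "complex set \<Rightarrow> complex \<Rightarrow> real" where
  "bdist G x = infdist x (frontier G)"

definition tildeset :: "complex set \<Rightarrow> complex \<Rightarrow> complex set" where
  "tildeset G x = {x'. x' \<in> sphere x (2 * bdist G x) \<and> (x + x') / 2 \<in> frontier G}"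

definition wmetric :: "complex set \<Rightarrow> complex \<Rightarrow> complex \<Rightarrow> real" where
  "wmetric G x y = dist x y /
     min (Inf ((\<lambda>y'. dist x y') ` tildeset G y)) (Inf ((\<lambda>x'. dist y x') ` tildeset G x))"

type_synonym curve = "real set \<times> (real \<Rightarrow> complex)"

definition is_curve :: "curve \<Rightarrow> bool" where
  "is_curve c = (is_interval (fst c) \<and> fst c \<noteq> {} \<and> continuous_on (fst c) (snd c))"

definition var_on :: "(real \<Rightarrow> complex) \<Rightarrow> real \<Rightarrow> real \<Rightarrow> ennreal" where
  "var_on g a b = (SUP ts \<in> {ts. sorted ts \<and> set ts \<subseteq> {a..b}}.
      ennreal (\<Sum>i<length ts - 1. dist (g (ts ! i)) (g (ts ! Suc i))))"

definition loc_rectifiable :: "curve \<Rightarrow> bool" where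
  "loc_rectifiable c = (\<forall>a b. a \<le> b \<and> {a..b} \<subseteq> fst c \<longrightarrow> var_on (snd c) a b < \<infinity>)"

text \<open>Line integral with respect to arc length over the closed subpath on [a,b]:
  Lebesgue-Stieltjes integral with respect to the length function.\<close>
definition arc_integral :: "(complex \<Rightarrow> ennreal) \<Rightarrow> (real \<Rightarrow> complex) \<Rightarrow> real \<Rightarrow> real \<Rightarrow> ennreal" where
  "arc_integral \<rho> g a b =
     (\<integral>\<^sup>+ t. \<rho> (g t) * indicator {a..b} t
        \<partial>(interval_measure (\<lambda>t. enn2real (var_on g a (max a (min t b))))))"

definition line_integral_ds :: "(complex \<Rightarrow> ennreal) \<Rightarrow> curve \<Rightarrow> ennreal" where
  "line_integral_ds \<rho> c = (SUP ab \<in> {(a, b). a \<le> b \<and> {a..b} \<subseteq> fst c}.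
      arc_integral \<rho> (snd c) (fst ab) (snd ab))"

definition admissible :: "curve set \<Rightarrow> (complex \<Rightarrow> ennreal) \<Rightarrow> bool" where
  "admissible \<Gamma> \<rho> = (\<rho> \<in> borel_measurable borel \<and>
     (\<forall>c\<in>\<Gamma>. loc_rectifiable c \<longrightarrow> 1 \<le> line_integral_ds \<rho> c))"

definition modulus :: "curve set \<Rightarrow> ennreal" where
  "modulus \<Gamma> = (INF \<rho> \<in> {\<rho>. admissible \<Gamma> \<rho>}. \<integral>\<^sup>+ z. (\<rho> z)\<^sup>2 \<partial>lborel)"

definition curve_image :: "(complex \<Rightarrow> complex) \<Rightarrow> curve set \<Rightarrow> curve set" where
  "curve_image f \<Gamma> = (\<lambda>c. (fst c, f \<circ> snd c)) ` \<Gamma>"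

definition quasiconformal :: "real \<Rightarrow> complex set \<Rightarrow> complex set \<Rightarrow> (complex \<Rightarrow> complex) \<Rightarrow> bool" where
  "quasiconformal K G G' f = ((\<exists>g. homeomorphism G G' f g) \<and>
     (\<forall>\<Gamma>. (\<forall>c\<in>\<Gamma>. is_curve c \<and> snd c ` fst c \<subseteq> G) \<longrightarrow>
        modulus \<Gamma> / ennreal K \<le> modulus (curve_image f \<Gamma>) \<and>
        modulus (curve_image f \<Gamma>) \<le> ennreal K * modulus \<Gamma>))"

definition ellK :: "real \<Rightarrow> real" where
  "ellK r = integral {0..1} (\<lambda>x. 1 / sqrt ((1 - x\<^sup>2) * (1 - r\<^sup>2 * x\<^sup>2)))"

definition mu :: "real \<Rightarrow> real" where
  "mu r = pi / 2 * ellK (sqrt (1 - r\<^sup>2)) / ellK r"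

definition gamma2 :: "real \<Rightarrow> real" where
  "gamma2 s = 2 * pi / mu (1 / s)"

definition gamma2_inv :: "real \<Rightarrow> real" where
  "gamma2_inv v = (THE s. 1 < s \<and> gamma2 s = v)"

definition phiK2 :: "real \<Rightarrow> real \<Rightarrow> real" where
  "phiK2 K r = 1 / gamma2_inv (K * gamma2 (1 / r))"

definition cK :: "real \<Rightarrow> real" where
  "cK K = 2 * artanh (phiK2 K (tanh (1 / 2)))"

end

theory Submission
  imports Defs "HOL-Complex_Analysis.Complex_Analysis"
begin

text \<open>
  The power map of exponent \<open>p = \<pi> / \<theta>\<close> carries the sector onto the upper half plane, and there
  \<open>w\<close> is comparable with the pseudo-hyperbolic distance \<open>r\<close> of the image points:
  \<open>w \<le> r \<le> p sin (\<theta> / 2) w\<close>. It therefore suffices to bound \<open>r\<close> and the corresponding \<open>r'\<close> of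
  the image points in terms of each other.

  A Moebius map moves the two points to \<open>\<i> k\<close> and \<open>\<i>\<close>, where \<open>k = (1 - r) / (1 + r)\<close>. The
  Schwarz-Christoffel map \<open>F\<close> takes the half plane, slit along \<open>\<i> (0, k]\<close> and \<open>\<i> [1, \<infinity>)\<close>, onto the
  rectangle \<open>(0, A) \<times> (- B, B)\<close>, where \<open>A / (2 B) = \<mu>(k) / \<pi>\<close>. The preimages of the vertical
  segments are crosscuts that separate the two points; by length-area their modulus is at least
  \<open>A / (2 B)\<close>. A homeomorphism maps them to curves whose two ends approach the boundary and which
  meet the segment \<open>\<i> [k', 1]\<close> of the target, so pulling back the Euclidean metric of the target
  rectangle bounds the modulus of the image family by \<open>A' / (2 B')\<close>. Hence \<open>\<mu>(k) \<le> K \<mu>(k')\<close>, and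
  the same for the inverse map, and \<open>\<mu>(r) \<mu>(k) = \<pi>\<^sup>2 / 2\<close> turns this into \<open>\<mu>(r') \<le> K \<mu>(r)\<close>.

  With \<open>l(c) = \<mu>(e\<^bsup>-c\<^esup>)\<close>, the constant \<open>c(K)\<close> is the solution of \<open>l(c) = K l(1)\<close>. Iterating the
  Landen transformation shows \<open>l(b) - l(a) \<ge> b - a\<close>, \<open>l(c) \<le> c + log 4\<close> and
  \<open>c(K) \<ge> 4\<^bsup>1 - 1/K\<^esup>\<close>; together these give \<open>r' \<le> c(K) r\<^bsup>1/K\<^esup>\<close>.
\<close>

section \<open>Elliptic integrals and the modulus function\<close>

text \<open>Quasiconformality is given by moduli of curve families inside the domain, so
  \<open>f\<close> has no boundary values, and image curves need be neither smooth nor rectifiable.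
  This dictates the family. For crosscuts that separate the two points, two facts survive a
  homeomorphism, both topological: the ends leave every compact set, and the curve meets every
  connected set joining the image points, in particular the segment \<open>\<i> [k', 1]\<close>. In
  the target rectangle the distance to the horizontal sides drops below every positive level towards
  both ends and is the full half height \<open>B'\<close> on that segment, so the density
  \<open>1 / (2 B')\<close> gives every locally rectifiable image curve length at least 1; other
  curves put no condition on a density. Source and target are estimated by the same expression in
  \<open>k\<close> and \<open>k'\<close>, so nothing is lost beyond the factor \<open>K\<close>. The
  constants leave little room: \<open>log 4\<close> is the limit of \<open>l(c) - c\<close>, and the
  lower bound for \<open>c(K)\<close> is an equality at \<open>K = 1\<close>, so that it needs
  estimates for the slope of \<open>l\<close> and not just for its size.\<close>

lemma integral_substitution_real:
  fixes f g g' :: "real \<Rightarrow> real"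
  assumes "S \<in> sets lebesgue" "\<And>x. x \<in> S \<Longrightarrow> (g has_field_derivative g' x) (at x within S)"
    and "inj_on g S" "f absolutely_integrable_on (g ` S)"
  shows "integral S (\<lambda>x. \<bar>g' x\<bar> * f (g x)) = integral (g ` S) f"
    "(\<lambda>x. \<bar>g' x\<bar> * f (g x)) absolutely_integrable_on S"
  using has_absolute_integral_change_of_variables_real[OF assms(1-3), of f "integral (g ` S) f"] assms(4)
  by auto

text \<open>The substitution \<open>tan\<close> turns the integral into the length of
  \<open>{0<..<pi/2}\<close>. This integrand serves as majorant and comparison function for the
  integrands \<open>agmf a b\<close>.\<close>

lemma has_integral_inverse_1_plus_square:
  "(\<lambda>x::real. 1 / (1 + x\<^sup>2)) absolutely_integrable_on {0<..}"
  "integral {0<..} (\<lambda>x::real. 1 / (1 + x\<^sup>2)) = pi / 2"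
proof -
  let ?S = "{0<..<pi/2}"
  have img: "tan ` ?S = {0<..}"
  proof (intro equalityI subsetI)
    fix y assume "y \<in> tan ` ?S" then show "y \<in> {0<..}"
      by (auto intro!: tan_gt_zero)
  next
    fix y :: real assume "y \<in> {0<..}"
    then show "y \<in> tan ` ?S"
      by (intro image_eqI[of _ _ "arctan y"]) (auto simp: tan_arctan arctan_ubound simp del: divide_eq_eq less_divide_eq_numeral1)
  qed
  have inj: "inj_on tan ?S"
    by (rule inj_onI) (metis arctan_tan greaterThanLessThan_iff minus_less_iff order_less_trans neg_less_0_iff_less pi_half_gt_zero)
  have der: "(tan has_field_derivative inverse ((cos x)\<^sup>2)) (at x within ?S)" if "x \<in> ?S" for x
    using that cos_gt_zero_pi[of x] by (intro DERIV_tan[THEN has_field_derivative_at_within]) auto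
  have eq: "\<bar>inverse ((cos x)\<^sup>2)\<bar> *\<^sub>R (1 / (1 + (tan x)\<^sup>2)) = 1" if "x \<in> ?S" for x
  proof -
    have "cos x > 0" using that cos_gt_zero_pi[of x] by auto
    then show ?thesis using tan_sec[of x] by (auto simp: field_simps)
  qed
  have c: "(\<lambda>x. 1 :: real) absolutely_integrable_on ?S \<and> integral ?S (\<lambda>x. 1 :: real) = pi/2"
    using integral_open_interval_real[of 0 "pi/2" "\<lambda>x. 1 :: real"] integrable_on_open_interval_real[of "\<lambda>x. 1 :: real" 0 "pi/2"]
      integrable_const_ivl[of "1::real" 0 "pi/2"]
    by (simp add: absolutely_integrable_on_def)
  have "(\<lambda>x. \<bar>inverse ((cos x)\<^sup>2)\<bar> *\<^sub>R (1 / (1 + (tan x)\<^sup>2))) absolutely_integrable_on ?S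
     \<and> integral ?S (\<lambda>x. \<bar>inverse ((cos x)\<^sup>2)\<bar> *\<^sub>R (1 / (1 + (tan x)\<^sup>2))) = pi/2"
  proof
    show "(\<lambda>x. \<bar>inverse ((cos x)\<^sup>2)\<bar> *\<^sub>R (1 / (1 + (tan x)\<^sup>2))) absolutely_integrable_on ?S"
      by (subst set_integrable_cong[OF refl refl eq]) (use c in auto)
    show "integral ?S (\<lambda>x. \<bar>inverse ((cos x)\<^sup>2)\<bar> *\<^sub>R (1 / (1 + (tan x)\<^sup>2))) = pi/2"
      by (subst integral_cong[OF eq]) (use c in auto)
  qed
  then have "(\<lambda>x. 1 / (1 + x\<^sup>2)) absolutely_integrable_on (tan ` ?S) \<and> integral (tan ` ?S) (\<lambda>x. 1 / (1 + x\<^sup>2)) = pi/2"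
    using has_absolute_integral_change_of_variables_real[of ?S tan "\<lambda>x. inverse ((cos x)\<^sup>2)" "\<lambda>x. 1 / (1 + x\<^sup>2)" "pi/2", OF _ der inj] by simp
  then show "(\<lambda>x::real. 1 / (1 + x\<^sup>2)) absolutely_integrable_on {0<..}"
    "integral {0<..} (\<lambda>x::real. 1 / (1 + x\<^sup>2)) = pi / 2" by (simp_all add: img)
qed

section \<open>The complete elliptic integral in the form of Gauss\<close>

text \<open>The integrand of Gauss's formula: \<open>agmI a b\<close> is \<open>pi / 2\<close>
  divided by the arithmetic-geometric mean of \<open>a\<close> and \<open>b\<close>. In this form
  Landen's transformation is a single substitution, and the integrand has no singularity.\<close>

definition agmf :: "real \<Rightarrow> real \<Rightarrow> real \<Rightarrow> real" where
  "agmf a b x = 1 / sqrt ((x\<^sup>2 + a\<^sup>2) * (x\<^sup>2 + b\<^sup>2))"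

definition agmI :: "real \<Rightarrow> real \<Rightarrow> real" where
  "agmI a b = integral {0<..} (agmf a b)"

lemma agmf_pos: "0 < a \<Longrightarrow> 0 < b \<Longrightarrow> 0 < agmf a b x"
  unfolding agmf_def by (intro divide_pos_pos real_sqrt_gt_zero mult_pos_pos) (auto simp: add_nonneg_pos)

lemma agmf_continuous: "0 < a \<Longrightarrow> 0 < b \<Longrightarrow> continuous_on S (agmf a b)"
  unfolding agmf_def
  by (intro continuous_intros) (auto simp: add_nonneg_eq_0_iff)

lemma agmf_bound:
  assumes "0 < a" "0 < b"
  shows "agmf a b x \<le> (1 / (min 1 (min a b))\<^sup>2) * (1 / (1 + x\<^sup>2))"
proof -
  define m where "m = min 1 (min a b)"
  have m: "0 < m" "m \<le> 1" "m \<le> a" "m \<le> b" using assms by (auto simp: m_def)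
  have 1: "m\<^sup>2 * (1 + x\<^sup>2) \<le> x\<^sup>2 + c\<^sup>2" if "m \<le> c" for c
  proof -
    have "m\<^sup>2 * x\<^sup>2 \<le> 1 * x\<^sup>2" using m by (intro mult_right_mono) (auto simp: power_le_one)
    moreover have "m\<^sup>2 \<le> c\<^sup>2" using m that by (intro power_mono) auto
    ultimately show ?thesis by (simp add: algebra_simps)
  qed
  have "(m\<^sup>2 * (1 + x\<^sup>2)) * (m\<^sup>2 * (1 + x\<^sup>2)) \<le> (x\<^sup>2 + a\<^sup>2) * (x\<^sup>2 + b\<^sup>2)"
    using m by (intro mult_mono 1) auto
  then have "m\<^sup>2 * (1 + x\<^sup>2) \<le> sqrt ((x\<^sup>2 + a\<^sup>2) * (x\<^sup>2 + b\<^sup>2))"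
    by (intro real_le_rsqrt) (simp add: power2_eq_square)
  moreover have "0 < m\<^sup>2 * (1 + x\<^sup>2)" using m by (auto intro!: mult_pos_pos simp: add_pos_nonneg)
  ultimately show ?thesis unfolding agmf_def m_def[symmetric]
    by (simp add: frac_le)
qed

lemma agmf_integrable:
  assumes "0 < a" "0 < b"
  shows "agmf a b absolutely_integrable_on {0<..}"
proof (rule measurable_bounded_by_integrable_imp_absolutely_integrable)
  show "agmf a b \<in> borel_measurable (lebesgue_on {0<..})"
    by (intro continuous_imp_measurable_on_sets_lebesgue agmf_continuous assms) auto
  show "(\<lambda>x. (1 / (min 1 (min a b))\<^sup>2) * (1 / (1 + x\<^sup>2))) integrable_on {0<..}"
    using has_integral_inverse_1_plus_square(1) by (intro integrable_on_mult_right) (auto simp: absolutely_integrable_on_def)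
  show "norm (agmf a b x) \<le> (1 / (min 1 (min a b))\<^sup>2) * (1 / (1 + x\<^sup>2))" for x
    using agmf_bound[OF assms, of x] agmf_pos[OF assms, of x] by simp
qed auto

text \<open>The AGM substitution maps the half line onto the whole line, where evenness doubles the
  integral.\<close>

lemma agmf_integrable_UNIV:
  assumes "0 < a" "0 < b"
  shows "agmf a b absolutely_integrable_on UNIV" "integral UNIV (agmf a b) = 2 * agmI a b"
proof -
  have e: "agmf a b (- x) = agmf a b x" for x by (simp add: agmf_def)
  have r: "(agmf a b) absolutely_integrable_on {..<0} \<and> integral {..<0} (agmf a b) = agmI a b"
  proof -
    have "(\<lambda>x. - x) ` {..<0::real} = {0<..}"
      by (auto simp: image_iff intro: bexI[of _ "- _"])
    then show ?thesis
      using has_absolute_integral_change_of_variables_real[of "{..<0}" "\<lambda>x. - x" "\<lambda>x. -1" "agmf a b" "agmI a b",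
          OF _ DERIV_minus[OF DERIV_ident]]
        agmf_integrable[OF assms] by (auto simp: e agmI_def inj_on_def)
  qed
  have n: "negligible {0::real}" by simp
  have i: "agmf a b absolutely_integrable_on ({..<0} \<union> {0<..})"
    using r agmf_integrable[OF assms] by (intro absolutely_integrable_Un) auto
  have s: "integral ({..<0} \<union> {0<..}) (agmf a b) = integral {..<0} (agmf a b) + integral {0<..} (agmf a b)"
    using r agmf_integrable[OF assms]
    by (intro integral_Un) (auto simp: absolutely_integrable_on_def intro: negligible_subset[OF n])
  have ng: "negligible ((UNIV - ({..<0} \<union> {0<..})) \<union> (({..<0::real} \<union> {0<..}) - UNIV))"
    by (rule negligible_subset[OF n]) auto
  show "integral UNIV (agmf a b) = 2 * agmI a b"
    using s r integral_spike_set[of UNIV "{..<0} \<union> {0<..}" "agmf a b"]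
    by (auto simp: agmI_def intro: negligible_subset[OF n] dest!: meta_mp[of "negligible {x. \<not> x < 0 \<and> \<not> 0 < x \<and> agmf a b x \<noteq> 0}"])
  show "agmf a b absolutely_integrable_on UNIV"
    using i by (subst absolutely_integrable_spike_set_eq[of _ "{..<0} \<union> {0<..}"]) (auto intro: negligible_subset[OF n])
qed

text \<open>The substitution \<open>u = (x - a * b / x) / 2\<close> is an increasing bijection of
  the half line onto the whole line. It turns \<open>u^2 + ((a + b) / 2)^2\<close> into
  \<open>(x^2 + a^2) * (x^2 + b^2) / (2 * x)^2\<close> and \<open>u^2 + a * b\<close> into the
  square of \<open>x\<close> times the derivative of the substitution. The roots cancel up to a
  factor 2, which matches the doubled integral over the whole line.\<close>

lemma agmI_AGM:
  assumes "0 < a" "0 < b"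
  shows "agmI a b = agmI ((a + b) / 2) (sqrt (a * b))"
proof -
  let ?g = "\<lambda>x::real. (x - a * b / x) / 2" and ?g' = "\<lambda>x::real. (1 + a * b / x\<^sup>2) / 2"
  let ?m = "(a + b) / 2" and ?q = "sqrt (a * b)"
  have ab: "0 < a * b" using assms by simp
  have mq: "0 < ?m" "0 < ?q" using assms by auto
  have inj: "inj_on ?g {0<..}"
  proof (rule strict_mono_on_imp_inj_on, rule strict_mono_onI)
    fix x y :: real assume "x \<in> {0<..}" "y \<in> {0<..}" "x < y"
    then have "a * b / y < a * b / x" using ab by (intro divide_strict_left_mono) auto
    then have "x - a * b / x < y - a * b / y" using \<open>x < y\<close> by linarith
    then show "?g x < ?g y" by (rule divide_strict_right_mono) simp
  qed
  have img: "?g ` {0<..} = UNIV"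
  proof (intro equalityI subsetI UNIV_I)
    fix u :: real
    have "u\<^sup>2 < u\<^sup>2 + a * b" using ab by simp
    then have "\<bar>u\<bar> < sqrt (u\<^sup>2 + a * b)" by (metis real_sqrt_abs real_sqrt_less_mono)
    then have p: "0 < u + sqrt (u\<^sup>2 + a * b)" by linarith
    have "(u + sqrt (u\<^sup>2 + a * b))\<^sup>2 - a * b = 2 * u * (u + sqrt (u\<^sup>2 + a * b))"
      using ab by (simp add: power2_sum algebra_simps power2_eq_square)
    \<comment> \<open>The witness is the positive root of
      \<open>x^2 - 2 * u * x - a * b = 0\<close>.\<close>
    then have "u = ?g (u + sqrt (u\<^sup>2 + a * b))"
      using p by (simp add: field_simps power2_eq_square)
    then show "u \<in> ?g ` {0<..}" using p by blast
  qed
  have der: "(?g has_field_derivative ?g' x) (at x within {0<..})" if "x \<in> {0<..}" for x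
    using that by (auto intro!: derivative_eq_intros simp: power2_eq_square)
  have eq: "\<bar>?g' x\<bar> * agmf ?m ?q (?g x) = 2 * agmf a b x" if "x \<in> {0<..}" for x
  proof -
    have x: "0 < x" using that by simp
    have 1: "(?g x)\<^sup>2 + ?m\<^sup>2 = (x\<^sup>2 + a\<^sup>2) * (x\<^sup>2 + b\<^sup>2) / (2 * x)\<^sup>2"
      using x by (simp add: field_simps power2_eq_square)
    have 2: "(?g x)\<^sup>2 + ?q\<^sup>2 = (x * ?g' x)\<^sup>2"
      using x ab by (simp add: field_simps power2_eq_square)
    have p: "0 < x * ?g' x" using x ab by (intro mult_pos_pos) (auto intro!: add_pos_pos divide_pos_pos)
    have "sqrt (((?g x)\<^sup>2 + ?m\<^sup>2) * ((?g x)\<^sup>2 + ?q\<^sup>2)) = sqrt ((x\<^sup>2 + a\<^sup>2) * (x\<^sup>2 + b\<^sup>2)) / (2 * x) * (x * ?g' x)"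
      unfolding 1 2 using x p by (simp add: real_sqrt_mult real_sqrt_divide)
    moreover have "0 < sqrt ((x\<^sup>2 + a\<^sup>2) * (x\<^sup>2 + b\<^sup>2))" using x by (intro real_sqrt_gt_zero mult_pos_pos add_pos_nonneg) auto
    moreover have "0 < ?g' x" using p x zero_less_mult_pos by blast
    moreover define G where "G = ?g' x"
    moreover define R where "R = sqrt ((x\<^sup>2 + a\<^sup>2) * (x\<^sup>2 + b\<^sup>2))"
    ultimately have s: "sqrt (((?g x)\<^sup>2 + ?m\<^sup>2) * ((?g x)\<^sup>2 + ?q\<^sup>2)) = R / (2 * x) * (x * G)" "0 < R" "0 < G" by auto
    show ?thesis unfolding agmf_def s(1) G_def[symmetric] R_def[symmetric] using x s(2,3) by (simp add: field_simps)
  qed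
  have "integral {0<..} (\<lambda>x. \<bar>?g' x\<bar> * agmf ?m ?q (?g x)) = integral UNIV (agmf ?m ?q)"
    using integral_substitution_real(1)[OF _ der inj, of "agmf ?m ?q"] agmf_integrable_UNIV[OF mq]
    unfolding img by auto
  also have "\<dots> = 2 * agmI ?m ?q" using agmf_integrable_UNIV[OF mq] by simp
  also have "integral {0<..} (\<lambda>x. \<bar>?g' x\<bar> * agmf ?m ?q (?g x)) = integral {0<..} (\<lambda>x. 2 * agmf a b x)"
    by (rule integral_cong) (use eq in auto)
  also have "\<dots> = 2 * agmI a b" by (simp add: agmI_def)
  finally show ?thesis by simp
qed

lemma agmI_scale:
  assumes "0 < a" "0 < b" "0 < c"
  shows "agmI (c * a) (c * b) = agmI a b / c"
proof -
  have img: "(\<lambda>x. c * x) ` {0<..} = {0<..}"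
    using assms by (auto simp: image_iff intro!: bexI[of _ "_ / c"])
  have "integral {0<..} (\<lambda>x. \<bar>c\<bar> * agmf (c * a) (c * b) (c * x)) = agmI (c * a) (c * b)"
    using integral_substitution_real(1)[of "{0<..}" "\<lambda>x. c * x" "\<lambda>x. c" "agmf (c * a) (c * b)"] agmf_integrable[of "c*a" "c*b"] assms
    unfolding img agmI_def by (auto intro!: derivative_eq_intros simp: inj_on_def)
  moreover have "\<bar>c\<bar> * agmf (c * a) (c * b) (c * x) = (1 / c) * agmf a b x" for x
  proof -
    have "((c * x)\<^sup>2 + (c * a)\<^sup>2) * ((c * x)\<^sup>2 + (c * b)\<^sup>2) = (c\<^sup>2)\<^sup>2 * ((x\<^sup>2 + a\<^sup>2) * (x\<^sup>2 + b\<^sup>2))"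
      by (simp add: algebra_simps power2_eq_square)
    then have "sqrt (((c * x)\<^sup>2 + (c * a)\<^sup>2) * ((c * x)\<^sup>2 + (c * b)\<^sup>2)) = c\<^sup>2 * sqrt ((x\<^sup>2 + a\<^sup>2) * (x\<^sup>2 + b\<^sup>2))"
      by (simp only: real_sqrt_mult real_sqrt_abs) simp
    then show ?thesis using assms unfolding agmf_def by (simp add: power2_eq_square)
  qed
  ultimately have "integral {0<..} (\<lambda>x. (1 / c) * agmf a b x) = agmI (c * a) (c * b)" by simp
  then show ?thesis by (simp add: agmI_def)
qed

text \<open>The substitution \<open>x / sqrt (x\<^sup>2 + q\<^sup>2)\<close> with
  \<open>q = sqrt (1 - r\<^sup>2)\<close> maps the half line onto the open unit interval and absorbs
  the singularity at 1, so \<open>ellK\<close> is a value of \<open>agmI\<close> at the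
  complementary modulus. Absolute integrability is recorded because the same integrand will measure
  an edge of the rectangle.\<close>

lemma ellK_eq_agmI:
  assumes "0 < r" "r < 1"
  shows "ellK r = agmI 1 (sqrt (1 - r\<^sup>2))"
    "(\<lambda>x. 1 / sqrt ((1 - x\<^sup>2) * (1 - r\<^sup>2 * x\<^sup>2))) absolutely_integrable_on {0<..<1}"
proof -
  define q where "q = sqrt (1 - r\<^sup>2)"
  have r1: "r\<^sup>2 < 1" using assms by (simp add: power_less_one_iff)
  have q: "0 < q" "q\<^sup>2 = 1 - r\<^sup>2" using r1 by (auto simp: q_def)
  let ?f = "\<lambda>x::real. 1 / sqrt ((1 - x\<^sup>2) * (1 - r\<^sup>2 * x\<^sup>2))"
  let ?g = "\<lambda>x::real. x / sqrt (x\<^sup>2 + q\<^sup>2)" and ?g' = "\<lambda>x::real. q\<^sup>2 / (sqrt (x\<^sup>2 + q\<^sup>2) * (x\<^sup>2 + q\<^sup>2))"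
  have pos: "0 < x\<^sup>2 + q\<^sup>2" for x using q(1) by (simp add: add_nonneg_pos)
  have sq: "sqrt (x\<^sup>2 + q\<^sup>2) * sqrt (x\<^sup>2 + q\<^sup>2) = x\<^sup>2 + q\<^sup>2" "0 < sqrt (x\<^sup>2 + q\<^sup>2)" for x using pos[of x] by auto
  have der: "(?g has_field_derivative ?g' x) (at x within {0<..})" for x
  proof -
    define s where "s = sqrt (x\<^sup>2 + q\<^sup>2)"
    have s: "0 < s" "x\<^sup>2 + q\<^sup>2 = s\<^sup>2" using sq[of x] by (auto simp: s_def)
    have "((\<lambda>x. sqrt (x\<^sup>2 + q\<^sup>2)) has_field_derivative (x / s)) (at x within {0<..})"
      unfolding s_def using pos[of x] by (auto intro!: derivative_eq_intros simp: field_simps)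
    from DERIV_divide[OF DERIV_ident this] s(1)
    have "(?g has_field_derivative ((s - x * (x / s)) / s\<^sup>2)) (at x within {0<..})"
      unfolding s_def[symmetric] by (simp add: power2_eq_square field_simps)
    moreover have "(s - x * (x / s)) / s\<^sup>2 = (s\<^sup>2 - x\<^sup>2) / (s * s\<^sup>2)" using s(1) by (simp add: field_simps power2_eq_square)
    moreover have "s\<^sup>2 - x\<^sup>2 = q\<^sup>2" using s(2) by simp
    ultimately show ?thesis using s(1) unfolding s(2) by simp
  qed
  have inj: "inj_on ?g {0<..}"
  proof (rule inj_onI)
    fix x y :: real assume xy: "x \<in> {0<..}" "y \<in> {0<..}" "?g x = ?g y"
    then have "(?g x)\<^sup>2 = (?g y)\<^sup>2" by simp
    then have "x\<^sup>2 / (x\<^sup>2 + q\<^sup>2) = y\<^sup>2 / (y\<^sup>2 + q\<^sup>2)" using pos[of x] pos[of y] by (simp add: power_divide)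
    then have "x\<^sup>2 * (y\<^sup>2 + q\<^sup>2) = y\<^sup>2 * (x\<^sup>2 + q\<^sup>2)"
      using pos[of x] pos[of y] by (metis frac_eq_eq less_irrefl)
    then have "x\<^sup>2 * q\<^sup>2 = y\<^sup>2 * q\<^sup>2" by (simp add: algebra_simps)
    then show "x = y" using q xy by auto
  qed
  have img: "?g ` {0<..} = {0<..<1}"
  proof (intro equalityI subsetI)
    fix y assume "y \<in> ?g ` {0<..}"
    then obtain x where x: "0 < x" "y = ?g x" by auto
    have "x < sqrt (x\<^sup>2 + q\<^sup>2)" using x q(1) by (intro real_less_rsqrt) auto
    then show "y \<in> {0<..<1}" using x sq(2)[of x] by auto
  next
    fix y :: real assume y: "y \<in> {0<..<1}"
    then have y1: "0 < 1 - y\<^sup>2" by (simp add: power_less_one_iff)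
    let ?x = "q * y / sqrt (1 - y\<^sup>2)"
    define t where "t = sqrt (1 - y\<^sup>2)"
    have t: "0 < t" "y\<^sup>2 = 1 - t\<^sup>2" using y1 by (auto simp: t_def)
    have "(q * y / t)\<^sup>2 + q\<^sup>2 = (q\<^sup>2 * y\<^sup>2 + q\<^sup>2 * t\<^sup>2) / t\<^sup>2"
      using t(1) by (simp add: power_divide power_mult_distrib add_divide_distrib)
    also have "\<dots> = (q / t)\<^sup>2" unfolding t(2) by (simp add: power_divide algebra_simps)
    finally have "sqrt ((q * y / t)\<^sup>2 + q\<^sup>2) = q / t" using q(1) t(1) by simp
    then have "?g ?x = y" using q(1) t(1) unfolding t_def[symmetric] by simp
    moreover have "?x \<in> {0<..}" using q(1) y y1 by auto
    ultimately show "y \<in> ?g ` {0<..}" by (intro image_eqI[where x = ?x]) (rule sym)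
  qed
  have eq: "\<bar>?g' x\<bar> *\<^sub>R ?f (?g x) = agmf 1 q x" if "x \<in> {0<..}" for x
  proof -
    have g2: "(?g x)\<^sup>2 = x\<^sup>2 / (x\<^sup>2 + q\<^sup>2)" using pos[of x] by (simp add: power_divide)
    have P: "x\<^sup>2 + q\<^sup>2 \<noteq> 0" using pos[of x] by linarith
    have "1 - (?g x)\<^sup>2 = q\<^sup>2 / (x\<^sup>2 + q\<^sup>2)" unfolding g2 using P by (simp add: diff_divide_eq_iff)
    moreover have "1 - r\<^sup>2 * (?g x)\<^sup>2 = q\<^sup>2 * (x\<^sup>2 + 1) / (x\<^sup>2 + q\<^sup>2)"
    proof -
      have r2: "r\<^sup>2 = 1 - q\<^sup>2" using q(2) by simp
      have e: "q\<^sup>2 * (x\<^sup>2 + 1) = (x\<^sup>2 + q\<^sup>2) - r\<^sup>2 * x\<^sup>2" unfolding r2 by (simp add: algebra_simps)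
      show ?thesis unfolding g2 e times_divide_eq_right diff_divide_distrib divide_self[OF P] ..
    qed
    ultimately have "(1 - (?g x)\<^sup>2) * (1 - r\<^sup>2 * (?g x)\<^sup>2) = (q\<^sup>2 / (x\<^sup>2 + q\<^sup>2))\<^sup>2 * (x\<^sup>2 + 1)"
      by (simp add: power2_eq_square)
    then have "sqrt ((1 - (?g x)\<^sup>2) * (1 - r\<^sup>2 * (?g x)\<^sup>2)) = q\<^sup>2 / (x\<^sup>2 + q\<^sup>2) * sqrt (x\<^sup>2 + 1)"
      using pos[of x] by (simp only: real_sqrt_mult real_sqrt_abs) simp
    moreover have "agmf 1 q x = 1 / (sqrt (x\<^sup>2 + 1) * sqrt (x\<^sup>2 + q\<^sup>2))" by (simp add: agmf_def real_sqrt_mult)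
    moreover define P where "P = x\<^sup>2 + q\<^sup>2"
    moreover define R where "R = sqrt (x\<^sup>2 + 1)"
    moreover have "0 < R" by (simp add: R_def add_nonneg_pos)
    moreover have "0 < P" using pos by (simp add: P_def)
    ultimately have e: "sqrt ((1 - (?g x)\<^sup>2) * (1 - r\<^sup>2 * (?g x)\<^sup>2)) = q\<^sup>2 / P * R" "agmf 1 q x = 1 / (R * sqrt P)"
      "0 < R" "0 < P" by blast+
    have f: "?f (?g x) = 1 / (q\<^sup>2 / P * R)" by (rule arg_cong[OF e(1), of "\<lambda>t. 1 / t"])
    show ?thesis unfolding f e(2) unfolding P_def[symmetric] using e(3,4) q(1) by (simp add: field_simps)
  qed
  have i: "(\<lambda>x. \<bar>?g' x\<bar> *\<^sub>R ?f (?g x)) absolutely_integrable_on {0<..}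
     \<and> integral {0<..} (\<lambda>x. \<bar>?g' x\<bar> *\<^sub>R ?f (?g x)) = agmI 1 q"
  proof
    show "(\<lambda>x. \<bar>?g' x\<bar> *\<^sub>R ?f (?g x)) absolutely_integrable_on {0<..}"
      by (subst set_integrable_cong[OF refl refl eq]) (use agmf_integrable[of 1 q] q(1) in auto)
    show "integral {0<..} (\<lambda>x. \<bar>?g' x\<bar> *\<^sub>R ?f (?g x)) = agmI 1 q"
      unfolding agmI_def by (rule integral_cong) (use eq in auto)
  qed
  have j: "?f absolutely_integrable_on {0<..<1} \<and> integral {0<..<1} ?f = agmI 1 q"
    using has_absolute_integral_change_of_variables_real[of "{0<..}" ?g ?g' ?f "agmI 1 q"] der inj i unfolding img
    by auto
  then show "?f absolutely_integrable_on {0<..<1}" by blast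
  show "ellK r = agmI 1 (sqrt (1 - r\<^sup>2))"
    using j unfolding ellK_def q_def by (simp add: integral_open_interval_real)
qed

text \<open>Both bounds are pointwise: for \<open>0 < b \<le> 1\<close> the root lies between
  \<open>b * (1 + x\<^sup>2)\<close> and \<open>1 + x\<^sup>2\<close>.\<close>

lemma agmI_bounds:
  assumes "0 < b" "b \<le> 1"
  shows "pi / 2 \<le> agmI 1 b" "agmI 1 b \<le> pi / 2 / b"
proof -
  have pt: "1 / (1 + x\<^sup>2) \<le> agmf 1 b x" "agmf 1 b x \<le> (1 / b) * (1 / (1 + x\<^sup>2))" for x
  proof -
    have p: "0 < 1 + x\<^sup>2" by (simp add: add_pos_nonneg)
    have b1: "b\<^sup>2 \<le> 1" using assms by (simp add: power_le_one)
    have "(x\<^sup>2 + 1) * (x\<^sup>2 + b\<^sup>2) \<le> (1 + x\<^sup>2)\<^sup>2"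
      using p b1 by (simp add: power2_eq_square[of "1 + x\<^sup>2"] add.commute mult_left_mono)
    then have "sqrt ((x\<^sup>2 + 1) * (x\<^sup>2 + b\<^sup>2)) \<le> 1 + x\<^sup>2" using p by (simp add: real_le_lsqrt)
    moreover have "0 < sqrt ((x\<^sup>2 + 1) * (x\<^sup>2 + b\<^sup>2))"
      using p assms by (intro real_sqrt_gt_zero mult_pos_pos) (auto intro: add_nonneg_pos)
    ultimately show "1 / (1 + x\<^sup>2) \<le> agmf 1 b x" unfolding agmf_def by (simp add: frac_le)
    have "b\<^sup>2 * (1 + x\<^sup>2) \<le> x\<^sup>2 + b\<^sup>2" using b1 mult_right_mono[OF b1, of "x\<^sup>2"] by (simp add: algebra_simps)
    then have "(b * (1 + x\<^sup>2))\<^sup>2 \<le> (x\<^sup>2 + 1) * (x\<^sup>2 + b\<^sup>2)"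
      using mult_left_mono[of "b\<^sup>2 * (1 + x\<^sup>2)" "x\<^sup>2 + b\<^sup>2" "1 + x\<^sup>2"] p by (simp add: power2_eq_square algebra_simps)
    then have "b * (1 + x\<^sup>2) \<le> sqrt ((x\<^sup>2 + 1) * (x\<^sup>2 + b\<^sup>2))" by (rule real_le_rsqrt)
    moreover have "0 < b * (1 + x\<^sup>2)" using p assms by simp
    ultimately show "agmf 1 b x \<le> (1 / b) * (1 / (1 + x\<^sup>2))" unfolding agmf_def by (simp add: frac_le)
  qed
  have i: "agmf 1 b integrable_on {0<..}" "(\<lambda>x::real. 1 / (1 + x\<^sup>2)) integrable_on {0<..}"
    using agmf_integrable[of 1 b] assms has_integral_inverse_1_plus_square(1) by (auto simp: absolutely_integrable_on_def)
  show "pi / 2 \<le> agmI 1 b" unfolding agmI_def has_integral_inverse_1_plus_square(2)[symmetric]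
    by (intro integral_le i pt)
  have "agmI 1 b \<le> integral {0<..} (\<lambda>x. (1 / b) * (1 / (1 + x\<^sup>2)))" unfolding agmI_def
    by (intro integral_le i(1) integrable_on_mult_right i(2) pt)
  then show "agmI 1 b \<le> pi / 2 / b"
    unfolding integral_mult_right has_integral_inverse_1_plus_square(2) by simp
qed

text \<open>On the unit interval the root is at most \<open>(x + 1) * (x + r)\<close>, whose
  reciprocal has an elementary primitive; this captures the logarithmic growth as \<open>r\<close>
  tends to 0.\<close>

lemma agmI_lower:
  assumes "0 < r" "r < 1"
  shows "- ln r - ln 2 \<le> agmI 1 r"
proof -
  let ?F = "\<lambda>x::real. (ln (x + r) - ln (x + 1)) / (1 - r)"
  have I: "((\<lambda>x. 1 / ((x + 1) * (x + r))) has_integral (?F 1 - ?F 0)) {0..1}"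
  proof (rule fundamental_theorem_of_calculus)
    fix x :: real assume x: "x \<in> {0..1}"
    have "(?F has_field_derivative (1 / (x + r) - 1 / (x + 1)) / (1 - r)) (at x within {0..1})"
      using x assms by (auto intro!: derivative_eq_intros)
    moreover have "(1 / (x + r) - 1 / (x + 1)) / (1 - r) = 1 / ((x + 1) * (x + r))"
    proof -
      have "1 / (x + r) - 1 / (x + 1) = (1 - r) / ((x + 1) * (x + r))"
        using x assms by (auto simp: field_simps)
      then show ?thesis using assms by simp
    qed
    ultimately show "(?F has_vector_derivative 1 / ((x + 1) * (x + r))) (at x within {0..1})"
      by (simp add: has_real_derivative_iff_has_vector_derivative)
  qed auto
  have i: "agmf 1 r integrable_on {0<..}"
    using agmf_integrable[of 1 r] assms by (auto simp: absolutely_integrable_on_def)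
  have i2: "agmf 1 r integrable_on {0..1}"
    using agmf_continuous[of 1 r "{0..1}"] assms by (intro integrable_continuous_real) auto
  have i3: "agmf 1 r integrable_on {0<..<1}" "integral {0<..<1} (agmf 1 r) = integral {0..1} (agmf 1 r)"
    using i2 by (auto simp: integrable_on_open_interval_real integral_open_interval_real)
  have pt: "1 / ((x + 1) * (x + r)) \<le> agmf 1 r x" if "x \<in> {0..1}" for x
  proof -
    have "(x\<^sup>2 + 1\<^sup>2) * (x\<^sup>2 + r\<^sup>2) \<le> (x + 1)\<^sup>2 * (x + r)\<^sup>2"
      using that assms by (intro mult_mono) (auto simp: power2_sum)
    then have "sqrt ((x\<^sup>2 + 1\<^sup>2) * (x\<^sup>2 + r\<^sup>2)) \<le> (x + 1) * (x + r)"
      using that assms by (intro real_le_lsqrt) (auto simp: power_mult_distrib)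
    moreover have "0 < sqrt ((x\<^sup>2 + 1\<^sup>2) * (x\<^sup>2 + r\<^sup>2))"
      using assms by (intro real_sqrt_gt_zero mult_pos_pos) (auto simp: add_nonneg_pos)
    ultimately show ?thesis unfolding agmf_def by (simp add: frac_le)
  qed
  have "?F 1 - ?F 0 \<le> integral {0..1} (agmf 1 r)"
    using integral_le[OF has_integral_integrable[OF I] i2 pt] integral_unique[OF I] by simp
  also have "\<dots> \<le> agmI 1 r" unfolding i3(2)[symmetric] agmI_def
    using assms agmf_pos[of 1 r] by (intro integral_subset_le i i3) (auto intro: less_imp_le)
  finally have "?F 1 - ?F 0 \<le> agmI 1 r" .
  moreover have "- ln r - ln 2 \<le> ?F 1 - ?F 0"
  proof -
    have e: "?F 1 - ?F 0 = (ln (1 + r) - ln 2 - ln r) / (1 - r)" by (simp add: diff_divide_distrib)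
    have "0 \<le> ln (1 + r)" using assms by simp
    moreover have "- ln 2 * (1 - r) - ln r * (1 - r) \<le> ln (1 + r) - ln 2 - ln r"
    proof -
      have "ln r * r \<le> 0" using assms by (simp add: mult_nonpos_nonneg)
      \<comment> \<open>Concavity of \<open>ln\<close> between 1 and 2.\<close>
      moreover have "ln 2 * r \<le> ln (1 + r)"
      proof -
        have "convex_on {0<..} (\<lambda>x. - ln x :: real)" using ln_concave by (simp add: concave_on_def)
        then have "- ln ((1 - r) *\<^sub>R 1 + r *\<^sub>R 2) \<le> (1 - r) * - ln 1 + r * - ln 2"
          using assms by (intro convex_onD) auto
        then show ?thesis by (simp add: algebra_simps)
      qed
      ultimately show ?thesis by (simp add: algebra_simps)
    qed
    ultimately show ?thesis unfolding e using assms by (simp add: field_simps)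
  qed
  ultimately show ?thesis by linarith
qed

text \<open>Up to 1 the integrand is compared with \<open>1 / sqrt (x^2 + r^2)\<close>, which
  carries the logarithm, and beyond 1 with \<open>2 / (1 + x^2)\<close>. Only the leading term
  \<open>- ln r\<close> has to be exact, since additive constants disappear in the Landen
  iteration.\<close>

lemma agmI_upper:
  assumes "0 < r" "r < 1"
  shows "agmI 1 r \<le> - ln r + ln 3 + pi"
proof -
  let ?F = "\<lambda>x::real. ln (x + sqrt (x\<^sup>2 + r\<^sup>2))"
  have sp: "0 < x\<^sup>2 + r\<^sup>2" for x using assms by (simp add: add_nonneg_pos)
  have I: "((\<lambda>x. 1 / sqrt (x\<^sup>2 + r\<^sup>2)) has_integral (?F 1 - ?F 0)) {0..1}"
  proof (rule fundamental_theorem_of_calculus)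
    fix x :: real assume x: "x \<in> {0..1}"
    define s where "s = sqrt (x\<^sup>2 + r\<^sup>2)"
    have s: "0 < s" using sp[of x] by (simp add: s_def)
    have "(?F has_field_derivative (1 + x / s) / (x + s)) (at x within {0..1})"
      unfolding s_def using x sp[of x] s[unfolded s_def]
      by (auto intro!: derivative_eq_intros simp: add_nonneg_pos field_simps)
    moreover have "(1 + x / s) / (x + s) = 1 / s"
    proof -
      have "x + s \<noteq> 0" using s x by auto
      moreover have "1 + x / s = (x + s) / s" using s by (simp add: field_simps)
      ultimately show ?thesis by simp
    qed
    ultimately show "(?F has_vector_derivative 1 / sqrt (x\<^sup>2 + r\<^sup>2)) (at x within {0..1})"
      by (simp add: has_real_derivative_iff_has_vector_derivative s_def)
  qed auto
  define g where "g = (\<lambda>x. if x \<in> {0..1} then 1 / sqrt (x\<^sup>2 + r\<^sup>2) else 0)"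
  have g1: "(g has_integral (?F 1 - ?F 0)) {0..}" unfolding g_def
    using I by (subst has_integral_restrict) auto
  have gg: "(g has_integral (?F 1 - ?F 0)) {0<..}"
    using g1 by (subst has_integral_spike_set_eq[of _ "{0..}"]) (auto intro: negligible_subset[of "{0}"])
  have h: "((\<lambda>x::real. 2 * (1 / (1 + x\<^sup>2))) has_integral (2 * (pi / 2))) {0<..}"
    using has_integral_inverse_1_plus_square
    by (intro has_integral_mult_right) (auto simp: has_integral_iff absolutely_integrable_on_def)
  have pt: "agmf 1 r x \<le> g x + 2 * (1 / (1 + x\<^sup>2))" if "x \<in> {0<..}" for x
  proof (cases "x \<le> 1")
    case True
    have "sqrt (x\<^sup>2 + r\<^sup>2) \<le> sqrt ((x\<^sup>2 + 1\<^sup>2) * (x\<^sup>2 + r\<^sup>2))"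
      using sp[of x] by (intro real_sqrt_le_mono) (simp add: mult_le_cancel_right1)
    then have "agmf 1 r x \<le> g x" unfolding agmf_def g_def using True that sp[of x] by (simp add: frac_le)
    then show ?thesis by (smt (verit) divide_nonneg_nonneg zero_le_power2)
  next
    case False
    then have x: "1 < x" by simp
    then have x2: "1 < x\<^sup>2" by simp
    have "((1 + x\<^sup>2) / 2) * ((1 + x\<^sup>2) / 2) \<le> (x\<^sup>2 + 1\<^sup>2) * (x\<^sup>2 + r\<^sup>2)"
      using x2 by (intro mult_mono) (auto simp: add.commute add_increasing2)
    then have "(1 + x\<^sup>2) / 2 \<le> sqrt ((x\<^sup>2 + 1\<^sup>2) * (x\<^sup>2 + r\<^sup>2))"
      by (intro real_le_rsqrt) (simp add: power2_eq_square)
    then have "agmf 1 r x \<le> 1 / ((1 + x\<^sup>2) / 2)"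
      unfolding agmf_def using x2 sp[of x] by (intro divide_left_mono) (auto intro!: mult_pos_pos)
    moreover have "0 \<le> g x" by (simp add: g_def)
    ultimately show ?thesis by simp
  qed
  have "agmI 1 r \<le> (?F 1 - ?F 0) + 2 * (pi / 2)"
    unfolding agmI_def
    using agmf_integrable[of 1 r] assms has_integral_add[OF gg h] pt
    by (intro has_integral_le[OF _ has_integral_add[OF gg h]]) (auto simp: absolutely_integrable_on_def has_integral_integral)
  moreover have "?F 1 \<le> ln 3"
  proof -
    have "sqrt (1 + r\<^sup>2) \<le> 2" using assms by (intro real_le_lsqrt) (auto simp: power_le_one intro: order_trans[OF power_le_one])
    then show ?thesis using assms by (simp add: add_pos_nonneg)
  qed
  ultimately show ?thesis using assms by simp
qed

lemma agmI_landen: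
  assumes "0 < s"
  shows "agmI 1 s = 2 / (1 + s) * agmI 1 (2 * sqrt s / (1 + s))"
proof -
  have "agmI 1 s = agmI ((1 + s) / 2 * 1) ((1 + s) / 2 * (2 * sqrt s / (1 + s)))"
    using agmI_AGM[of 1 s] assms by simp
  also have "\<dots> = agmI 1 (2 * sqrt s / (1 + s)) / ((1 + s) / 2)"
    using assms by (intro agmI_scale) auto
  finally show ?thesis by simp
qed

section \<open>Functional equations of the modulus function\<close>

lemma mu_eq_agmI:
  assumes "0 < r" "r < 1"
  shows "mu r = pi / 2 * agmI 1 r / agmI 1 (sqrt (1 - r\<^sup>2))"
proof -
  have "r\<^sup>2 < 1" using assms by (simp add: power_less_one_iff)
  then show ?thesis using assms unfolding mu_def by (simp add: ellK_eq_agmI)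
qed

lemma agmI_pos: "0 < b \<Longrightarrow> b \<le> 1 \<Longrightarrow> 0 < agmI 1 b"
  using agmI_bounds(1)[of b] pi_gt_zero by linarith

lemma mu_pos: "0 < r \<Longrightarrow> r < 1 \<Longrightarrow> 0 < mu r"
  by (simp add: mu_eq_agmI agmI_pos power_less_one_iff)

text \<open>With \<open>s = (1 - q) / (1 + q)\<close>, the map
  \<open>t \<mapsto> 2 * sqrt t / (1 + t)\<close> sends \<open>s\<close> to \<open>r\<close> and
  \<open>q\<close> to \<open>sqrt (1 - s^2)\<close>. So \<open>agmI_landen\<close> rewrites both
  numerator and denominator of \<open>mu s\<close>, and the two factors have quotient 2.\<close>

lemma mu_landen:
  assumes "0 < r" "r < 1"
  defines "q \<equiv> sqrt (1 - r\<^sup>2)"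
  shows "mu r = mu ((1 - q) / (1 + q)) / 2"
proof -
  have r2: "r\<^sup>2 < 1" "0 < r\<^sup>2" using assms by (auto simp: power_less_one_iff)
  have q: "0 < q" "q < 1" "q\<^sup>2 = 1 - r\<^sup>2" using r2 by (auto simp: q_def)
  define s where "s = (1 - q) / (1 + q)"
  have s: "0 < s" "s < 1" using q by (auto simp: s_def)
  have s1: "1 + s = 2 / (1 + q)" using q by (simp add: s_def field_simps)
  have "2 * sqrt s / (1 + s) = r"
  proof -
    have "r\<^sup>2 = (1 - q) * (1 + q)" using q(3) by (simp add: algebra_simps power2_eq_square)
    then have "s = r\<^sup>2 / (1 + q)\<^sup>2" using q(1) by (simp add: s_def power2_eq_square)
    then have "sqrt s = r / (1 + q)" using q assms by (simp add: real_sqrt_divide)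
    then show ?thesis using s1 q by simp
  qed
  then have a: "agmI 1 s = (1 + q) * agmI 1 r" using agmI_landen[OF s(1)] unfolding s1 using q(1) by (simp add: field_simps)
  have "sqrt (1 - s\<^sup>2) = 2 * sqrt q / (1 + q)"
  proof -
    have "1 - s\<^sup>2 = ((1 + q)\<^sup>2 - (1 - q)\<^sup>2) / (1 + q)\<^sup>2" unfolding s_def power_divide diff_divide_distrib[of "(1 + q)\<^sup>2" "(1 - q)\<^sup>2"] using q(1) by simp
    also have "(1 + q)\<^sup>2 - (1 - q)\<^sup>2 = 4 * q" by (simp add: power2_eq_square algebra_simps)
    finally have "1 - s\<^sup>2 = 4 * q / (1 + q)\<^sup>2" .
    then show ?thesis using q by (simp add: real_sqrt_divide real_sqrt_mult)
  qed
  then have b: "agmI 1 q = 2 / (1 + q) * agmI 1 (sqrt (1 - s\<^sup>2))" using agmI_landen[OF q(1)] by metis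
  have p: "0 < agmI 1 r" "0 < agmI 1 q" using agmI_pos assms q by auto
  have b': "agmI 1 (sqrt (1 - s\<^sup>2)) = (1 + q) / 2 * agmI 1 q" using b q by (simp add: field_simps)
  show ?thesis unfolding s_def[symmetric] mu_eq_agmI[OF s] mu_eq_agmI[OF assms(1,2)] q_def[symmetric] a b'
    using q(1) p by simp
qed

text \<open>The Landen step expresses \<open>agmI 1 k\<close> by the value at
  \<open>sqrt (1 - r^2)\<close>, and the AGM step for \<open>1 + k\<close> and \<open>1 - k\<close>
  expresses the value at \<open>sqrt (1 - k^2)\<close> by \<open>agmI 1 r\<close>: numerator and
  denominator of \<open>mu\<close> change places. This links the normal position
  \<open>\<i> k\<close>, \<open>\<i>\<close> of two points with their pseudo-hyperbolic
  distance.\<close>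

lemma mu_complement:
  assumes "0 < r" "r < 1"
  shows "mu r * mu ((1 - r) / (1 + r)) = pi\<^sup>2 / 2"
proof -
  define k where "k = (1 - r) / (1 + r)"
  have k: "0 < k" "k < 1" using assms by (auto simp: k_def)
  have kr: "(1 - k) / (1 + k) = r" using assms by (simp add: k_def field_simps)
  define q where "q = sqrt (1 - r\<^sup>2)"
  have "r\<^sup>2 < 1" "0 < r\<^sup>2" using assms by (auto simp: power_less_one_iff)
  then have q: "0 < q" "q \<le> 1" using assms by (auto simp: q_def)
  have "2 * sqrt k / (1 + k) = q"
  proof -
    have "q\<^sup>2 = (1 - r) * (1 + r)" using \<open>r\<^sup>2 < 1\<close> by (simp add: q_def algebra_simps power2_eq_square)
    then have "k = q\<^sup>2 / (1 + r)\<^sup>2" using assms(1) by (simp add: k_def power2_eq_square)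
    then have "sqrt k = q / (1 + r)" using q assms by (simp add: real_sqrt_divide)
    moreover have "1 + k = 2 / (1 + r)" using assms by (simp add: k_def field_simps)
    ultimately show ?thesis using assms by simp
  qed
  then have 1: "agmI 1 k = 2 / (1 + k) * agmI 1 q" using agmI_landen[OF k(1)] by simp
  have "agmI (1 + k) (1 - k) = agmI 1 (sqrt (1 - k\<^sup>2))"
    using agmI_AGM[of "1 + k" "1 - k"] k by (simp add: algebra_simps power2_eq_square)
  moreover have "agmI (1 + k) (1 - k) = agmI ((1 + k) * 1) ((1 + k) * r)"
    unfolding kr[symmetric] using k(1) by simp
  ultimately have 2: "agmI 1 (sqrt (1 - k\<^sup>2)) = agmI 1 r / (1 + k)" using agmI_scale[of 1 r "1 + k"] assms k by simp
  have p: "0 < agmI 1 r" "0 < agmI 1 q" using agmI_pos assms q by auto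
  show ?thesis unfolding k_def[symmetric] mu_eq_agmI[OF k] mu_eq_agmI[OF assms] q_def[symmetric] 1 2
    using p k(1) by (simp add: power2_eq_square)
qed

section \<open>Landen iteration on the logarithmic scale\<close>

text \<open>In this variable \<open>mu\<close> is almost linear: \<open>ell c - c\<close> is
  nondecreasing and stays between 0 and \<open>2 * ln 2\<close>.\<close>

definition ell :: "real \<Rightarrow> real" where "ell c = mu (exp (- c))"

text \<open>The Landen transformation \<open>r \<mapsto> (1 - q) / (1 + q)\<close>, \<open>q = sqrt (1 - r\<^sup>2)\<close>, in the variable
  \<open>c = - ln r\<close>.\<close>

definition landen :: "real \<Rightarrow> real" where "landen c = 2 * c + 2 * ln (1 + sqrt (1 - exp (- 2 * c)))"

lemma sqrt_exp_bounds: "0 < c \<Longrightarrow> 0 < sqrt (1 - exp (- 2 * c))" "0 < c \<Longrightarrow> sqrt (1 - exp (- 2 * c)) < (1::real)"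
  by auto

lemma ell_landen:
  assumes "0 < c"
  shows "ell c = ell (landen c) / 2"
proof -
  define q where "q = sqrt (1 - exp (- 2 * c))"
  have q: "0 < q" "q < 1" "q\<^sup>2 = 1 - exp (- 2 * c)" using sqrt_exp_bounds[OF assms] assms by (auto simp: q_def)
  have e: "(exp (- c))\<^sup>2 = exp (- 2 * c)" by (simp add: exp_of_nat_mult[symmetric] power2_eq_square exp_add[symmetric])
  have "exp (- landen c) = exp (- 2 * c) * inverse ((exp (ln (1 + q)))\<^sup>2)"
    unfolding landen_def q_def[symmetric] by (simp add: exp_add exp_diff exp_minus power2_eq_square exp_double field_simps)
  also have "\<dots> = (1 - q\<^sup>2) / (1 + q)\<^sup>2" using q by (simp add: field_simps)
  also have "1 - q\<^sup>2 = (1 - q) * (1 + q)" by (simp add: algebra_simps power2_eq_square)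
  also have "(1 - q) * (1 + q) / (1 + q)\<^sup>2 = (1 - q) / (1 + q)" using q(1) by (simp add: power2_eq_square)
  finally show ?thesis using mu_landen[of "exp (- c)"] assms unfolding ell_def e q_def by simp
qed

text \<open>The numerator \<open>agmI 1 r\<close> is \<open>c\<close> up to a bounded error, and the
  denominator approaches \<open>pi / 2\<close> so fast that \<open>c\<close> times its relative
  error stays bounded. Any bounded error would serve, because it is divided by \<open>2 ^ n\<close>
  after \<open>n\<close> Landen steps.\<close>

lemma ell_approx:
  assumes "1 \<le> c"
  shows "\<bar>ell c - c\<bar> \<le> 5"
proof -
  define r where "r = exp (- c)"
  have r: "0 < r" "r < 1" "ln r = - c" using assms by (auto simp: r_def)
  define q where "q = sqrt (1 - r\<^sup>2)"
  have r2: "r\<^sup>2 < 1" "0 < r\<^sup>2" using r by (auto simp: power_less_one_iff)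
  have q: "0 < q" "q \<le> 1" "1 - r\<^sup>2 \<le> q"
    using r2 by (auto simp: q_def intro!: real_le_rsqrt simp: power2_eq_square mult_le_cancel_left1)
  have m: "ell c = pi / 2 * agmI 1 r / agmI 1 q" using mu_eq_agmI[OF r(1,2)] by (simp add: ell_def r_def q_def)
  have a: "pi / 2 \<le> agmI 1 q" "agmI 1 q \<le> pi / 2 / q" using agmI_bounds q by auto
  have b: "c - ln 2 \<le> agmI 1 r" "agmI 1 r \<le> c + ln 3 + pi" using agmI_lower agmI_upper r by force+
  have l2: "ln 2 \<le> (1::real)" using ln_le_minus_one[of "2::real"] by simp
  have pp: "0 < agmI 1 r" using agmI_pos r by auto
  have pq: "0 < agmI 1 q" using a pi_gt_zero by linarith
  have "ell c \<le> agmI 1 r"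
    unfolding m using a pp pq by (simp add: field_simps mult_right_mono)
  moreover have "ln 3 \<le> (3/2::real)"
  proof -
    have "ln (3::real) \<le> ln 4" by simp
    also have "ln (4::real) = 2 * ln 2" using ln_realpow[of 2 2] by simp
    finally show ?thesis using ln2_le_25_over_36 by simp
  qed
  moreover have "pi \<le> 3.5" using pi_less_4 pi_approx by simp
  ultimately have u: "ell c \<le> c + 5" using b by linarith
  have "agmI 1 r * q \<le> ell c"
  proof -
    have "q * agmI 1 q \<le> pi / 2" using a q by (simp add: field_simps)
    then have "agmI 1 r * (q * agmI 1 q) \<le> agmI 1 r * (pi / 2)" using pp by (intro mult_left_mono) auto
    then show ?thesis unfolding m using pq by (simp add: field_simps)
  qed
  moreover have "(c - ln 2) * (1 - r\<^sup>2) \<le> agmI 1 r * q" using b q r2 pp by (intro mult_mono) auto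
  \<comment> \<open>The loss \<open>c * r\<^sup>2\<close> is at most 1, because
    \<open>c \<le> exp c\<close> and \<open>r = exp (- c)\<close>.\<close>
  moreover have "c - 2 \<le> (c - ln 2) * (1 - r\<^sup>2)"
  proof -
    have "c \<le> exp c" using exp_ge_add_one_self[of c] by linarith
    then have "c * r \<le> 1" by (simp add: r_def exp_minus field_simps)
    then have "c * r * r \<le> 1 * 1" using r assms by (intro mult_mono) auto
    then have "c * r\<^sup>2 \<le> 1" by (simp add: power2_eq_square)
    moreover have "0 \<le> ln 2 * r\<^sup>2" using r2 by simp
    ultimately have "ln 2 + c * r\<^sup>2 \<le> 2 + ln 2 * r\<^sup>2" using l2 by linarith
    then show ?thesis by (simp add: algebra_simps)
  qed
  ultimately have "c - 2 \<le> ell c" by linarith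
  then show ?thesis using u by linarith
qed

text \<open>The derivative of \<open>landen\<close> is \<open>2 / sqrt (1 - exp (- 2 * c))\<close>,
  which decreases to 2. Increments therefore lie between twice the step and the step times the slope
  at the left end.\<close>

lemma landen_diff:
  assumes "0 < a" "a \<le> b"
  shows "2 * (b - a) \<le> landen b - landen a"
    "landen b - landen a \<le> 2 / sqrt (1 - exp (- 2 * a)) * (b - a)"
proof -
  show "2 * (b - a) \<le> landen b - landen a"
    using assms sqrt_exp_bounds[of a] sqrt_exp_bounds[of b] unfolding landen_def by (simp add: add_pos_pos)
  show "landen b - landen a \<le> 2 / sqrt (1 - exp (- 2 * a)) * (b - a)"
  proof (cases "a = b")
    case False
    then have ab: "a < b" using assms by simp
    have der: "(landen has_real_derivative 2 / sqrt (1 - exp (- 2 * c))) (at c)" if "0 < c" for c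
    proof -
      define s where "s = sqrt (1 - exp (- 2 * c))"
      have s: "0 < s" "exp (- 2 * c) = 1 - s\<^sup>2" using sqrt_exp_bounds[OF that] that by (auto simp: s_def)
      have "((\<lambda>c. sqrt (1 - exp (- 2 * c))) has_real_derivative exp (- 2 * c) / s) (at c)"
        unfolding s_def using that by (auto intro!: derivative_eq_intros simp: field_simps)
      then have "((\<lambda>c. 1 + sqrt (1 - exp (- 2 * c))) has_real_derivative exp (- 2 * c) / s) (at c)"
        by (intro DERIV_const[THEN DERIV_add, THEN DERIV_cong]) auto
      then have "((\<lambda>c. ln (1 + sqrt (1 - exp (- 2 * c)))) has_real_derivative 1 / (1 + s) * (exp (- 2 * c) / s)) (at c)"
        using s(1) unfolding s_def by (intro DERIV_chain2[OF DERIV_ln_divide]) (auto intro!: add_pos_nonneg)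
      then have "(landen has_real_derivative 2 + 2 * ((exp (- 2 * c) / s) / (1 + s))) (at c)"
        unfolding landen_def[abs_def]
        by (intro DERIV_add DERIV_cmult_Id DERIV_cmult) (simp add: mult.commute)
      moreover have "2 + 2 * (((1 - s\<^sup>2) / s) / (1 + s)) = 2 / s"
      proof -
        have "1 - s\<^sup>2 = (1 - s) * (1 + s)" by (simp add: algebra_simps power2_eq_square)
        moreover have "(1 - s) * (1 + s) / s / (1 + s) = (1 - s) / s" using s(1) by simp
        ultimately show ?thesis using s(1) by (simp add: diff_divide_distrib)
      qed
      ultimately show ?thesis using s by (simp add: s_def)
    qed
    obtain z where z: "a < z" "z < b" "landen b - landen a = (b - a) * (2 / sqrt (1 - exp (- 2 * z)))"
      using MVT2[OF ab, of landen "\<lambda>c. 2 / sqrt (1 - exp (- 2 * c))"] der assms by auto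
    have "2 / sqrt (1 - exp (- 2 * z)) \<le> 2 / sqrt (1 - exp (- 2 * a))"
      using z assms sqrt_exp_bounds[of a] by (intro divide_left_mono) (auto intro!: mult_pos_pos)
    then have "(b - a) * (2 / sqrt (1 - exp (- 2 * z))) \<le> (b - a) * (2 / sqrt (1 - exp (- 2 * a)))"
      using ab by (intro mult_left_mono) auto
    then show ?thesis unfolding z(3) by (simp only: mult.commute)
  qed simp
qed

lemma landen_ge: "0 < c \<Longrightarrow> 2 * c \<le> landen c"
  using sqrt_exp_bounds[of c] unfolding landen_def by simp

lemma landen_iter_ge: "0 < c \<Longrightarrow> 2 ^ n * c \<le> (landen ^^ n) c"
proof (induction n)
  case (Suc n)
  have p: "0 < (landen ^^ n) c" using Suc by (smt (verit) mult_pos_pos zero_less_power)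
  show ?case using Suc landen_ge[OF p] by simp
qed simp

lemma landen_iter_pos: "0 < c \<Longrightarrow> 0 < (landen ^^ n) c"
  using landen_iter_ge[of c n] by (smt (verit) mult_pos_pos zero_less_power)

lemma ell_landen_iter: "0 < c \<Longrightarrow> ell c = ell ((landen ^^ n) c) / 2 ^ n"
proof (induction n)
  case (Suc n)
  show ?case using Suc ell_landen[OF landen_iter_pos[OF Suc.prems], of n] by simp
qed simp

text \<open>Since \<open>ell c\<close> is the value of \<open>ell\<close> at the \<open>n\<close>-th
  iterate divided by \<open>2 ^ n\<close>, and \<open>ell\<close> differs from the identity by a
  bounded amount, the normalised iterates converge to \<open>ell c\<close>. From here on
  inequalities for \<open>ell\<close> are inequalities for iterates, without elliptic
  integrals.\<close>

lemma landen_iter_tendsto: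
  assumes "0 < c"
  shows "(\<lambda>n. (landen ^^ n) c / 2 ^ n) \<longlonglongrightarrow> ell c"
proof -
  have "\<forall>\<^sub>F n in sequentially. \<bar>(landen ^^ n) c / 2 ^ n - ell c\<bar> \<le> 5 * (1/2) ^ n"
  proof -
    \<comment> \<open>From this index on the iterate, at least \<open>2 ^ n * c\<close>, has reached
      1, where \<open>ell_approx\<close> applies.\<close>
    obtain N where N: "1 / c < 2 ^ N" using real_arch_pow[of 2 "1/c"] by auto
    have "\<bar>(landen ^^ n) c / 2 ^ n - ell c\<bar> \<le> 5 * (1/2) ^ n" if "N \<le> n" for n
    proof -
      have "(2::real) ^ N \<le> 2 ^ n" using that by simp
      then have "1 / c \<le> 2 ^ n" using N by linarith
      then have "1 \<le> 2 ^ n * c" using assms by (simp add: pos_divide_le_eq)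
      then have "1 \<le> (landen ^^ n) c" using landen_iter_ge[OF assms, of n] by linarith
      then have "\<bar>ell ((landen ^^ n) c) - (landen ^^ n) c\<bar> \<le> 5" by (rule ell_approx)
      then show ?thesis unfolding ell_landen_iter[OF assms, of n]
        by (simp add: diff_divide_distrib[symmetric] power_divide abs_minus_commute divide_right_mono)
    qed
    then show ?thesis by (auto simp: eventually_sequentially)
  qed
  moreover have "(\<lambda>n. 5 * (1/2::real) ^ n) \<longlonglongrightarrow> 0" by (intro tendsto_mult_right_zero LIMSEQ_power_zero) auto
  ultimately have "(\<lambda>n. (landen ^^ n) c / 2 ^ n - ell c) \<longlonglongrightarrow> 0"
    unfolding real_norm_def[symmetric] by (rule Lim_null_comparison)
  then show ?thesis by (simp add: LIM_zero_iff)
qed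

lemma landen_iter_diff:
  assumes "0 < a" "a \<le> b"
  shows "2 ^ n * (b - a) \<le> (landen ^^ n) b - (landen ^^ n) a"
proof (induction n)
  case (Suc n)
  have "(landen ^^ n) a \<le> (landen ^^ n) b" using Suc assms by (smt (verit) mult_nonneg_nonneg zero_le_power)
  then show ?case using Suc landen_diff(1)[OF landen_iter_pos[OF assms(1), of n], of "(landen ^^ n) b"] by simp
qed simp

text \<open>Every Landen step at least doubles differences; division by \<open>2 ^ n\<close> and the
  limit leave the difference itself. In other words, \<open>ell c - c\<close> is
  nondecreasing.\<close>

lemma ell_diff_ge:
  assumes "0 < a" "a \<le> b"
  shows "b - a \<le> ell b - ell a"
proof (rule LIMSEQ_le_const)
  show "(\<lambda>n. (landen ^^ n) b / 2 ^ n - (landen ^^ n) a / 2 ^ n) \<longlonglongrightarrow> ell b - ell a"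
    using assms by (intro tendsto_diff landen_iter_tendsto) auto
  show "\<exists>N. \<forall>n\<ge>N. b - a \<le> (landen ^^ n) b / 2 ^ n - (landen ^^ n) a / 2 ^ n"
    using landen_iter_diff[OF assms] by (auto simp: field_simps)
qed

text \<open>One exact Landen step before the rough bound \<open>c \<le> ell c\<close> sharpens it:
  \<open>landen c / 2\<close> exceeds \<open>c\<close> by
  \<open>ln (1 + sqrt (1 - exp (- 2 * c)))\<close>.\<close>

lemma ell_ge:
  assumes "0 < c"
  shows "landen c / 2 \<le> ell c" "c \<le> ell c"
proof -
  have p: "0 < landen c" using landen_ge[OF assms] assms by linarith
  have ge: "c \<le> ell c" if "0 < c" for c
  proof (rule LIMSEQ_le_const[OF landen_iter_tendsto[OF that]])
    show "\<exists>N. \<forall>n\<ge>N. c \<le> (landen ^^ n) c / 2 ^ n" using landen_iter_ge[OF that] by (auto simp: field_simps)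
  qed
  show "c \<le> ell c" using ge assms by simp
  show "landen c / 2 \<le> ell c" using ge[OF p] ell_landen[OF assms] by simp
qed

text \<open>A Landen step is doubling plus at most \<open>2 * ln 2\<close>. The induction carries
  the extra term \<open>- 2 * ln 2\<close>, the fixed point of this recursion, so that the added
  constants do not accumulate.\<close>

lemma ell_le:
  assumes "0 < c"
  shows "ell c \<le> c + 2 * ln 2"
proof (rule LIMSEQ_le_const2[OF landen_iter_tendsto[OF assms]])
  have "(landen ^^ n) c \<le> 2 ^ n * (c + 2 * ln 2) - 2 * ln 2" for n
  proof (induction n)
    case (Suc n)
    have "landen ((landen ^^ n) c) \<le> 2 * ((landen ^^ n) c) + 2 * ln 2"
      using sqrt_exp_bounds[OF landen_iter_pos[OF assms, of n]] unfolding landen_def by (simp add: add_pos_pos)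
    then show ?case using Suc by (simp add: algebra_simps)
  qed simp
  then have "(landen ^^ n) c \<le> 2 ^ n * (c + 2 * ln 2)" for n by (smt (verit) ln_gt_zero)
  then show "\<exists>N. \<forall>n\<ge>N. (landen ^^ n) c / 2 ^ n \<le> c + 2 * ln 2" by (auto simp: field_simps)
qed

text \<open>The quadratic Taylor bound for \<open>exp (1/4)\<close>, raised to the eighth power,
  exceeds \<open>1 / 0.14\<close>.\<close>

lemma exp_minus_two_le: "exp (- 2) \<le> (0.14 :: real)"
proof -
  have "(1 + 1/4 + (1/4)\<^sup>2 / 2 :: real) ^ 8 \<le> exp (1/4) ^ 8"
    by (intro power_mono exp_lower_Taylor_quadratic) auto
  also have "\<dots> = exp 2" by (simp add: exp_of_nat_mult[symmetric])
  finally have "1 / 0.14 \<le> exp (2::real)" by (simp add: power2_eq_square eval_nat_numeral)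
  then show ?thesis by (simp add: exp_minus field_simps)
qed

text \<open>Put \<open>x = exp (- 2 * a)\<close>. One step has slope at most
  \<open>2 / sqrt (1 - x)\<close>, and the value of \<open>x\<close> for the next step is at most
  \<open>x^2\<close>. The factor \<open>1 + x\<close> reproduces itself under this recursion because
  \<open>(1 + x^2) / sqrt (1 - x) \<le> 1 + x\<close> for \<open>x \<le> 0.14\<close>, which
  \<open>1 \<le> a\<close> guarantees.\<close>

lemma landen_iter_diff_le:
  assumes "1 \<le> a" "a \<le> b"
  shows "(landen ^^ n) b - (landen ^^ n) a \<le> 2 ^ n * (1 + exp (- 2 * a)) * (b - a)"
  using assms
proof (induction n arbitrary: a b)
  case 0
  then show ?case by (simp add: algebra_simps)
next
  case (Suc n)
  define x where "x = exp (- 2 * a)"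
  have x: "0 < x" "x \<le> 0.14" using exp_minus_two_le Suc.prems by (auto simp: x_def intro: order_trans[rotated])
  have a: "0 < a" using Suc.prems by simp
  have ge: "a \<le> landen a" "landen a \<le> landen b"
    using landen_ge[OF a] landen_diff(1)[of a b] Suc.prems by auto
  have "(landen ^^ Suc n) b - (landen ^^ Suc n) a = (landen ^^ n) (landen b) - (landen ^^ n) (landen a)"
    by (simp add: funpow_swap1)
  also have "\<dots> \<le> 2 ^ n * (1 + exp (- 2 * landen a)) * (landen b - landen a)"
    using Suc.prems ge by (intro Suc.IH) auto
  also have "\<dots> \<le> 2 ^ n * (1 + x\<^sup>2) * (2 / sqrt (1 - x) * (b - a))"
  proof (intro mult_mono)
    have "exp (- 2 * landen a) \<le> exp (- 2 * (2 * a))" using landen_ge[OF a] by simp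
    also have "\<dots> = x\<^sup>2" by (simp add: x_def power2_eq_square exp_add[symmetric])
    finally show "1 + exp (- 2 * landen a) \<le> 1 + x\<^sup>2" by simp
    show "landen b - landen a \<le> 2 / sqrt (1 - x) * (b - a)"
      using landen_diff(2)[OF a] Suc.prems by (simp add: x_def)
  qed (use ge in auto)
  also have "\<dots> = 2 ^ Suc n * ((1 + x\<^sup>2) / sqrt (1 - x)) * (b - a)" by simp
  also have "\<dots> \<le> 2 ^ Suc n * (1 + x) * (b - a)"
  proof (intro mult_right_mono mult_left_mono)
    have "(1 + x\<^sup>2)\<^sup>2 \<le> (1 + x)\<^sup>2 * (1 - x)"
    proof -
      have "x * x \<le> 0.14 * 0.14" using x by (intro mult_mono) auto
      moreover have "x * (x * x) \<le> 0.14 * (0.14 * 0.14)" using x by (intro mult_mono) auto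
      \<comment> \<open>The difference of the two sides to be compared is
        \<open>x * (1 - 3 * x - x^2 - x^3)\<close>.\<close>
      ultimately have "3 * x + x * x + x * (x * x) \<le> 1" using x by simp
      then have "x * (3 * x + x * x + x * (x * x)) \<le> x * 1" using x by (intro mult_left_mono) auto
      then show ?thesis by (simp add: power2_eq_square algebra_simps)
    qed
    then have "1 + x\<^sup>2 \<le> sqrt ((1 + x)\<^sup>2 * (1 - x))" by (rule real_le_rsqrt)
    also have "\<dots> = (1 + x) * sqrt (1 - x)" using x by (simp add: real_sqrt_mult)
    finally show "(1 + x\<^sup>2) / sqrt (1 - x) \<le> 1 + x" using x by (simp add: field_simps)
  qed (use Suc.prems in auto)
  finally show ?case by (simp add: x_def)
qed

lemma ell_diff_le:
  assumes "1 \<le> a" "a \<le> b"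
  shows "ell b - ell a \<le> 1.14 * (b - a)"
proof (rule LIMSEQ_le_const2)
  show "(\<lambda>n. (landen ^^ n) b / 2 ^ n - (landen ^^ n) a / 2 ^ n) \<longlonglongrightarrow> ell b - ell a"
    using assms by (intro tendsto_diff landen_iter_tendsto) auto
  have "(landen ^^ n) b / 2 ^ n - (landen ^^ n) a / 2 ^ n \<le> 1.14 * (b - a)" for n
  proof -
    have "exp (- 2 * a) \<le> exp (- 2)" using assms by simp
    then have "2 ^ n * (1 + exp (- 2 * a)) * (b - a) \<le> 2 ^ n * 1.14 * (b - a)"
      using assms order_trans[OF \<open>exp (- 2 * a) \<le> exp (- 2)\<close> exp_minus_two_le] by (intro mult_right_mono mult_left_mono) auto
    then have "(landen ^^ n) b - (landen ^^ n) a \<le> 2 ^ n * 1.14 * (b - a)"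
      using landen_iter_diff_le[OF assms, of n] by linarith
    then show ?thesis by (simp add: field_simps)
  qed
  then show "\<exists>N. \<forall>n\<ge>N. (landen ^^ n) b / 2 ^ n - (landen ^^ n) a / 2 ^ n \<le> 1.14 * (b - a)" by blast
qed

text \<open>By one Landen step \<open>ell 1\<close> is at least
  \<open>1 + ln (1 + sqrt (1 - exp (- 2)))\<close>, where the root exceeds 0.9. The value
  \<open>ln 1.9\<close> is estimated as \<open>ln 2\<close> minus the small correction
  \<open>ln (2 / 1.9)\<close>.\<close>

lemma ell_one_ge: "1.6 \<le> ell 1"
proof -
  have "(0.9::real) \<le> sqrt (1 - exp (- 2))" using exp_minus_two_le by (intro real_le_rsqrt) (auto simp: power2_eq_square)
  then have "ln 1.9 \<le> ln (1 + sqrt (1 - exp (- 2 :: real)))" by simp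
  moreover have "ln (1.9::real) = ln 2 - ln (2 / 1.9)" using ln_div[of 2 "2 / 1.9 :: real"] by simp
  moreover have "ln (2 / 1.9) \<le> (2 / 1.9 - 1 :: real)" by (rule ln_le_minus_one) simp
  moreover have "(2/3::real) \<le> ln 2" by (rule ln2_ge_two_thirds)
  ultimately have "0.6 \<le> ln (1 + sqrt (1 - exp (- 2 :: real)))" by simp
  then show ?thesis using ell_ge(1)[of 1] by (simp add: landen_def)
qed

text \<open>The slope bounds make \<open>ell\<close> Lipschitz on \<open>{1..}\<close>, hence
  continuous there. The intermediate value theorem applies on \<open>{1..d}\<close> with
  \<open>d = K * ell 1\<close>, since \<open>ell d \<ge> d\<close>.\<close>

lemma ell_surj:
  assumes "1 \<le> K"
  obtains c where "1 \<le> c" "ell c = K * ell 1"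
proof -
  have lip: "\<bar>ell x - ell y\<bar> \<le> 1.14 * \<bar>x - y\<bar>" if "1 \<le> x" "1 \<le> y" for x y
  proof (cases "x \<le> y")
    case True
    then show ?thesis using ell_diff_le[of x y] ell_diff_ge[of x y] that by simp
  next
    case False
    then show ?thesis using ell_diff_le[of y x] ell_diff_ge[of y x] that by simp
  qed
  have "1.14-lipschitz_on {1..} ell"
    by (rule lipschitz_onI) (use lip in \<open>auto simp: dist_real_def\<close>)
  then have cont: "continuous_on {1..} ell" by (rule lipschitz_on_continuous_on)
  define d where "d = K * ell 1"
  have d: "ell 1 \<le> d" using assms ell_one_ge by (simp add: d_def mult_le_cancel_right1)
  have "d \<le> ell d" using ell_ge(2)[of d] d ell_one_ge by simp
  moreover have "1 \<le> d" using d ell_one_ge by simp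
  ultimately obtain c where "1 \<le> c" "c \<le> d" "ell c = d"
    using IVT'[of ell 1 d d] d continuous_on_subset[OF cont, of "{1..d}"] by auto
  then show ?thesis using that d_def by blast
qed

section \<open>The constant c(K) and the bound deduced from an inequality for mu\<close>

lemma mu_strict_antimono:
  assumes "0 < r" "r < s" "s < 1"
  shows "mu s < mu r"
proof -
  have "- ln r - (- ln s) \<le> ell (- ln r) - ell (- ln s)" using assms by (intro ell_diff_ge) auto
  moreover have "ln r < ln s" using assms by simp
  ultimately have "ell (- ln s) < ell (- ln r)" by linarith
  then show ?thesis using assms by (simp add: ell_def)
qed

text \<open>The numbers \<open>tanh (c / 2)\<close>, written \<open>r c\<close>, and
  \<open>exp (- c)\<close> are complementary in the sense of \<open>mu_complement\<close>. So the
  equation that makes \<open>tanh (c / 2)\<close> the value of \<open>phiK2 K\<close> at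
  \<open>tanh (1 / 2)\<close> turns into \<open>ell c = K * ell 1\<close>, and
  \<open>2 * artanh\<close> recovers \<open>c\<close>.\<close>

lemma cK_char:
  assumes "1 \<le> K"
  shows "1 \<le> cK K" "ell (cK K) = K * ell 1"
proof -
  obtain c where c: "1 \<le> c" "ell c = K * ell 1" using ell_surj[OF assms] by blast
  define r where "r = (\<lambda>c::real. (1 - exp (- c)) / (1 + exp (- c)))"
  have r: "0 < r c" "r c < 1" "(1 - r c) / (1 + r c) = exp (- c)" if "0 < c" for c
  proof -
    have "exp (- c) < 1" "0 < exp (- c)" using that by auto
    then show "0 < r c" "r c < 1" by (auto simp: r_def field_simps add_pos_pos)
    define e where "e = exp (- c)"
    have e: "0 < e" by (simp add: e_def)
    have "1 - r c = 2 * e / (1 + e)" "1 + r c = 2 / (1 + e)"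
      using e by (auto simp: r_def e_def[symmetric] field_simps)
    then show "(1 - r c) / (1 + r c) = exp (- c)" using e unfolding e_def[symmetric] by simp
  qed
  have m: "mu (r c) * ell c = pi\<^sup>2 / 2" if "0 < c" for c
    using mu_complement[OF r(1,2)[OF that]] r(3)[OF that] by (simp add: ell_def)
  have t: "tanh (1 / 2) = r 1"
    by (simp add: tanh_real_altdef r_def)
  define s where "s = r c"
  have s: "0 < s" "s < 1" using r[of c] c by (auto simp: s_def)
  have lp: "0 < ell 1" "0 < ell c" using ell_one_ge ell_ge(2)[of c] c by auto
  have ms: "mu s = mu (r 1) / K"
  proof -
    have "mu s * ell c = mu (r 1) * ell 1" using m[of c] m[of 1] c(1) by (simp add: s_def)
    then have "mu s * (K * ell 1) = mu (r 1) * ell 1" unfolding c(2) .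
    then have "(mu s * K - mu (r 1)) * ell 1 = 0" by (simp add: algebra_simps)
    then have "mu s * K = mu (r 1)" using lp by simp
    then show ?thesis using assms by (simp add: field_simps)
  qed
  have mp: "0 < mu (r 1)" "0 < mu s" using mu_pos r s by auto
  have g: "gamma2 (1 / x) = 2 * pi / mu x" for x by (simp add: gamma2_def)
  have "gamma2_inv (K * gamma2 (1 / r 1)) = 1 / s"
    unfolding gamma2_inv_def
  \<comment> \<open>\<open>gamma2_inv\<close> is a definite description: existence comes from
    \<open>ell_surj\<close>, uniqueness from the strict monotonicity of \<open>mu\<close>.\<close>
  proof (rule the_equality)
    show "1 < 1 / s \<and> gamma2 (1 / s) = K * gamma2 (1 / r 1)"
      using s ms assms mp by (simp add: g field_simps)
  next
    fix v assume v: "1 < v \<and> gamma2 v = K * gamma2 (1 / r 1)"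
    define u where "u = 1 / v"
    have u: "0 < u" "u < 1" "v = 1 / u" using v by (auto simp: u_def)
    have "2 * pi / mu u = K * (2 * pi / mu (r 1))" using v u g by simp
    then have "mu u = mu s" using ms mu_pos[OF u(1,2)] mp assms by (simp add: field_simps)
    then have "u = s" using mu_strict_antimono[of u s] mu_strict_antimono[of s u] u s by (metis less_irrefl linorder_neqE_linordered_idom)
    then show "v = 1 / s" using u by simp
  qed
  then have "cK K = 2 * artanh s" unfolding cK_def phiK2_def t by simp
  also have "\<dots> = - ln ((1 - s) / (1 + s))" using s by (simp add: artanh_def ln_div)
  also have "\<dots> = c" using r(3)[of c] c by (simp add: s_def)
  finally show "1 \<le> cK K" "ell (cK K) = K * ell 1" using c by auto
qed

text \<open>This is \<open>4 powr (1 - 1 / K) \<le> cK K\<close>. The value 1.6 for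
  \<open>ell 1\<close> and the slope 1.14 have a quotient above \<open>7/5\<close>, whence
  \<open>cK K \<ge> 1 + (7/5) * (K - 1)\<close>; on the other side
  \<open>2 * ln 2 \<le> 7/5\<close>. There remains an inequality in \<open>K\<close> with equality
  at 1.\<close>

lemma cK_ge:
  assumes "1 \<le> K"
  shows "2 * ln 2 * (1 - 1 / K) \<le> ln (cK K)"
proof -
  have c: "1 \<le> cK K" "ell (cK K) = K * ell 1" using cK_char[OF assms] by auto
  have "(K - 1) * 1.6 \<le> (K - 1) * ell 1" using assms ell_one_ge by (intro mult_left_mono) auto
  also have "\<dots> = ell (cK K) - ell 1" using c by (simp add: algebra_simps)
  also have "\<dots> \<le> 1.14 * (cK K - 1)" using ell_diff_le[of 1 "cK K"] c by simp
  finally have "160 * (K - 1) \<le> 114 * (cK K - 1)" by simp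
  then have "160 * K - 160 \<le> 114 * cK K - 114" by (simp add: algebra_simps)
  then have "14 * K - 4 \<le> 10 * cK K" using assms by linarith
  then have 1: "1 + (7/5) * (K - 1) \<le> cK K" by (simp add: field_simps)
  have "2 * ln 2 * (1 - 1 / K) \<le> (7/5) * (1 - 1 / K)"
    using ln2_le_25_over_36 assms by (intro mult_right_mono) auto
  also have "\<dots> \<le> ln (1 + (7/5) * (K - 1))"
  proof -
    let ?f = "\<lambda>K::real. ln (1 + (7/5) * (K - 1)) - (7/5) * (1 - 1 / K)"
    have "?f 1 \<le> ?f K"
    proof (rule DERIV_nonneg_imp_nondecreasing[OF assms])
      fix x :: real assume x: "1 \<le> x" "x \<le> K"
      have "(?f has_real_derivative ((7/5) / (1 + (7/5) * (x - 1)) - (7/5) / x\<^sup>2)) (at x)"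
        using x add_pos_nonneg[of 1 "(7/5) * (x - 1)"] by (auto intro!: derivative_eq_intros simp: power2_eq_square)
      \<comment> \<open>The comparison of derivatives amounts to
        \<open>(x - 1) * (x - 2/5) \<ge> 0\<close>.\<close>
      moreover have "(7/5) / x\<^sup>2 \<le> (7/5) / (1 + (7/5) * (x - 1))"
      proof (rule divide_left_mono)
        have "0 \<le> (x - 1) * (x - 2/5)" using x by simp
        also have "(x - 1) * (x - 2/5) = x\<^sup>2 - (1 + (7/5) * (x - 1))" by (simp add: field_simps power2_eq_square)
        finally show "1 + (7/5) * (x - 1) \<le> x\<^sup>2" by simp
        have "0 < 1 + (7/5) * (x - 1)" using x by (intro add_pos_nonneg) auto
        then show "0 < x\<^sup>2 * (1 + (7/5) * (x - 1))" using x by (intro mult_pos_pos) auto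
      qed simp
      ultimately show "\<exists>y. (?f has_real_derivative y) (at x) \<and> 0 \<le> y" by force
    qed
    then show ?thesis by simp
  qed
  also have "\<dots> \<le> ln (cK K)" using 1 assms by (intro ln_mono add_pos_nonneg) auto
  finally show ?thesis .
qed

text \<open>Write \<open>r = exp (- a)\<close> and \<open>s = exp (- b)\<close>. If
  \<open>s \<le> r\<close>, then \<open>s \<le> r powr (1 / K)\<close> already. Otherwise
  \<open>D = ell a - a\<close> also bounds \<open>ell b - b\<close>, by monotonicity, so the
  hypothesis gives \<open>a + D \<le> K * (b + D)\<close>. Hence
  \<open>a / K - b \<le> D * (1 - 1 / K)\<close>, which is at most \<open>ln (cK K)\<close> because
  \<open>D \<le> 2 * ln 2\<close>.\<close>

lemma schwarz_bound_of_mu_le: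
  assumes K: "1 \<le> K" and r: "0 < r" "r < 1" and s: "0 < s" "s < 1" and le: "mu r \<le> K * mu s"
  shows "s \<le> cK K * r powr (1 / K)"
proof -
  define a b where "a = - ln r" and "b = - ln s"
  have ab: "0 < a" "0 < b" "mu r = ell a" "mu s = ell b" using r s by (auto simp: a_def b_def ell_def)
  have c: "1 \<le> cK K" using cK_char[OF K] by simp
  have "- b \<le> ln (cK K) - a / K"
  proof (cases "a \<le> b")
    case True
    have "a / K \<le> a" using ab K by (simp add: field_simps mult_le_cancel_left1)
    then show ?thesis using True c ln_ge_zero[OF c] by linarith
  next
    case False
    define D where "D = ell a - a"
    have D: "ell b \<le> b + D" "D \<le> 2 * ln 2" using ell_diff_ge[of b a] ell_le[of a] ab False by (auto simp: D_def)
    have "ell a \<le> K * ell b" using le ab by simp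
    also have "\<dots> \<le> K * (b + D)" using K by (intro mult_left_mono D) auto
    finally have "a + D \<le> K * (b + D)" unfolding D_def by simp
    then have "a / K + D / K \<le> b + D" using K by (simp add: field_simps)
    moreover have "D * (1 - 1 / K) \<le> 2 * ln 2 * (1 - 1 / K)" using D K by (intro mult_right_mono) auto
    ultimately show ?thesis using cK_ge[OF K] by (simp add: algebra_simps)
  qed
  then have "ln s \<le> ln (cK K) + (1 / K) * ln r" by (simp add: a_def b_def)
  also have "\<dots> = ln (cK K * r powr (1 / K))" using c r by (simp add: ln_mult ln_powr)
  finally show ?thesis using s c r by (subst (asm) ln_le_cancel_iff) auto
qed

section \<open>The metric of a sector\<close>

lemma sinh_mult_ge:
  fixes u :: real
  assumes "1 \<le> p" "0 \<le> u"
  shows "p * sinh u \<le> sinh (p * u)"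
proof -
  have "(\<lambda>u. sinh (p * u) - p * sinh u) 0 \<le> (\<lambda>u. sinh (p * u) - p * sinh u) u"
  proof (rule DERIV_nonneg_imp_nondecreasing[OF assms(2)])
    fix x :: real assume x: "0 \<le> x" "x \<le> u"
    have "((\<lambda>u. sinh (p * u) - p * sinh u) has_real_derivative p * (cosh (p * x) - cosh x)) (at x)"
      by (auto intro!: derivative_eq_intros simp: algebra_simps)
    moreover have "cosh x \<le> cosh (p * x)"
      using assms x by (subst cosh_real_nonneg_le_iff) (auto simp: mult_le_cancel_right1)
    ultimately show "\<exists>y. ((\<lambda>u. sinh (p * u) - p * sinh u) has_real_derivative y) (at x) \<and> 0 \<le> y"
      using assms by (intro exI[of _ "p * (cosh (p * x) - cosh x)"]) auto
  qed
  then show ?thesis by simp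
qed

lemma sin_mult_le:
  fixes a :: real
  assumes "1 \<le> p" "0 \<le> a" "p * a \<le> pi"
  shows "sin (p * a) \<le> p * sin a"
proof -
  have "(\<lambda>u. p * sin u - sin (p * u)) 0 \<le> (\<lambda>u. p * sin u - sin (p * u)) a"
  proof (rule DERIV_nonneg_imp_nondecreasing[OF assms(2)])
    fix x :: real assume x: "0 \<le> x" "x \<le> a"
    have "((\<lambda>u. p * sin u - sin (p * u)) has_real_derivative p * (cos x - cos (p * x))) (at x)"
      by (auto intro!: derivative_eq_intros simp: algebra_simps)
    moreover have "cos (p * x) \<le> cos x"
    proof (rule cos_monotone_0_pi_le)
      have "p * x \<le> p * a" using x assms by (intro mult_left_mono) auto
      then show "p * x \<le> pi" using assms by linarith
      show "x \<le> p * x" using x assms by (simp add: mult_le_cancel_right1)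
    qed (use x in auto)
    ultimately show "\<exists>y. ((\<lambda>u. p * sin u - sin (p * u)) has_real_derivative y) (at x) \<and> 0 \<le> y"
      using assms by (intro exI[of _ "p * (cos x - cos (p * x))"]) auto
  qed
  then show ?thesis by simp
qed

text \<open>Cross-multiplied form of the fact that \<open>sin (p * t) / sin t\<close> is
  nonincreasing. The auxiliary inequality \<open>h\<close> is the sign of its derivative, and holds
  because the difference of its sides vanishes at 0 and has derivative
  \<open>(p^2 - 1) * sin (p * t) * sin t\<close>.\<close>

lemma sin_ratio_mono:
  fixes d s :: real
  assumes "1 \<le> p" "0 \<le> d" "d \<le> s" "p * s \<le> pi / 2"
  shows "sin d * sin (p * s) \<le> sin s * sin (p * d)"
proof (cases "d = 0")
  case False
  then have d: "0 < d" using assms by simp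
  have h: "p * cos (p * t) * sin t \<le> sin (p * t) * cos t" if "0 \<le> t" "t \<le> s" for t
  proof -
    let ?h = "\<lambda>t. sin (p * t) * cos t - p * cos (p * t) * sin t"
    have "?h 0 \<le> ?h t"
    proof (rule DERIV_nonneg_imp_nondecreasing[OF that(1)])
      fix x :: real assume x: "0 \<le> x" "x \<le> t"
      have px: "p * x \<le> pi / 2" "x \<le> p * x" "0 \<le> p * x"
      proof -
        have "p * x \<le> p * s" using x that assms by (intro mult_left_mono) auto
        then show "p * x \<le> pi / 2" using assms by linarith
        show "x \<le> p * x" using x assms by (simp add: mult_le_cancel_right1)
        show "0 \<le> p * x" using x assms by simp
      qed
      have "(?h has_real_derivative (p * p - 1) * (sin (p * x) * sin x)) (at x)"
        by (auto intro!: derivative_eq_intros simp: algebra_simps)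
      moreover have "0 \<le> sin (p * x)" using px pi_gt_zero by (intro sin_ge_zero) linarith+
      moreover have "0 \<le> sin x" using px x pi_gt_zero by (intro sin_ge_zero) linarith+
      moreover have "0 \<le> p * p - 1" using assms mult_mono[of 1 p 1 p] by simp
      ultimately show "\<exists>y. (?h has_real_derivative y) (at x) \<and> 0 \<le> y"
        by (intro exI[of _ "(p * p - 1) * (sin (p * x) * sin x)"]) auto
    qed
    then show ?thesis by simp
  qed
  have sp: "s \<le> p * s" using assms by (simp add: mult_le_cancel_right1)
  have pos: "0 < sin x" if "d \<le> x" "x \<le> s" for x
    using that d sp assms pi_gt_zero by (intro sin_gt_zero) linarith+
  have "(\<lambda>t. sin (p * t) / sin t) s \<le> (\<lambda>t. sin (p * t) / sin t) d"
  proof (rule DERIV_nonpos_imp_nonincreasing[OF assms(3)])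
    fix x :: real assume x: "d \<le> x" "x \<le> s"
    have "((\<lambda>t. sin (p * t) / sin t) has_real_derivative (p * cos (p * x) * sin x - sin (p * x) * cos x) / (sin x)\<^sup>2) (at x)"
      using pos[OF x] by (auto intro!: derivative_eq_intros simp: power2_eq_square algebra_simps)
    moreover have "(p * cos (p * x) * sin x - sin (p * x) * cos x) / (sin x)\<^sup>2 \<le> 0"
      using h[of x] x d by (intro divide_nonpos_nonneg) auto
    ultimately show "\<exists>y. ((\<lambda>t. sin (p * t) / sin t) has_real_derivative y) (at x) \<and> y \<le> 0" by blast
  qed
  then show ?thesis using pos[of s] pos[of d] assms by (simp add: field_simps)
qed simp

lemma sin_sq_diff:
  fixes s d :: real
  shows "(sin s)\<^sup>2 - (sin d)\<^sup>2 = sin (s + d) * sin (s - d)"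
proof -
  have "sin (s + d) * sin (s - d) = (sin s)\<^sup>2 * (cos d)\<^sup>2 - (cos s)\<^sup>2 * (sin d)\<^sup>2"
    by (simp add: sin_add sin_diff power2_eq_square algebra_simps)
  then show ?thesis by (simp add: cos_squared_eq algebra_simps)
qed

text \<open>Cross-multiplied form of the comparison of the half-angle quotients
  \<open>(sinh\<^sup>2 u + sin\<^sup>2 d) / (sinh\<^sup>2 u + sin\<^sup>2 s)\<close>, which avoids the degenerate case \<open>u = d = 0\<close>.\<close>

lemma half_angle_quotient_le:
  fixes u :: real
  assumes p: "1 \<le> p" and d: "0 \<le> d" "d \<le> s" and s: "p * s \<le> pi / 2"
  shows "((sinh u)\<^sup>2 + (sin d)\<^sup>2) * ((sinh (p * u))\<^sup>2 + (sin (p * s))\<^sup>2)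
     \<le> ((sinh (p * u))\<^sup>2 + (sin (p * d))\<^sup>2) * ((sinh u)\<^sup>2 + (sin s)\<^sup>2)"
proof -
  have sp: "s \<le> p * s" "d \<le> p * d" using d p by (auto simp: mult_le_cancel_right1)
  have pds: "p * d \<le> p * s" "0 \<le> p * d" using d p by (auto intro: mult_left_mono)
  \<comment> \<open>After expansion the pure \<open>sinh\<close> products cancel. The mixed terms
    are compared through \<open>X\<close>, \<open>B\<close> and \<open>A\<close>; the terms without
    \<open>sinh\<close> are the square of \<open>sin_ratio_mono\<close>.\<close>
  have X: "p\<^sup>2 * (sinh u)\<^sup>2 \<le> (sinh (p * u))\<^sup>2"
  proof -
    have "p * sinh \<bar>u\<bar> \<le> sinh (p * \<bar>u\<bar>)" by (rule sinh_mult_ge) (use p in auto)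
    then have "(p * sinh \<bar>u\<bar>)\<^sup>2 \<le> (sinh (p * \<bar>u\<bar>))\<^sup>2" using p by (intro power_mono) auto
    moreover have "(sinh \<bar>u\<bar>)\<^sup>2 = (sinh u)\<^sup>2" "(sinh (p * \<bar>u\<bar>))\<^sup>2 = (sinh (p * u))\<^sup>2"
      by (cases "0 \<le> u"; simp)+
    ultimately show ?thesis by (simp add: power_mult_distrib)
  qed
  have B: "(sin (p * s))\<^sup>2 - (sin (p * d))\<^sup>2 \<le> p\<^sup>2 * ((sin s)\<^sup>2 - (sin d)\<^sup>2)"
  proof -
    have nn: "0 \<le> sin (s + d)" "0 \<le> sin (s - d)" "0 \<le> sin (p * (s - d))"
      using d s sp pds pi_gt_zero by (intro sin_ge_zero; simp add: algebra_simps)+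
    have "p * (s + d) \<le> pi" "p * (s - d) \<le> pi"
      using s pds unfolding distrib_left right_diff_distrib by linarith+
    then have "sin (p * (s + d)) \<le> p * sin (s + d)" "sin (p * (s - d)) \<le> p * sin (s - d)"
      using p d by (auto intro: sin_mult_le)
    then have "sin (p * (s + d)) * sin (p * (s - d)) \<le> (p * sin (s + d)) * (p * sin (s - d))"
      using nn p by (intro mult_mono) auto
    then show ?thesis unfolding sin_sq_diff by (simp add: algebra_simps power2_eq_square)
  qed
  have A: "0 \<le> (sin s)\<^sup>2 - (sin d)\<^sup>2"
  proof -
    have "0 \<le> sin d" "sin d \<le> sin s"
      using d s sp pi_gt_zero by (auto intro!: sin_ge_zero sin_monotone_2pi_le)
    then show ?thesis by (simp add: power_mono)
  qed
  have "(sinh u)\<^sup>2 * ((sin (p * s))\<^sup>2 - (sin (p * d))\<^sup>2) \<le> (sinh u)\<^sup>2 * (p\<^sup>2 * ((sin s)\<^sup>2 - (sin d)\<^sup>2))"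
    using B by (intro mult_left_mono) auto
  also have "\<dots> = p\<^sup>2 * (sinh u)\<^sup>2 * ((sin s)\<^sup>2 - (sin d)\<^sup>2)" by simp
  also have "\<dots> \<le> (sinh (p * u))\<^sup>2 * ((sin s)\<^sup>2 - (sin d)\<^sup>2)" using X A by (intro mult_right_mono) auto
  finally have 1: "(sinh u)\<^sup>2 * ((sin (p * s))\<^sup>2 - (sin (p * d))\<^sup>2) \<le> (sinh (p * u))\<^sup>2 * ((sin s)\<^sup>2 - (sin d)\<^sup>2)" .
  have 2: "(sin d)\<^sup>2 * (sin (p * s))\<^sup>2 \<le> (sin s)\<^sup>2 * (sin (p * d))\<^sup>2"
  proof -
    have "0 \<le> sin d" "0 \<le> sin (p * s)" using d s sp pds pi_gt_zero by (auto intro!: sin_ge_zero)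
    then have "(sin d * sin (p * s))\<^sup>2 \<le> (sin s * sin (p * d))\<^sup>2"
      using sin_ratio_mono[OF p d s] by (intro power_mono) auto
    then show ?thesis by (simp add: power_mult_distrib)
  qed
  show ?thesis using 1 2 by (simp add: algebra_simps)
qed

text \<open>Lazarevic's inequality, which gives the sign of the derivative of
  \<open>1 / (sinh x)^2 - 1 / x^2\<close>. With \<open>y = cosh t powr (-2/3)\<close> the derivative
  of the auxiliary function is \<open>(y - 1)^2 * (y + 2) / (3 * y)\<close>.\<close>

lemma sinh_cubed_ge:
  fixes x :: real
  assumes "0 \<le> x"
  shows "x ^ 3 * cosh x \<le> (sinh x) ^ 3"
proof -
  let ?g = "\<lambda>x::real. sinh x * cosh x powr (-1/3) - x"
  have "?g 0 \<le> ?g x"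
  proof (rule DERIV_nonneg_imp_nondecreasing[OF assms])
    fix t :: real assume "0 \<le> t"
    define y where "y = cosh t powr (-2/3)"
    have c: "0 < cosh t" by (rule cosh_real_pos)
    have y: "0 < y" using c by (simp add: y_def)
    have e1: "cosh t powr (-1/3) * cosh t = 1 / y"
      using c by (simp add: y_def powr_minus_divide[symmetric] powr_mult_base mult.commute flip: powr_minus)
    have e2: "cosh t powr (-1/3 - 1) = y * y"
      using c by (simp add: y_def powr_add[symmetric])
    have e3: "(cosh t)\<^sup>2 * (y * y) = 1 / y"
    proof -
      have "(cosh t)\<^sup>2 = cosh t powr 2" using c by simp
      then have "(cosh t)\<^sup>2 * (y * y) = cosh t powr (2 + (-2/3 + -2/3))" by (simp only: y_def powr_add)
      then show ?thesis by (simp add: y_def powr_minus_divide)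
    qed
    have "(?g has_real_derivative cosh t * cosh t powr (-1/3) + sinh t * ((-1/3) * cosh t powr (-1/3 - 1) * sinh t) - 1) (at t)"
      using c by (auto intro!: derivative_eq_intros simp: mult_ac)
    moreover have "cosh t * cosh t powr (-1/3) + sinh t * ((-1/3) * cosh t powr (-1/3 - 1) * sinh t) - 1
       = 2 / 3 / y + y * y / 3 - 1"
    proof -
      have "sinh t * ((-1/3) * (y * y) * sinh t) = - ((cosh t)\<^sup>2 - 1) * (y * y) / 3"
      proof -
        have "sinh t * sinh t = cosh t * cosh t - 1" using cosh_square_eq[of t] by (simp add: power2_eq_square)
        moreover have "sinh t * ((-1/3) * (y * y) * sinh t) = - (sinh t * sinh t) * (y * y) / 3" by simp
        ultimately show ?thesis by (simp only: power2_eq_square)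
      qed
      also have "\<dots> = - (1 / y) / 3 + y * y / 3" using e3 by (simp add: algebra_simps diff_divide_distrib)
      finally show ?thesis using e1 unfolding e2 by (simp add: mult.commute)
    qed
    moreover have "0 \<le> 2 / 3 / y + y * y / 3 - 1"
    proof -
      have "2 / 3 / y + y * y / 3 - 1 = (y - 1)\<^sup>2 * (y + 2) / (3 * y)"
        using y by (simp add: field_simps power2_eq_square)
      then show ?thesis using y by simp
    qed
    ultimately show "\<exists>y. (?g has_real_derivative y) (at t) \<and> 0 \<le> y"
      by (intro exI[of _ "2 / 3 / y + y * y / 3 - 1"] conjI) simp_all
  qed
  then have "x \<le> sinh x * cosh x powr (-1/3)" by simp
  then have "x ^ 3 \<le> (sinh x * cosh x powr (-1/3)) ^ 3" using assms by (intro power_mono) auto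
  also have "\<dots> = sinh x ^ 3 * cosh x powr (-1)"
  proof -
    have "(cosh x powr (-1/3)) ^ 3 = cosh x powr (-1/3 + -1/3 + -1/3)" by (simp only: powr_add power3_eq_cube)
    then show ?thesis by (simp add: power_mult_distrib)
  qed
  also have "\<dots> = sinh x ^ 3 / cosh x" using cosh_real_pos[of x] by (simp add: powr_neg_one)
  finally show ?thesis using cosh_real_pos[of x] by (simp add: field_simps)
qed

lemma inverse_sinh_sq_mono:
  fixes x y :: real
  assumes "0 < x" "x \<le> y"
  shows "1 / (sinh x)\<^sup>2 - 1 / x\<^sup>2 \<le> 1 / (sinh y)\<^sup>2 - 1 / y\<^sup>2"
proof -
  let ?j = "\<lambda>x::real. 1 / (sinh x)\<^sup>2 - 1 / x\<^sup>2"
  have "?j x \<le> ?j y"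
  proof (rule DERIV_nonneg_imp_nondecreasing[OF assms(2)])
    fix t :: real assume "x \<le> t"
    then have t: "0 < t" "0 < sinh t" using assms by auto
    have "(?j has_real_derivative (2 / t ^ 3 - 2 * cosh t / sinh t ^ 3)) (at t)"
      using t by (auto intro!: derivative_eq_intros simp: field_simps eval_nat_numeral)
    moreover have "cosh t / sinh t ^ 3 \<le> 1 / t ^ 3"
      using sinh_cubed_ge[of t] t by (simp add: field_simps)
    ultimately show "\<exists>y. (?j has_real_derivative y) (at t) \<and> 0 \<le> y"
      by (intro exI[of _ "2 / t ^ 3 - 2 * cosh t / sinh t ^ 3"]) auto
  qed
  then show ?thesis .
qed

text \<open>The bound \<open>-1/3\<close> is the limit at 0. Solved for \<open>x\<close> it reads
  \<open>sqrt 3 * sinh x / sqrt (3 + (sinh x)^2) \<le> x\<close>, where both sides vanish at 0 and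
  no limit is involved; the derivatives compare by \<open>27 * (1 + T) \<le> (3 + T)^3\<close> with
  \<open>T = (sinh x)^2\<close>.\<close>

lemma inverse_sinh_sq_ge:
  fixes x :: real
  assumes "0 < x"
  shows "- 1 / 3 \<le> 1 / (sinh x)\<^sup>2 - 1 / x\<^sup>2"
proof -
  let ?g = "\<lambda>x::real. x - sqrt 3 * sinh x / sqrt (3 + (sinh x)\<^sup>2)"
  have pos: "0 < 3 + (sinh t)\<^sup>2" for t :: real by (simp add: add_pos_nonneg)
  have "?g 0 \<le> ?g x"
  proof (rule DERIV_nonneg_imp_nondecreasing[OF less_imp_le[OF assms]])
    fix t :: real assume t: "0 \<le> t"
    define q where "q = sqrt (3 + (sinh t)\<^sup>2)"
    have q: "0 < q" "q\<^sup>2 = 3 + (sinh t)\<^sup>2" using pos[of t] by (auto simp: q_def)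
    have "((\<lambda>t. sqrt (3 + (sinh t)\<^sup>2)) has_real_derivative sinh t * cosh t / q) (at t)"
      unfolding q_def using pos[of t] by (auto intro!: derivative_eq_intros simp: field_simps)
    then have "((\<lambda>t. sqrt 3 * sinh t / sqrt (3 + (sinh t)\<^sup>2)) has_real_derivative
        (sqrt 3 * cosh t * q - sqrt 3 * sinh t * (sinh t * cosh t / q)) / (q * q)) (at t)"
      unfolding q_def using q(1)[unfolded q_def] pos[of t]
      by (intro DERIV_divide) (auto intro!: derivative_eq_intros)
    moreover have "(sqrt 3 * cosh t * q - sqrt 3 * sinh t * (sinh t * cosh t / q)) / (q * q) = 3 * sqrt 3 * cosh t / q ^ 3"
    proof -
      have "(sqrt 3 * cosh t * q - sqrt 3 * sinh t * (sinh t * cosh t / q)) = sqrt 3 * cosh t * (q\<^sup>2 - (sinh t)\<^sup>2) / q"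
        using q(1) by (simp add: field_simps power2_eq_square)
      also have "\<dots> = sqrt 3 * cosh t * 3 / q" unfolding q(2) by simp
      finally show ?thesis using q(1) by (simp add: eval_nat_numeral)
    qed
    ultimately have 1: "(?g has_real_derivative (1 - 3 * sqrt 3 * cosh t / q ^ 3)) (at t)"
      by (intro DERIV_diff DERIV_ident) simp
    have "(3 * sqrt 3 * cosh t)\<^sup>2 \<le> (q ^ 3)\<^sup>2"
    proof -
      have "(q ^ 3)\<^sup>2 = (3 + (sinh t)\<^sup>2) ^ 3" unfolding q(2)[symmetric] by (simp add: power_mult[symmetric])
      moreover have "(3 * sqrt 3 * cosh t)\<^sup>2 = 27 * (1 + (sinh t)\<^sup>2)"
        by (simp add: power_mult_distrib cosh_square_eq)
      moreover have "(3 + (sinh t)\<^sup>2) ^ 3 = 27 * (1 + (sinh t)\<^sup>2) + 9 * ((sinh t)\<^sup>2)\<^sup>2 + ((sinh t)\<^sup>2) ^ 3"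
        by (simp add: eval_nat_numeral algebra_simps)
      ultimately show ?thesis by simp
    qed
    moreover have "0 \<le> q ^ 3" using q(1) by simp
    ultimately have "3 * sqrt 3 * cosh t \<le> q ^ 3" by (rule power2_le_imp_le)
    then have "3 * sqrt 3 * cosh t / q ^ 3 \<le> 1" using q(1) by simp
    then show "\<exists>y. (?g has_real_derivative y) (at t) \<and> 0 \<le> y" using 1 by force
  qed
  then have "sqrt 3 * sinh x / sqrt (3 + (sinh x)\<^sup>2) \<le> x" by simp
  then have "(sqrt 3 * sinh x / sqrt (3 + (sinh x)\<^sup>2))\<^sup>2 \<le> x\<^sup>2"
    using assms by (intro power_mono) auto
  then have le: "3 * (sinh x)\<^sup>2 / (3 + (sinh x)\<^sup>2) \<le> x\<^sup>2"
    using pos[of x] by (simp add: power_divide power_mult_distrib)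
  define T where "T = (sinh x)\<^sup>2"
  have T: "0 < T" using assms by (simp add: T_def)
  have "1 / x\<^sup>2 \<le> 1 / (3 * T / (3 + T))"
    using le T assms unfolding T_def[symmetric] by (intro divide_left_mono mult_pos_pos) auto
  also have "\<dots> = 1 / T + 1 / 3" using T by (simp add: field_simps)
  finally show ?thesis by (simp add: T_def)
qed

text \<open>The left-hand side is nondecreasing up to \<open>pi / 2\<close>, where it has the value
  \<open>pi^2 / 4 - pi^2 / 12\<close>. Its derivative is nonnegative by
  \<open>(sin t)^3 / 3 \<le> sin t - t * cos t\<close>.\<close>

lemma sq_div_sin_sq_le:
  assumes "0 < y" "y \<le> pi / 2"
  shows "y\<^sup>2 / (sin y)\<^sup>2 - y\<^sup>2 / 3 \<le> pi\<^sup>2 / 6"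
proof -
  have q: "(sin t) ^ 3 / 3 \<le> sin t - t * cos t" if "0 \<le> t" "t \<le> pi / 2" for t
  proof -
    let ?q = "\<lambda>t::real. sin t - t * cos t - (sin t) ^ 3 / 3"
    have "?q 0 \<le> ?q t"
    proof (rule DERIV_nonneg_imp_nondecreasing[OF that(1)])
      fix x :: real assume x: "0 \<le> x" "x \<le> t"
      have s: "0 \<le> sin x" using x that pi_gt_zero by (intro sin_ge_zero) linarith+
      have "(?q has_real_derivative sin x * (x - sin x * cos x)) (at x)"
        by (auto intro!: derivative_eq_intros simp: algebra_simps power2_eq_square)
      moreover have "sin x * cos x \<le> x"
      proof -
        have "sin x * cos x \<le> sin x" using s by (simp add: mult_left_le)
        also have "sin x \<le> x" using x by (intro sin_x_le_x) auto
        finally show ?thesis .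
      qed
      ultimately show "\<exists>y. (?q has_real_derivative y) (at x) \<and> 0 \<le> y" using s
        by (intro exI[of _ "sin x * (x - sin x * cos x)"]) auto
    qed
    then show ?thesis by simp
  qed
  let ?F = "\<lambda>y::real. y\<^sup>2 / (sin y)\<^sup>2 - y\<^sup>2 / 3"
  have "?F y \<le> ?F (pi / 2)"
  proof (rule DERIV_nonneg_imp_nondecreasing[OF assms(2)])
    fix t :: real assume t: "y \<le> t" "t \<le> pi / 2"
    then have t0: "0 < t" using assms by simp
    have s: "0 < sin t" using t t0 pi_gt_zero by (intro sin_gt_zero) linarith+
    define S where "S = sin t"
    have S: "0 < S" using s by (simp add: S_def)
    have "(?F has_real_derivative (2 * t * (S - t * cos t) / S ^ 3 - 2 * t / 3)) (at t)"
      unfolding S_def using s by (auto intro!: derivative_eq_intros simp: field_simps eval_nat_numeral)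
    moreover have "2 * t / 3 \<le> 2 * t * (S - t * cos t) / S ^ 3"
    proof -
      have "2 * t * (S ^ 3 / 3) \<le> 2 * t * (S - t * cos t)"
        using q[of t] t t0 by (intro mult_left_mono) (auto simp: S_def)
      then have "2 * t * (S ^ 3 / 3) / S ^ 3 \<le> 2 * t * (S - t * cos t) / S ^ 3" using S by (intro divide_right_mono) auto
      then show ?thesis using S by simp
    qed
    ultimately show "\<exists>y. (?F has_real_derivative y) (at t) \<and> 0 \<le> y"
      by (intro exI[of _ "2 * t * (S - t * cos t) / S ^ 3 - 2 * t / 3"]) auto
  qed
  then show ?thesis by (simp add: power_divide)
qed

text \<open>The angles are removed by two uses of \<open>half_angle_quotient_le\<close>:
  \<open>hs\<close> moves \<open>s\<close> to the extreme angle \<open>pi / (2 * p)\<close>, where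
  \<open>sin (p * s)\<close> is 1, and \<open>hd\<close> moves \<open>d\<close> to 0. What is left
  is the inequality \<open>key\<close> in \<open>u\<close> alone; it splits into \<open>a\<close>,
  which concerns only \<open>sinh\<close>, and \<open>b\<close>, which concerns only the constant,
  with right-hand sides adding up to 1. At \<open>u = 0\<close> the quantities \<open>X\<close> and
  \<open>Y\<close> vanish, so that case is direct.\<close>

lemma half_angle_quotient_ge:
  fixes u :: real
  assumes p: "1 \<le> p" and d: "0 \<le> d" "d \<le> s" and s: "p * s \<le> pi / 2"
  defines "S \<equiv> sin (pi / (2 * p))"
  shows "((sinh (p * u))\<^sup>2 + (sin (p * d))\<^sup>2) * ((sinh u)\<^sup>2 + (sin s)\<^sup>2)
     \<le> (p * S)\<^sup>2 * (((sinh u)\<^sup>2 + (sin d)\<^sup>2) * ((sinh (p * u))\<^sup>2 + (sin (p * s))\<^sup>2))"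
proof -
  let ?y = "pi / (2 * p)"
  have y: "0 < ?y" "?y \<le> pi / 2" "p * ?y = pi / 2" "s \<le> ?y" using p s by (auto simp: field_simps)
  have S: "0 < S" unfolding S_def using y pi_gt_zero by (intro sin_gt_zero) linarith+
  have ds: "p * d \<le> pi / 2" using d p s mult_left_mono[of d s p] by linarith
  define X Y where "X = (sinh u)\<^sup>2" and "Y = (sinh (p * u))\<^sup>2"
  define Ad As Bd Bs where "Ad = (sin d)\<^sup>2" and "As = (sin s)\<^sup>2" and "Bd = (sin (p * d))\<^sup>2" and "Bs = (sin (p * s))\<^sup>2"
  have nn: "0 \<le> X" "0 \<le> Y" "0 \<le> Ad" "0 \<le> As" "0 \<le> Bd" "0 \<le> Bs"
    by (auto simp: X_def Y_def Ad_def As_def Bd_def Bs_def)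
  have hs: "(X + As) * (Y + 1) \<le> (Y + Bs) * (X + S\<^sup>2)"
    using half_angle_quotient_le[OF p _ y(4), of u] d unfolding y(3)
    by (simp add: X_def Y_def As_def Bs_def S_def)
  have hd: "X * (Y + Bd) \<le> Y * (X + Ad)"
    using half_angle_quotient_le[OF p _ d(1) ds, of u] by (simp add: X_def Y_def Ad_def Bd_def)
  have main: "(Y + Bd) * (X + As) \<le> (p * S)\<^sup>2 * ((X + Ad) * (Y + Bs))"
  proof (cases "u = 0")
    case True
    have 0: "X = 0" "Y = 0" using True by (auto simp: X_def Y_def)
    have "sin (p * d) \<le> p * sin d" using p d ds pi_gt_zero by (intro sin_mult_le) linarith+
    moreover have "0 \<le> sin (p * d)"
    proof (rule sin_ge_zero)
      show "0 \<le> p * d" using p d by simp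
      show "p * d \<le> pi" using ds pi_gt_zero by linarith
    qed
    ultimately have "Bd \<le> p\<^sup>2 * Ad" unfolding Bd_def Ad_def power_mult_distrib[symmetric] by (intro power_mono)
    moreover have "As \<le> Bs * S\<^sup>2" using hs 0 by simp
    ultimately have "Bd * As \<le> (p\<^sup>2 * Ad) * (Bs * S\<^sup>2)" using nn by (intro mult_mono) auto
    then show ?thesis using 0 by (simp add: power_mult_distrib mult_ac)
  next
    case False
    define v where "v = \<bar>u\<bar>"
    have v: "0 < v" using False by (simp add: v_def)
    have Xv: "X = (sinh v)\<^sup>2" "Y = (sinh (p * v))\<^sup>2"
      unfolding X_def Y_def v_def by (cases "0 \<le> u"; simp)+
    have XY: "0 < X" "0 < Y" using v p unfolding Xv by auto
    \<comment> \<open>The function \<open>1 / (sinh x)^2 - 1 / x^2 + 1 / 3\<close> is nonnegative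
      and nondecreasing, so its value at \<open>v\<close> divided by \<open>p^2\<close> is at most
      its value at \<open>p * v\<close>.\<close>
    have a: "1 / (p\<^sup>2 * X) - 1 / Y \<le> 1 / 3 - 1 / (3 * p\<^sup>2)"
    proof -
      have j1: "1 / X - 1 / v\<^sup>2 \<le> 1 / Y - 1 / (p * v)\<^sup>2"
        unfolding Xv using v p by (intro inverse_sinh_sq_mono) (auto simp: mult_le_cancel_right1)
      have j0: "0 \<le> 1 / X - 1 / v\<^sup>2 + 1 / 3" using inverse_sinh_sq_ge[OF v] unfolding Xv by simp
      have "(1 / X - 1 / v\<^sup>2 + 1 / 3) / p\<^sup>2 \<le> (1 / X - 1 / v\<^sup>2 + 1 / 3) / 1"
        using j0 p by (intro divide_left_mono) (auto simp: one_le_power)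
      also have "\<dots> \<le> 1 / Y - 1 / (p * v)\<^sup>2 + 1 / 3" using j1 by simp
      finally show ?thesis by (simp add: add_divide_distrib diff_divide_distrib power_mult_distrib mult.commute)
    qed
    have b: "1 / (p\<^sup>2 * S\<^sup>2) \<le> 2 / 3 + 1 / (3 * p\<^sup>2)"
    proof -
      have "?y\<^sup>2 / S\<^sup>2 - ?y\<^sup>2 / 3 \<le> pi\<^sup>2 / 6" unfolding S_def by (rule sq_div_sin_sq_le) (use y in auto)
      then have "(?y\<^sup>2 / S\<^sup>2 - ?y\<^sup>2 / 3) * (4 / pi\<^sup>2) \<le> pi\<^sup>2 / 6 * (4 / pi\<^sup>2)" by (intro mult_right_mono) auto
      moreover have "?y\<^sup>2 = pi\<^sup>2 / (4 * p\<^sup>2)" by (simp add: power_divide power_mult_distrib)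
      moreover have "?y\<^sup>2 / S\<^sup>2 * (4 / pi\<^sup>2) = 1 / (p\<^sup>2 * S\<^sup>2)" "?y\<^sup>2 / 3 * (4 / pi\<^sup>2) = 1 / (3 * p\<^sup>2)"
        "pi\<^sup>2 / 6 * (4 / pi\<^sup>2) = 2 / 3"
        by (simp_all add: power_divide power_mult_distrib)
      ultimately show ?thesis by (simp only: left_diff_distrib)
    qed
    have key: "1 / (p\<^sup>2 * S\<^sup>2) + 1 / (p\<^sup>2 * X) \<le> 1 + 1 / Y" using a b by simp
    define P where "P = p\<^sup>2" define Q where "Q = S\<^sup>2"
    have PQ: "0 < P" "0 < Q" using p S by (auto simp: P_def Q_def)
    have "(1 / (P * Q) + 1 / (P * X)) * (P * Q * X * Y) \<le> (1 + 1 / Y) * (P * Q * X * Y)"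
      using key XY PQ unfolding P_def[symmetric] Q_def[symmetric] by (intro mult_right_mono) auto
    moreover have "(1 / (P * Q) + 1 / (P * X)) * (P * Q * X * Y) = Y * (X + Q)"
      "(1 + 1 / Y) * (P * Q * X * Y) = P * Q * (X * (Y + 1))"
      using XY PQ by (simp_all add: field_simps)
    ultimately have *: "Y * (X + Q) \<le> P * Q * (X * (Y + 1))" by simp
    have "(Y + Bd) * (X + As) * (X * (Y + 1)) = (X * (Y + Bd)) * ((X + As) * (Y + 1))" by (simp add: mult_ac)
    also have "\<dots> \<le> (Y * (X + Ad)) * ((Y + Bs) * (X + Q))"
      using hd hs nn XY PQ unfolding Q_def by (intro mult_mono[OF hd hs]) auto
    also have "\<dots> = (Y * (X + Q)) * ((X + Ad) * (Y + Bs))" by (simp add: mult_ac)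
    also have "\<dots> \<le> (P * Q * (X * (Y + 1))) * ((X + Ad) * (Y + Bs))"
      using * nn XY by (intro mult_right_mono) auto
    also have "\<dots> = (P * Q * ((X + Ad) * (Y + Bs))) * (X * (Y + 1))" by (simp add: mult_ac)
    finally have "(Y + Bd) * (X + As) \<le> P * Q * ((X + Ad) * (Y + Bs))"
      using XY by (auto dest: mult_right_le_imp_le)
    then show ?thesis by (simp add: P_def Q_def power_mult_distrib)
  qed
  then show ?thesis by (simp add: X_def Y_def Ad_def As_def Bd_def Bs_def)
qed


section \<open>Power maps, polar coordinates and the boundary of a sector\<close>

text \<open>The principal branch of the power; for \<open>p = pi / \<theta>\<close> it maps the
  sector conformally onto the upper half plane.\<close>

definition zpow :: "real \<Rightarrow> complex \<Rightarrow> complex" where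
  "zpow p z = exp (complex_of_real p * Ln z)"

text \<open>In the upper half plane this is the hyperbolic tangent of half the hyperbolic
  distance.\<close>

definition pseudo_hyp :: "complex \<Rightarrow> complex \<Rightarrow> real" where
  "pseudo_hyp z w = cmod (z - w) / cmod (z - cnj w)"

abbreviation "polar a t \<equiv> complex_of_real a * cis t"

lemma Ln_polar:
  assumes "0 < a" "- pi < t" "t \<le> pi"
  shows "Ln (polar a t) = complex_of_real (ln a) + \<i> * complex_of_real t"
proof (rule Ln_unique)
  show "exp (complex_of_real (ln a) + \<i> * complex_of_real t) = polar a t"
    using assms by (simp add: exp_add cis_conv_exp exp_of_real)
qed (use assms in auto)

lemma zpow_polar:
  assumes "0 < a" "- pi < t" "t \<le> pi"
  shows "zpow p (polar a t) = polar (a powr p) (p * t)"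
proof -
  have "zpow p (polar a t) = exp (complex_of_real (p * ln a)) * exp (\<i> * complex_of_real (p * t))"
    unfolding zpow_def Ln_polar[OF assms] by (simp add: distrib_left exp_add mult_ac)
  then show ?thesis using assms(1) by (simp add: exp_of_real powr_def cis_conv_exp del: of_real_mult)
qed

lemma sector_polar:
  assumes "z \<in> sector \<theta>"
  obtains a t where "0 < a" "0 < t" "t < \<theta>" "z = polar a t"
proof -
  obtain t where t: "z \<noteq> 0" "0 < t" "t < \<theta>" "z = polar (cmod z) t" using assms unfolding sector_def by blast
  show ?thesis by (rule that[OF _ t(2-4)]) (use t(1) in simp)
qed

lemma polar_in_sector: "0 < a \<Longrightarrow> 0 < t \<Longrightarrow> t < \<theta> \<Longrightarrow> polar a t \<in> sector \<theta>"
  unfolding sector_def by (auto simp: norm_mult)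

lemma mult_cis_polar: "cis s * polar a t = polar a (s + t)"
  by (simp add: cis_mult[symmetric] mult_ac)

lemma dist_polar_sq: "(dist (polar a t) (polar b s))\<^sup>2 = a\<^sup>2 + b\<^sup>2 - 2 * a * b * cos (t - s)"
proof -
  have "(dist (polar a t) (polar b s))\<^sup>2 = (a * cos t - b * cos s)\<^sup>2 + (a * sin t - b * sin s)\<^sup>2"
    by (simp add: dist_norm cmod_power2)
  also have "\<dots> = a\<^sup>2 * ((sin t)\<^sup>2 + (cos t)\<^sup>2) + b\<^sup>2 * ((sin s)\<^sup>2 + (cos s)\<^sup>2) - 2 * a * b * (cos t * cos s + sin t * sin s)"
    by algebra
  finally show ?thesis by (simp add: cos_diff)
qed

text \<open>Replaces the angle by two linear conditions, from which openness, the frontier and the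
  avoidance of the branch cut by \<open>zpow\<close> are read off.\<close>

lemma sector_eq_halfplanes:
  assumes "0 < \<theta>" "\<theta> \<le> pi"
  shows "sector \<theta> = {z. 0 < Im z \<and> Im (cis (- \<theta>) * z) < 0}"
proof (intro equalityI subsetI CollectI)
  fix z assume "z \<in> sector \<theta>"
  then obtain a t where z: "0 < a" "0 < t" "t < \<theta>" "z = polar a t" by (rule sector_polar)
  have "0 < sin t" using z assms by (intro sin_gt_zero) auto
  moreover have "0 < sin (\<theta> - t)" using z assms by (intro sin_gt_zero) auto
  ultimately show "0 < Im z \<and> Im (cis (- \<theta>) * z) < 0"
    using z(1) sin_minus[of "\<theta> - t"] unfolding z(4) mult_cis_polar by (simp add: mult_pos_neg)
next
  fix z assume "z \<in> {z. 0 < Im z \<and> Im (cis (- \<theta>) * z) < 0}"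
  then have z: "0 < Im z" "Im (cis (- \<theta>) * z) < 0" by auto
  then have z0: "z \<noteq> 0" by auto
  define a t where "a = cmod z" and "t = Arg z"
  have at: "z = polar a t" "0 < a" "- pi < t" "t \<le> pi"
    using Arg_eq[OF z0] z0 Arg_bounded[of z] by (auto simp: a_def t_def cis_conv_exp mult.commute)
  have "0 < sin t" using z(1) at by (simp add: zero_less_mult_iff)
  have t0: "0 < t"
  proof (rule ccontr)
    assume "\<not> 0 < t"
    then have "0 \<le> sin (- t)" using at by (intro sin_ge_zero) auto
    then show False using \<open>0 < sin t\<close> by simp
  qed
  have "t < \<theta>"
  proof (rule ccontr)
    assume "\<not> t < \<theta>"
    then have "0 \<le> sin (t - \<theta>)" using at assms by (intro sin_ge_zero) auto
    moreover have "a * sin (- \<theta> + t) < 0" using z(2) unfolding at(1) mult_cis_polar by simp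
    ultimately show False using at(2) by (simp add: mult_less_0_iff)
  qed
  then show "z \<in> sector \<theta>" unfolding at(1) using at t0 by (intro polar_in_sector)
qed

lemma open_sector:
  assumes "0 < \<theta>" "\<theta> \<le> pi"
  shows "open (sector \<theta>)"
  unfolding sector_eq_halfplanes[OF assms] by (intro open_Collect_conj open_Collect_less continuous_intros)

lemma frontier_sector:
  assumes "0 < \<theta>" "\<theta> \<le> pi"
  shows "frontier (sector \<theta>) = {z. \<exists>r\<ge>0. z = complex_of_real r \<or> z = polar r \<theta>}"
proof (intro equalityI subsetI CollectI)
  fix z assume "z \<in> frontier (sector \<theta>)"
  then have z: "z \<in> closure (sector \<theta>)" "z \<notin> sector \<theta>"
    using open_sector[OF assms] by (auto simp: frontier_def interior_open)
  have "closed {z. 0 \<le> Im z \<and> Im (cis (- \<theta>) * z) \<le> 0}"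
    by (intro closed_Collect_conj closed_Collect_le continuous_intros)
  then have "closure (sector \<theta>) \<subseteq> {z. 0 \<le> Im z \<and> Im (cis (- \<theta>) * z) \<le> 0}"
    by (intro closure_minimal) (auto simp: sector_eq_halfplanes[OF assms])
  then have c: "0 \<le> Im z" "Im (cis (- \<theta>) * z) \<le> 0" using z(1) by auto
  then consider "Im z = 0" | "Im (cis (- \<theta>) * z) = 0" using z(2) unfolding sector_eq_halfplanes[OF assms] by force
  then show "\<exists>r\<ge>0. z = complex_of_real r \<or> z = polar r \<theta>"
  proof cases
    case 1
    then have zr: "z = complex_of_real (Re z)" by (simp add: complex_eq_iff)
    show ?thesis
    proof (cases "0 \<le> Re z")
      case True
      then show ?thesis using zr by blast
    next
      case False
      \<comment> \<open>A negative real boundary point occurs only for the half plane, and it then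
        belongs to the second ray.\<close>
      have "\<theta> = pi"
      proof (rule ccontr)
        assume "\<theta> \<noteq> pi"
        then have "0 < sin \<theta>" using assms by (intro sin_gt_zero) auto
        then show False using c(2) False 1 by (simp add: mult_le_0_iff zero_le_mult_iff)
      qed
      then show ?thesis using zr False by (intro exI[of _ "- Re z"]) (auto simp: complex_eq_iff)
    qed
  next
    case 2
    define r where "r = Re (cis (- \<theta>) * z)"
    have "cis (- \<theta>) * z = complex_of_real r" using 2 by (simp add: complex_eq_iff r_def)
    then have "cis \<theta> * (cis (- \<theta>) * z) = polar r \<theta>" by (simp only: mult.commute)
    moreover have "cis \<theta> * (cis (- \<theta>) * z) = z" unfolding mult.assoc[symmetric] cis_mult by simp
    ultimately have zr: "z = polar r \<theta>" by (simp only:)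
    show ?thesis
    proof (cases "0 \<le> r")
      case True
      then show ?thesis using zr by blast
    next
      case False
      have "\<theta> = pi"
      proof (rule ccontr)
        assume "\<theta> \<noteq> pi"
        then have "0 < sin \<theta>" using assms by (intro sin_gt_zero) auto
        then show False using c(1) False zr by (simp add: zero_le_mult_iff)
      qed
      then show ?thesis using zr False by (intro exI[of _ "- r"]) (auto simp: complex_eq_iff)
    qed
  qed
next
  fix z assume "z \<in> {z. \<exists>r\<ge>0. z = complex_of_real r \<or> z = polar r \<theta>}"
  then obtain r where r: "0 \<le> r" "z = complex_of_real r \<or> z = polar r \<theta>" by auto
  have ns: "z \<notin> sector \<theta>"
  proof -
    have "Im z = 0 \<or> Im (cis (- \<theta>) * z) = 0" using r unfolding mult_cis_polar by (auto simp: mult_cis_polar simp del: cis_mult)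
    then show ?thesis unfolding sector_eq_halfplanes[OF assms] by auto
  qed
  \<comment> \<open>Radii above \<open>r\<close> and angles strictly inside the sector approach the
    boundary point; \<open>R n\<close> is positive even at the vertex, and the shift by two in
    \<open>T\<close> keeps \<open>T n < \<theta>\<close> for \<open>n = 0\<close>.\<close>
  define R where "R = (\<lambda>n::nat. r + inverse (real (Suc n)))"
  define T where "T = (\<lambda>n::nat. \<theta> * inverse (real (Suc (Suc n))))"
  have T: "0 < T n" "T n < \<theta>" for n
    unfolding T_def using assms by (auto intro!: mult_pos_pos) (auto simp: field_simps add_pos_nonneg)
  have R: "0 < R n" for n using r by (simp add: R_def add_nonneg_pos)
  have Rl: "R \<longlonglongrightarrow> r" unfolding R_def using tendsto_add[OF tendsto_const[of r] LIMSEQ_inverse_real_of_nat] by simp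
  have Tl: "T \<longlonglongrightarrow> 0" unfolding T_def
    using tendsto_mult[OF tendsto_const[of \<theta>] LIMSEQ_Suc[OF LIMSEQ_inverse_real_of_nat]] by simp
  have "z \<in> closure (sector \<theta>)"
    using r(2)
  proof
    assume z: "z = complex_of_real r"
    have "(\<lambda>n. polar (R n) (T n)) \<longlonglongrightarrow> polar r 0"
      unfolding cis_conv_exp by (intro tendsto_intros Rl Tl)
    then show ?thesis unfolding closure_sequential z
      using R T by (intro exI[of _ "\<lambda>n. polar (R n) (T n)"]) (auto intro!: polar_in_sector)
  next
    assume z: "z = polar r \<theta>"
    have "(\<lambda>n. polar (R n) (\<theta> - T n)) \<longlonglongrightarrow> polar r (\<theta> - 0)"
      unfolding cis_conv_exp by (intro tendsto_intros Rl Tl)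
    then show ?thesis unfolding closure_sequential z
      using R T by (intro exI[of _ "\<lambda>n. polar (R n) (\<theta> - T n)"]) (auto intro!: polar_in_sector)
  qed
  then show "z \<in> frontier (sector \<theta>)" using ns interior_subset[of "sector \<theta>"] by (auto simp: frontier_def)
qed

section \<open>The metric w of a sector in polar coordinates\<close>

context
  fixes \<theta> :: real
  assumes th: "0 < \<theta>" "\<theta> \<le> pi"
begin

text \<open>Pythagoras, after a rotation by \<open>- \<theta>\<close> for the second ray. The
  equality clauses recover the foot of the perpendicular from the distance, so each ray carries at
  most one nearest boundary point.\<close>

lemma sector_dist_rays:
  assumes "0 < a" "0 < t" "t < \<theta>" "0 \<le> r"
  shows "a * sin t \<le> cmod (polar a t - complex_of_real r)"
    "a * sin (\<theta> - t) \<le> cmod (polar a t - polar r \<theta>)"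
    "cmod (polar a t - complex_of_real r) = a * sin t \<Longrightarrow> r = a * cos t"
    "cmod (polar a t - polar r \<theta>) = a * sin (\<theta> - t) \<Longrightarrow> r = a * cos (\<theta> - t)"
proof -
  have s: "0 \<le> a * sin t" "0 \<le> a * sin (\<theta> - t)"
    using assms th by (auto intro!: mult_nonneg_nonneg sin_ge_zero)
  have 1: "(cmod (polar a t - complex_of_real r))\<^sup>2 = (a * sin t)\<^sup>2 + (a * cos t - r)\<^sup>2"
    by (simp add: cmod_power2)
  have "cmod (polar a t - polar r \<theta>) = cmod (cis (- \<theta>) * (polar a t - polar r \<theta>))"
    by (simp only: norm_mult norm_cis mult_1)
  also have "\<dots> = cmod (polar a (- \<theta> + t) - polar r (- \<theta> + \<theta>))"
    by (simp only: right_diff_distrib mult_cis_polar)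
  finally have e: "cmod (polar a t - polar r \<theta>) = cmod (polar a (t - \<theta>) - complex_of_real r)" by simp
  have "sin (t - \<theta>) = - sin (\<theta> - t)" "cos (t - \<theta>) = cos (\<theta> - t)"
    using sin_minus[of "\<theta> - t"] cos_minus[of "\<theta> - t"] by simp_all
  then have 2: "(cmod (polar a t - polar r \<theta>))\<^sup>2 = (a * sin (\<theta> - t))\<^sup>2 + (a * cos (\<theta> - t) - r)\<^sup>2"
    unfolding e by (simp add: cmod_power2)
  show "a * sin t \<le> cmod (polar a t - complex_of_real r)"
    by (rule power2_le_imp_le) (simp_all add: 1)
  show "a * sin (\<theta> - t) \<le> cmod (polar a t - polar r \<theta>)"
    by (rule power2_le_imp_le) (simp_all add: 2)
  show "cmod (polar a t - complex_of_real r) = a * sin t \<Longrightarrow> r = a * cos t" using 1 by simp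
  show "cmod (polar a t - polar r \<theta>) = a * sin (\<theta> - t) \<Longrightarrow> r = a * cos (\<theta> - t)" using 2 by simp
qed

text \<open>For the nearer ray the angle is at most \<open>\<theta> / 2 \<le> pi / 2\<close>, so the
  foot of the perpendicular lies on the ray and not on its extension.\<close>

lemma sector_feet:
  assumes "0 < a" "0 < t" "t < \<theta>"
  shows "t \<le> \<theta> / 2 \<Longrightarrow> complex_of_real (a * cos t) \<in> frontier (sector \<theta>)"
    "\<theta> / 2 \<le> t \<Longrightarrow> polar (a * cos (\<theta> - t)) \<theta> \<in> frontier (sector \<theta>)"
    "cmod (polar a t - complex_of_real (a * cos t)) = a * sin t"
    "cmod (polar a t - polar (a * cos (\<theta> - t)) \<theta>) = a * sin (\<theta> - t)"
    "t \<le> \<theta> / 2 \<Longrightarrow> sin t \<le> sin (\<theta> - t)" "\<theta> / 2 \<le> t \<Longrightarrow> sin (\<theta> - t) \<le> sin t"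
proof -
  show "complex_of_real (a * cos t) \<in> frontier (sector \<theta>)" if "t \<le> \<theta> / 2"
    unfolding frontier_sector[OF th] using that assms th
    by (auto intro!: exI[of _ "a * cos t"] mult_nonneg_nonneg cos_ge_zero)
  show "polar (a * cos (\<theta> - t)) \<theta> \<in> frontier (sector \<theta>)" if "\<theta> / 2 \<le> t"
    unfolding frontier_sector[OF th] using that assms th
    by (auto intro!: exI[of _ "a * cos (\<theta> - t)"] mult_nonneg_nonneg cos_ge_zero)
  have s: "0 \<le> sin t" "0 \<le> sin (\<theta> - t)" using assms th by (auto intro!: sin_ge_zero)
  have "polar a t - complex_of_real (a * cos t) = \<i> * complex_of_real (a * sin t)" by (simp add: complex_eq_iff)
  then show "cmod (polar a t - complex_of_real (a * cos t)) = a * sin t" using s assms by (simp add: norm_mult)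
  have "polar a t - polar (a * cos (\<theta> - t)) \<theta> = cis \<theta> * (polar a (t - \<theta>) - complex_of_real (a * cos (\<theta> - t)))"
    unfolding right_diff_distrib mult_cis_polar by (simp add: mult.commute)
  also have "polar a (t - \<theta>) - complex_of_real (a * cos (\<theta> - t)) = \<i> * complex_of_real (- a * sin (\<theta> - t))"
    using sin_minus[of "\<theta> - t"] cos_minus[of "\<theta> - t"] by (simp add: complex_eq_iff)
  finally show "cmod (polar a t - polar (a * cos (\<theta> - t)) \<theta>) = a * sin (\<theta> - t)"
    using s assms by (simp add: norm_mult)
  have d: "sin (\<theta> - t) - sin t = 2 * (sin ((\<theta> - 2 * t) / 2) * cos (\<theta> / 2))"
    using sin_diff_sin[of "\<theta> - t" t] by (simp add: algebra_simps)
  have c: "0 \<le> cos (\<theta> / 2)" using th by (intro cos_ge_zero) auto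
  show "sin t \<le> sin (\<theta> - t)" if "t \<le> \<theta> / 2"
  proof -
    have "0 \<le> sin ((\<theta> - 2 * t) / 2)" using that assms th by (intro sin_ge_zero) auto
    then show ?thesis using d c by (smt (verit) mult_nonneg_nonneg)
  qed
  show "sin (\<theta> - t) \<le> sin t" if "\<theta> / 2 \<le> t"
  proof -
    have "0 \<le> sin (- ((\<theta> - 2 * t) / 2))" by (intro sin_ge_zero) (use that assms th in \<open>simp_all add: field_simps\<close>)
    then have "sin ((\<theta> - 2 * t) / 2) \<le> 0" by simp
    then show ?thesis using d c by (smt (verit) mult_nonpos_nonneg)
  qed
qed

lemma bdist_sector:
  assumes "0 < a" "0 < t" "t < \<theta>"
  shows "bdist (sector \<theta>) (polar a t) = (if t \<le> \<theta> / 2 then a * sin t else a * sin (\<theta> - t))" (is "_ = ?m")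
proof -
  have ne: "frontier (sector \<theta>) \<noteq> {}" by (auto simp: frontier_sector[OF th])
  have ge: "?m \<le> dist (polar a t) p" if "p \<in> frontier (sector \<theta>)" for p
  proof -
    have "\<exists>r\<ge>0. p = complex_of_real r \<or> p = polar r \<theta>" using that unfolding frontier_sector[OF th] by (rule CollectD)
    then obtain r where r: "0 \<le> r" "p = complex_of_real r \<or> p = polar r \<theta>" by (elim exE conjE)
    have m: "?m \<le> a * sin t" "?m \<le> a * sin (\<theta> - t)"
      using mult_left_mono[OF sector_feet(5)[OF assms], of a] mult_left_mono[OF sector_feet(6)[OF assms], of a] assms(1)
      by (simp_all split: if_split)
    from r(2) show ?thesis
    proof
      assume "p = complex_of_real r"
      then show ?thesis using order_trans[OF m(1) sector_dist_rays(1)[OF assms r(1)]] by (simp only: dist_norm)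
    next
      assume "p = polar r \<theta>"
      then show ?thesis using order_trans[OF m(2) sector_dist_rays(2)[OF assms r(1)]] by (simp only: dist_norm)
    qed
  qed
  show ?thesis
  proof (rule antisym)
    show "bdist (sector \<theta>) (polar a t) \<le> ?m"
    proof (cases "t \<le> \<theta> / 2")
      case True
      then show ?thesis unfolding bdist_def
        using infdist_le[OF sector_feet(1)[OF assms True], of "polar a t"] sector_feet(3)[OF assms] by (simp add: dist_norm)
    next
      case False
      then have "\<theta> / 2 \<le> t" by simp
      from infdist_le[OF sector_feet(2)[OF assms this], of "polar a t"] False show ?thesis
        using sector_feet(4)[OF assms] unfolding bdist_def dist_norm by simp
    qed
    show "?m \<le> bdist (sector \<theta>) (polar a t)" unfolding bdist_def infdist_notempty[OF ne]
      using ne ge by (intro cINF_greatest) auto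
  qed
qed

text \<open>A point of the tilde set is the reflection of the given point in a nearest boundary
  point. Nearest boundary points are feet on the rays, so these reflections are the mirror images in
  the two boundary lines, at the angles \<open>- t\<close> and \<open>2 * \<theta> - t\<close>. On
  the bisector both occur.\<close>

lemma tildeset_sector:
  assumes "0 < a" "0 < t" "t < \<theta>"
  shows "tildeset (sector \<theta>) (polar a t) \<subseteq> {polar a (- t), polar a (2 * \<theta> - t)}"
    "t \<le> \<theta> / 2 \<Longrightarrow> polar a (- t) \<in> tildeset (sector \<theta>) (polar a t)"
    "\<theta> / 2 \<le> t \<Longrightarrow> polar a (2 * \<theta> - t) \<in> tildeset (sector \<theta>) (polar a t)"
proof -
  let ?x = "polar a t" and ?d = "bdist (sector \<theta>) (polar a t)"
  have f1: "polar a (- t) = 2 * complex_of_real (a * cos t) - ?x" by (simp add: complex_eq_iff)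
  have f2: "polar a (2 * \<theta> - t) = 2 * polar (a * cos (\<theta> - t)) \<theta> - ?x"
  proof -
    have "polar a (2 * \<theta> - t) + ?x = polar (2 * a * cos (\<theta> - t)) \<theta>"
    proof -
      have "cos (\<theta> + (\<theta> - t)) + cos (\<theta> - (\<theta> - t)) = 2 * cos (\<theta> - t) * cos \<theta>"
        "sin (\<theta> + (\<theta> - t)) + sin (\<theta> - (\<theta> - t)) = 2 * cos (\<theta> - t) * sin \<theta>"
        by (simp_all only: cos_add cos_diff sin_add sin_diff) (simp_all add: algebra_simps)
      moreover have "\<theta> + (\<theta> - t) = 2 * \<theta> - t" "\<theta> - (\<theta> - t) = t" by simp_all
      ultimately have "cos (2 * \<theta> - t) + cos t = 2 * cos (\<theta> - t) * cos \<theta>" "sin (2 * \<theta> - t) + sin t = 2 * cos (\<theta> - t) * sin \<theta>"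
        by metis+
      then show ?thesis by (simp add: complex_eq_iff distrib_left[symmetric])
    qed
    then show ?thesis by (simp add: algebra_simps)
  qed
  have mem: "2 * p - ?x \<in> tildeset (sector \<theta>) ?x" if "p \<in> frontier (sector \<theta>)" "cmod (?x - p) = ?d" for p
  proof -
    have "?x - (2 * p - ?x) = 2 * (?x - p)" by simp
    then have "dist ?x (2 * p - ?x) = cmod (2 * (?x - p))" by (simp only: dist_norm)
    also have "\<dots> = 2 * ?d" unfolding norm_mult using that(2) by simp
    finally show ?thesis using that(1) by (simp add: tildeset_def)
  qed
  show "polar a (- t) \<in> tildeset (sector \<theta>) ?x" if "t \<le> \<theta> / 2"
    unfolding f1 using sector_feet(1,3)[OF assms] that bdist_sector[OF assms] by (intro mem) auto
  show "polar a (2 * \<theta> - t) \<in> tildeset (sector \<theta>) ?x" if "\<theta> / 2 \<le> t"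
  proof -
    have "?d = a * sin (\<theta> - t)" using bdist_sector[OF assms] that by (auto simp: field_simps)
    then show ?thesis unfolding f2 using sector_feet(2,4)[OF assms] that by (intro mem) auto
  qed
  show "tildeset (sector \<theta>) ?x \<subseteq> {polar a (- t), polar a (2 * \<theta> - t)}"
  proof
    fix x' assume x': "x' \<in> tildeset (sector \<theta>) ?x"
    define p where "p = (?x + x') / 2"
    have p: "p \<in> frontier (sector \<theta>)" using x' by (simp add: tildeset_def p_def)
    have px: "x' = 2 * p - ?x" by (simp add: p_def field_simps)
    have "?x - x' = 2 * (?x - p)" unfolding px by simp
    then have "cmod (2 * (?x - p)) = dist ?x x'" unfolding dist_norm by (simp only:)
    then have "cmod (2 * (?x - p)) = 2 * ?d" using x' unfolding tildeset_def mem_Collect_eq mem_sphere by (simp only:)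
    then have d: "cmod (?x - p) = ?d" unfolding norm_mult by simp
    have "\<exists>r\<ge>0. p = complex_of_real r \<or> p = polar r \<theta>" using p unfolding frontier_sector[OF th] by (rule CollectD)
    then obtain r where r: "0 \<le> r" "p = complex_of_real r \<or> p = polar r \<theta>" by (elim exE conjE)
    have le: "?d \<le> a * sin t" "?d \<le> a * sin (\<theta> - t)"
      unfolding bdist_sector[OF assms] using sector_feet(5,6)[OF assms] assms by auto
    from r(2) show "x' \<in> {polar a (- t), polar a (2 * \<theta> - t)}"
    proof
      assume q: "p = complex_of_real r"
      then have "r = a * cos t" using sector_dist_rays(1,3)[OF assms r(1)] d le by auto
      then show ?thesis using px q f1 by simp
    next
      assume q: "p = polar r \<theta>"
      then have "r = a * cos (\<theta> - t)" using sector_dist_rays(2,4)[OF assms r(1)] d le by auto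
      then show ?thesis using px q f2 by simp
    qed
  qed
qed

text \<open>By symmetry both infima range over at most the two values \<open>R0\<close> and
  \<open>R1\<close>. Which is smaller depends only on the sign of \<open>\<theta> - (t + s)\<close>,
  since \<open>R1^2 - R0^2 = 4 * a * b * sin \<theta> * sin (\<theta> - (t + s))\<close>. The
  smaller one is attained because at least one of the two points lies on the matching side of the
  bisector.\<close>

lemma wmetric_sector:
  assumes x: "0 < a" "0 < t" "t < \<theta>" and y: "0 < b" "0 < s" "s < \<theta>"
  shows "wmetric (sector \<theta>) (polar a t) (polar b s) = dist (polar a t) (polar b s) /
     (if t + s \<le> \<theta> then dist (polar a t) (polar b (- s)) else dist (polar a t) (polar b (2 * \<theta> - s)))"
proof -
  let ?x = "polar a t" and ?y = "polar b s"
  define R0 R1 where "R0 = dist ?x (polar b (- s))" and "R1 = dist ?x (polar b (2 * \<theta> - s))"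
  have R0': "dist ?y (polar a (- t)) = R0"
  proof -
    have "(dist ?y (polar a (- t)))\<^sup>2 = R0\<^sup>2" unfolding R0_def dist_polar_sq by (simp add: add.commute)
    then show ?thesis by (simp add: R0_def)
  qed
  have R1': "dist ?y (polar a (2 * \<theta> - t)) = R1"
  proof -
    have "(dist ?y (polar a (2 * \<theta> - t)))\<^sup>2 = R1\<^sup>2" unfolding R1_def dist_polar_sq
      by (simp add: algebra_simps)
    then show ?thesis by (simp add: R1_def)
  qed
  have cmp: "R1\<^sup>2 - R0\<^sup>2 = 4 * a * b * (sin \<theta> * sin (\<theta> - (t + s)))"
  proof -
    have "R1\<^sup>2 - R0\<^sup>2 = 2 * a * b * (cos (t + s) - cos (2 * \<theta> - (t + s)))"
      unfolding R0_def R1_def dist_polar_sq using cos_minus[of "2 * \<theta> - (t + s)"] by (simp add: algebra_simps)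
    also have "cos (t + s) - cos (2 * \<theta> - (t + s)) = 2 * (sin \<theta> * sin (\<theta> - (t + s)))"
    proof -
      have "((t + s) + (2 * \<theta> - (t + s))) / 2 = \<theta>" "((2 * \<theta> - (t + s)) - (t + s)) / 2 = \<theta> - (t + s)"
        by (simp_all add: field_simps)
      then show ?thesis using cos_diff_cos[of "t + s" "2 * \<theta> - (t + s)"] by (simp only: mult.assoc)
    qed
    finally show ?thesis by simp
  qed
  have st: "0 \<le> sin \<theta>" using th by (intro sin_ge_zero) auto
  have low: "R0 \<le> R1" if "t + s \<le> \<theta>"
  proof -
    have "0 \<le> sin (\<theta> - (t + s))" using that x y th by (intro sin_ge_zero) auto
    then have "R0\<^sup>2 \<le> R1\<^sup>2" using cmp st x y by (smt (verit) mult_nonneg_nonneg)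
    then show ?thesis by (rule power2_le_imp_le) (simp add: R1_def)
  qed
  have high: "R1 \<le> R0" if "\<not> t + s \<le> \<theta>"
  proof -
    have "0 \<le> sin (- (\<theta> - (t + s)))" using that x y th by (intro sin_ge_zero) auto
    then have "sin (\<theta> - (t + s)) \<le> 0" unfolding sin_minus by simp
    then have "R1\<^sup>2 \<le> R0\<^sup>2" using cmp st x y by (smt (verit) mult_nonneg_nonpos mult_nonneg_nonneg)
    then show ?thesis by (rule power2_le_imp_le) (simp add: R0_def)
  qed
  define Y X where "Y = (\<lambda>y'. dist ?x y') ` tildeset (sector \<theta>) ?y" and "X = (\<lambda>x'. dist ?y x') ` tildeset (sector \<theta>) ?x"
  have sub: "Y \<subseteq> {R0, R1}" "X \<subseteq> {R0, R1}"
    unfolding X_def Y_def using tildeset_sector(1)[OF x] tildeset_sector(1)[OF y] R0' R1'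
    by (auto simp: R0_def R1_def dest!: subsetD)
  have fin: "finite X" "finite Y" using sub by (auto intro: finite_subset)
  have ne: "X \<noteq> {}" "Y \<noteq> {}"
  proof -
    have "tildeset (sector \<theta>) ?x \<noteq> {}" using tildeset_sector(2,3)[OF x] by (cases "t \<le> \<theta> / 2") auto
    then show "X \<noteq> {}" by (simp add: X_def)
    have "tildeset (sector \<theta>) ?y \<noteq> {}" using tildeset_sector(2,3)[OF y] by (cases "s \<le> \<theta> / 2") auto
    then show "Y \<noteq> {}" by (simp add: Y_def)
  qed
  have m0: "R0 \<in> X" if "t \<le> \<theta> / 2" unfolding X_def using tildeset_sector(2)[OF x that] R0' by (metis image_eqI)
  have m1: "R1 \<in> X" if "\<theta> / 2 \<le> t" unfolding X_def using tildeset_sector(3)[OF x that] R1' by (metis image_eqI)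
  have n0: "R0 \<in> Y" if "s \<le> \<theta> / 2" unfolding Y_def using tildeset_sector(2)[OF y that] by (auto simp: R0_def)
  have n1: "R1 \<in> Y" if "\<theta> / 2 \<le> s" unfolding Y_def using tildeset_sector(3)[OF y that] by (auto simp: R1_def)
  have "min (Min Y) (Min X) = (if t + s \<le> \<theta> then R0 else R1)"
  proof (cases "t + s \<le> \<theta>")
    case True
    have "R0 \<le> Min Y" "R0 \<le> Min X" using low[OF True] sub fin ne by auto
    moreover have "Min X \<le> R0 \<or> Min Y \<le> R0"
      using m0 n0 fin True by (cases "t \<le> \<theta> / 2") (auto intro: Min_le)
    ultimately show ?thesis using True by auto
  next
    case False
    have "R1 \<le> Min Y" "R1 \<le> Min X" using high[OF False] sub fin ne by auto
    moreover have "Min X \<le> R1 \<or> Min Y \<le> R1"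
      using m1 n1 fin False by (cases "\<theta> / 2 \<le> t") (auto intro: Min_le)
    ultimately show ?thesis using False by auto
  qed
  then show ?thesis unfolding wmetric_def X_def[symmetric] Y_def[symmetric] R0_def[symmetric] R1_def[symmetric]
    using cInf_eq_Min[OF fin(1) ne(1)] cInf_eq_Min[OF fin(2) ne(2)] by simp
qed

end

section \<open>Comparison of w with the pseudo-hyperbolic distance\<close>

text \<open>The law of cosines with \<open>a^2 + b^2 = 2 * a * b * cosh (ln (a / b))\<close> and
  half-angle formulas. In this form a power map simply multiplies both the logarithm and the angle
  by the exponent.\<close>

lemma polar_sq_half_angle:
  fixes a b e :: real
  assumes "0 < a" "0 < b"
  shows "a\<^sup>2 + b\<^sup>2 - 2 * a * b * cos e = 4 * a * b * ((sinh (ln (a / b) / 2))\<^sup>2 + (sin (e / 2))\<^sup>2)"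
proof -
  define u where "u = ln (a / b)"
  have "exp u = a / b" unfolding u_def using assms by (subst exp_ln_iff) auto
  then have "2 * a * b * cosh u = a\<^sup>2 + b\<^sup>2"
  proof -
    assume e: "exp u = a / b"
    have "2 * a * b * cosh u = a * b * (exp u + inverse (exp u))" by (simp add: cosh_def exp_minus)
    also have "\<dots> = a\<^sup>2 + b\<^sup>2" unfolding e using assms by (simp add: field_simps power2_eq_square)
    finally show ?thesis .
  qed
  moreover have "cosh u = 1 + 2 * (sinh (u / 2))\<^sup>2"
    using cosh_double[of "u / 2"] cosh_square_eq[of "u / 2"] by simp
  moreover have "cos e = 1 - 2 * (sin (e / 2))\<^sup>2"
    using cos_double_sin[of "e / 2"] by simp
  ultimately have "a\<^sup>2 + b\<^sup>2 = 2 * a * b * (1 + 2 * (sinh (u / 2))\<^sup>2)" and ce: "cos e = 1 - 2 * (sin (e / 2))\<^sup>2" by auto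
  then have "a\<^sup>2 + b\<^sup>2 = 2 * a * b * (1 + 2 * (sinh (u / 2))\<^sup>2)" by simp
  then show ?thesis unfolding ce u_def[symmetric] by (simp only:) (simp add: algebra_simps)
qed

text \<open>The squares of \<open>w\<close> and \<open>r\<close> are the half-angle quotients at
  \<open>(u, d, e)\<close> and at \<open>p\<close> times these arguments, so the two
  cross-multiplied inequalities apply directly. The condition on \<open>t + s\<close> selects the
  case in which \<open>w\<close> mirrors in the real axis.\<close>

lemma half_angle_bounds_polar:
  assumes p: "1 \<le> p" and ab: "0 < a" "0 < b" and ts: "0 < t" "0 < s" "p * (t + s) \<le> pi"
  defines "A \<equiv> a powr p" and "B \<equiv> b powr p"
  defines "w \<equiv> dist (polar a t) (polar b s) / dist (polar a t) (polar b (- s))"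
    and "r \<equiv> dist (polar A (p * t)) (polar B (p * s)) / dist (polar A (p * t)) (polar B (- (p * s)))"
  shows "w \<le> r" "r \<le> p * sin (pi / (2 * p)) * w" "r < 1"
proof -
  have AB: "0 < A" "0 < B" using ab by (auto simp: A_def B_def)
  define u where "u = ln (a / b) / 2"
  have lu: "ln (A / B) / 2 = p * u" using ab by (simp add: A_def B_def u_def ln_div ln_powr algebra_simps)
  define d e where "d = \<bar>t - s\<bar> / 2" and "e = (t + s) / 2"
  have de: "0 \<le> d" "d \<le> e" "p * e \<le> pi / 2" "0 < e" using ts by (auto simp: d_def e_def field_simps)
  have ep: "e \<le> p * e" using p de by (simp add: mult_le_cancel_right1)
  have sd: "(sin ((t - s) / 2))\<^sup>2 = (sin d)\<^sup>2" "(sin ((p * t - p * s) / 2))\<^sup>2 = (sin (p * d))\<^sup>2"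
  proof -
    have "(t - s) / 2 = d \<or> (t - s) / 2 = - d" unfolding d_def by auto
    then show "(sin ((t - s) / 2))\<^sup>2 = (sin d)\<^sup>2" by auto
    have "(p * t - p * s) / 2 = p * ((t - s) / 2)" by (simp add: right_diff_distrib)
    with \<open>(t - s) / 2 = d \<or> (t - s) / 2 = - d\<close>
    have "(p * t - p * s) / 2 = p * d \<or> (p * t - p * s) / 2 = - (p * d)" by auto
    then show "(sin ((p * t - p * s) / 2))\<^sup>2 = (sin (p * d))\<^sup>2" by auto
  qed
  define X Y where "X = (sinh u)\<^sup>2" and "Y = (sinh (p * u))\<^sup>2"
  define Ad As Bd Bs where "Ad = (sin d)\<^sup>2" and "As = (sin e)\<^sup>2" and "Bd = (sin (p * d))\<^sup>2" and "Bs = (sin (p * e))\<^sup>2"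
  have w2: "w\<^sup>2 = (X + Ad) / (X + As)"
    unfolding w_def power_divide dist_polar_sq polar_sq_half_angle[OF ab]
    using ab by (simp add: sd X_def Ad_def As_def u_def e_def)
  have r2: "r\<^sup>2 = (Y + Bd) / (Y + Bs)"
  proof -
    have e: "(p * t - - (p * s)) / 2 = p * e" by (simp add: e_def field_simps)
    show ?thesis
      unfolding r_def power_divide dist_polar_sq polar_sq_half_angle[OF AB] lu e sd Y_def Bd_def Bs_def
      using AB by simp
  qed
  have se: "0 < sin e" "0 < sin (p * e)"
  proof -
    have "e < pi" "p * e < pi" using de ep pi_gt_zero by linarith+
    moreover have "0 < p * e" using de p by simp
    ultimately show "0 < sin e" "0 < sin (p * e)" using de by (auto intro: sin_gt_zero)
  qed
  have pos: "0 < X + As" "0 < Y + Bs" using se by (auto simp: X_def Y_def As_def Bs_def intro!: add_nonneg_pos)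
  have nn: "0 \<le> w" "0 \<le> r" by (auto simp: w_def r_def)
  have 1: "(X + Ad) * (Y + Bs) \<le> (Y + Bd) * (X + As)"
    using half_angle_quotient_le[OF p de(1-3), of u] by (simp add: X_def Y_def Ad_def As_def Bd_def Bs_def)
  have "w\<^sup>2 \<le> r\<^sup>2" unfolding w2 r2 using 1 pos by (simp add: frac_le_eq divide_le_eq field_simps)
  then show "w \<le> r" using nn(2) by (rule power2_le_imp_le)
  define C where "C = p * sin (pi / (2 * p))"
  have C: "0 \<le> C" using p unfolding C_def by (intro mult_nonneg_nonneg sin_ge_zero) (auto simp: field_simps)
  have "(Y + Bd) * (X + As) \<le> C\<^sup>2 * ((X + Ad) * (Y + Bs))"
    using half_angle_quotient_ge[OF p de(1-3), of u] by (simp add: X_def Y_def Ad_def As_def Bd_def Bs_def C_def)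
  then have "r\<^sup>2 \<le> C\<^sup>2 * w\<^sup>2" unfolding w2 r2 using pos by (simp add: field_simps)
  then have "r\<^sup>2 \<le> (C * w)\<^sup>2" by (simp add: power_mult_distrib)
  then show "r \<le> p * sin (pi / (2 * p)) * w" unfolding C_def[symmetric] by (rule power2_le_imp_le) (use C nn in auto)
  have "Bd < Bs"
  proof -
    have "d < e" using ts by (auto simp: d_def e_def)
    then have pd: "p * d < p * e" "0 \<le> p * d" using p de by auto
    then have "sin (p * d) < sin (p * e)" using de(3) pi_gt_zero by (intro sin_monotone_2pi) linarith+
    moreover have "0 \<le> sin (p * d)" using pd de(3) pi_gt_zero by (intro sin_ge_zero) linarith+
    ultimately show ?thesis unfolding Bd_def Bs_def by (intro power_strict_mono) auto
  qed
  then have "r\<^sup>2 < 1\<^sup>2" unfolding r2 using pos by simp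
  then show "r < 1" by (rule power2_less_imp_less) simp
qed

text \<open>The case \<open>t + s > \<theta>\<close> is reduced to the other one by reflection in
  the bisector, \<open>t \<mapsto> \<theta> - t\<close>. In the half plane this is reflection in the
  imaginary axis, which preserves the pseudo-hyperbolic distance.\<close>

lemma wmetric_sector_bounds:
  assumes th: "0 < \<theta>" "\<theta> \<le> pi" and x: "x \<in> sector \<theta>" and y: "y \<in> sector \<theta>"
  defines "r \<equiv> pseudo_hyp (zpow (pi / \<theta>) x) (zpow (pi / \<theta>) y)"
  shows "wmetric (sector \<theta>) x y \<le> r" "r \<le> pi / \<theta> * sin (\<theta> / 2) * wmetric (sector \<theta>) x y" "r < 1"
proof -
  obtain a t where a: "0 < a" "0 < t" "t < \<theta>" "x = polar a t" using x by (rule sector_polar)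
  obtain b s where b: "0 < b" "0 < s" "s < \<theta>" "y = polar b s" using y by (rule sector_polar)
  define p where "p = pi / \<theta>"
  have p: "1 \<le> p" "p * \<theta> = pi" "pi / (2 * p) = \<theta> / 2" using th by (auto simp: p_def)
  have zx: "zpow p x = polar (a powr p) (p * t)" using a th by (simp add: zpow_polar)
  have zy: "zpow p y = polar (b powr p) (p * s)" using b th by (simp add: zpow_polar)
  have r: "r = dist (polar (a powr p) (p * t)) (polar (b powr p) (p * s)) / dist (polar (a powr p) (p * t)) (polar (b powr p) (- (p * s)))"
    unfolding r_def p_def[symmetric] zx zy pseudo_hyp_def by (simp add: dist_norm cis_cnj)
  have "wmetric (sector \<theta>) x y \<le> r \<and> r \<le> p * sin (pi / (2 * p)) * wmetric (sector \<theta>) x y \<and> r < 1"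
  proof (cases "t + s \<le> \<theta>")
    case True
    have "p * (t + s) \<le> pi" using True p mult_left_mono[of "t + s" \<theta> p] by simp
    then show ?thesis
      using half_angle_bounds_polar[OF p(1) a(1) b(1) a(2) b(2)] wmetric_sector[OF th a(1-3) b(1-3)] True a(4) b(4) r by simp
  next
    case False
    define t' s' where "t' = \<theta> - t" and "s' = \<theta> - s"
    have ts: "0 < t'" "0 < s'" "p * (t' + s') \<le> pi"
      using a b False p mult_left_mono[of "t' + s'" \<theta> p] by (auto simp: t'_def s'_def)
    have e1: "dist x y = dist (polar a t') (polar b s')"
    proof -
      have "(dist x y)\<^sup>2 = (dist (polar a t') (polar b s'))\<^sup>2"
        unfolding a(4) b(4) dist_polar_sq t'_def s'_def using cos_minus[of "t - s"] by simp
      then show ?thesis by simp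
    qed
    have e2: "dist (polar a t) (polar b (2 * \<theta> - s)) = dist (polar a t') (polar b (- s'))"
    proof -
      have "(dist (polar a t) (polar b (2 * \<theta> - s)))\<^sup>2 = (dist (polar a t') (polar b (- s')))\<^sup>2"
        unfolding dist_polar_sq t'_def s'_def using cos_minus[of "t - (2 * \<theta> - s)"] by (simp add: algebra_simps)
      then show ?thesis by simp
    qed
    have e3: "dist (polar (a powr p) (p * t)) (polar (b powr p) (p * s)) = dist (polar (a powr p) (p * t')) (polar (b powr p) (p * s'))"
    proof -
      have "(dist (polar (a powr p) (p * t)) (polar (b powr p) (p * s)))\<^sup>2 = (dist (polar (a powr p) (p * t')) (polar (b powr p) (p * s')))\<^sup>2"
        unfolding dist_polar_sq t'_def s'_def using cos_minus[of "p * t - p * s"] by (simp add: algebra_simps)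
      then show ?thesis by simp
    qed
    have e4: "dist (polar (a powr p) (p * t)) (polar (b powr p) (- (p * s))) = dist (polar (a powr p) (p * t')) (polar (b powr p) (- (p * s')))"
    proof -
      have "p * t' + p * s' = 2 * pi - (p * t + p * s)"
        using p(2) by (simp add: t'_def s'_def algebra_simps)
      then have "cos (p * t' + p * s') = cos (p * t + p * s)" by (simp add: cos_diff)
      then have "(dist (polar (a powr p) (p * t)) (polar (b powr p) (- (p * s))))\<^sup>2 = (dist (polar (a powr p) (p * t')) (polar (b powr p) (- (p * s'))))\<^sup>2"
        unfolding dist_polar_sq by simp
      then show ?thesis by simp
    qed
    show ?thesis
      using half_angle_bounds_polar[OF p(1) a(1) b(1) ts] wmetric_sector[OF th a(1-3) b(1-3)] False
      unfolding r e1 e2[symmetric] e3 e4 by (simp add: e1 e2 a(4)[symmetric] b(4)[symmetric])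
  qed
  then show "wmetric (sector \<theta>) x y \<le> r" "r \<le> pi / \<theta> * sin (\<theta> / 2) * wmetric (sector \<theta>) x y" "r < 1"
    unfolding p(3) by (auto simp: p_def)
qed

section \<open>Arc length integrals and conformal modulus\<close>

definition psum :: "(real \<Rightarrow> complex) \<Rightarrow> real list \<Rightarrow> real" where
  "psum g ts = (\<Sum>i<length ts - 1. dist (g (ts ! i)) (g (ts ! Suc i)))"

lemma psum_simps [simp]:
  "psum g [] = 0" "psum g [x] = 0" "psum g (x # y # zs) = dist (g x) (g y) + psum g (y # zs)"
  by (simp_all add: psum_def sum.lessThan_Suc_shift del: sum.lessThan_Suc)

lemma psum_nonneg [simp]: "0 \<le> psum g ts"
  by (simp add: psum_def sum_nonneg)

lemma psum_append: "psum g (xs @ [m]) + psum g (m # ys) = psum g (xs @ m # ys)"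
proof (induction xs)
  case (Cons x xs)
  then show ?case by (cases xs) auto
qed simp

lemma psum_insert: "psum g (xs @ ys) \<le> psum g (xs @ m # ys)"
proof (induction xs)
  case Nil
  then show ?case by (cases ys) auto
next
  case (Cons x xs)
  show ?case
  proof (cases xs)
    case Nil
    then show ?thesis using dist_triangle[of "g x" _ "g m"] by (cases ys) (auto simp: add.assoc[symmetric] intro: order_trans)
  qed (use Cons in auto)
qed

lemma psum_Cons_ge: "psum g ts \<le> psum g (t # ts)"
  using psum_insert[of g "[]" ts t] by simp

lemma psum_append_ge: "psum g xs + psum g ys \<le> psum g (xs @ ys)"
proof (induction xs)
  case Nil
  then show ?case by simp
next
  case (Cons x xs)
  show ?case
  proof (cases xs)
    case Nil
    then show ?thesis using psum_Cons_ge by simp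
  qed (use Cons in auto)
qed

text \<open>The lists need not contain the end points and may repeat values or be empty; thus
  appending to a partition or inserting a point only requires order and range to be checked.\<close>

definition partitions :: "real \<Rightarrow> real \<Rightarrow> real list set" where
  "partitions a b = {ts. sorted ts \<and> set ts \<subseteq> {a..b}}"

lemma var_on_eq: "var_on g a b = (SUP ts \<in> partitions a b. ennreal (psum g ts))"
  by (simp add: var_on_def partitions_def psum_def)

lemma partitions_nonempty [simp]: "partitions a b \<noteq> {}"
  by (auto simp: partitions_def intro: exI[of _ "[]"])

lemma psum_le_var: "ts \<in> partitions a b \<Longrightarrow> ennreal (psum g ts) \<le> var_on g a b"
  unfolding var_on_eq by (rule SUP_upper)

lemma var_le: "(\<And>ts. ts \<in> partitions a b \<Longrightarrow> ennreal (psum g ts) \<le> C) \<Longrightarrow> var_on g a b \<le> C"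
  unfolding var_on_eq by (rule SUP_least)

lemma var_mono: "a \<le> c \<Longrightarrow> d \<le> b \<Longrightarrow> var_on g c d \<le> var_on g a b"
  unfolding var_on_eq by (rule SUP_subset_mono) (auto simp: partitions_def)

lemma dist_le_var: "a \<le> s \<Longrightarrow> s \<le> t \<Longrightarrow> t \<le> b \<Longrightarrow> ennreal (dist (g s) (g t)) \<le> var_on g a b"
  using psum_le_var[of "[s, t]" a b g] by (simp add: partitions_def)

text \<open>For one inequality \<open>m\<close> is inserted into a partition, which is cut there;
  for the other, partitions of the two parts are concatenated.\<close>

lemma var_add:
  assumes "a \<le> m" "m \<le> b"
  shows "var_on g a b = var_on g a m + var_on g m b"
proof (rule antisym)
  show "var_on g a b \<le> var_on g a m + var_on g m b"
  proof (rule var_le)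
    fix ts assume ts: "ts \<in> partitions a b"
    define xs ys where "xs = filter (\<lambda>t. t \<le> m) ts" and "ys = filter (\<lambda>t. \<not> t \<le> m) ts"
    have s: "sorted ts" using ts by (simp add: partitions_def)
    have eq: "ts = xs @ ys"
      using s unfolding xs_def ys_def
    proof (induction ts)
      case (Cons t ts)
      show ?case
      proof (cases "t \<le> m")
        case False
        then have "filter (\<lambda>t. t \<le> m) ts = []" using Cons.prems by (auto simp: filter_empty_conv)
        then show ?thesis using Cons False by simp
      qed (use Cons in simp)
    qed simp
    have "xs @ [m] \<in> partitions a m" "m # ys \<in> partitions m b"
      using ts assms unfolding xs_def ys_def partitions_def
      by (auto simp: sorted_append sorted_wrt_filter)
    then have "ennreal (psum g (xs @ [m])) + ennreal (psum g (m # ys)) \<le> var_on g a m + var_on g m b"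
      by (intro add_mono psum_le_var)
    moreover have "psum g ts \<le> psum g (xs @ [m]) + psum g (m # ys)"
      unfolding eq psum_append by (rule psum_insert)
    ultimately show "ennreal (psum g ts) \<le> var_on g a m + var_on g m b"
      by (metis ennreal_leI ennreal_plus order_trans psum_nonneg)
  qed
  have "var_on g a m + ennreal (psum g ys) \<le> var_on g a b" if ys: "ys \<in> partitions m b" for ys
  proof -
    have "var_on g a m + ennreal (psum g ys) = (SUP xs \<in> partitions a m. ennreal (psum g xs) + ennreal (psum g ys))"
      unfolding var_on_eq by (simp add: ennreal_SUP_add_left)
    also have "\<dots> \<le> var_on g a b"
    proof (rule SUP_least)
      fix xs assume xs: "xs \<in> partitions a m"
      have "xs @ ys \<in> partitions a b" using xs ys assms by (fastforce simp: partitions_def sorted_append)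
      then have "ennreal (psum g (xs @ ys)) \<le> var_on g a b" by (rule psum_le_var)
      moreover have "ennreal (psum g xs) + ennreal (psum g ys) \<le> ennreal (psum g (xs @ ys))"
        by (simp add: ennreal_plus[symmetric] ennreal_leI psum_append_ge del: ennreal_plus)
      ultimately show "ennreal (psum g xs) + ennreal (psum g ys) \<le> var_on g a b" by (rule order_trans[rotated])
    qed
    finally show ?thesis .
  qed
  then show "var_on g a m + var_on g m b \<le> var_on g a b"
    unfolding var_on_eq[of g m b] by (simp add: ennreal_SUP_add_right SUP_le_iff)
qed

lemma var_refl [simp]: "var_on g a a = 0"
proof -
  have "ennreal (psum g ts) \<le> 0" if "ts \<in> partitions a a" for ts
    using that
  proof (induction ts)
    case (Cons x ts)
    then show ?case by (cases ts) (auto simp: partitions_def)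
  qed simp
  then have "var_on g a a \<le> 0" by (rule var_le)
  then show ?thesis by simp
qed

lemma var_le_lipschitz:
  assumes "a \<le> b" "0 \<le> M" and "\<And>s t. a \<le> s \<Longrightarrow> s \<le> t \<Longrightarrow> t \<le> b \<Longrightarrow> dist (g s) (g t) \<le> M * (t - s)"
  shows "var_on g a b \<le> ennreal (M * (b - a))"
proof (rule var_le)
  fix ts assume ts: "ts \<in> partitions a b"
  have "psum g ts \<le> M * (b - a)"
  proof (cases ts)
    case (Cons x xs)
    have "psum g (x # xs) \<le> M * (last (x # xs) - x)" if "sorted (x # xs)" "set (x # xs) \<subseteq> {a..b}" for x xs
      using that
    proof (induction xs arbitrary: x)
      case (Cons y ys)
      have "psum g (y # ys) \<le> M * (last (y # ys) - y)" using Cons by (intro Cons.IH) auto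
      moreover have "dist (g x) (g y) \<le> M * (y - x)" using Cons.prems by (intro assms) auto
      ultimately show ?case by (simp add: algebra_simps)
    qed simp
    then have "psum g ts \<le> M * (last ts - x)" using ts Cons by (auto simp: partitions_def)
    also have "\<dots> \<le> M * (b - a)"
    proof -
      have "last ts \<in> {a..b}" "x \<in> {a..b}" using ts Cons last_in_set[of ts] by (auto simp: partitions_def)
      then show ?thesis using assms(2) by (intro mult_left_mono) auto
    qed
    finally show ?thesis .
  qed (use assms in simp)
  then show "ennreal (psum g ts) \<le> ennreal (M * (b - a))" by (rule ennreal_leI)
qed

text \<open>Removes copies of the left end point, so that there is room between it and the next
  partition point.\<close>

lemma psum_drop_initial:
  assumes "sorted (t # ts)"
  obtains us where "sorted us" "\<And>u. u \<in> set us \<Longrightarrow> t < u" "set us \<subseteq> set ts" "psum g (t # us) = psum g (t # ts)"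
  using assms
proof (induction ts arbitrary: thesis)
  case Nil
  show ?case by (rule Nil.prems(1)[of "[]"]) auto
next
  case (Cons x ts)
  show ?case
  proof (cases "x = t")
    case True
    obtain us where "sorted us" "\<And>u. u \<in> set us \<Longrightarrow> t < u" "set us \<subseteq> set ts" "psum g (t # us) = psum g (t # ts)"
      by (rule Cons.IH) (use Cons.prems True in auto)
    then show ?thesis using True by (intro Cons.prems(1)[of us]) auto
  next
    case False
    then show ?thesis using Cons.prems(2) by (intro Cons.prems(1)[of "x # ts"]) auto
  qed
qed

text \<open>Take a partition of \<open>{t..b}\<close> whose sum is within \<open>e / 2\<close> of
  the total variation. For \<open>s\<close> between \<open>t\<close> and its next point, replacing
  \<open>t\<close> by \<open>s\<close> costs at most \<open>dist (g t) (g s)\<close>, which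
  continuity makes smaller than \<open>e / 2\<close>. So the variation on \<open>{s..b}\<close> is
  within \<open>e\<close> of the total, and additivity leaves at most \<open>e\<close> for
  \<open>{t..s}\<close>.\<close>

lemma var_right_small:
  assumes fin: "var_on g a b < \<infinity>" and cont: "continuous_on {a..b} g" and t: "a \<le> t" "t < b" and e: "0 < e"
  obtains d where "0 < d" "\<And>s. t \<le> s \<Longrightarrow> s < t + d \<Longrightarrow> s \<le> b \<Longrightarrow> var_on g t s \<le> ennreal e"
proof -
  have vfin: "var_on g t b < \<infinity>" using var_mono[of a t b b g] fin t by auto
  define v where "v = enn2real (var_on g t b)"
  have v: "var_on g t b = ennreal v" "0 \<le> v" using vfin by (auto simp: v_def)
  obtain ts where ts: "ts \<in> partitions t b" "v - e / 2 < psum g ts"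
  proof (cases "v - e / 2 < 0")
    case True
    then show ?thesis using that[of "[]"] by (auto simp: partitions_def)
  next
    case False
    have "ennreal (v - e / 2) < (SUP ts \<in> partitions t b. ennreal (psum g ts))"
      unfolding var_on_eq[symmetric] v using False e by (intro ennreal_lessI) auto
    then obtain ts where "ts \<in> partitions t b" "ennreal (v - e / 2) < ennreal (psum g ts)" by (auto simp: less_SUP_iff)
    then show ?thesis using that False by (auto simp: ennreal_less_iff)
  qed
  have "sorted (t # ts)" using ts by (auto simp: partitions_def)
  then obtain us where us: "sorted us" "\<And>u. u \<in> set us \<Longrightarrow> t < u" "set us \<subseteq> set ts" "psum g (t # us) = psum g (t # ts)"
    by (rule psum_drop_initial[where g = g]) blast
  have big: "v - e / 2 < psum g (t # us)" using ts(2) psum_Cons_ge[of g ts t] us(4) by simp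
  have usb: "set us \<subseteq> {t..b}" using us(3) ts(1) by (auto simp: partitions_def)
  obtain d0 where d0: "0 < d0" "\<And>s. s \<in> {a..b} \<Longrightarrow> dist s t < d0 \<Longrightarrow> dist (g s) (g t) < e / 2"
    using cont t e unfolding continuous_on_iff by (metis atLeastAtMost_iff half_gt_zero less_imp_le)
  define d where "d = (if us = [] then d0 else min d0 (hd us - t))"
  have d: "0 < d" using d0 us(2) by (auto simp: d_def)
  have "var_on g t s \<le> ennreal e" if s: "t \<le> s" "s < t + d" "s \<le> b" for s
  proof -
    have "s # us \<in> partitions s b"
      using us(1) usb s d_def
    proof (cases us)
      case (Cons u us')
      have "s \<le> u" using s Cons by (auto simp: d_def)
      then show ?thesis using us(1) usb s Cons by (fastforce simp: partitions_def)
    qed (auto simp: partitions_def)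
    then have 1: "ennreal (psum g (s # us)) \<le> var_on g s b" by (rule psum_le_var)
    have "dist s t < d0" using s by (auto simp: d_def dist_real_def split: if_splits)
    then have 2: "dist (g t) (g s) < e / 2" using d0(2)[of s] s t by (simp add: dist_commute)
    have "psum g (t # us) \<le> psum g (t # s # us)" using psum_insert[of g "[t]" us s] by simp
    then have "v \<le> e + psum g (s # us)" using big 2 by simp
    then have "ennreal v \<le> ennreal e + ennreal (psum g (s # us))" using e by (simp add: ennreal_plus[symmetric] ennreal_leI del: ennreal_plus)
    also have "\<dots> \<le> ennreal e + var_on g s b" using 1 by (intro add_left_mono)
    finally have "var_on g t s + var_on g s b \<le> ennreal e + var_on g s b"
      using var_add[of t s b g] s v(1) by simp
    moreover have "var_on g s b < \<infinity>" using var_mono[of t s b b g] vfin s by (auto intro: le_less_trans)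
    ultimately show ?thesis by (auto simp: add.commute[of _ "var_on g s b"] ennreal_add_left_cancel_le)
  qed
  then show ?thesis using that d by blast
qed

section \<open>Integration against the length function\<close>

text \<open>The function whose Lebesgue-Stieltjes measure occurs in \<open>arc_integral\<close>; by
  the clamp it is constant on either side of the interval.\<close>

definition varfun :: "(real \<Rightarrow> complex) \<Rightarrow> real \<Rightarrow> real \<Rightarrow> real \<Rightarrow> real" where
  "varfun g a b t = enn2real (var_on g a (max a (min t b)))"

context
  fixes g :: "real \<Rightarrow> complex" and a b :: real
  assumes ab: "a \<le> b" and fin: "var_on g a b < \<infinity>" and cont: "continuous_on {a..b} g"
begin

lemma var_fin: "a \<le> s \<Longrightarrow> t \<le> b \<Longrightarrow> var_on g s t < \<infinity>"
  using var_mono[of a s t b g] fin by (auto intro: le_less_trans)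

lemma varfun_diff:
  assumes "a \<le> s" "s \<le> t" "t \<le> b"
  shows "varfun g a b t - varfun g a b s = enn2real (var_on g s t)"
proof -
  have "var_on g a t = var_on g a s + var_on g s t" using assms by (intro var_add)
  moreover have "var_on g a s < \<infinity>" "var_on g s t < \<infinity>"
    using var_fin[of a s] var_fin[of s t] assms by auto
  ultimately show ?thesis using assms by (simp add: varfun_def enn2real_plus max_def min_def)
qed

lemma varfun_mono: "s \<le> t \<Longrightarrow> varfun g a b s \<le> varfun g a b t"
  unfolding varfun_def
  by (intro enn2real_mono var_mono) (use ab var_fin[of a "max a (min t b)"] in \<open>auto simp: max_def min_def\<close>)

text \<open>Right continuity is what allows \<open>interval_measure\<close> to be evaluated on
  half-open intervals as a difference of values.\<close>

lemma varfun_right_cont: "continuous (at_right t) (varfun g a b)"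
proof -
  have *: "\<exists>d>0. \<forall>s>t. s < t + d \<longrightarrow> dist (varfun g a b s) (varfun g a b t) < e" if e: "0 < e" for e
  proof -
    consider "t < a" | "a \<le> t" "t < b" | "b \<le> t" by linarith
    then show ?thesis
    proof cases
      case 1
      then show ?thesis using e by (intro exI[of _ "a - t"]) (auto simp: varfun_def max_def min_def)
    next
      case 2
      obtain d where d: "0 < d" "\<And>s. t \<le> s \<Longrightarrow> s < t + d \<Longrightarrow> s \<le> b \<Longrightarrow> var_on g t s \<le> ennreal (e / 2)"
        using var_right_small[OF fin cont 2] e by (metis half_gt_zero)
      show ?thesis
      proof (intro exI[of _ "min d (b - t)"] conjI allI impI)
        fix s assume s: "t < s" "s < t + min d (b - t)"
        have "varfun g a b s - varfun g a b t = enn2real (var_on g t s)" using 2 s by (intro varfun_diff) auto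
        moreover have "enn2real (var_on g t s) \<le> e / 2" using d(2)[of s] s e by (intro enn2real_leI) auto
        ultimately show "dist (varfun g a b s) (varfun g a b t) < e" using e by (simp add: dist_real_def)
      qed (use d 2 in auto)
    next
      case 3
      then show ?thesis using e ab by (intro exI[of _ 1]) (auto simp: varfun_def max_def min_def)
    qed
  qed
  then have "\<exists>d>0. \<forall>s\<in>{t<..}. 0 < dist s t \<and> dist s t < d \<longrightarrow> dist (varfun g a b s) (varfun g a b t) < e" if "0 < e" for e
  proof -
    obtain d where d: "0 < d" "\<And>s. s > t \<Longrightarrow> s < t + d \<Longrightarrow> dist (varfun g a b s) (varfun g a b t) < e"
      using *[OF \<open>0 < e\<close>] by blast
    have "\<forall>s\<in>{t<..}. 0 < dist s t \<and> dist s t < d \<longrightarrow> dist (varfun g a b s) (varfun g a b t) < e"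
      using d(2) by (auto simp: dist_real_def)
    then show ?thesis using d(1) by blast
  qed
  then show ?thesis unfolding continuous_within Lim_within by blast
qed

lemma emeasure_varfun_Ioc:
  assumes "a \<le> s" "s \<le> t" "t \<le> b"
  shows "emeasure (interval_measure (varfun g a b)) {s<..t} = var_on g s t"
proof -
  have "emeasure (interval_measure (varfun g a b)) {s<..t} = varfun g a b t - varfun g a b s"
    using assms by (intro emeasure_interval_measure_Ioc varfun_mono varfun_right_cont)
  also have "\<dots> = var_on g s t" unfolding varfun_diff[OF assms] using var_fin[OF assms(1,3)] by (simp add: ennreal_enn2real)
  finally show ?thesis .
qed

text \<open>Clamping the parameter changes nothing on \<open>{a..b}\<close>, but lets the integrand
  be Borel on the whole line although \<open>g\<close> is continuous only on the interval.\<close>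

lemma arc_integral_eq:
  "arc_integral \<rho> g a b = (\<integral>\<^sup>+ t. \<rho> (g (max a (min t b))) * indicator {a..b} t \<partial>interval_measure (varfun g a b))"
proof -
  have e: "varfun g a b = (\<lambda>t. enn2real (var_on g a (max a (min t b))))" by (simp add: varfun_def fun_eq_iff)
  show ?thesis unfolding arc_integral_def e
    by (rule nn_integral_cong) (auto simp: indicator_def)
qed

lemma clamp_measurable: "\<rho> \<in> borel_measurable borel \<Longrightarrow> (\<lambda>t. \<rho> (g (max a (min t b)))) \<in> borel_measurable borel"
proof -
  assume \<rho>: "\<rho> \<in> borel_measurable borel"
  have "continuous_on UNIV (\<lambda>t. g (max a (min t b)))"
    using ab by (intro continuous_on_compose2[OF cont] continuous_intros) auto
  then show ?thesis by (intro measurable_compose[OF _ \<rho>] borel_measurable_continuous_onI)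
qed

text \<open>A curve of finite length need not be differentiable, so the increment of
  \<open>w\<close> is compared with the arc integral by Bolzano's bisection principle: the
  inequality with slack \<open>2 * e\<close> times the variation passes to unions of adjacent
  intervals and holds on short intervals around each point. Letting \<open>e\<close> tend to 0
  removes the slack.\<close>

lemma arc_integral_ge:
  assumes \<rho>: "\<rho> \<in> borel_measurable borel" and R: "continuous_on {a..b} R" "\<And>t. t \<in> {a..b} \<Longrightarrow> 0 \<le> R t"
    "\<And>t. t \<in> {a..b} \<Longrightarrow> \<rho> (g t) = ennreal (R t)"
    and w: "\<And>t0 e. t0 \<in> {a..b} \<Longrightarrow> 0 < e \<Longrightarrow> \<exists>d>0. \<forall>s t. a \<le> s \<longrightarrow> s \<le> t0 \<longrightarrow> t0 \<le> t \<longrightarrow> t \<le> b \<longrightarrow> t - s < d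
        \<longrightarrow> w t - w s \<le> (R t0 + e) * enn2real (var_on g s t)"
  shows "ennreal (w b - w a) \<le> arc_integral \<rho> g a b"
proof -
  let ?\<nu> = "interval_measure (varfun g a b)"
  let ?r = "\<lambda>t. \<rho> (g (max a (min t b)))"
  have meas: "?r \<in> borel_measurable ?\<nu>" using clamp_measurable[OF \<rho>] by simp
  have main: "ennreal (w b - w a) \<le> arc_integral \<rho> g a b + ennreal (2 * e) * var_on g a b" if e: "0 < e" for e
  proof -
    \<comment> \<open>Half-open intervals make the integral exactly additive at a common end
      point.\<close>
    define P where "P = (\<lambda>s t. a \<le> s \<longrightarrow> t \<le> b \<longrightarrow>
       ennreal (w t - w s) \<le> (\<integral>\<^sup>+ x. ?r x * indicator {s<..t} x \<partial>?\<nu>) + ennreal (2 * e) * var_on g s t)"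
    have "P a b"
      using ab
    proof (induction rule: Bolzano)
      case (trans s t u)
      show ?case unfolding P_def
      proof (intro impI)
        assume su: "a \<le> s" "u \<le> b"
        have "ennreal (w u - w s) \<le> ennreal (w u - w t) + ennreal (w t - w s)"
          by (cases "0 \<le> w u - w t"; cases "0 \<le> w t - w s")
             (auto simp: ennreal_plus[symmetric] ennreal_neg simp del: ennreal_plus intro!: ennreal_leI)
        also have "\<dots> \<le> ((\<integral>\<^sup>+ x. ?r x * indicator {t<..u} x \<partial>?\<nu>) + ennreal (2 * e) * var_on g t u)
           + ((\<integral>\<^sup>+ x. ?r x * indicator {s<..t} x \<partial>?\<nu>) + ennreal (2 * e) * var_on g s t)"
          using trans su by (intro add_mono) (auto simp: P_def)
        also have "\<dots> = ((\<integral>\<^sup>+ x. ?r x * indicator {s<..t} x \<partial>?\<nu>) + (\<integral>\<^sup>+ x. ?r x * indicator {t<..u} x \<partial>?\<nu>))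
            + ennreal (2 * e) * (var_on g s t + var_on g t u)"
          by (simp add: distrib_left add_ac)
        also have "(\<integral>\<^sup>+ x. ?r x * indicator {s<..t} x \<partial>?\<nu>) + (\<integral>\<^sup>+ x. ?r x * indicator {t<..u} x \<partial>?\<nu>)
            = (\<integral>\<^sup>+ x. ?r x * indicator {s<..t} x + ?r x * indicator {t<..u} x \<partial>?\<nu>)"
          using meas by (intro nn_integral_add[symmetric]) auto
        also have "\<dots> = (\<integral>\<^sup>+ x. ?r x * indicator {s<..u} x \<partial>?\<nu>)"
          using trans(3,4) by (intro nn_integral_cong) (auto simp: indicator_def)
        also have "var_on g s t + var_on g t u = var_on g s u" using trans by (intro var_add[symmetric]) auto
        finally show "ennreal (w u - w s) \<le> (\<integral>\<^sup>+ x. ?r x * indicator {s<..u} x \<partial>?\<nu>) + ennreal (2 * e) * var_on g s u" .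
      qed
    next
      case (local t0)
      then have t0: "t0 \<in> {a..b}" by simp
      obtain d1 where d1: "0 < d1" "\<And>s t. a \<le> s \<Longrightarrow> s \<le> t0 \<Longrightarrow> t0 \<le> t \<Longrightarrow> t \<le> b \<Longrightarrow> t - s < d1
        \<Longrightarrow> w t - w s \<le> (R t0 + e) * enn2real (var_on g s t)" using w[OF t0 e] by blast
      obtain d2 where d2: "0 < d2" "\<And>t. t \<in> {a..b} \<Longrightarrow> dist t t0 < d2 \<Longrightarrow> dist (R t) (R t0) < e"
        using R(1) t0 e unfolding continuous_on_iff by metis
      show ?case
      proof (intro exI[of _ "min d1 d2"] conjI allI impI)
        show "0 < min d1 d2" using d1 d2 by simp
        fix s t assume st: "s \<le> t0 \<and> t0 \<le> t \<and> t - s < min d1 d2"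
        show "P s t" unfolding P_def
        proof (intro impI)
          assume b: "a \<le> s" "t \<le> b"
          define v where "v = enn2real (var_on g s t)"
          have v: "var_on g s t = ennreal v" "0 \<le> v" using var_fin[OF b] by (auto simp: v_def ennreal_enn2real)
          \<comment> \<open>A lower bound for \<open>R\<close> near \<open>t0\<close>, cut off at 0
            for the passage to \<open>ennreal\<close>; \<open>R t0 + e\<close> exceeds it by at most
            \<open>2 * e\<close>.\<close>
          define m where "m = max 0 (R t0 - e)"
          have "ennreal m * var_on g s t = (\<integral>\<^sup>+ x. ennreal m * indicator {s<..t} x \<partial>?\<nu>)"
            using emeasure_varfun_Ioc[of s t] b st by (subst nn_integral_cmult_indicator) auto
          also have "\<dots> \<le> (\<integral>\<^sup>+ x. ?r x * indicator {s<..t} x \<partial>?\<nu>)"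
          proof (rule nn_integral_mono)
            fix x show "ennreal m * indicator {s<..t} x \<le> ?r x * indicator {s<..t} x"
            proof (cases "x \<in> {s<..t}")
              case True
              then have x: "x \<in> {a..b}" "dist x t0 < d2" "max a (min x b) = x" using b st by (auto simp: dist_real_def)
              have "m \<le> R x" using d2(2)[OF x(1,2)] R(2)[OF x(1)] by (auto simp: m_def dist_real_def)
              then show ?thesis using True x R(3)[OF x(1)] by (simp add: ennreal_leI)
            qed simp
          qed
          finally have 1: "ennreal m * var_on g s t \<le> (\<integral>\<^sup>+ x. ?r x * indicator {s<..t} x \<partial>?\<nu>)" .
          have "w t - w s \<le> (R t0 + e) * v" using d1(2)[of s t] b st by (simp add: v_def)
          also have "\<dots> \<le> (m + 2 * e) * v" using v(2) by (intro mult_right_mono) (auto simp: m_def)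
          finally have "ennreal (w t - w s) \<le> ennreal m * ennreal v + ennreal (2 * e) * ennreal v"
            using v(2) e by (simp add: m_def distrib_right[symmetric] ennreal_plus[symmetric] ennreal_mult[symmetric] ennreal_leI del: ennreal_plus)
          also have "\<dots> \<le> (\<integral>\<^sup>+ x. ?r x * indicator {s<..t} x \<partial>?\<nu>) + ennreal (2 * e) * var_on g s t"
            using 1 unfolding v by (intro add_mono) auto
          finally show "ennreal (w t - w s) \<le> (\<integral>\<^sup>+ x. ?r x * indicator {s<..t} x \<partial>?\<nu>) + ennreal (2 * e) * var_on g s t" .
        qed
      qed
    qed
    then have "ennreal (w b - w a) \<le> (\<integral>\<^sup>+ x. ?r x * indicator {a<..b} x \<partial>?\<nu>) + ennreal (2 * e) * var_on g a b"
      by (simp add: P_def)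
    also have "(\<integral>\<^sup>+ x. ?r x * indicator {a<..b} x \<partial>?\<nu>) \<le> arc_integral \<rho> g a b"
      unfolding arc_integral_eq by (intro nn_integral_mono) (auto simp: indicator_def)
    finally show ?thesis by (simp add: add_right_mono)
  qed
  show ?thesis
  proof (rule ennreal_le_epsilon)
    fix e :: real assume e: "0 < e"
    define v where "v = enn2real (var_on g a b)"
    have v: "var_on g a b = ennreal v" "0 \<le> v" using fin by (auto simp: v_def ennreal_enn2real)
    \<comment> \<open>The choice \<open>e / (2 * (v + 1))\<close> keeps the total slack below
      \<open>e\<close> and stays meaningful when the length \<open>v\<close> is 0.\<close>
    have "ennreal (2 * (e / (2 * (v + 1)))) * ennreal v \<le> ennreal e"
      using v e by (simp add: ennreal_mult[symmetric] field_simps ennreal_leI del: ennreal_mult)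
    then show "ennreal (w b - w a) \<le> arc_integral \<rho> g a b + ennreal e"
      using main[of "e / (2 * (v + 1))"] e v by (auto intro: order_trans add_left_mono)
  qed
qed

end

section \<open>Continuously differentiable curves\<close>

context
  fixes g :: "real \<Rightarrow> complex" and g' :: "real \<Rightarrow> complex" and a b :: real
  assumes ab: "a \<le> b" and der: "\<And>t. t \<in> {a..b} \<Longrightarrow> (g has_vector_derivative g' t) (at t within {a..b})"
    and cont': "continuous_on {a..b} g'"
begin

lemma C1_dist_le:
  assumes "a \<le> c" "d \<le> b" "\<And>t. t \<in> {c..d} \<Longrightarrow> norm (g' t) \<le> M" "c \<le> s" "s \<le> t" "t \<le> d"
  shows "dist (g s) (g t) \<le> M * (t - s)"
proof -
  have "norm (g s - g t) \<le> M * norm (s - t)"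
  proof (rule differentiable_bound[of "{c..d}" g "\<lambda>x h. h *\<^sub>R g' x"])
    fix x assume x: "x \<in> {c..d}"
    have "(g has_vector_derivative g' x) (at x within {c..d})"
      using has_vector_derivative_within_subset[OF der, of x "{c..d}"] x assms by auto
    then show "(g has_derivative (\<lambda>h. h *\<^sub>R g' x)) (at x within {c..d})" by (simp add: has_vector_derivative_def)
    show "onorm (\<lambda>h. h *\<^sub>R g' x) \<le> M"
      using assms(3)[OF x] by (intro onorm_le) (simp add: mult.commute[of _ "cmod (g' x)"] mult_right_mono)
  qed (use assms in auto)
  then show ?thesis using assms by (simp add: dist_norm)
qed

lemma C1_bound: obtains M where "0 \<le> M" "\<And>t. t \<in> {a..b} \<Longrightarrow> norm (g' t) \<le> M"
proof -
  have "bounded (g' ` {a..b})" using cont' by (intro compact_imp_bounded compact_continuous_image) auto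
  then obtain M where M: "\<forall>z\<in>g' ` {a..b}. norm z \<le> M" unfolding bounded_iff by blast
  then have "\<And>t. t \<in> {a..b} \<Longrightarrow> norm (g' t) \<le> M" by blast
  moreover from this[of a] have "0 \<le> M" using ab by (meson atLeastAtMost_iff norm_ge_zero order_refl order_trans)
  ultimately show ?thesis using that by blast
qed

lemma C1_var_finite: "var_on g a b < \<infinity>"
proof -
  obtain M where M: "0 \<le> M" "\<And>t. t \<in> {a..b} \<Longrightarrow> norm (g' t) \<le> M" by (rule C1_bound) blast
  have "var_on g a b \<le> ennreal (M * (b - a))"
    using C1_dist_le[OF order_refl order_refl M(2)] ab M(1) by (intro var_le_lipschitz) auto
  then show ?thesis by (rule le_less_trans) simp
qed

lemma C1_cont: "continuous_on {a..b} g"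
  using der by (meson continuous_on_eq_continuous_within has_vector_derivative_continuous)

text \<open>For an interval with one end at \<open>t0\<close>, the variation lies between the chord
  length and the interval length times the supremum of the speed; both are
  \<open>norm (g' t0)\<close> times the interval length up to a small relative error.\<close>

lemma varfun_has_derivative:
  assumes t0: "t0 \<in> {a..b}"
  shows "(varfun g a b has_real_derivative norm (g' t0)) (at t0 within {a..b})"
  unfolding has_field_derivative_def has_derivative_within_alt
proof (intro conjI allI impI)
  show "bounded_linear ((*) (norm (g' t0)))" by (rule bounded_linear_mult_right)
  fix e :: real assume e: "0 < e"
  obtain d1 where d1: "0 < d1" "\<And>t. t \<in> {a..b} \<Longrightarrow> dist t t0 < d1 \<Longrightarrow> dist (g' t) (g' t0) < e"
    using cont' t0 e unfolding continuous_on_iff by metis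
  obtain d2 where d2: "0 < d2" "\<And>y. y \<in> {a..b} \<Longrightarrow> norm (y - t0) < d2 \<Longrightarrow> norm (g y - g t0 - (y - t0) *\<^sub>R g' t0) \<le> e * norm (y - t0)"
    using der[OF t0] e unfolding has_vector_derivative_def has_derivative_within_alt by metis
  have key: "\<bar>enn2real (var_on g s t) - norm (g' t0) * (t - s)\<bar> \<le> e * (t - s)"
    if st: "a \<le> s" "s \<le> t" "t \<le> b" "s = t0 \<or> t = t0" "t - s < d1" "t - s < d2" for s t
  proof -
    have "norm (g' x) \<le> norm (g' t0) + e" if "x \<in> {s..t}" for x
    proof -
      have "dist (g' x) (g' t0) < e" using that st by (intro d1(2)) (auto simp: dist_real_def)
      then show ?thesis using norm_triangle_ineq2[of "g' x" "g' t0"] by (simp add: dist_norm)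
    qed
    from C1_dist_le[OF st(1,3) this]
    have "var_on g s t \<le> ennreal ((norm (g' t0) + e) * (t - s))"
      using st e by (intro var_le_lipschitz) (auto simp: add_nonneg_nonneg)
    then have up: "enn2real (var_on g s t) \<le> (norm (g' t0) + e) * (t - s)"
      using st e by (intro enn2real_leI) (auto simp: add_nonneg_nonneg)
    have "var_on g s t < \<infinity>" using C1_var_finite var_mono[of a s t b g] st by (auto intro: le_less_trans)
    then have "dist (g s) (g t) \<le> enn2real (var_on g s t)"
      using dist_le_var[of s s t t g] st by (metis enn2real_ennreal enn2real_mono order_refl zero_le_dist infinity_ennreal_def)
    moreover have "norm (g' t0) * (t - s) - e * (t - s) \<le> dist (g s) (g t)"
      using st(4)
    proof
      assume "s = t0"
      then have "norm (g t - g t0 - (t - t0) *\<^sub>R g' t0) \<le> e * norm (t - t0)" using st by (intro d2(2)) auto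
      then show ?thesis using norm_triangle_ineq2[of "(t - t0) *\<^sub>R g' t0" "g t - g t0"] \<open>s = t0\<close> st
        by (simp add: dist_norm norm_minus_commute mult.commute)
    next
      assume "t = t0"
      then have "norm (g s - g t0 - (s - t0) *\<^sub>R g' t0) \<le> e * norm (s - t0)" using st by (intro d2(2)) auto
      then show ?thesis using norm_triangle_ineq2[of "(s - t0) *\<^sub>R g' t0" "g s - g t0"] \<open>t = t0\<close> st
        by (simp add: dist_norm norm_minus_commute mult.commute)
    qed
    ultimately show ?thesis using up by (simp add: algebra_simps abs_le_iff)
  qed
  show "\<exists>d>0. \<forall>y\<in>{a..b}. norm (y - t0) < d \<longrightarrow>
     norm (varfun g a b y - varfun g a b t0 - norm (g' t0) * (y - t0)) \<le> e * norm (y - t0)"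
  proof (intro exI[of _ "min d1 d2"] conjI ballI impI)
    fix y assume y: "y \<in> {a..b}" "norm (y - t0) < min d1 d2"
    show "norm (varfun g a b y - varfun g a b t0 - norm (g' t0) * (y - t0)) \<le> e * norm (y - t0)"
    proof (cases "t0 \<le> y")
      case True
      have "varfun g a b y - varfun g a b t0 = enn2real (var_on g t0 y)"
        using y t0 True by (intro varfun_diff ab C1_var_finite C1_cont) auto
      then show ?thesis using key[of t0 y] y t0 True by simp
    next
      case False
      have "varfun g a b t0 - varfun g a b y = enn2real (var_on g y t0)"
        using y t0 False by (intro varfun_diff ab C1_var_finite C1_cont) auto
      then show ?thesis using key[of y t0] y t0 False by (simp add: abs_le_iff algebra_simps)
    qed
  qed (use d1 d2 in auto)
qed

text \<open>Half-open intervals form an intersection-stable generator, and on them the two measures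
  agree by the fundamental theorem of calculus for the length function.\<close>

lemma interval_measure_varfun:
  "interval_measure (varfun g a b) = density lborel (\<lambda>x. ennreal (norm (g' (max a (min x b)))) * indicator {a<..b} x)"
proof (rule measure_eqI_generator_eq[where E = "range (\<lambda>(s, t). {s<..t::real})" and \<Omega> = UNIV and A = "\<lambda>n. {- real n<..real n}"])
  have cm: "continuous_on UNIV (\<lambda>x. g' (max a (min x b)))"
    using ab by (intro continuous_on_compose2[OF cont'] continuous_intros) auto
  then have meas: "(\<lambda>x. ennreal (norm (g' (max a (min x b)))) * indicator {a<..b} x) \<in> borel_measurable borel"
    by (intro borel_measurable_times_ennreal borel_measurable_indicator measurable_compose[OF _ measurable_ennreal])
       (auto intro!: borel_measurable_continuous_onI continuous_on_norm)
  note vf = ab C1_var_finite C1_cont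
  show "Int_stable (range (\<lambda>(s, t). {s<..t::real}))"
    by (auto simp: Int_stable_def Int_greaterThanAtMost)
  show "sets (interval_measure (varfun g a b)) = sigma_sets UNIV (range (\<lambda>(s, t). {s<..t::real}))"
    by (simp add: borel_sigma_sets_Ioc)
  show "sets (density lborel (\<lambda>x. ennreal (norm (g' (max a (min x b)))) * indicator {a<..b} x)) = sigma_sets UNIV (range (\<lambda>(s, t). {s<..t::real}))"
    by (simp add: borel_sigma_sets_Ioc)
  show "(\<Union>n. {- real n<..real n}) = UNIV"
  proof (intro equalityI subsetI UNIV_I)
    fix x :: real
    obtain n where "\<bar>x\<bar> < real n" using reals_Archimedean2 by blast
    then show "x \<in> (\<Union>n. {- real n<..real n})" by (intro UN_I[of n]) auto
  qed
  show "emeasure (interval_measure (varfun g a b)) {- real n<..real n} \<noteq> \<infinity>" for n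
    by (subst emeasure_interval_measure_Ioc) (auto intro!: varfun_mono[OF vf] varfun_right_cont[OF vf])
  fix X assume "X \<in> range (\<lambda>(s, t). {s<..t::real})"
  then obtain s t where X: "X = {s<..t}" by auto
  show "emeasure (interval_measure (varfun g a b)) X = emeasure (density lborel (\<lambda>x. ennreal (norm (g' (max a (min x b)))) * indicator {a<..b} x)) X"
  proof (cases "s \<le> t")
    case True
    \<comment> \<open>Outside \<open>{a..b}\<close> the length function is constant and the density
      vanishes, so both sides depend only on the clamped end points.\<close>
    define s' t' where "s' = max a (min s b)" and "t' = max a (min t b)"
    have st: "a \<le> s'" "s' \<le> t'" "t' \<le> b" using True ab by (auto simp: s'_def t'_def)
    have "emeasure (interval_measure (varfun g a b)) X = varfun g a b t - varfun g a b s"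
      unfolding X using True by (intro emeasure_interval_measure_Ioc varfun_mono[OF vf] varfun_right_cont[OF vf])
    also have "varfun g a b t - varfun g a b s = varfun g a b t' - varfun g a b s'"
      using ab by (simp add: varfun_def s'_def t'_def)
    finally have 1: "emeasure (interval_measure (varfun g a b)) X = ennreal (varfun g a b t' - varfun g a b s')" .
    have "((\<lambda>x. norm (g' x)) has_integral (varfun g a b t' - varfun g a b s')) {s'..t'}"
      using st by (intro fundamental_theorem_of_calculus)
        (auto simp: has_real_derivative_iff_has_vector_derivative[symmetric] intro!: DERIV_subset[OF varfun_has_derivative])
    from nn_integral_has_integral_lebesgue'[OF _ this]
    have 2: "(\<integral>\<^sup>+ x. ennreal (norm (g' x)) * indicator {s'..t'} x \<partial>lborel) = ennreal (varfun g a b t' - varfun g a b s')" by simp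
    have "emeasure (density lborel (\<lambda>x. ennreal (norm (g' (max a (min x b)))) * indicator {a<..b} x)) X
       = (\<integral>\<^sup>+ x. ennreal (norm (g' (max a (min x b)))) * indicator {a<..b} x * indicator X x \<partial>lborel)"
      using meas unfolding X by (intro emeasure_density) auto
    also have "\<dots> = (\<integral>\<^sup>+ x. ennreal (norm (g' x)) * indicator {s'..t'} x \<partial>lborel)"
    proof (rule nn_integral_cong_AE)
      have "AE x in lborel. x \<noteq> s'" by (rule AE_lborel_singleton)
      then show "AE x in lborel. ennreal (norm (g' (max a (min x b)))) * indicator {a<..b} x * indicator X x
         = ennreal (norm (g' x)) * indicator {s'..t'} x"
      proof eventually_elim
        case (elim x)
        have "x \<in> {a<..b} \<and> x \<in> X \<longleftrightarrow> x \<in> {s'..t'}"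
          using elim ab True unfolding X s'_def t'_def by (auto simp: max_def min_def split: if_splits)
        moreover have "x \<in> {s'..t'} \<Longrightarrow> max a (min x b) = x" using st by auto
        ultimately show ?case by (cases "x \<in> {s'..t'}") (auto simp: indicator_def)
      qed
    qed
    finally show ?thesis using 1 2 by simp
  qed (simp add: X)
qed auto

lemma arc_integral_C1_le:
  assumes \<rho>: "\<rho> \<in> borel_measurable borel"
  shows "arc_integral \<rho> g a b \<le> (\<integral>\<^sup>+ t. \<rho> (g t) * ennreal (norm (g' t)) * indicator {a..b} t \<partial>lborel)"
proof -
  note vf = ab C1_var_finite C1_cont
  have cm: "continuous_on UNIV (\<lambda>x. g' (max a (min x b)))"
    using ab by (intro continuous_on_compose2[OF cont'] continuous_intros) auto
  then have meas: "(\<lambda>x. ennreal (norm (g' (max a (min x b)))) * indicator {a<..b} x) \<in> borel_measurable borel"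
    by (intro borel_measurable_times_ennreal borel_measurable_indicator measurable_compose[OF _ measurable_ennreal])
       (auto intro!: borel_measurable_continuous_onI continuous_on_norm)
  have "arc_integral \<rho> g a b = (\<integral>\<^sup>+ t. (ennreal (norm (g' (max a (min t b)))) * indicator {a<..b} t) * (\<rho> (g (max a (min t b))) * indicator {a..b} t) \<partial>lborel)"
    unfolding arc_integral_eq[OF vf] interval_measure_varfun
    using meas clamp_measurable[OF vf \<rho>] by (intro nn_integral_density) auto
  also have "\<dots> \<le> (\<integral>\<^sup>+ t. \<rho> (g t) * ennreal (norm (g' t)) * indicator {a..b} t \<partial>lborel)"
    by (intro nn_integral_mono) (auto simp: indicator_def mult.commute)
  finally show ?thesis .
qed

end

section \<open>Plane measure and holomorphic changes of variables\<close>

lemma lborel_complex_eq: "(lborel :: complex measure) = distr (lborel \<Otimes>\<^sub>M lborel) borel (\<lambda>(x, y). Complex x y)"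
proof (rule lborel_eqI)
  have [measurable]: "(\<lambda>(x, y). Complex x y) \<in> borel_measurable (lborel \<Otimes>\<^sub>M lborel)"
    unfolding Complex_eq case_prod_beta' by measurable
  fix l u :: complex assume "\<And>b. b \<in> Basis \<Longrightarrow> l \<bullet> b \<le> u \<bullet> b"
  from this[of 1] this[of \<i>] have le: "Re l \<le> Re u" "Im l \<le> Im u" by (auto simp: Basis_complex_def inner_complex_def)
  have "(\<lambda>(x, y). Complex x y) -` box l u \<inter> space (lborel \<Otimes>\<^sub>M lborel) = {Re l<..<Re u} \<times> {Im l<..<Im u}"
    by (auto simp: in_box_complex_iff space_pair_measure)
  then have "emeasure (distr (lborel \<Otimes>\<^sub>M lborel) borel (\<lambda>(x, y). Complex x y)) (box l u)
     = emeasure (lborel \<Otimes>\<^sub>M lborel) ({Re l<..<Re u} \<times> {Im l<..<Im u})"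
    by (subst emeasure_distr) auto
  also have "\<dots> = ennreal (Re u - Re l) * ennreal (Im u - Im l)"
    using le by (subst lborel.emeasure_pair_measure_Times) auto
  also have "\<dots> = (\<Prod>b\<in>Basis. (u - l) \<bullet> b)"
    using le by (simp add: Basis_complex_def inner_complex_def ennreal_mult)
  finally show "emeasure (distr (lborel \<Otimes>\<^sub>M lborel) borel (\<lambda>(x, y). Complex x y)) (box l u) = (\<Prod>b\<in>Basis. (u - l) \<bullet> b)" .
qed simp

lemma nn_integral_complex:
  assumes "f \<in> borel_measurable borel"
  shows "(\<integral>\<^sup>+ z. f z \<partial>lborel) = (\<integral>\<^sup>+ x. \<integral>\<^sup>+ y. f (Complex x y) \<partial>lborel \<partial>lborel)"
proof -
  have [measurable]: "(\<lambda>(x, y). Complex x y) \<in> borel_measurable (lborel \<Otimes>\<^sub>M lborel)"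
    unfolding Complex_eq case_prod_beta' by measurable
  have "(\<integral>\<^sup>+ z. f z \<partial>lborel) = (\<integral>\<^sup>+ p. f (case p of (x, y) \<Rightarrow> Complex x y) \<partial>(lborel \<Otimes>\<^sub>M lborel))"
    unfolding lborel_complex_eq using assms by (subst nn_integral_distr) auto
  also have "\<dots> = (\<integral>\<^sup>+ x. \<integral>\<^sup>+ y. f (Complex x y) \<partial>lborel \<partial>lborel)"
    using assms by (subst lborel.nn_integral_fst[symmetric]) auto
  finally show ?thesis .
qed

text \<open>Coordinates in \<open>real^2\<close>, where the area formula for injective
  differentiable maps is stated with determinants.\<close>

definition vec_complex :: "real^2 \<Rightarrow> complex" where "vec_complex v = Complex (v $ 1) (v $ 2)"
definition complex_vec :: "complex \<Rightarrow> real^2" where "complex_vec z = vector [Re z, Im z]"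

lemma vec_complex_inverse [simp]: "vec_complex (complex_vec z) = z" "complex_vec (vec_complex v) = v"
  by (auto simp: vec_complex_def complex_vec_def vec_eq_iff forall_2)

lemma bounded_linear_vec_complex: "bounded_linear vec_complex" "bounded_linear complex_vec"
proof -
  have "linear vec_complex" by (rule linearI) (auto simp: vec_complex_def complex_eq_iff)
  then show "bounded_linear vec_complex" by (rule linear_conv_bounded_linear[THEN iffD1])
  have "linear complex_vec" by (rule linearI) (auto simp: complex_vec_def vec_eq_iff forall_2)
  then show "bounded_linear complex_vec" by (rule linear_conv_bounded_linear[THEN iffD1])
qed

lemma vec_complex_measurable [measurable]: "vec_complex \<in> borel_measurable borel" "complex_vec \<in> borel_measurable borel"
  using bounded_linear_vec_complex by (auto intro!: borel_measurable_continuous_onI linear_continuous_on)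

lemma lborel_complex_vec: "(lborel :: complex measure) = distr lborel borel vec_complex"
proof (rule lborel_eqI)
  fix l u :: complex assume "\<And>b. b \<in> Basis \<Longrightarrow> l \<bullet> b \<le> u \<bullet> b"
  from this[of 1] this[of \<i>] have le: "Re l \<le> Re u" "Im l \<le> Im u" by (auto simp: Basis_complex_def inner_complex_def)
  have "vec_complex -` box l u \<inter> space lborel = box (complex_vec l) (complex_vec u)"
    by (auto simp: in_box_complex_iff mem_box_cart vec_complex_def complex_vec_def forall_2)
  then have "emeasure (distr lborel borel vec_complex) (box l u) = emeasure lborel (box (complex_vec l) (complex_vec u))"
    by (subst emeasure_distr) auto
  also have "\<dots> = (\<Prod>b\<in>Basis. (complex_vec u - complex_vec l) \<bullet> b)"
  proof (subst emeasure_lborel_box)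
    fix b :: "real^2" assume "b \<in> Basis"
    then obtain i where "b = axis i 1" by (auto simp: Basis_vec_def)
    then show "complex_vec l \<bullet> b \<le> complex_vec u \<bullet> b" using exhaust_2[of i] le by (auto simp: inner_axis complex_vec_def)
  qed simp
  also have "(\<Prod>b\<in>Basis. (complex_vec u - complex_vec l) \<bullet> b) = (Re u - Re l) * (Im u - Im l)"
  proof -
    have B: "(Basis :: (real^2) set) = {axis 1 1, axis 2 1}" by (simp add: Basis_vec_def UNIV_2 insert_commute)
    have "axis 1 1 \<noteq> (axis 2 1 :: real^2)" by (simp add: axis_eq_axis)
    then show ?thesis unfolding B by (simp add: inner_axis complex_vec_def)
  qed
  also have "\<dots> = (\<Prod>b\<in>Basis. (u - l) \<bullet> b)" by (simp add: Basis_complex_def inner_complex_def)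
  finally show "emeasure (distr lborel borel vec_complex) (box l u) = (\<Prod>b\<in>Basis. (u - l) \<bullet> b)" .
qed simp

text \<open>Multiplication by a complex number \<open>c\<close> has determinant
  \<open>(cmod c)^2\<close>, so the left-hand side is the area of the part of \<open>A\<close>
  covered by the image of \<open>T\<close>. For infinite area of \<open>A\<close> the claim is
  trivial; otherwise that part has finite measure and the area formula applies.\<close>

lemma holomorphic_jacobian_le:
  assumes S: "open S" and T: "T holomorphic_on S" and inj: "inj_on T S" and A: "A \<in> sets borel"
  shows "(\<integral>\<^sup>+ z. ennreal ((cmod (deriv T z))\<^sup>2) * indicator {z \<in> S. T z \<in> A} z \<partial>lborel) \<le> emeasure lborel A"
proof (cases "emeasure lborel A = \<infinity>")
  case False
  define E where "E = {z \<in> S. T z \<in> A}"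
  have contT: "continuous_on S T" using T by (rule holomorphic_on_imp_continuous_on)
  have meT: "(\<lambda>z. if z \<in> S then T z else 0) \<in> borel_measurable borel"
    using S contT by (intro borel_measurable_continuous_on_if) auto
  have "E = S \<inter> ((\<lambda>z. if z \<in> S then T z else 0) -` A \<inter> space borel)" by (auto simp: E_def)
  then have Eb: "E \<in> sets borel" using S measurable_sets[OF meT A] by simp
  define f where "f = complex_vec \<circ> T \<circ> vec_complex"
  define f' where "f' = (\<lambda>v. complex_vec \<circ> (\<lambda>h. deriv T (vec_complex v) * h) \<circ> vec_complex)"
  define E2 where "E2 = vec_complex -` E"
  have E2b: "E2 \<in> sets borel" using measurable_sets[OF vec_complex_measurable(1) Eb] by (simp add: E2_def)
  have derf: "(f has_derivative f' v) (at v within E2)" if "v \<in> E2" for v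
  proof -
    have v: "vec_complex v \<in> S" using that by (simp add: E2_def E_def)
    have "(T has_field_derivative deriv T (vec_complex v)) (at (vec_complex v))"
      using holomorphic_derivI[OF T S v] .
    then have "(T has_derivative (*) (deriv T (vec_complex v))) (at (vec_complex v))" by (simp add: has_field_derivative_def)
    then have "(f has_derivative f' v) (at v)" unfolding f_def f'_def
      by (intro diff_chain_at) (auto intro: bounded_linear_imp_has_derivative bounded_linear_vec_complex)
    then show ?thesis by (rule has_derivative_at_withinI)
  qed
  have det: "\<bar>det (matrix (f' v))\<bar> = (cmod (deriv T (vec_complex v)))\<^sup>2" for v
  proof -
    have "vec_complex (axis 1 1) = 1" "vec_complex (axis 2 1) = \<i>" by (simp_all add: vec_complex_def axis_def complex_eq_iff)
    then have "det (matrix (f' v)) = (Re (deriv T (vec_complex v)))\<^sup>2 + (Im (deriv T (vec_complex v)))\<^sup>2"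
      by (simp add: det_2 matrix_def f'_def complex_vec_def power2_eq_square)
    then show ?thesis by (simp add: cmod_power2)
  qed
  have injf: "inj_on f E2"
  proof (rule inj_onI)
    fix v w assume "v \<in> E2" "w \<in> E2" "f v = f w"
    then have "T (vec_complex v) = T (vec_complex w)" "vec_complex v \<in> S" "vec_complex w \<in> S"
      by (auto simp: f_def E2_def E_def) (metis vec_complex_inverse(1))
    then have "vec_complex v = vec_complex w" using inj by (auto dest: inj_onD)
    then show "v = w" by (metis vec_complex_inverse(2))
  qed
  define A2 where "A2 = vec_complex -` A"
  have A2: "A2 \<in> sets borel" "emeasure lborel A2 = emeasure lborel A"
    using measurable_sets[OF vec_complex_measurable(1) A] emeasure_distr[of vec_complex lborel borel A] A
    by (auto simp: A2_def lborel_complex_vec[symmetric])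
  have A2m: "A2 \<in> lmeasurable" using A2 False by (auto simp: fmeasurable_def less_top)
  have sub: "f ` E2 \<subseteq> A2" by (auto simp: f_def E2_def E_def A2_def)
  have "f differentiable_on E2" using derf unfolding differentiable_on_def differentiable_def by blast
  then have "f ` E2 \<in> sets lebesgue" using E2b by (intro differentiable_image_in_sets_lebesgue) auto
  then have m: "f ` E2 \<in> lmeasurable" using A2m sub by (rule fmeasurableI2[rotated 2])
  have E2l: "E2 \<in> sets lebesgue" using E2b by auto
  have hi: "((\<lambda>v. \<bar>det (matrix (f' v))\<bar>) has_integral measure lebesgue (f ` E2)) E2"
    using has_measure_differentiable_image[OF E2l derf injf] m by blast
  have "(\<integral>\<^sup>+ z. ennreal ((cmod (deriv T z))\<^sup>2) * indicator E z \<partial>lborel)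
     = (\<integral>\<^sup>+ v. ennreal ((cmod (deriv T (vec_complex v)))\<^sup>2) * indicator E (vec_complex v) \<partial>lborel)"
  proof -
    have "deriv T holomorphic_on S" using T S by (rule holomorphic_deriv)
    then have "(\<lambda>z. if z \<in> S then deriv T z else 0) \<in> borel_measurable borel"
      using S by (intro borel_measurable_continuous_on_if holomorphic_on_imp_continuous_on) auto
    then have mm: "(\<lambda>z. ennreal ((cmod (if z \<in> S then deriv T z else 0))\<^sup>2) * indicator E z) \<in> borel_measurable borel"
      using Eb by measurable
    have e: "ennreal ((cmod (deriv T z))\<^sup>2) * indicator E z = ennreal ((cmod (if z \<in> S then deriv T z else 0))\<^sup>2) * indicator E z" for z
      by (auto simp: indicator_def E_def)
    show ?thesis unfolding e lborel_complex_vec using mm by (subst nn_integral_distr) auto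
  qed
  also have "\<dots> = (\<integral>\<^sup>+ v. ennreal \<bar>det (matrix (f' v))\<bar> * indicator E2 v \<partial>lborel)"
    unfolding det by (intro nn_integral_cong) (auto simp: E2_def indicator_def)
  also have "\<dots> = ennreal (measure lebesgue (f ` E2))"
    by (rule nn_integral_has_integral_lebesgue'[OF _ hi]) simp
  also have "\<dots> \<le> ennreal (measure lebesgue A2)"
    using sub m A2m by (intro ennreal_leI measure_mono_fmeasurable) auto
  also have "\<dots> = emeasure lborel A"
    using A2 emeasure_eq_measure2[OF A2m] by simp
  finally show ?thesis by (simp add: E_def)
qed simp

text \<open>The inequality for sets says that the push-forward \<open>N\<close> of the measure with
  density \<open>(cmod (deriv T z))^2\<close> on \<open>S\<close> is dominated by Lebesgue measure;
  it remains to integrate \<open>g\<close> against both.\<close>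

lemma nn_integral_holomorphic_image_le:
  assumes S: "open S" and T: "T holomorphic_on S" and inj: "inj_on T S" and g: "g \<in> borel_measurable borel"
  shows "(\<integral>\<^sup>+ z. g (T z) * ennreal ((cmod (deriv T z))\<^sup>2) * indicator S z \<partial>lborel) \<le> (\<integral>\<^sup>+ w. g w \<partial>lborel)"
proof -
  \<comment> \<open>The value 0 off the open set \<open>S\<close> makes the map Borel on the whole
    plane.\<close>
  define T0 where "T0 = (\<lambda>z. if z \<in> S then T z else 0)"
  define J where "J = (\<lambda>z. ennreal ((cmod (if z \<in> S then deriv T z else 0))\<^sup>2) * indicator S z)"
  have T0[measurable]: "T0 \<in> borel_measurable borel"
    unfolding T0_def using S T by (intro borel_measurable_continuous_on_if holomorphic_on_imp_continuous_on) auto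
  have "deriv T holomorphic_on S" using T S by (rule holomorphic_deriv)
  then have D[measurable]: "(\<lambda>z. if z \<in> S then deriv T z else 0) \<in> borel_measurable borel"
    using S by (intro borel_measurable_continuous_on_if holomorphic_on_imp_continuous_on) auto
  have [measurable]: "S \<in> sets borel" using S by simp
  have "(\<lambda>z. cmod (if z \<in> S then deriv T z else 0)) \<in> borel_measurable borel"
    by (rule measurable_compose[OF D borel_measurable_norm])
  then have J[measurable]: "J \<in> borel_measurable borel" unfolding J_def
    by (intro borel_measurable_times_ennreal borel_measurable_indicator measurable_compose[OF _ measurable_ennreal] borel_measurable_power) auto
  define N where "N = distr (density lborel J) borel T0"
  have "N \<le> lborel"
  proof (subst le_measure)
    show "\<forall>A\<in>sets N. emeasure N A \<le> emeasure lborel A"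
    proof
      fix A assume "A \<in> sets N"
      then have A: "A \<in> sets borel" by (simp add: N_def)
      have "emeasure N A = (\<integral>\<^sup>+ z. J z * indicator (T0 -` A) z \<partial>lborel)"
        unfolding N_def using A measurable_sets[OF T0 A] by (simp add: emeasure_distr emeasure_density)
      also have "\<dots> = (\<integral>\<^sup>+ z. ennreal ((cmod (deriv T z))\<^sup>2) * indicator {z \<in> S. T z \<in> A} z \<partial>lborel)"
        by (intro nn_integral_cong) (auto simp: J_def T0_def indicator_def)
      also have "\<dots> \<le> emeasure lborel A" by (rule holomorphic_jacobian_le[OF S T inj A])
      finally show "emeasure N A \<le> emeasure lborel A" .
    qed
  qed (simp add: N_def)
  have "(\<integral>\<^sup>+ z. g (T z) * ennreal ((cmod (deriv T z))\<^sup>2) * indicator S z \<partial>lborel) = (\<integral>\<^sup>+ z. J z * g (T0 z) \<partial>lborel)"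
    by (intro nn_integral_cong) (auto simp: J_def T0_def indicator_def mult.commute)
  also have "\<dots> = (\<integral>\<^sup>+ w. g w \<partial>N)"
    unfolding N_def using g by (simp add: nn_integral_distr nn_integral_density)
  also have "\<dots> \<le> (\<integral>\<^sup>+ w. g w \<partial>lborel)"
    using \<open>N \<le> lborel\<close> by (intro nn_integral_mono_measure) (simp_all add: N_def)
  finally show ?thesis .
qed

section \<open>The length-area estimate for vertical crosscuts\<close>

definition rect :: "real \<Rightarrow> real \<Rightarrow> complex set" where
  "rect A B = {z. 0 < Re z \<and> Re z < A \<and> - B < Im z \<and> Im z < B}"

text \<open>The value \<open>p\<close> off the parameter interval makes \<open>f \<circ> (g \<circ> c) = c\<close> an identity of functions on
  the whole line when \<open>f\<close> and \<open>g\<close> are only inverse to each other on a domain containing \<open>p\<close>.\<close>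

definition crosscut :: "(complex \<Rightarrow> complex) \<Rightarrow> real \<Rightarrow> complex \<Rightarrow> real \<Rightarrow> curve" where
  "crosscut T B p u = ({- B<..<B}, \<lambda>v. if v \<in> {- B<..<B} then T (Complex u v) else p)"

lemma open_rect: "open (rect A B)"
  unfolding rect_def by (intro open_Collect_conj open_Collect_less continuous_intros)

lemma emeasure_rect:
  assumes "0 \<le> A" "0 \<le> B"
  shows "emeasure lborel (rect A B) = ennreal (2 * A * B)"
proof -
  have "rect A B = box (Complex 0 (- B)) (Complex A B)" by (auto simp: rect_def in_box_complex_iff)
  then show ?thesis using assms
    by (simp add: emeasure_lborel_box_eq Basis_complex_def inner_complex_def ennreal_mult[symmetric] mult_ac)
qed

context
  fixes T :: "complex \<Rightarrow> complex" and A B :: real and p :: complex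
  assumes AB: "0 < A" "0 < B" and T: "T holomorphic_on rect A B"
begin

lemma crosscut_C1:
  assumes u: "0 < u" "u < A" and ab: "a \<le> b" "{a..b} \<subseteq> {- B<..<B}"
  shows "\<And>t. t \<in> {a..b} \<Longrightarrow> (snd (crosscut T B p u) has_vector_derivative \<i> * deriv T (Complex u t)) (at t within {a..b})"
    "continuous_on {a..b} (\<lambda>t. \<i> * deriv T (Complex u t))"
proof -
  have in_rect: "Complex u t \<in> rect A B" if "t \<in> {a..b}" for t
  proof -
    have "t \<in> {- B<..<B}" using that ab by blast
    then show ?thesis using u by (auto simp: rect_def)
  qed
  show "(snd (crosscut T B p u) has_vector_derivative \<i> * deriv T (Complex u t)) (at t within {a..b})" if t: "t \<in> {a..b}" for t
  proof -
    have "(Complex u has_vector_derivative \<i>) (at t)"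
    proof -
      have "((\<lambda>t. complex_of_real u + t *\<^sub>R \<i>) has_vector_derivative \<i>) (at t)"
        by (auto intro!: derivative_eq_intros)
      moreover have "(\<lambda>t. complex_of_real u + t *\<^sub>R \<i>) = Complex u" by (auto simp: complex_eq_iff)
      ultimately show ?thesis by simp
    qed
    then have "(T \<circ> Complex u has_vector_derivative \<i> * deriv T (Complex u t)) (at t)"
      using holomorphic_derivI[OF T open_rect in_rect[OF t]] by (rule field_vector_diff_chain_at)
    then have d: "(T \<circ> Complex u has_vector_derivative \<i> * deriv T (Complex u t)) (at t within {a..b})"
      by (rule has_vector_derivative_at_within)
    show ?thesis
      by (rule has_vector_derivative_transform[OF t _ d]) (use ab in \<open>auto simp: crosscut_def\<close>)
  qed
  have cC: "continuous_on {a..b} (Complex u)" unfolding Complex_eq[abs_def] by (intro continuous_intros)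
  have "continuous_on (rect A B) (deriv T)"
    using holomorphic_deriv[OF T open_rect] by (rule holomorphic_on_imp_continuous_on)
  then show "continuous_on {a..b} (\<lambda>t. \<i> * deriv T (Complex u t))"
    using in_rect by (intro continuous_intros continuous_on_compose2[OF _ cC]) auto
qed

lemma crosscut_is_curve:
  assumes u: "0 < u" "u < A"
  shows "is_curve (crosscut T B p u)"
proof -
  have "continuous_on {- B<..<B} (\<lambda>v. T (Complex u v))"
  proof (rule continuous_on_compose2[OF holomorphic_on_imp_continuous_on[OF T]])
    show "continuous_on {- B<..<B} (Complex u)" unfolding Complex_eq[abs_def] by (intro continuous_intros)
  qed (use u in \<open>auto simp: rect_def\<close>)
  then have "continuous_on {- B<..<B} (snd (crosscut T B p u))"
    by (rule continuous_on_eq) (auto simp: crosscut_def)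
  then show ?thesis using AB by (auto simp: is_curve_def crosscut_def)
qed

lemma crosscut_loc_rectifiable:
  assumes u: "0 < u" "u < A"
  shows "loc_rectifiable (crosscut T B p u)"
  unfolding loc_rectifiable_def
proof (intro allI impI)
  fix a b assume ab: "a \<le> b \<and> {a..b} \<subseteq> fst (crosscut T B p u)"
  then have ab': "a \<le> b" "{a..b} \<subseteq> {- B<..<B}" by (auto simp: crosscut_def)
  show "var_on (snd (crosscut T B p u)) a b < \<infinity>"
    by (rule C1_var_finite[OF ab'(1) crosscut_C1[OF u ab']])
qed

lemma crosscut_line_integral_le:
  assumes u: "0 < u" "u < A" and \<rho>: "\<rho> \<in> borel_measurable borel"
  shows "line_integral_ds \<rho> (crosscut T B p u) \<le>
    (\<integral>\<^sup>+ v. \<rho> (T (Complex u v)) * ennreal (cmod (deriv T (Complex u v))) * indicator (rect A B) (Complex u v) \<partial>lborel)"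
  unfolding line_integral_ds_def
proof (rule SUP_least, clarify)
  fix a b assume ab: "a \<le> b" "{a..b} \<subseteq> fst (crosscut T B p u)"
  then have ab': "a \<le> b" "{a..b} \<subseteq> {- B<..<B}" by (auto simp: crosscut_def)
  have "arc_integral \<rho> (snd (crosscut T B p u)) a b \<le>
     (\<integral>\<^sup>+ t. \<rho> (snd (crosscut T B p u) t) * ennreal (norm (\<i> * deriv T (Complex u t))) * indicator {a..b} t \<partial>lborel)"
    by (rule arc_integral_C1_le[OF ab'(1) crosscut_C1[OF u ab'] \<rho>])
  also have "\<dots> \<le> (\<integral>\<^sup>+ v. \<rho> (T (Complex u v)) * ennreal (cmod (deriv T (Complex u v))) * indicator (rect A B) (Complex u v) \<partial>lborel)"
  proof (rule nn_integral_mono)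
    fix t show "\<rho> (snd (crosscut T B p u) t) * ennreal (norm (\<i> * deriv T (Complex u t))) * indicator {a..b} t
       \<le> \<rho> (T (Complex u t)) * ennreal (cmod (deriv T (Complex u t))) * indicator (rect A B) (Complex u t)"
    proof (cases "t \<in> {a..b}")
      case True
      then have "t \<in> {- B<..<B}" using ab' by blast
      then show ?thesis using True u by (simp add: crosscut_def rect_def norm_mult)
    qed simp
  qed
  finally show "arc_integral \<rho> (snd (crosscut T B p u)) (fst (a, b)) (snd (a, b))
     \<le> (\<integral>\<^sup>+ v. \<rho> (T (Complex u v)) * ennreal (cmod (deriv T (Complex u v))) * indicator (rect A B) (Complex u v) \<partial>lborel)"
    by simp
qed

text \<open>Integrating the admissibility condition over \<open>u\<close> gives \<open>A\<close> as
  a lower bound for the area integral of \<open>h\<close>, the pulled-back density. The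
  Cauchy-Schwarz step is replaced by the pointwise inequality \<open>amgm\<close>, valid in
  \<open>ennreal\<close> without finiteness assumptions; integrated over the rectangle it gives
  \<open>2 * A \<le> 2 * B * X + A\<close>.\<close>

lemma modulus_crosscuts_ge:
  assumes inj: "inj_on T (rect A B)"
  shows "ennreal (A / (2 * B)) \<le> modulus (crosscut T B p ` {0<..<A})"
  unfolding modulus_def
proof (rule INF_greatest)
  fix \<rho> assume "\<rho> \<in> {\<rho>. admissible (crosscut T B p ` {0<..<A}) \<rho>}"
  then have \<rho>: "\<rho> \<in> borel_measurable borel"
    "\<And>u. 0 < u \<Longrightarrow> u < A \<Longrightarrow> 1 \<le> line_integral_ds \<rho> (crosscut T B p u)"
    using crosscut_loc_rectifiable by (auto simp: admissible_def)
  define R where "R = rect A B"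
  define T0 where "T0 = (\<lambda>z. if z \<in> R then T z else 0)"
  define D0 where "D0 = (\<lambda>z. if z \<in> R then deriv T z else 0)"
  have Ro: "open R" unfolding R_def by (rule open_rect)
  have T0[measurable]: "T0 \<in> borel_measurable borel"
    unfolding T0_def using Ro T by (intro borel_measurable_continuous_on_if holomorphic_on_imp_continuous_on) (auto simp: R_def)
  have D0[measurable]: "D0 \<in> borel_measurable borel"
    unfolding D0_def using Ro holomorphic_deriv[OF T open_rect]
    by (intro borel_measurable_continuous_on_if holomorphic_on_imp_continuous_on) (auto simp: R_def)
  note [measurable] = \<rho>(1)
  have Rs[measurable]: "R \<in> sets borel" using Ro by simp
  define h where "h = (\<lambda>z. \<rho> (T0 z) * ennreal (cmod (D0 z)) * indicator R z)"
  have h[measurable]: "h \<in> borel_measurable borel" unfolding h_def by measurable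
  define X where "X = (\<integral>\<^sup>+ w. (\<rho> w)\<^sup>2 \<partial>lborel)"
  have heq: "h z = \<rho> (T z) * ennreal (cmod (deriv T z)) * indicator (rect A B) z" for z
    by (auto simp: h_def T0_def D0_def R_def indicator_def)
  have "ennreal A = (\<integral>\<^sup>+ u. indicator {0<..<A} u \<partial>lborel)" using AB by simp
  also have "\<dots> \<le> (\<integral>\<^sup>+ u. \<integral>\<^sup>+ v. h (Complex u v) \<partial>lborel \<partial>lborel)"
  proof (rule nn_integral_mono)
    fix u show "indicator {0<..<A} u \<le> (\<integral>\<^sup>+ v. h (Complex u v) \<partial>lborel)"
    proof (cases "u \<in> {0<..<A}")
      case True
      then have "1 \<le> (\<integral>\<^sup>+ v. h (Complex u v) \<partial>lborel)"
        using order_trans[OF \<rho>(2)[of u] crosscut_line_integral_le[of u, OF _ _ \<rho>(1)]] unfolding heq by auto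
      then show ?thesis using True by simp
    qed simp
  qed
  also have "\<dots> = (\<integral>\<^sup>+ z. h z \<partial>lborel)" by (rule nn_integral_complex[symmetric]) (rule h)
  finally have 1: "ennreal A \<le> (\<integral>\<^sup>+ z. h z \<partial>lborel)" .
  \<comment> \<open>Equality holds for \<open>x = 1 / (2 * B)\<close>, the constant density that
    gives every vertical segment length 1; hence the weight \<open>2 * B\<close>.\<close>
  have amgm: "2 * x \<le> ennreal (2 * B) * x\<^sup>2 + ennreal (1 / (2 * B))" for x :: ennreal
  proof (cases x)
    case (real r)
    have "2 * r \<le> 2 * B * r\<^sup>2 + 1 / (2 * B)"
    proof -
      have "2 * B * r\<^sup>2 + 1 / (2 * B) - 2 * r = (2 * B * r - 1)\<^sup>2 / (2 * B)"
        using AB by (simp add: field_simps power2_eq_square)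
      moreover have "0 \<le> (2 * B * r - 1)\<^sup>2 / (2 * B)" using AB by simp
      ultimately show ?thesis by linarith
    qed
    then have "ennreal (2 * r) \<le> ennreal (2 * B * r\<^sup>2 + 1 / (2 * B))" by (rule ennreal_leI)
    also have "\<dots> = ennreal (2 * B) * x\<^sup>2 + ennreal (1 / (2 * B))"
      using AB real by (simp add: ennreal_plus ennreal_mult ennreal_power)
    finally show ?thesis using real by (simp add: ennreal_mult)
  next
    case top
    then show ?thesis using AB by (simp add: ennreal_mult_top power2_eq_square)
  qed
  have "2 * ennreal A \<le> (\<integral>\<^sup>+ z. 2 * h z \<partial>lborel)" using 1 by (simp add: nn_integral_cmult mult_left_mono)
  also have "\<dots> \<le> (\<integral>\<^sup>+ z. ennreal (2 * B) * ((\<rho> (T0 z))\<^sup>2 * ennreal ((cmod (D0 z))\<^sup>2) * indicator R z) + ennreal (1 / (2 * B)) * indicator R z \<partial>lborel)"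
  proof (rule nn_integral_mono)
    fix z show "2 * h z \<le> ennreal (2 * B) * ((\<rho> (T0 z))\<^sup>2 * ennreal ((cmod (D0 z))\<^sup>2) * indicator R z) + ennreal (1 / (2 * B)) * indicator R z"
      using amgm[of "\<rho> (T0 z) * ennreal (cmod (D0 z))"]
      by (auto simp: h_def indicator_def power_mult_distrib ennreal_power)
  qed
  also have "\<dots> = ennreal (2 * B) * (\<integral>\<^sup>+ z. (\<rho> (T0 z))\<^sup>2 * ennreal ((cmod (D0 z))\<^sup>2) * indicator R z \<partial>lborel) + ennreal (1 / (2 * B)) * emeasure lborel R"
    by (simp add: nn_integral_add nn_integral_cmult)
  also have "(\<integral>\<^sup>+ z. (\<rho> (T0 z))\<^sup>2 * ennreal ((cmod (D0 z))\<^sup>2) * indicator R z \<partial>lborel)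
     = (\<integral>\<^sup>+ z. (\<rho> (T z))\<^sup>2 * ennreal ((cmod (deriv T z))\<^sup>2) * indicator R z \<partial>lborel)"
    by (intro nn_integral_cong) (auto simp: T0_def D0_def indicator_def)
  also have "ennreal (2 * B) * \<dots> \<le> ennreal (2 * B) * X"
    unfolding X_def R_def
    by (intro mult_left_mono nn_integral_holomorphic_image_le[OF open_rect T inj]) auto
  also have "ennreal (1 / (2 * B)) * emeasure lborel R = ennreal A"
    using AB unfolding R_def by (simp add: emeasure_rect ennreal_mult[symmetric])
  finally have "2 * ennreal A \<le> ennreal (2 * B) * X + ennreal A" by (simp add: add_right_mono)
  then have 2: "ennreal A \<le> ennreal (2 * B) * X" 
    using AB unfolding mult_2 add.commute[of "ennreal (2 * B) * X" "ennreal A"] ennreal_add_left_cancel_le by simp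
  show "ennreal (A / (2 * B)) \<le> (\<integral>\<^sup>+ z. (\<rho> z)\<^sup>2 \<partial>lborel)"
    unfolding X_def[symmetric]
  proof (cases X)
    case (real x)
    then have "A \<le> 2 * B * x" using 2 AB by (simp add: ennreal_mult[symmetric])
    then show "ennreal (A / (2 * B)) \<le> X" using real AB by (simp add: field_simps ennreal_leI)
  qed simp
qed

end

section \<open>The Schwarz-Christoffel map of the slit half plane\<close>

definition quad :: "complex set" where "quad = {z. 0 < Re z \<and> 0 < Im z}"
definition cquad :: "complex set" where "cquad = {z. 0 \<le> Re z \<and> 0 \<le> Im z}"
definition slitplane :: "real \<Rightarrow> complex set" where
  "slitplane k = {z. 0 < Im z \<and> (Re z = 0 \<longrightarrow> k < Im z \<and> Im z < 1)}"
text \<open>The branches are chosen such that both radicands avoid the negative reals on the slit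
  half plane.\<close>

definition sc_dens :: "real \<Rightarrow> complex \<Rightarrow> complex" where
  "sc_dens k z = 1 / (csqrt (1 + z\<^sup>2) * csqrt (- (z\<^sup>2) - (of_real k)\<^sup>2))"
text \<open>The modulus of \<open>sc_dens\<close>, free of any choice of branch: it is continuous in
  the half plane away from \<open>\<i>\<close> and \<open>\<i> k\<close>, also across the
  slits.\<close>

definition sc_norm :: "real \<Rightarrow> complex \<Rightarrow> real" where
  "sc_norm k z = 1 / sqrt (cmod ((1 + z\<^sup>2) * (z\<^sup>2 + (of_real k)\<^sup>2)))"

lemma quad_simps: "open quad" "convex quad" "closed cquad" "convex cquad" "quad \<subseteq> cquad" "closure quad \<subseteq> cquad"
proof -
  have q: "quad = {z. Re z > 0} \<inter> {z. Im z > 0}" and c: "cquad = {z. Re z \<ge> 0} \<inter> {z. Im z \<ge> 0}"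
    by (auto simp: quad_def cquad_def)
  show "open quad" unfolding q by (intro open_Int open_halfspace_Re_gt open_halfspace_Im_gt)
  show "convex quad" unfolding q by (intro convex_Int convex_halfspace_Re_gt convex_halfspace_Im_gt)
  show "closed cquad" unfolding c by (intro closed_Int closed_halfspace_Re_ge closed_halfspace_Im_ge)
  then show "closure quad \<subseteq> cquad" by (intro closure_minimal) (auto simp: quad_def cquad_def)
  show "convex cquad" unfolding c by (intro convex_Int convex_halfspace_Re_ge convex_halfspace_Im_ge)
qed (auto simp: quad_def cquad_def)

text \<open>The diagonal shift moves every point of the closed quadrant into the open one, so
  boundary values are limits along one explicit sequence.\<close>

lemma cquad_shift: "z \<in> cquad \<Longrightarrow> 0 < e \<Longrightarrow> z + of_real e * (1 + \<i>) \<in> quad"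
  by (auto simp: quad_def cquad_def)

lemma cquad_shift_tendsto: "(\<lambda>n. z + of_real (inverse (real (Suc n))) * (1 + \<i>)) \<longlonglongrightarrow> z"
proof -
  have "(\<lambda>n. z + of_real (inverse (real (Suc n))) * (1 + \<i>)) \<longlonglongrightarrow> z + of_real 0 * (1 + \<i>)"
    by (intro tendsto_intros LIMSEQ_inverse_real_of_nat)
  then show ?thesis by simp
qed

lemma quad_subset_slitplane: "quad \<subseteq> slitplane k"
  by (auto simp: quad_def slitplane_def)

lemma cquad_subset_closure: "cquad \<subseteq> closure quad"
proof
  fix z assume "z \<in> cquad"
  then show "z \<in> closure quad" unfolding closure_sequential
    by (intro exI[of _ "\<lambda>n. z + of_real (inverse (real (Suc n))) * (1 + \<i>)"] conjI allI cquad_shift cquad_shift_tendsto) auto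
qed

lemma Im_csqrt_sign:
  "0 < Im z \<Longrightarrow> 0 < Im (csqrt z)" "Im z < 0 \<Longrightarrow> Im (csqrt z) < 0"
proof -
  have e: "Im z = 2 * Re (csqrt z) * Im (csqrt z)"
    by (metis power2_csqrt Im_power2)
  have r: "0 \<le> Re (csqrt z)" by (rule Re_csqrt)
  show "0 < Im z \<Longrightarrow> 0 < Im (csqrt z)" using e r by (smt (verit) mult_nonneg_nonpos mult_nonneg_nonneg)
  show "Im z < 0 \<Longrightarrow> Im (csqrt z) < 0" using e r by (smt (verit) mult_nonneg_nonneg)
qed

lemma Im_sq: "Im (z\<^sup>2) = 2 * Re z * Im z" and Re_sq: "Re (z\<^sup>2) = (Re z)\<^sup>2 - (Im z)\<^sup>2" for z :: complex
  by (simp_all add: power2_eq_square)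

lemma Re_csqrt_pos:
  assumes "z \<notin> \<real>\<^sub>\<le>\<^sub>0"
  shows "0 < Re (csqrt z)"
proof (rule ccontr)
  assume "\<not> 0 < Re (csqrt z)"
  then have r: "Re (csqrt z) = 0" using Re_csqrt[of z] by simp
  have "Re ((csqrt z)\<^sup>2) = - ((Im (csqrt z))\<^sup>2)" unfolding Re_sq r by simp
  moreover have "Im ((csqrt z)\<^sup>2) = 0" unfolding Im_sq r by simp
  ultimately have "Re z = - ((Im (csqrt z))\<^sup>2)" "Im z = 0" by (simp_all only: power2_csqrt)
  moreover have "0 \<le> (Im (csqrt z))\<^sup>2" by (rule zero_le_power2)
  ultimately have "Re z \<le> 0" "Im z = 0" by linarith+
  then show False using assms unfolding complex_nonpos_Reals_iff by blast
qed

lemma convex_plus_segment_starlike: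
  assumes "a \<in> S" "\<And>z u. z \<in> S \<Longrightarrow> 0 < u \<Longrightarrow> u < 1 \<Longrightarrow> (1 - u) *\<^sub>R a + u *\<^sub>R z \<in> S"
  shows "starlike S"
  unfolding starlike_def
proof (intro bexI[of _ a] ballI subsetI)
  fix z x assume z: "z \<in> S" and "x \<in> closed_segment a z"
  then obtain u where u: "0 \<le> u" "u \<le> 1" "x = (1 - u) *\<^sub>R a + u *\<^sub>R z" by (auto simp: in_segment)
  show "x \<in> S" using assms z u by (cases "u = 0"; cases "u = 1") auto
qed (rule assms)

context
  fixes k :: real
  assumes k: "0 < k" "k < 1"
begin

lemma open_slitplane: "open (slitplane k)"
proof -
  have "slitplane k = {z. 0 < Im z} \<inter> ({z. Re z \<noteq> 0} \<union> ({z. k < Im z} \<inter> {z. Im z < 1}))"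
    by (auto simp: slitplane_def)
  moreover have "open {z::complex. Re z \<noteq> 0}" by (intro open_Collect_neq continuous_intros)
  ultimately show ?thesis using open_halfspace_Im_gt open_halfspace_Im_lt by (simp add: open_Int open_Un)
qed

text \<open>The centre is the midpoint of the gap between the slits, from which every point is
  visible. Starlikeness supplies a primitive of the integrand.\<close>

lemma starlike_slitplane: "starlike (slitplane k)"
proof (rule convex_plus_segment_starlike[where a = "Complex 0 ((1 + k) / 2)"])
  show "Complex 0 ((1 + k) / 2) \<in> slitplane k" using k by (simp add: slitplane_def)
  fix z u assume z: "z \<in> slitplane k" and u: "0 < u" "u < (1::real)"
  have "0 < (1 - u) * ((1 + k) / 2) + u * Im z" using z u k by (intro add_pos_pos mult_pos_pos) (auto simp: slitplane_def)
  moreover have "k < (1 - u) * ((1 + k) / 2) + u * Im z \<and> (1 - u) * ((1 + k) / 2) + u * Im z < 1" if "Re z = 0"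
  proof -
    have zz: "k < Im z" "Im z < 1" using z that by (auto simp: slitplane_def)
    have "(1 - u) * k + u * k < (1 - u) * ((1 + k) / 2) + u * Im z"
      using u k zz by (intro add_strict_mono mult_strict_left_mono) auto
    moreover have "(1 - u) * ((1 + k) / 2) + u * Im z < (1 - u) * 1 + u * 1"
      using u k zz by (intro add_strict_mono mult_strict_left_mono) auto
    ultimately show ?thesis by (simp add: algebra_simps)
  qed
  ultimately show "(1 - u) *\<^sub>R Complex 0 ((1 + k) / 2) + u *\<^sub>R z \<in> slitplane k"
    using u by (auto simp: slitplane_def)
qed

lemma slitplane_csqrt_args:
  assumes "z \<in> slitplane k"
  shows "1 + z\<^sup>2 \<notin> \<real>\<^sub>\<le>\<^sub>0" "- (z\<^sup>2) - (of_real k)\<^sup>2 \<notin> \<real>\<^sub>\<le>\<^sub>0"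
proof -
  have z: "0 < Im z" "Re z = 0 \<Longrightarrow> k < Im z \<and> Im z < 1" using assms by (auto simp: slitplane_def)
  have a: "Re z = 0 \<Longrightarrow> (Im z)\<^sup>2 < 1" "Re z = 0 \<Longrightarrow> k\<^sup>2 < (Im z)\<^sup>2"
    using z k by (auto simp: power_less_one_iff intro: power_strict_mono)
  show "1 + z\<^sup>2 \<notin> \<real>\<^sub>\<le>\<^sub>0" using z a by (auto simp: complex_nonpos_Reals_iff Im_sq Re_sq)
  show "- (z\<^sup>2) - (of_real k)\<^sup>2 \<notin> \<real>\<^sub>\<le>\<^sub>0" using z a by (auto simp: complex_nonpos_Reals_iff Im_sq Re_sq)
qed

lemma sc_dens_holomorphic: "sc_dens k holomorphic_on slitplane k"
  unfolding sc_dens_def[abs_def]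
  using slitplane_csqrt_args by (intro holomorphic_intros) (metis csqrt_eq_0 mult_eq_0_iff complex_nonpos_Reals_iff order_refl zero_complex.simps)+

lemma cmod_sc_dens: "cmod (sc_dens k z) = sc_norm k z"
proof -
  have "cmod (- (z\<^sup>2) - (of_real k)\<^sup>2) = cmod (z\<^sup>2 + (of_real k)\<^sup>2)" by (metis minus_diff_eq norm_minus_cancel diff_minus_eq_add minus_minus add_uminus_conv_diff minus_add_distrib)
  then show ?thesis by (simp add: sc_dens_def sc_norm_def norm_divide norm_mult real_sqrt_mult)
qed

text \<open>The two roots have positive real parts, and their imaginary parts have opposite signs or
  vanish, because their radicands have opposite imaginary parts. So the product has positive real
  part. This positivity is the source of injectivity of the primitive.\<close>

lemma Re_sc_dens_pos:
  assumes "z \<in> slitplane k"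
  shows "0 < Re (sc_dens k z)"
proof -
  define p where "p = csqrt (1 + z\<^sup>2)"
  define q where "q = csqrt (- (z\<^sup>2) - (of_real k)\<^sup>2)"
  have r: "0 < Re p" "0 < Re q" using slitplane_csqrt_args[OF assms] unfolding p_def q_def by (blast intro: Re_csqrt_pos)+
  have "Im p * Im q \<le> 0"
  proof -
    consider "0 < Re z" | "Re z < 0" | "Re z = 0" by linarith
    then show ?thesis
    proof cases
      case 1
      then have "0 < Im (z\<^sup>2)" using assms by (auto simp: slitplane_def Im_sq)
      then have "0 < Im p" "Im q < 0" unfolding p_def q_def by (intro Im_csqrt_sign; simp)+
      then show ?thesis by (simp add: mult_le_0_iff)
    next
      case 2
      then have "Im (z\<^sup>2) < 0" using assms by (auto simp: slitplane_def Im_sq mult_less_0_iff)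
      then have "Im p < 0" "0 < Im q" unfolding p_def q_def by (intro Im_csqrt_sign; simp)+
      then show ?thesis by (simp add: mult_le_0_iff)
    next
      case 3
      then have "Im (1 + z\<^sup>2) = 0" "0 \<le> Re (1 + z\<^sup>2)"
        using slitplane_csqrt_args(1)[OF assms] by (auto simp: Im_sq complex_nonpos_Reals_iff)
      then have "Im p = 0" unfolding p_def by (simp add: csqrt_of_real_nonneg)
      then show ?thesis by simp
    qed
  qed
  then have "0 < Re (p * q)" using r by (simp add: mult_pos_pos add_pos_nonneg) (smt (verit) mult_pos_pos)
  moreover have "sc_dens k z = 1 / (p * q)" by (simp add: sc_dens_def p_def q_def)
  moreover have "0 < (Re (p * q))\<^sup>2 + (Im (p * q))\<^sup>2" using \<open>0 < Re (p * q)\<close> by (simp add: add_pos_nonneg)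
  ultimately show ?thesis by (simp add: Re_divide del: times_complex.simps)
qed

lemma sc_dens_reflect:
  assumes "z \<in> slitplane k"
  shows "sc_dens k (- cnj z) = cnj (sc_dens k z)"
proof -
  have "(- cnj z)\<^sup>2 = cnj (z\<^sup>2)" by simp
  then have "1 + (- cnj z)\<^sup>2 = cnj (1 + z\<^sup>2)" "- ((- cnj z)\<^sup>2) - (of_real k)\<^sup>2 = cnj (- (z\<^sup>2) - (of_real k)\<^sup>2)" by simp_all
  then show ?thesis unfolding sc_dens_def using cnj_csqrt slitplane_csqrt_args[OF assms] by simp
qed

definition sc_const :: real where "sc_const = sqrt (2 / (k * (1 - k)))"

text \<open>The points \<open>\<i>\<close> and \<open>\<i> k\<close> have distance
  \<open>1 - k\<close>, so at least one of them is at distance \<open>(1 - k) / 2\<close> or more,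
  while both are at distance at least \<open>Re z\<close>. The factors \<open>z + \<i>\<close> and
  \<open>z + \<i> k\<close> are bounded below by 1 and \<open>k\<close>.\<close>

lemma sc_norm_bound:
  assumes "0 < Re z" "0 \<le> Im z"
  shows "sc_norm k z \<le> sc_const / sqrt (Re z)"
proof -
  let ?a = "cmod (z - \<i>)" and ?b = "cmod (z - \<i> * of_real k)"
  have e1: "1 + z\<^sup>2 = (z - \<i>) * (z + \<i>)" by (simp add: algebra_simps power2_eq_square)
  have e2: "z\<^sup>2 + (of_real k)\<^sup>2 = (z - \<i> * of_real k) * (z + \<i> * of_real k)"
    by (simp add: algebra_simps power2_eq_square)
  have n1: "1 \<le> cmod (z + \<i>)" using abs_Im_le_cmod[of "z + \<i>"] assms by simp
  have n2: "k \<le> cmod (z + \<i> * of_real k)" using abs_Im_le_cmod[of "z + \<i> * of_real k"] assms k by simp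
  have r: "Re z \<le> ?a" "Re z \<le> ?b" using complex_Re_le_cmod[of "z - \<i>"] complex_Re_le_cmod[of "z - \<i> * of_real k"] by auto
  have "1 - k \<le> ?a + ?b"
  proof -
    have "cmod ((z - \<i> * of_real k) - (z - \<i>)) \<le> ?b + ?a" by (rule norm_triangle_ineq4)
    moreover have "(z - \<i> * of_real k) - (z - \<i>) = \<i> * of_real (1 - k)" by (simp add: algebra_simps)
    moreover have "cmod (\<i> * of_real (1 - k)) = 1 - k" using k by (simp add: norm_mult del: of_real_diff)
    ultimately show ?thesis by (simp only: add.commute)
  qed
  then have "(1 - k) / 2 \<le> ?a \<or> (1 - k) / 2 \<le> ?b" by (cases "?a \<le> ?b") (auto simp: field_simps)
  then consider "(1 - k) / 2 \<le> ?a" | "(1 - k) / 2 \<le> ?b" by blast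
  then have ab: "(1 - k) / 2 * Re z \<le> ?a * ?b"
  proof cases
    case 1
    then show ?thesis using r assms k by (intro mult_mono) auto
  next
    case 2
    then have "Re z * ((1 - k) / 2) \<le> ?a * ?b" using r assms k by (intro mult_mono) auto
    then show ?thesis by (simp add: mult.commute)
  qed
  have "(1 - k) / 2 * Re z * k \<le> (?a * ?b) * (cmod (z + \<i>) * cmod (z + \<i> * of_real k))"
  proof (rule mult_mono[OF ab])
    show "k \<le> cmod (z + \<i>) * cmod (z + \<i> * of_real k)" using mult_mono[OF n1 n2] k by simp
  qed (use k in auto)
  then have "k * (1 - k) / 2 * Re z \<le> cmod ((1 + z\<^sup>2) * (z\<^sup>2 + (of_real k)\<^sup>2))"
    unfolding e1 e2 norm_mult by (simp add: mult_ac)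
  then have "sqrt (k * (1 - k) / 2 * Re z) \<le> sqrt (cmod ((1 + z\<^sup>2) * (z\<^sup>2 + (of_real k)\<^sup>2)))" by simp
  moreover have "0 < sqrt (k * (1 - k) / 2 * Re z)" using k assms by simp
  ultimately have "sc_norm k z \<le> 1 / sqrt (k * (1 - k) / 2 * Re z)"
    unfolding sc_norm_def by (simp add: frac_le)
  also have "\<dots> = sc_const / sqrt (Re z)"
    by (simp add: sc_const_def real_sqrt_mult real_sqrt_divide)
  finally show ?thesis .
qed

lemma sc_const_pos: "0 < sc_const"
  using k by (simp add: sc_const_def)

text \<open>The bound \<open>sc_const / sqrt (Re z)\<close> is integrable in the horizontal
  direction: moving right by \<open>e\<close> costs at most \<open>2 * sc_const * sqrt e\<close>.
  When both points are shifted by \<open>e\<close>, their own distance, the derivative is at most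
  \<open>sc_const / sqrt e\<close>, and the segment between them costs
  \<open>sc_const * sqrt e\<close>. Thus \<open>G\<close> is Hoelder continuous of order 1/2, as the
  square-root singularities suggest.\<close>

lemma sc_primitive_uniformly_continuous:
  assumes G: "\<And>z. z \<in> quad \<Longrightarrow> (G has_field_derivative G' z) (at z)"
    and nG: "\<And>z. z \<in> quad \<Longrightarrow> cmod (G' z) = sc_norm k z"
  shows "uniformly_continuous_on quad G"
proof -
  have hor: "cmod (G (z + of_real e) - G z) \<le> 2 * sc_const * sqrt e" if z: "z \<in> quad" and e: "0 < e" for z e
  proof -
    let ?g = "\<lambda>t::real. G (z + of_real t)" and ?\<phi> = "\<lambda>t. 2 * sc_const * sqrt (Re z + t)"
    have zt: "z + of_real t \<in> quad" if "0 \<le> t" for t using z that by (auto simp: quad_def)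
    have d: "(?g has_vector_derivative G' (z + of_real t)) (at t)" if "0 \<le> t" for t
    proof -
      have "((\<lambda>t. z + of_real t) has_vector_derivative 1) (at t)"
        by (auto intro!: derivative_eq_intros has_vector_derivative_of_real simp: )
      from field_vector_diff_chain_at[OF this G[OF zt[OF that]]] show ?thesis by (simp add: o_def)
    qed
    have rz: "0 < Re z" using z by (simp add: quad_def)
    have d2: "(?\<phi> has_vector_derivative sc_const / sqrt (Re z + t)) (at t)" if "0 \<le> t" for t
      unfolding has_real_derivative_iff_has_vector_derivative[symmetric]
      using rz that by (auto intro!: derivative_eq_intros simp: field_simps)
    have "norm (?g e - ?g 0) \<le> ?\<phi> e - ?\<phi> 0"
    proof (rule differentiable_bound_general[OF e])
      show "continuous_on {0..e} ?g"
        using d by (intro continuous_at_imp_continuous_on ballI has_vector_derivative_continuous) auto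
      show "continuous_on {0..e} ?\<phi>" by (intro continuous_intros)
      fix t assume t: "0 < t" "t < e"
      show "(?g has_vector_derivative G' (z + of_real t)) (at t)" using d t by simp
      show "(?\<phi> has_vector_derivative sc_const / sqrt (Re z + t)) (at t)" using d2 t by simp
      show "norm (G' (z + of_real t)) \<le> sc_const / sqrt (Re z + t)"
        using nG[OF zt[of t]] sc_norm_bound[of "z + of_real t"] zt[of t] t by (simp add: quad_def)
    qed
    also have "\<dots> = 2 * sc_const * (sqrt (Re z + e) - sqrt (Re z))" by (simp add: algebra_simps)
    also have "\<dots> \<le> 2 * sc_const * sqrt e"
      using sc_const_pos rz e sqrt_add_le_add_sqrt[of "Re z" e] by (intro mult_left_mono) auto
    finally show ?thesis by simp
  qed
  have main: "cmod (G z - G w) \<le> 5 * sc_const * sqrt (cmod (z - w))" if zw: "z \<in> quad" "w \<in> quad" for z w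
  proof (cases "z = w")
    case False
    define e where "e = cmod (z - w)"
    have e: "0 < e" using False by (simp add: e_def)
    have "cmod (G (z + of_real e) - G (w + of_real e)) \<le> sc_const / sqrt e * cmod ((z + of_real e) - (w + of_real e))"
    proof (rule field_differentiable_bound[of "{z. e \<le> Re z} \<inter> {z. 0 < Im z}" G G'])
      show "convex ({z. e \<le> Re z} \<inter> {z. 0 < Im z})"
        by (intro convex_Int convex_halfspace_Re_ge convex_halfspace_Im_gt)
      fix x assume x: "x \<in> {z. e \<le> Re z} \<inter> {z. 0 < Im z}"
      then have xq: "x \<in> quad" using e by (auto simp: quad_def)
      show "(G has_field_derivative G' x) (at x within {z. e \<le> Re z} \<inter> {z. 0 < Im z})"
        using G[OF xq] by (rule has_field_derivative_at_within)
      have "cmod (G' x) \<le> sc_const / sqrt (Re x)" using nG[OF xq] sc_norm_bound[of x] xq by (simp add: quad_def)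
      also have "\<dots> \<le> sc_const / sqrt e" using x e sc_const_pos by (intro divide_left_mono) auto
      finally show "cmod (G' x) \<le> sc_const / sqrt e" .
    qed (use zw e in \<open>auto simp: quad_def\<close>)
    also have "\<dots> = sc_const * sqrt e" using e real_div_sqrt[of e] by (simp add: e_def[symmetric] mult.assoc[symmetric] del: real_div_sqrt) (metis mult.commute times_divide_eq_right less_imp_le real_div_sqrt)
    finally have 1: "cmod (G (z + of_real e) - G (w + of_real e)) \<le> sc_const * sqrt e" .
    have "G z - G w = (G (z + of_real e) - G (w + of_real e)) - (G (z + of_real e) - G z) + (G (w + of_real e) - G w)" by simp
    also have "cmod \<dots> \<le> cmod (G (z + of_real e) - G (w + of_real e)) + cmod (G (z + of_real e) - G z) + cmod (G (w + of_real e) - G w)"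
      by (rule order_trans[OF norm_triangle_ineq add_right_mono[OF norm_triangle_ineq4]])
    also have "\<dots> \<le> 5 * sc_const * sqrt e" using 1 hor[OF zw(1) e] hor[OF zw(2) e] by simp
    finally show ?thesis by (simp add: e_def)
  qed simp
  show ?thesis unfolding uniformly_continuous_on_def
  proof (intro allI impI)
    fix \<epsilon> :: real assume eps: "0 < \<epsilon>"
    define d where "d = (\<epsilon> / (5 * sc_const))\<^sup>2"
    have d: "0 < d" using eps sc_const_pos by (simp add: d_def)
    have "dist (G w) (G z) < \<epsilon>" if "z \<in> quad" "w \<in> quad" "dist w z < d" for z w
    proof -
      have "sqrt (cmod (w - z)) < sqrt d" using that(3) by (simp add: dist_norm)
      also have "sqrt d = \<epsilon> / (5 * sc_const)" using eps sc_const_pos by (simp add: d_def)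
      finally have "5 * sc_const * sqrt (cmod (w - z)) < \<epsilon>" using sc_const_pos by (simp add: field_simps)
      then show ?thesis using main[OF that(2,1)] by (simp add: dist_norm)
    qed
    then show "\<exists>d>0. \<forall>z\<in>quad. \<forall>w\<in>quad. dist w z < d \<longrightarrow> dist (G w) (G z) < \<epsilon>" using d by blast
  qed
qed

text \<open>The factor \<open>- \<i>\<close> turns the picture so that the gap
  \<open>\<i> (k, 1)\<close>, the axis of symmetry, goes to the real line; the additive constant
  puts the image of \<open>\<i> k\<close> at the origin.\<close>

lemma sc_primitive_exists:
  obtains F Fh where "\<And>z. z \<in> slitplane k \<Longrightarrow> (F has_field_derivative - \<i> * sc_dens k z) (at z)"
    "continuous_on cquad Fh" "\<And>z. z \<in> quad \<Longrightarrow> Fh z = F z" "Fh (\<i> * of_real k) = 0"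
proof -
  have "(\<lambda>z. - \<i> * sc_dens k z) holomorphic_on slitplane k" by (intro holomorphic_intros sc_dens_holomorphic)
  then obtain G where G: "\<And>z. z \<in> slitplane k \<Longrightarrow> (G has_field_derivative - \<i> * sc_dens k z) (at z)"
    using holomorphic_starlike_primitive[OF _ starlike_slitplane open_slitplane finite.emptyI, of "\<lambda>z. - \<i> * sc_dens k z"]
      holomorphic_on_imp_continuous_on holomorphic_on_imp_differentiable_at[OF _ open_slitplane] by (metis Diff_empty)
  have "uniformly_continuous_on quad G"
    by (rule sc_primitive_uniformly_continuous[of G "\<lambda>z. - \<i> * sc_dens k z"])
      (use quad_subset_slitplane[of k] in \<open>auto intro!: G[simplified] simp: norm_mult cmod_sc_dens\<close>)
  then obtain Gh where Gh: "uniformly_continuous_on (closure quad) Gh" "\<And>z. z \<in> quad \<Longrightarrow> G z = Gh z"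
    by (rule uniformly_continuous_on_extension_on_closure) blast
  define c where "c = Gh (\<i> * of_real k)"
  show ?thesis
  proof (rule that[of "\<lambda>z. G z - c" "\<lambda>z. Gh z - c"])
    show "((\<lambda>z. G z - c) has_field_derivative - \<i> * sc_dens k z) (at z)" if "z \<in> slitplane k" for z
      using G[OF that] by (auto intro!: derivative_eq_intros)
    have "continuous_on cquad Gh"
      using uniformly_continuous_imp_continuous[OF Gh(1)] cquad_subset_closure by (rule continuous_on_subset)
    then show "continuous_on cquad (\<lambda>z. Gh z - c)" by (intro continuous_intros)
  qed (auto simp: Gh(2) c_def)
qed

end


section \<open>Boundary values on the edges of the quadrant\<close>

text \<open>\<open>F\<close> lives on the slit half plane, \<open>Fh\<close> on the closed right
  quadrant. The continuous extension is made from one quadrant only, because the boundary values of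
  \<open>F\<close> on the two sides of a slit are complex conjugates of each other.\<close>

locale slit_map =
  fixes k :: real and F Fh :: "complex \<Rightarrow> complex"
  assumes k1: "0 < k" and k2: "k < 1"
    and F_deriv: "\<And>z. z \<in> slitplane k \<Longrightarrow> (F has_field_derivative - \<i> * sc_dens k z) (at z)"
    and Fh_cont: "continuous_on cquad Fh"
    and Fh_eq: "\<And>z. z \<in> quad \<Longrightarrow> Fh z = F z"
    and Fh_ik: "Fh (\<i> * of_real k) = 0"
begin

lemma Fh_limit:
  assumes "z \<in> cquad"
  shows "(\<lambda>n. F (z + of_real (inverse (real (Suc n))) * (1 + \<i>))) \<longlonglongrightarrow> Fh z"
proof -
  let ?z = "\<lambda>n. z + of_real (inverse (real (Suc n))) * (1 + \<i>)"
  have q: "?z n \<in> quad" for n by (rule cquad_shift[OF assms]) simp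
  have "(\<lambda>n. Fh (?z n)) \<longlonglongrightarrow> Fh z"
    by (rule continuous_on_tendsto_compose[OF Fh_cont cquad_shift_tendsto assms])
      (rule always_eventually, use q quad_simps(5) in blast)
  then show ?thesis using Fh_eq[OF q] by simp
qed

text \<open>A primitive of \<open>h\<close> differs from \<open>F\<close> by a constant on the
  quadrant. With the constant removed, it agrees with \<open>Fh\<close> on the part of the boundary
  inside \<open>D\<close> by continuity, so \<open>Fh\<close> can be differentiated along that
  part.\<close>

lemma continuation:
  assumes D: "open D" "starlike D" "quad \<subseteq> D" and h: "h holomorphic_on D"
    and eq: "\<And>z. z \<in> quad \<Longrightarrow> h z = - \<i> * sc_dens k z"
  obtains FD where "\<And>z. z \<in> D \<Longrightarrow> (FD has_field_derivative h z) (at z)" "\<And>z. z \<in> D \<Longrightarrow> z \<in> cquad \<Longrightarrow> Fh z = FD z"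
proof -
  obtain G where G: "\<And>z. z \<in> D \<Longrightarrow> (G has_field_derivative h z) (at z)"
    using holomorphic_starlike_primitive[OF holomorphic_on_imp_continuous_on[OF h] D(2,1) finite.emptyI]
      holomorphic_on_imp_differentiable_at[OF h D(1)] by (metis Diff_empty)
  have dz: "((\<lambda>z. G z - F z) has_field_derivative 0) (at z within quad)" if z: "z \<in> quad" for z
  proof -
    have "((\<lambda>z. G z - F z) has_field_derivative (h z - (- \<i> * sc_dens k z))) (at z)"
      using z D(3) quad_subset_slitplane[of k] by (intro DERIV_diff G F_deriv) auto
    then show ?thesis using eq[OF z] by (simp add: has_field_derivative_at_within)
  qed
  have "\<exists>c. \<forall>z\<in>quad. G z - F z = c"
    by (rule has_field_derivative_zero_constant[OF quad_simps(2) dz])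
  then obtain c where c: "\<And>z. z \<in> quad \<Longrightarrow> G z - F z = c" by (elim exE) (rule, erule bspec)
  show ?thesis
  proof (rule that[of "\<lambda>z. G z - c"])
    show d: "((\<lambda>z. G z - c) has_field_derivative h z) (at z)" if "z \<in> D" for z
      using G[OF that] by (auto intro!: derivative_eq_intros)
    fix z assume z: "z \<in> D" "z \<in> cquad"
    let ?z = "\<lambda>n. z + of_real (inverse (real (Suc n))) * (1 + \<i>)"
    have q: "?z n \<in> quad" for n by (rule cquad_shift[OF z(2)]) simp
    have "isCont (\<lambda>z. G z - c) z" using d[OF z(1)] by (rule DERIV_isCont)
    then have "(\<lambda>n. G (?z n) - c) \<longlonglongrightarrow> G z - c" using cquad_shift_tendsto by (rule isCont_tendsto_compose)
    moreover have "G (?z n) - c = F (?z n)" for n using c[OF q] by (simp add: algebra_simps)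
    ultimately have "(\<lambda>n. F (?z n)) \<longlonglongrightarrow> G z - c" by (simp only:)
    then show "Fh z = G z - c" using Fh_limit[OF z(2)] LIMSEQ_unique by blast
  qed
qed

lemma csqrt_minus: "0 < Im w \<Longrightarrow> csqrt (- w) = - \<i> * csqrt w"
proof -
  assume w: "0 < Im w"
  have "(- \<i> * csqrt w)\<^sup>2 = - w" by (simp add: power_mult_distrib)
  moreover have "0 < Re (- \<i> * csqrt w)" using Im_csqrt_sign(1)[OF w] by (simp del: csqrt.simps)
  ultimately show "csqrt (- w) = - \<i> * csqrt w" by (intro csqrt_unique) auto
qed

lemma quad_Im_sq: "z \<in> quad \<Longrightarrow> 0 < Im (z\<^sup>2)"
  by (simp add: quad_def Im_sq)

text \<open>On the quadrant, \<open>h0\<close> and \<open>h1\<close> agree with \<open>- \<i> * sc_dens k\<close>, but they extend across the other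
  boundary pieces: the real axis and \<open>\<i> (0, k)\<close>, respectively \<open>\<i> (1, \<infinity>)\<close>.\<close>

definition dom0 where "dom0 = {z. Re z = 0 \<longrightarrow> - k < Im z \<and> Im z < k}"
definition h0 where "h0 z = 1 / (csqrt (1 + z\<^sup>2) * csqrt (z\<^sup>2 + (of_real k)\<^sup>2))"
definition dom1 where "dom1 = {z. 0 < Im z \<and> (Re z = 0 \<longrightarrow> 1 < Im z)}"
definition h1 where "h1 z = - 1 / (csqrt (- 1 - z\<^sup>2) * csqrt (- (z\<^sup>2) - (of_real k)\<^sup>2))"

lemma dom0_piece: "open dom0" "starlike dom0" "quad \<subseteq> dom0" "h0 holomorphic_on dom0"
  "\<And>z. z \<in> quad \<Longrightarrow> h0 z = - \<i> * sc_dens k z"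
proof -
  have "dom0 = {z. Re z \<noteq> 0} \<union> ({z. - k < Im z} \<inter> {z. Im z < k})" by (auto simp: dom0_def)
  moreover have "open {z::complex. Re z \<noteq> 0}" by (intro open_Collect_neq continuous_intros)
  ultimately show "open dom0" using open_halfspace_Im_gt open_halfspace_Im_lt by (simp add: open_Int open_Un)
  show "starlike dom0"
  proof (rule convex_plus_segment_starlike[where a = 0])
    fix z u assume "z \<in> dom0" and u: "0 < u" "u < (1::real)"
    moreover have "- k < u * y \<and> u * y < k" if "- k < y" "y < k" for y
    proof -
      have "\<bar>u * y\<bar> \<le> \<bar>y\<bar>" using u by (simp add: abs_mult mult_left_le_one_le)
      then show ?thesis using that by linarith
    qed
    ultimately show "(1 - u) *\<^sub>R 0 + u *\<^sub>R z \<in> dom0" by (auto simp: dom0_def)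
  qed (use k1 in \<open>auto simp: dom0_def\<close>)
  show "quad \<subseteq> dom0" by (auto simp: quad_def dom0_def)
  have args: "1 + z\<^sup>2 \<notin> \<real>\<^sub>\<le>\<^sub>0" "z\<^sup>2 + (of_real k)\<^sup>2 \<notin> \<real>\<^sub>\<le>\<^sub>0" if "z \<in> dom0" for z
  proof -
    have a: "(Im z)\<^sup>2 < k\<^sup>2" if "Re z = 0"
    proof -
      have "\<bar>Im z\<bar> < k" using \<open>z \<in> dom0\<close> that by (auto simp: dom0_def)
      then have "\<bar>Im z\<bar>\<^sup>2 < k\<^sup>2" by (intro power_strict_mono) auto
      then show ?thesis by simp
    qed
    have "k\<^sup>2 < 1" using k1 k2 by (simp add: power_less_one_iff)
    then show "1 + z\<^sup>2 \<notin> \<real>\<^sub>\<le>\<^sub>0" "z\<^sup>2 + (of_real k)\<^sup>2 \<notin> \<real>\<^sub>\<le>\<^sub>0"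
      using a k1 by (auto simp: complex_nonpos_Reals_iff Im_sq Re_sq not_le add_pos_nonneg intro: add_nonneg_pos)
  qed
  then show "h0 holomorphic_on dom0" unfolding h0_def[abs_def]
    by (intro holomorphic_intros) (metis csqrt_eq_0 mult_eq_0_iff complex_nonpos_Reals_iff order_refl zero_complex.simps)+
  show "h0 z = - \<i> * sc_dens k z" if "z \<in> quad" for z
  proof -
    have "csqrt (- (z\<^sup>2 + (of_real k)\<^sup>2)) = - \<i> * csqrt (z\<^sup>2 + (of_real k)\<^sup>2)"
      using quad_Im_sq[OF that] by (intro csqrt_minus) simp
    then have e: "csqrt (- (z\<^sup>2) - (of_real k)\<^sup>2) = - \<i> * csqrt (z\<^sup>2 + (of_real k)\<^sup>2)" by simp
    show ?thesis unfolding h0_def sc_dens_def e by simp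
  qed
qed

lemma dom1_piece: "open dom1" "starlike dom1" "quad \<subseteq> dom1" "h1 holomorphic_on dom1"
  "\<And>z. z \<in> quad \<Longrightarrow> h1 z = - \<i> * sc_dens k z"
proof -
  have e: "dom1 = {z. 0 < Im z} \<inter> ({z. Re z \<noteq> 0} \<union> {z. 1 < Im z})" by (auto simp: dom1_def)
  show "open dom1" unfolding e
    by (intro open_Int open_Un open_Collect_neq open_Collect_less continuous_intros)
  show "starlike dom1"
  proof (rule convex_plus_segment_starlike[where a = "Complex 0 2"])
    fix z u assume z: "z \<in> dom1" and u: "0 < u" "u < (1::real)"
    have "0 < (1 - u) * 2 + u * Im z" using z u by (intro add_pos_pos mult_pos_pos) (auto simp: dom1_def)
    moreover have "1 < (1 - u) * 2 + u * Im z" if "1 < Im z"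
    proof -
      have "(1 - u) * 1 + u * 1 < (1 - u) * 2 + u * Im z"
        using u that by (intro add_strict_mono mult_strict_left_mono) auto
      then show ?thesis by simp
    qed
    ultimately show "(1 - u) *\<^sub>R Complex 0 2 + u *\<^sub>R z \<in> dom1" using z u by (auto simp: dom1_def)
  qed (auto simp: dom1_def)
  show "quad \<subseteq> dom1" by (auto simp: quad_def dom1_def)
  have args: "- 1 - z\<^sup>2 \<notin> \<real>\<^sub>\<le>\<^sub>0" "- (z\<^sup>2) - (of_real k)\<^sup>2 \<notin> \<real>\<^sub>\<le>\<^sub>0" if "z \<in> dom1" for z
  proof -
    have a: "1 < (Im z)\<^sup>2" if "Re z = 0" using \<open>z \<in> dom1\<close> that by (simp add: dom1_def one_less_power)
    have "k\<^sup>2 < 1" using k1 k2 by (simp add: power_less_one_iff)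
    have pos: "0 < Im z" using \<open>z \<in> dom1\<close> by (simp add: dom1_def)
    show "- 1 - z\<^sup>2 \<notin> \<real>\<^sub>\<le>\<^sub>0"
    proof
      assume "- 1 - z\<^sup>2 \<in> \<real>\<^sub>\<le>\<^sub>0"
      then have "Re (- 1 - z\<^sup>2) \<le> 0" "Im (- 1 - z\<^sup>2) = 0" by (simp_all only: complex_nonpos_Reals_iff)
      then have "- 1 - ((Re z)\<^sup>2 - (Im z)\<^sup>2) \<le> 0" "Re z = 0" using pos by (simp_all add: Im_sq Re_sq)
      then have "(Im z)\<^sup>2 \<le> 1" by simp
      with a[OF \<open>Re z = 0\<close>] show False by linarith
    qed
    show "- (z\<^sup>2) - (of_real k)\<^sup>2 \<notin> \<real>\<^sub>\<le>\<^sub>0"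
    proof
      assume "- (z\<^sup>2) - (of_real k)\<^sup>2 \<in> \<real>\<^sub>\<le>\<^sub>0"
      then have "Re (- (z\<^sup>2) - (of_real k)\<^sup>2) \<le> 0" "Im (- (z\<^sup>2) - (of_real k)\<^sup>2) = 0"
        by (simp_all only: complex_nonpos_Reals_iff)
      then have "- ((Re z)\<^sup>2 - (Im z)\<^sup>2) - k\<^sup>2 \<le> 0" "Re z = 0" using pos by (simp_all add: Im_sq Re_sq)
      then have "(Im z)\<^sup>2 \<le> k\<^sup>2" by simp
      with a[OF \<open>Re z = 0\<close>] \<open>k\<^sup>2 < 1\<close> show False by linarith
    qed
  qed
  then show "h1 holomorphic_on dom1" unfolding h1_def[abs_def]
    by (intro holomorphic_intros) (metis csqrt_eq_0 mult_eq_0_iff complex_nonpos_Reals_iff order_refl zero_complex.simps)+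
  show "h1 z = - \<i> * sc_dens k z" if "z \<in> quad" for z
  proof -
    have "csqrt (- (1 + z\<^sup>2)) = - \<i> * csqrt (1 + z\<^sup>2)"
      using quad_Im_sq[OF that] by (intro csqrt_minus) simp
    then have e: "csqrt (- 1 - z\<^sup>2) = - \<i> * csqrt (1 + z\<^sup>2)" by simp
    show ?thesis unfolding h1_def sc_dens_def e by (simp add: divide_simps)
  qed
qed

text \<open>The curve runs in the closed quadrant and through \<open>D\<close>, where
  \<open>Fh\<close> agrees with a holomorphic primitive of \<open>h\<close>; the chain rule for that
  primitive gives a two-sided derivative along the edge.\<close>

lemma Fh_edge_deriv:
  assumes D: "open D" "starlike D" "quad \<subseteq> D" "h holomorphic_on D" "\<And>z. z \<in> quad \<Longrightarrow> h z = - \<i> * sc_dens k z"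
    and t: "\<gamma> t \<in> D" and cq: "\<And>s. s \<in> S \<Longrightarrow> \<gamma> s \<in> cquad" and S: "open S" "t \<in> S"
    and \<gamma>: "(\<gamma> has_vector_derivative d) (at t)"
  shows "((\<lambda>s. Fh (\<gamma> s)) has_vector_derivative d * h (\<gamma> t)) (at t)"
proof -
  obtain FD where FD: "\<And>z. z \<in> D \<Longrightarrow> (FD has_field_derivative h z) (at z)" "\<And>z. z \<in> D \<Longrightarrow> z \<in> cquad \<Longrightarrow> Fh z = FD z"
    using continuation[OF D] by blast
  have 1: "((FD \<circ> \<gamma>) has_vector_derivative d * h (\<gamma> t)) (at t)"
    by (rule field_vector_diff_chain_at[OF \<gamma> FD(1)[OF t]])
  have "isCont \<gamma> t" using \<gamma> by (rule has_vector_derivative_continuous)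
  then obtain U where U: "open U" "t \<in> U" "\<And>s. s \<in> U \<Longrightarrow> \<gamma> s \<in> D"
  proof -
    assume that: "\<And>U. open U \<Longrightarrow> t \<in> U \<Longrightarrow> (\<And>s. s \<in> U \<Longrightarrow> \<gamma> s \<in> D) \<Longrightarrow> thesis"
    assume "isCont \<gamma> t"
    then have "\<exists>U. open U \<and> t \<in> U \<and> (\<forall>s\<in>U. \<gamma> s \<in> D)"
      unfolding continuous_at_open using D(1) t by simp
    then show thesis using that by (elim exE conjE) simp
  qed
  show ?thesis
    by (rule has_vector_derivative_transform_within_open[OF 1, of "S \<inter> U"])
      (use S U cq FD(2) in \<open>auto intro: open_Int\<close>)
qed

lemma Fh_real_deriv:
  assumes "0 < x"
  shows "((\<lambda>x. Fh (of_real x)) has_vector_derivative of_real (agmf 1 k x)) (at x)"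
proof -
  have "((\<lambda>x. Fh (of_real x)) has_vector_derivative 1 * h0 (of_real x)) (at x)"
    by (rule Fh_edge_deriv[OF dom0_piece, where S = "{0<..}"])
      (use assms in \<open>auto simp: dom0_def cquad_def intro!: derivative_eq_intros has_vector_derivative_of_real\<close>)
  moreover have "h0 (of_real x) = of_real (agmf 1 k x)"
  proof -
    have "1 + (complex_of_real x)\<^sup>2 = of_real (x\<^sup>2 + 1)" "(complex_of_real x)\<^sup>2 + (of_real k)\<^sup>2 = of_real (x\<^sup>2 + k\<^sup>2)" by simp_all
    then show ?thesis unfolding h0_def agmf_def
      by (simp add: csqrt_of_real_nonneg real_sqrt_mult del: of_real_add of_real_power)
  qed
  ultimately show ?thesis by simp
qed

text \<open>The modulus of the integrand on the imaginary axis. As \<open>y\<close> grows, the image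
  point moves up for \<open>y < k\<close>, to the right for \<open>k < y < 1\<close>, and down for
  \<open>1 < y\<close>, with this speed.\<close>

definition edge_dens where "edge_dens y = 1 / sqrt (\<bar>1 - y\<^sup>2\<bar> * \<bar>k\<^sup>2 - y\<^sup>2\<bar>)"

lemma edge_dens_pos: "0 < y \<Longrightarrow> y \<noteq> k \<Longrightarrow> y \<noteq> 1 \<Longrightarrow> 0 < edge_dens y"
  unfolding edge_dens_def using k1
  by (intro divide_pos_pos real_sqrt_gt_zero mult_pos_pos) (auto simp: power2_eq_iff power2_eq_1_iff)

lemma imag_line_deriv: "((\<lambda>y. \<i> * of_real y) has_vector_derivative \<i>) (at y)"
proof -
  have "((\<lambda>y. \<i> * of_real y) has_vector_derivative \<i> * 1) (at y)"
    by (intro has_vector_derivative_mult_right has_vector_derivative_of_real) (auto intro!: derivative_eq_intros)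
  then show ?thesis by simp
qed

lemma Fh_imag_deriv0:
  assumes "0 < y" "y < k"
  shows "((\<lambda>y. Fh (\<i> * of_real y)) has_vector_derivative \<i> * of_real (edge_dens y)) (at y)"
proof -
  have "((\<lambda>y. Fh (\<i> * of_real y)) has_vector_derivative \<i> * h0 (\<i> * of_real y)) (at y)"
    by (rule Fh_edge_deriv[OF dom0_piece, where S = "{0<..}"])
      (use assms imag_line_deriv in \<open>auto simp: dom0_def cquad_def\<close>)
  moreover have "h0 (\<i> * of_real y) = of_real (edge_dens y)"
  proof -
    have "y\<^sup>2 < k\<^sup>2" "k\<^sup>2 < 1" using assms k1 k2 by (auto intro: power_strict_mono simp: power_less_one_iff)
    then have le: "0 \<le> 1 - y\<^sup>2" "0 \<le> k\<^sup>2 - y\<^sup>2" by linarith+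
    have "1 + (\<i> * complex_of_real y)\<^sup>2 = of_real (1 - y\<^sup>2)" "(\<i> * complex_of_real y)\<^sup>2 + (of_real k)\<^sup>2 = of_real (k\<^sup>2 - y\<^sup>2)"
      by (simp_all add: power_mult_distrib)
    then show ?thesis unfolding h0_def edge_dens_def using le
      by (simp add: csqrt_of_real_nonneg real_sqrt_mult del: of_real_diff of_real_power)
  qed
  ultimately show ?thesis by simp
qed

lemma Fh_imag_deriv1:
  assumes "k < y" "y < 1"
  shows "((\<lambda>y. Fh (\<i> * of_real y)) has_vector_derivative of_real (edge_dens y)) (at y)"
proof -
  have "((\<lambda>y. Fh (\<i> * of_real y)) has_vector_derivative \<i> * (- \<i> * sc_dens k (\<i> * of_real y))) (at y)"
    by (rule Fh_edge_deriv[OF open_slitplane[OF k1 k2] starlike_slitplane[OF k1 k2] quad_subset_slitplane, where S = "{0<..}"])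
      (use assms k1 imag_line_deriv sc_dens_holomorphic[OF k1 k2] in \<open>auto simp: slitplane_def cquad_def intro!: holomorphic_intros\<close>)
  moreover have "sc_dens k (\<i> * of_real y) = of_real (edge_dens y)"
  proof -
    have "y\<^sup>2 < 1" "k\<^sup>2 < y\<^sup>2" using assms k1 k2 by (auto intro: power_strict_mono simp: power_less_one_iff)
    then have le: "0 \<le> 1 - y\<^sup>2" "0 \<le> y\<^sup>2 - k\<^sup>2" "\<bar>k\<^sup>2 - y\<^sup>2\<bar> = y\<^sup>2 - k\<^sup>2" by linarith+
    have "1 + (\<i> * complex_of_real y)\<^sup>2 = of_real (1 - y\<^sup>2)" "- ((\<i> * complex_of_real y)\<^sup>2) - (of_real k)\<^sup>2 = of_real (y\<^sup>2 - k\<^sup>2)"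
      by (simp_all add: power_mult_distrib)
    then show ?thesis unfolding sc_dens_def edge_dens_def using le
      by (simp add: csqrt_of_real_nonneg real_sqrt_mult del: of_real_diff of_real_power)
  qed
  ultimately show ?thesis by simp
qed

lemma Fh_imag_deriv2:
  assumes "1 < y"
  shows "((\<lambda>y. Fh (\<i> * of_real y)) has_vector_derivative - \<i> * of_real (edge_dens y)) (at y)"
proof -
  have "((\<lambda>y. Fh (\<i> * of_real y)) has_vector_derivative \<i> * h1 (\<i> * of_real y)) (at y)"
    by (rule Fh_edge_deriv[OF dom1_piece, where S = "{0<..}"])
      (use assms imag_line_deriv in \<open>auto simp: dom1_def cquad_def\<close>)
  moreover have "h1 (\<i> * of_real y) = - of_real (edge_dens y)"
  proof -
    have "1 < y\<^sup>2" "k\<^sup>2 < 1" using assms k1 k2 by (auto simp: power_less_one_iff)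
    then have le: "0 \<le> y\<^sup>2 - 1" "0 \<le> y\<^sup>2 - k\<^sup>2" "\<bar>k\<^sup>2 - y\<^sup>2\<bar> = y\<^sup>2 - k\<^sup>2" "\<bar>1 - y\<^sup>2\<bar> = y\<^sup>2 - 1" by linarith+
    have "- 1 - (\<i> * complex_of_real y)\<^sup>2 = of_real (y\<^sup>2 - 1)" "- ((\<i> * complex_of_real y)\<^sup>2) - (of_real k)\<^sup>2 = of_real (y\<^sup>2 - k\<^sup>2)"
      by (simp_all add: power_mult_distrib)
    then show ?thesis unfolding h1_def edge_dens_def using le
      by (simp add: csqrt_of_real_nonneg real_sqrt_mult del: of_real_diff of_real_power)
  qed
  ultimately show ?thesis by simp
qed

lemma Fh_cont_real: "continuous_on {0..} (\<lambda>x. Fh (of_real x))"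
  by (intro continuous_on_compose2[OF Fh_cont] continuous_intros) (auto simp: cquad_def)

lemma Fh_cont_imag: "continuous_on {0..} (\<lambda>y. Fh (\<i> * of_real y))"
  by (intro continuous_on_compose2[OF Fh_cont] continuous_intros) (auto simp: cquad_def)

lemma has_vector_derivative_Re_Im:
  assumes "(f has_vector_derivative d) (at t)"
  shows "((\<lambda>t. Re (f t)) has_real_derivative Re d) (at t)" "((\<lambda>t. Im (f t)) has_real_derivative Im d) (at t)"
  unfolding has_real_derivative_iff_has_vector_derivative
  using assms by (auto intro: bounded_linear.has_vector_derivative bounded_linear_Re bounded_linear_Im)

text \<open>\<open>B\<close> is Legendre's complete integral for \<open>k\<close> and
  \<open>A\<close> the one for the complementary modulus, by \<open>ellK_eq_agmI\<close>. They turn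
  out to be the half height and the width of the image rectangle.\<close>

definition A where "A = agmI 1 k"
definition B where "B = ellK k"

lemma AB_pos: "0 < A" "0 < B"
proof -
  have p: "0 < agmI 1 b" if b: "0 < b" for b
  proof -
    have i: "agmf 1 b integrable_on {0<..}" using agmf_integrable[of 1 b] b by (simp add: absolutely_integrable_on_def)
    have i2: "agmf 1 b integrable_on {0..1}" using agmf_continuous[of 1 b] b by (intro integrable_continuous_real) auto
    have c: "continuous_on {0..1} (agmf 1 b)" using agmf_continuous[of 1 b] b by auto
    have "agmf 1 b 1 = integral {0..1} (\<lambda>x::real. agmf 1 b 1)" by simp
    also have "\<dots> \<le> integral {0..1} (agmf 1 b)"
    proof (rule integral_le[OF _ i2])
      fix x :: real assume x: "x \<in> {0..1}"
      then have "x\<^sup>2 \<le> 1" by (simp add: power_le_one)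
      then have "(x\<^sup>2 + 1\<^sup>2) * (x\<^sup>2 + b\<^sup>2) \<le> (1\<^sup>2 + 1\<^sup>2) * (1\<^sup>2 + b\<^sup>2)" by (intro mult_mono) auto
      then have "sqrt ((x\<^sup>2 + 1\<^sup>2) * (x\<^sup>2 + b\<^sup>2)) \<le> sqrt ((1\<^sup>2 + 1\<^sup>2) * (1\<^sup>2 + b\<^sup>2))" by (rule real_sqrt_le_mono)
      moreover have "0 < sqrt ((x\<^sup>2 + 1\<^sup>2) * (x\<^sup>2 + b\<^sup>2))"
        using b by (intro real_sqrt_gt_zero mult_pos_pos) (auto intro: add_nonneg_pos)
      ultimately show "agmf 1 b 1 \<le> agmf 1 b x" unfolding agmf_def by (intro divide_left_mono mult_pos_pos) auto
    qed auto
    finally have "0 < integral {0..1} (agmf 1 b)" using agmf_pos[of 1 b 1] b by simp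
    also have "integral {0..1} (agmf 1 b) = integral {0<..<1} (agmf 1 b)" by (simp add: integral_open_interval_real)
    also have "\<dots> \<le> agmI 1 b" unfolding agmI_def
      using agmf_pos[of 1 b] b i2 by (intro integral_subset_le i) (auto simp: integrable_on_open_interval_real intro: less_imp_le)
    finally show ?thesis .
  qed
  show "0 < A" unfolding A_def by (rule p[OF k1])
  have "k\<^sup>2 < 1" using k1 k2 by (simp add: power_less_one_iff)
  then show "0 < B" unfolding B_def ellK_eq_agmI(1)[OF k1 k2] by (intro p) simp
qed

text \<open>The edge \<open>\<i> (0, k)\<close> is mapped vertically upwards and ends at the origin;
  its length is the integral of \<open>edge_dens\<close>, which the substitution
  \<open>y = k * s\<close> turns into the integral defining \<open>ellK k\<close>.\<close>

lemma Fh_zero: "Fh 0 = - \<i> * of_real B"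
proof -
  have "((\<lambda>y. \<i> * of_real (edge_dens y)) has_integral (Fh (\<i> * of_real k) - Fh (\<i> * of_real 0))) {0..k}"
    using k1 continuous_on_subset[OF Fh_cont_imag, of "{0..k}"]
    by (intro fundamental_theorem_of_calculus_interior Fh_imag_deriv0) auto
  then have "((\<lambda>y. \<i> * of_real (edge_dens y)) has_integral - Fh 0) {0..k}" by (simp add: Fh_ik)
  from has_integral_linear[OF this bounded_linear_Im] has_integral_linear[OF this bounded_linear_Re]
  have 1: "(edge_dens has_integral - Im (Fh 0)) {0..k}" and "((\<lambda>_. 0) has_integral - Re (Fh 0)) {0..k}"
    by (simp_all add: o_def)
  then have re: "Re (Fh 0) = 0" using has_integral_unique[OF has_integral_0] by fastforce
  have n: "negligible {0, k}" by simp
  have "((\<lambda>s. 1 / sqrt ((1 - s\<^sup>2) * (1 - k\<^sup>2 * s\<^sup>2))) absolutely_integrable_on {0<..<1})" by (rule ellK_eq_agmI(2)[OF k1 k2])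
  have img: "(\<lambda>s. k * s) ` {0<..<1} = {0<..<k}"
    using k1 by (auto simp: image_iff intro!: bexI[of _ "_ / k"])
  have eq: "\<bar>k\<bar> *\<^sub>R edge_dens (k * s) = 1 / sqrt ((1 - s\<^sup>2) * (1 - k\<^sup>2 * s\<^sup>2))" if "s \<in> {0<..<1}" for s
  proof -
    have s1: "s\<^sup>2 < 1" using that by (simp add: power_less_one_iff)
    have "k\<^sup>2 * s\<^sup>2 \<le> 1 * s\<^sup>2" using k1 k2 by (intro mult_right_mono) (auto simp: power_le_one)
    then have e: "\<bar>1 - (k * s)\<^sup>2\<bar> = 1 - k\<^sup>2 * s\<^sup>2" using s1 by (simp add: power_mult_distrib)
    have "\<bar>k\<^sup>2 - (k * s)\<^sup>2\<bar> = k\<^sup>2 * (1 - s\<^sup>2)"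
    proof -
      have "k\<^sup>2 - (k * s)\<^sup>2 = k\<^sup>2 * (1 - s\<^sup>2)" by (simp add: power_mult_distrib algebra_simps)
      then show ?thesis using s1 by simp
    qed
    then have "edge_dens (k * s) = 1 / (k * sqrt ((1 - s\<^sup>2) * (1 - k\<^sup>2 * s\<^sup>2)))"
      unfolding edge_dens_def e using k1 by (simp add: real_sqrt_mult)
    then show ?thesis using k1 by simp
  qed
  have "integral {0<..<1} (\<lambda>s. 1 / sqrt ((1 - s\<^sup>2) * (1 - k\<^sup>2 * s\<^sup>2))) = B"
    unfolding B_def ellK_def by (simp add: integral_open_interval_real)
  then have "(\<lambda>s. \<bar>k\<bar> *\<^sub>R edge_dens (k * s)) absolutely_integrable_on {0<..<1} \<and> integral {0<..<1} (\<lambda>s. \<bar>k\<bar> *\<^sub>R edge_dens (k * s)) = B"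
  proof (intro conjI)
    show "(\<lambda>s. \<bar>k\<bar> *\<^sub>R edge_dens (k * s)) absolutely_integrable_on {0<..<1}"
      by (subst set_integrable_cong[OF refl refl eq]) (use ellK_eq_agmI(2)[OF k1 k2] in auto)
    assume "integral {0<..<1} (\<lambda>s. 1 / sqrt ((1 - s\<^sup>2) * (1 - k\<^sup>2 * s\<^sup>2))) = B"
    then show "integral {0<..<1} (\<lambda>s. \<bar>k\<bar> *\<^sub>R edge_dens (k * s)) = B"
      by (subst integral_cong[OF eq]) auto
  qed
  then have "integral {0<..<k} edge_dens = B"
    using has_absolute_integral_change_of_variables_real[of "{0<..<1}" "\<lambda>s. k * s" "\<lambda>s. k" edge_dens B] k1
    unfolding img by (auto simp: inj_on_def intro!: derivative_eq_intros)
  then have "integral {0..k} edge_dens = B" by (simp add: integral_open_interval_real)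
  then have "- Im (Fh 0) = B" using 1 by (simp add: integral_unique)
  then show ?thesis using re by (simp add: complex_eq_iff)
qed

lemma Fh_imag0:
  assumes "0 \<le> y" "y \<le> k"
  shows "Re (Fh (\<i> * of_real y)) = 0" "- B \<le> Im (Fh (\<i> * of_real y))" "Im (Fh (\<i> * of_real y)) \<le> 0"
proof -
  let ?r = "\<lambda>y. Re (Fh (\<i> * of_real y))" and ?i = "\<lambda>y. Im (Fh (\<i> * of_real y))"
  have c: "continuous_on {0..k} ?r" "continuous_on {0..k} ?i"
    by (intro continuous_intros continuous_on_subset[OF Fh_cont_imag]; auto)+
  have d: "DERIV ?r t :> 0" "DERIV ?i t :> edge_dens t" if "0 < t" "t < k" for t
    using has_vector_derivative_Re_Im[OF Fh_imag_deriv0[OF that]] by auto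
  have "?r y = ?r 0" if "0 < y" by (rule DERIV_isconst2[of 0 k]) (use that assms k1 c d in auto)
  moreover have "?r 0 = 0" by (simp add: Fh_zero)
  ultimately show "?r y = 0" using assms(1) by (metis less_eq_real_def)
  have m: "?i s \<le> ?i t" if "0 \<le> s" "s \<le> t" "t \<le> k" for s t
  proof (rule DERIV_nonneg_imp_increasing_open[OF that(2)])
    fix u assume u: "s < u" "u < t"
    then have "DERIV ?i u :> edge_dens u" "0 \<le> edge_dens u"
      using d(2)[of u] edge_dens_pos[of u] that k2 by auto
    then show "\<exists>y. DERIV ?i u :> y \<and> 0 \<le> y" by blast
  qed (use that in \<open>auto intro: continuous_on_subset[OF c(2)]\<close>)
  show "- B \<le> ?i y" "?i y \<le> 0" using m[of 0 y] m[of y k] assms Fh_zero Fh_ik by auto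
qed

lemma Fh_imag1:
  assumes "k \<le> y" "y \<le> 1"
  shows "Im (Fh (\<i> * of_real y)) = 0"
    and "\<And>s t. k \<le> s \<Longrightarrow> s < t \<Longrightarrow> t \<le> 1 \<Longrightarrow> Re (Fh (\<i> * of_real s)) < Re (Fh (\<i> * of_real t))"
proof -
  let ?r = "\<lambda>y. Re (Fh (\<i> * of_real y))" and ?i = "\<lambda>y. Im (Fh (\<i> * of_real y))"
  have c: "continuous_on {k..1} ?r" "continuous_on {k..1} ?i"
    using k1 by (intro continuous_intros continuous_on_subset[OF Fh_cont_imag]; auto)+
  have d: "DERIV ?i t :> 0" "DERIV ?r t :> edge_dens t" if "k < t" "t < 1" for t
    using has_vector_derivative_Re_Im[OF Fh_imag_deriv1[OF that]] by auto
  have "?i y = ?i k" if "k < y" by (rule DERIV_isconst2[of k 1]) (use that assms k2 c d in auto)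
  moreover have "?i k = 0" by (simp add: Fh_ik)
  ultimately show "?i y = 0" using assms(1) by (metis less_eq_real_def)
  show "?r s < ?r t" if "k \<le> s" "s < t" "t \<le> 1" for s t
  proof (rule DERIV_pos_imp_increasing_open[OF that(2)])
    fix u assume u: "s < u" "u < t"
    then have "DERIV ?r u :> edge_dens u" "0 < edge_dens u"
      using d(2)[of u] edge_dens_pos[of u] that k1 by auto
    then show "\<exists>y. DERIV ?r u :> y \<and> 0 < y" by blast
  qed (use that in \<open>auto intro: continuous_on_subset[OF c(1)]\<close>)
qed

lemma Fh_imag2:
  assumes "1 \<le> y"
  shows "Re (Fh (\<i> * of_real y)) = Re (Fh \<i>)"
    and "\<And>s t. 1 \<le> s \<Longrightarrow> s \<le> t \<Longrightarrow> Im (Fh (\<i> * of_real t)) \<le> Im (Fh (\<i> * of_real s))"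
proof -
  let ?r = "\<lambda>y. Re (Fh (\<i> * of_real y))" and ?i = "\<lambda>y. Im (Fh (\<i> * of_real y))"
  have c: "continuous_on {1..b} ?r" "continuous_on {1..b} ?i" for b
    by (intro continuous_intros continuous_on_subset[OF Fh_cont_imag]; auto)+
  have d: "DERIV ?r t :> 0" "DERIV ?i t :> - edge_dens t" if "1 < t" for t
    using has_vector_derivative_Re_Im[OF Fh_imag_deriv2[OF that]] by auto
  have "?r y = ?r 1" if "1 < y" by (rule DERIV_isconst2[of 1 y]) (use that assms c d in auto)
  moreover have "?r 1 = Re (Fh \<i>)" by simp
  ultimately show "?r y = Re (Fh \<i>)" using assms by (metis less_eq_real_def)
  show "?i t \<le> ?i s" if "1 \<le> s" "s \<le> t" for s t
  proof (rule DERIV_nonpos_imp_decreasing_open[OF that(2)])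
    fix u assume u: "s < u" "u < t"
    then have "DERIV ?i u :> - edge_dens u" "- edge_dens u \<le> 0"
      using d(2)[of u] edge_dens_pos[of u] that k2 by auto
    then show "\<exists>y. DERIV ?i u :> y \<and> y \<le> 0" by blast
  qed (use that in \<open>auto intro: continuous_on_subset[OF c(2)]\<close>)
qed

lemma Fh_real:
  assumes "0 \<le> x"
  shows "Fh (of_real x) = Complex (integral {0..x} (agmf 1 k)) (- B)"
proof -
  have "((\<lambda>x. complex_of_real (agmf 1 k x)) has_integral (Fh (of_real x) - Fh (of_real 0))) {0..x}"
    using assms continuous_on_subset[OF Fh_cont_real, of "{0..x}"]
    by (intro fundamental_theorem_of_calculus_interior Fh_real_deriv) auto
  from has_integral_linear[OF this bounded_linear_Im] has_integral_linear[OF this bounded_linear_Re]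
  have "((\<lambda>_. 0) has_integral Im (Fh (of_real x) - Fh 0)) {0..x}" "(agmf 1 k has_integral Re (Fh (of_real x) - Fh 0)) {0..x}"
    by (simp_all add: o_def)
  then have "Im (Fh (of_real x)) = - B" "Re (Fh (of_real x)) = integral {0..x} (agmf 1 k)"
    using has_integral_unique[OF has_integral_0] Fh_zero by (fastforce, simp add: integral_unique)
  then show ?thesis by (simp add: complex_eq_iff)
qed

lemma agmf_partial_integral:
  "0 \<le> x \<Longrightarrow> integral {0..x} (agmf 1 k) \<le> A" "0 \<le> x \<Longrightarrow> x \<le> y \<Longrightarrow> integral {0..x} (agmf 1 k) \<le> integral {0..y} (agmf 1 k)"
  "(\<lambda>n. integral {0..real n} (agmf 1 k)) \<longlonglongrightarrow> A" "0 \<le> x \<Longrightarrow> 0 \<le> integral {0..x} (agmf 1 k)"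
proof -
  have i: "agmf 1 k integrable_on {0<..}" using agmf_integrable[of 1 k] k1 by (simp add: absolutely_integrable_on_def)
  have i2: "agmf 1 k integrable_on {0..x}" for x using agmf_continuous[of 1 k] k1 by (intro integrable_continuous_real) auto
  have nn: "0 \<le> agmf 1 k x" for x using agmf_pos[of 1 k x] k1 by simp
  have e: "integral {0..x} (agmf 1 k) = integral {0<..<x} (agmf 1 k)" for x by (simp add: integral_open_interval_real)
  show "integral {0..x} (agmf 1 k) \<le> A" if "0 \<le> x"
    unfolding A_def agmI_def e using i2 nn by (intro integral_subset_le i) (auto simp: integrable_on_open_interval_real)
  show "integral {0..x} (agmf 1 k) \<le> integral {0..y} (agmf 1 k)" if "0 \<le> x" "x \<le> y"
    using i2 nn that by (intro integral_subset_le) auto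
  show "0 \<le> integral {0..x} (agmf 1 k)" if "0 \<le> x" using i2 nn by (intro integral_nonneg) auto
  let ?f = "\<lambda>n x. if x \<in> {0<..<real n} then agmf 1 k x else 0"
  have "(\<lambda>n. integral {0<..} (?f n)) \<longlonglongrightarrow> integral {0<..} (agmf 1 k)"
  proof (rule dominated_convergence(2)[OF _ i])
    show "?f n integrable_on {0<..}" for n
    proof -
      have "agmf 1 k integrable_on {0<..<real n}" using i2 by (simp add: integrable_on_open_interval_real)
      then show ?thesis by (subst integrable_restrict_Int) (auto simp: Int_absorb2 greaterThanLessThan_def)
    qed
    show "norm (?f n x) \<le> agmf 1 k x" for n x using nn[of x] by auto
    show "(\<lambda>n. ?f n x) \<longlonglongrightarrow> agmf 1 k x" if "x \<in> {0<..}" for x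
    proof (rule tendsto_eventually)
      obtain N where "x < real N" using reals_Archimedean2 by blast
      then show "\<forall>\<^sub>F n in sequentially. ?f n x = agmf 1 k x"
        using that by (auto simp: eventually_sequentially intro!: exI[of _ N])
    qed
  qed
  moreover have "integral {0<..} (?f n) = integral {0..real n} (agmf 1 k)" for n
    unfolding e by (subst integral_restrict_Int) (auto simp: Int_absorb2 intro!: arg_cong[where f = "\<lambda>S. integral S (agmf 1 k)"])
  ultimately show "(\<lambda>n. integral {0..real n} (agmf 1 k)) \<longlonglongrightarrow> A" by (simp add: A_def agmI_def)
qed


section \<open>Behaviour at infinity\<close>

lemma F_has_deriv_sc_norm:
  assumes "z \<in> slitplane k"
  shows "cmod (- \<i> * sc_dens k z) = sc_norm k z"
  using cmod_sc_dens[OF k1 k2, of z] by (simp add: norm_mult)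

lemma sc_norm_far:
  assumes "2 \<le> (cmod z)\<^sup>2"
  shows "sc_norm k z \<le> 2 / (cmod z)\<^sup>2"
proof -
  have k2': "k\<^sup>2 \<le> 1" using k1 k2 by (simp add: power_le_one)
  have "(cmod z)\<^sup>2 / 2 \<le> cmod (1 + z\<^sup>2)"
    using norm_diff_ineq[of "z\<^sup>2" 1] assms by (simp add: norm_power add.commute)
  moreover have "(cmod z)\<^sup>2 / 2 \<le> cmod (z\<^sup>2 + (of_real k)\<^sup>2)"
    using norm_diff_ineq[of "z\<^sup>2" "(of_real k)\<^sup>2"] assms k2' by (simp add: norm_power)
  ultimately have "((cmod z)\<^sup>2 / 2) * ((cmod z)\<^sup>2 / 2) \<le> cmod ((1 + z\<^sup>2) * (z\<^sup>2 + (of_real k)\<^sup>2))"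
    unfolding norm_mult by (intro mult_mono) auto
  then have "(cmod z)\<^sup>2 / 2 \<le> sqrt (cmod ((1 + z\<^sup>2) * (z\<^sup>2 + (of_real k)\<^sup>2)))"
    by (intro real_le_rsqrt) (simp add: power2_eq_square)
  then have "sc_norm k z \<le> 1 / ((cmod z)\<^sup>2 / 2)"
    unfolding sc_norm_def using assms by (intro divide_left_mono mult_pos_pos) auto
  then show ?thesis by simp
qed

text \<open>On the chord from \<open>z\<close> to the real point of equal modulus \<open>R\<close>
  one has \<open>Re w + Im w \<ge> R\<close>, hence \<open>(cmod w)^2 \<ge> R^2 / 2\<close>, and the
  integrand is at most \<open>4 / R^2\<close>. The chord has length at most \<open>2 * R\<close>.
  Since it ends on the real axis, the continuation to \<open>dom0\<close> is used.\<close>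

lemma Fh_chord_quad:
  assumes z: "z \<in> quad" "2 \<le> cmod z"
  shows "dist (Fh z) (Fh (of_real (cmod z))) \<le> 8 / cmod z"
proof -
  define R where "R = cmod z"
  have R: "2 \<le> R" using z by (simp add: R_def)
  obtain FD where FD: "\<And>z. z \<in> dom0 \<Longrightarrow> (FD has_field_derivative h0 z) (at z)" "\<And>z. z \<in> dom0 \<Longrightarrow> z \<in> cquad \<Longrightarrow> Fh z = FD z"
    using continuation[OF dom0_piece] by blast
  have sub: "Re w + Im w \<ge> R \<and> 0 < Re w \<and> 0 \<le> Im w" if "w \<in> closed_segment z (of_real R)" for w
  proof -
    obtain u where u: "0 \<le> u" "u \<le> 1" "w = (1 - u) *\<^sub>R z + u *\<^sub>R of_real R" using \<open>w \<in> _\<close> by (auto simp: in_segment)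
    have "R \<le> Re z + Im z" using cmod_le[of z] z by (simp add: R_def quad_def)
    then have "(1 - u) * R + u * R \<le> (1 - u) * (Re z + Im z) + u * R" using u by (intro add_right_mono mult_left_mono) auto
    moreover have "(1 - u) * (Re z + Im z) + u * R = Re w + Im w" unfolding u(3) by (simp add: distrib_left)
    moreover have "(1 - u) * R + u * R = R" by (simp add: left_diff_distrib)
    ultimately have 1: "R \<le> Re w + Im w" by simp
    have "0 < (1 - u) * Re z + u * R"
      using u z R by (cases "u = 1") (auto simp: quad_def intro!: add_pos_nonneg)
    moreover have "0 \<le> (1 - u) * Im z" using u z by (simp add: quad_def)
    ultimately show ?thesis using 1 u(3) by simp
  qed
  have big: "R\<^sup>2 / 2 \<le> (cmod w)\<^sup>2" if "w \<in> closed_segment z (of_real R)" for w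
  proof -
    have "R\<^sup>2 \<le> (Re w + Im w)\<^sup>2" using sub[OF that] R by (intro power_mono) auto
    also have "\<dots> \<le> 2 * (cmod w)\<^sup>2"
      using zero_le_power2[of "Re w - Im w"] by (simp add: cmod_power2 power2_sum power2_diff)
    finally show ?thesis by simp
  qed
  have nh: "cmod (h0 w) = sc_norm k w" for w
    by (simp add: h0_def sc_norm_def norm_divide norm_mult real_sqrt_mult)
  have "norm (FD z - FD (of_real R)) \<le> 4 / R\<^sup>2 * norm (z - of_real R)"
  proof (rule field_differentiable_bound[of "closed_segment z (of_real R)" FD h0])
    fix w assume w: "w \<in> closed_segment z (of_real R)"
    have "w \<in> dom0" using sub[OF w] by (auto simp: dom0_def)
    then show "(FD has_field_derivative h0 w) (at w within closed_segment z (of_real R))"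
      using FD(1) has_field_derivative_at_within by blast
    have "4 \<le> R\<^sup>2" using power_mono[OF R, of 2] by simp
    then have "2 \<le> (cmod w)\<^sup>2" using big[OF w] by simp
    then have "cmod (h0 w) \<le> 2 / (cmod w)\<^sup>2" unfolding nh by (rule sc_norm_far)
    also have "\<dots> \<le> 2 / (R\<^sup>2 / 2)" using big[OF w] R \<open>4 \<le> R\<^sup>2\<close> by (intro divide_left_mono mult_pos_pos) auto
    finally show "cmod (h0 w) \<le> 4 / R\<^sup>2" by simp
  qed auto
  also have "\<dots> \<le> 4 / R\<^sup>2 * (2 * R)"
    using norm_triangle_ineq4[of z "of_real R"] R by (intro mult_left_mono) (auto simp: R_def)
  also have "\<dots> = 8 / R" using R by (simp add: power2_eq_square)
  finally have "norm (FD z - FD (of_real R)) \<le> 8 / R" .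
  moreover have "Fh z = FD z" "Fh (of_real R) = FD (of_real R)"
    using z R by (auto intro!: FD(2) simp: dom0_def cquad_def quad_def)
  ultimately show ?thesis by (simp add: dist_norm R_def)
qed

lemma Fh_chord:
  assumes z: "z \<in> cquad" "2 < cmod z"
  shows "dist (Fh z) (Fh (of_real (cmod z))) \<le> 8 / cmod z"
proof (rule LIMSEQ_le)
  let ?z = "\<lambda>n. z + of_real (inverse (real (Suc n))) * (1 + \<i>)"
  have q: "?z n \<in> quad" for n by (rule cquad_shift[OF z(1)]) simp
  have l: "(\<lambda>n. cmod (?z n)) \<longlonglongrightarrow> cmod z" by (intro tendsto_norm cquad_shift_tendsto)
  have "(\<lambda>n. Fh (?z n)) \<longlonglongrightarrow> Fh z"
    by (rule continuous_on_tendsto_compose[OF Fh_cont cquad_shift_tendsto z(1)])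
      (rule always_eventually, use q quad_simps(5) in blast)
  moreover have "(\<lambda>n. Fh (of_real (cmod (?z n)))) \<longlonglongrightarrow> Fh (of_real (cmod z))"
    by (rule continuous_on_tendsto_compose[OF Fh_cont_real l]) auto
  ultimately show "(\<lambda>n. dist (Fh (?z n)) (Fh (of_real (cmod (?z n))))) \<longlonglongrightarrow> dist (Fh z) (Fh (of_real (cmod z)))"
    by (rule tendsto_dist)
  show "(\<lambda>n. 8 / cmod (?z n)) \<longlonglongrightarrow> 8 / cmod z" using z by (intro tendsto_divide tendsto_const l) auto
  have "eventually (\<lambda>n. 2 < cmod (?z n)) sequentially" using order_tendstoD(1)[OF l z(2)] .
  then obtain N where "\<And>n. n \<ge> N \<Longrightarrow> 2 < cmod (?z n)" by (auto simp: eventually_sequentially)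
  then show "\<exists>N. \<forall>n\<ge>N. dist (Fh (?z n)) (Fh (of_real (cmod (?z n)))) \<le> 8 / cmod (?z n)"
    using Fh_chord_quad[OF q] by (meson less_imp_le)
qed

text \<open>The chord estimate reduces every direction to the positive real axis, where
  \<open>Fh\<close> runs along the bottom edge to its right end. So infinity corresponds to a single
  corner of the rectangle.\<close>

lemma Fh_infinity:
  assumes e: "0 < e"
  obtains M where "0 < M" "\<And>z. z \<in> cquad \<Longrightarrow> M \<le> cmod z \<Longrightarrow> dist (Fh z) (Complex A (- B)) < e"
proof -
  obtain N where N: "\<And>n. n \<ge> N \<Longrightarrow> dist (integral {0..real n} (agmf 1 k)) A < e / 2"
    using agmf_partial_integral(3) e unfolding lim_sequentially by (metis half_gt_zero)
  \<comment> \<open>\<open>17 / e\<close> makes the chord error \<open>8 / R\<close> smaller than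
    \<open>e / 2\<close>, and 3 puts \<open>R\<close> in the range of the chord estimate.\<close>
  define M where "M = max (real N) (max 3 (17 / e))"
  show ?thesis
  proof (rule that[of M])
    show "0 < M" by (simp add: M_def)
    fix z assume z: "z \<in> cquad" "M \<le> cmod z"
    define R where "R = cmod z"
    have R: "real N \<le> R" "3 \<le> R" "17 / e \<le> R" using z by (auto simp: M_def R_def)
    have "dist (Fh z) (Fh (of_real R)) \<le> 8 / R" unfolding R_def using z R by (intro Fh_chord) (auto simp: R_def)
    also have "8 / R < e / 2"
    proof -
      have "17 \<le> R * e" using R(3) e by (simp add: field_simps)
      then have "16 < e * R" by (simp add: mult.commute)
      then show ?thesis using R by (simp add: field_simps)
    qed
    finally have 1: "dist (Fh z) (Fh (of_real R)) < e / 2" .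
    have "\<bar>integral {0..real N} (agmf 1 k) - A\<bar> < e / 2" using N[of N] by (simp only: dist_real_def order_refl)
    then have "A - e / 2 < integral {0..real N} (agmf 1 k)" by linarith
    also have "\<dots> \<le> integral {0..R} (agmf 1 k)" using R by (intro agmf_partial_integral(2)) auto
    finally have "\<bar>integral {0..R} (agmf 1 k) - A\<bar> < e / 2" using agmf_partial_integral(1)[of R] R e by (simp add: abs_less_iff)
    moreover have "dist (Fh (of_real R)) (Complex A (- B)) = \<bar>integral {0..R} (agmf 1 k) - A\<bar>"
      using Fh_real[of R] R by (simp add: dist_norm cmod_def)
    ultimately show "dist (Fh z) (Complex A (- B)) < e"
      using 1 dist_triangle[of "Fh z" "Complex A (- B)" "Fh (of_real R)"] by simp
  qed
qed

text \<open>\<open>Re (Fh z)\<close> is constant on \<open>\<i> [1, \<infinity>)\<close> and tends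
  to \<open>A\<close> at infinity. In this way the width of the upper edge is found without
  evaluating the elliptic integral between \<open>k\<close> and 1.\<close>

lemma Re_Fh_i: "Re (Fh \<i>) = A"
proof (rule ccontr)
  assume "Re (Fh \<i>) \<noteq> A"
  then obtain M where M: "0 < M" "\<And>z. z \<in> cquad \<Longrightarrow> M \<le> cmod z \<Longrightarrow> dist (Fh z) (Complex A (- B)) < \<bar>Re (Fh \<i>) - A\<bar>"
    using Fh_infinity[of "\<bar>Re (Fh \<i>) - A\<bar>"] by auto
  define y where "y = max 1 M"
  have "dist (Fh (\<i> * of_real y)) (Complex A (- B)) < \<bar>Re (Fh \<i>) - A\<bar>"
    by (rule M(2)) (auto simp: y_def cquad_def norm_mult)
  moreover have "\<bar>Re (Fh (\<i> * of_real y)) - A\<bar> \<le> dist (Fh (\<i> * of_real y)) (Complex A (- B))"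
    using abs_Re_le_cmod[of "Fh (\<i> * of_real y) - Complex A (- B)"] by (simp add: dist_norm)
  moreover have "Re (Fh (\<i> * of_real y)) = Re (Fh \<i>)" by (rule Fh_imag2(1)) (simp add: y_def)
  ultimately show False by simp
qed

lemma Fh_i: "Fh \<i> = of_real A"
  using Re_Fh_i Fh_imag1(1)[of 1] k2 by (simp add: complex_eq_iff)

lemma Im_Fh_imag2:
  assumes "1 \<le> y"
  shows "- B \<le> Im (Fh (\<i> * of_real y))" "Im (Fh (\<i> * of_real y)) \<le> 0"
proof -
  show "Im (Fh (\<i> * of_real y)) \<le> 0" using Fh_imag2(2)[of y 1 y] assms Fh_i by simp
  show "- B \<le> Im (Fh (\<i> * of_real y))"
  proof (rule ccontr)
    assume n: "\<not> - B \<le> Im (Fh (\<i> * of_real y))"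
    define e where "e = - B - Im (Fh (\<i> * of_real y))"
    have e: "0 < e" using n by (simp add: e_def)
    obtain M where M: "0 < M" "\<And>z. z \<in> cquad \<Longrightarrow> M \<le> cmod z \<Longrightarrow> dist (Fh z) (Complex A (- B)) < e"
      using Fh_infinity[OF e] by blast
    define t where "t = max y M"
    have "dist (Fh (\<i> * of_real t)) (Complex A (- B)) < e"
      using assms by (intro M(2)) (auto simp: t_def cquad_def norm_mult)
    moreover have "\<bar>Im (Fh (\<i> * of_real t)) + B\<bar> \<le> dist (Fh (\<i> * of_real t)) (Complex A (- B))"
      using abs_Im_le_cmod[of "Fh (\<i> * of_real t) - Complex A (- B)"] by (simp add: dist_norm)
    moreover have "Im (Fh (\<i> * of_real t)) \<le> Im (Fh (\<i> * of_real y))"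
      using Fh_imag2(2)[of y y t] assms by (simp add: t_def)
    ultimately show False by (simp add: e_def abs_le_iff)
  qed
qed

section \<open>The image of the quadrant\<close>

definition crect where "crect = {w. 0 \<le> Re w \<and> Re w \<le> A \<and> - B \<le> Im w \<and> Im w \<le> 0}"
definition irect where "irect = {w. 0 < Re w \<and> Re w < A \<and> - B < Im w \<and> Im w < 0}"

lemma crect_box: "crect = cbox (Complex 0 (- B)) (Complex A 0)" and irect_box: "irect = box (Complex 0 (- B)) (Complex A 0)"
  by (auto simp: crect_def irect_def in_cbox_complex_iff in_box_complex_iff)

lemma cquad_boundary_cases:
  assumes "z \<in> cquad" "z \<notin> quad"
  obtains x where "0 \<le> x" "z = of_real x" | y where "0 \<le> y" "z = \<i> * of_real y"
proof -
  have "Re z = 0 \<or> Im z = 0" using assms by (auto simp: cquad_def quad_def)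
  then show ?thesis
  proof
    assume "Re z = 0"
    then have "z = \<i> * of_real (Im z)" by (simp add: complex_eq_iff)
    then show ?thesis using that(2)[of "Im z"] assms by (simp add: cquad_def)
  next
    assume "Im z = 0"
    then have "z = of_real (Re z)" by (simp add: complex_eq_iff)
    then show ?thesis using that(1)[of "Re z"] assms by (simp add: cquad_def)
  qed
qed

lemma Fh_boundary:
  assumes "z \<in> cquad" "z \<notin> quad"
  shows "Fh z \<in> crect - irect"
  using assms
proof (cases rule: cquad_boundary_cases)
  case (1 x)
  then show ?thesis using Fh_real[of x] agmf_partial_integral(1,4)[of x] AB_pos by (simp add: crect_def irect_def)
next
  case (2 y)
  consider "y \<le> k" | "k \<le> y" "y \<le> 1" | "1 \<le> y" by linarith
  then show ?thesis
  proof cases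
    case 1
    then show ?thesis using Fh_imag0[of y] 2 AB_pos by (simp add: crect_def irect_def)
  next
    case a: 2
    have "Re (Fh (\<i> * of_real k)) \<le> Re (Fh (\<i> * of_real y))" "Re (Fh (\<i> * of_real y)) \<le> Re (Fh (\<i> * of_real 1))"
      using Fh_imag1(2)[OF a, of k y] Fh_imag1(2)[OF a, of y 1] a by (cases "y = k"; cases "y = 1"; force)+
    then show ?thesis using Fh_imag1(1)[OF a] 2 AB_pos Fh_ik Fh_i by (simp add: crect_def irect_def)
  next
    case 3
    then show ?thesis using Fh_imag2(1)[of y] Im_Fh_imag2[of y] Re_Fh_i 2 AB_pos by (simp add: crect_def irect_def)
  qed
qed

text \<open>Consider a convergent sequence of image points. If the preimages are bounded, a
  subsequence converges in the closed quadrant and \<open>Fh\<close> gives the limit; if not, the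
  limit is the corner that corresponds to infinity. Either way no new limit point lies in the open
  rectangle.\<close>

lemma F_quad_closure: "closure (F ` quad) \<subseteq> F ` quad \<union> (crect - irect)"
proof
  fix w assume "w \<in> closure (F ` quad)"
  then obtain s where s: "\<And>n. s n \<in> F ` quad" "s \<longlonglongrightarrow> w" unfolding closure_sequential by blast
  then have "\<forall>n. \<exists>z. z \<in> quad \<and> s n = F z" by blast
  then obtain z where z: "\<And>n. z n \<in> quad" "\<And>n. s n = F (z n)" by metis
  have sF: "s n = Fh (z n)" for n using z Fh_eq by simp
  show "w \<in> F ` quad \<union> (crect - irect)"
  proof (cases "\<exists>M. \<forall>n. cmod (z n) \<le> M")
    case True
    then have "bounded (range z)" by (auto simp: bounded_iff)
    then obtain l r where lr: "strict_mono r" "(z \<circ> r) \<longlonglongrightarrow> l"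
      using bounded_imp_convergent_subsequence by blast
    have "l \<in> cquad"
      using closed_sequentially[OF quad_simps(3), of "z \<circ> r" l] lr z(1) quad_simps(5) by auto
    then have "(\<lambda>n. Fh ((z \<circ> r) n)) \<longlonglongrightarrow> Fh l"
      by (intro continuous_on_tendsto_compose[OF Fh_cont lr(2)] always_eventually) (use z(1) quad_simps(5) in auto)
    moreover have "(\<lambda>n. Fh ((z \<circ> r) n)) \<longlonglongrightarrow> w" using LIMSEQ_subseq_LIMSEQ[OF s(2) lr(1)] sF by (simp add: o_def)
    ultimately have "w = Fh l" using LIMSEQ_unique by blast
    then show ?thesis using Fh_boundary[OF \<open>l \<in> cquad\<close>] Fh_eq by (cases "l \<in> quad") auto
  next
    case False
    have "w = Complex A (- B)"
    proof (rule ccontr)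
      assume "w \<noteq> Complex A (- B)"
      then have e: "0 < dist w (Complex A (- B)) / 2" by simp
      obtain M where M: "0 < M" "\<And>z. z \<in> cquad \<Longrightarrow> M \<le> cmod z \<Longrightarrow> dist (Fh z) (Complex A (- B)) < dist w (Complex A (- B)) / 2"
        using Fh_infinity[OF e] by blast
      obtain N where N: "\<And>n. n \<ge> N \<Longrightarrow> dist (s n) w < dist w (Complex A (- B)) / 2"
        using s(2) e unfolding lim_sequentially by blast
      have "\<exists>n\<ge>N. M \<le> cmod (z n)"
      proof (rule ccontr)
        assume a: "\<not> (\<exists>n\<ge>N. M \<le> cmod (z n))"
        have "cmod (z n) \<le> max M (Max ((\<lambda>n. cmod (z n)) ` {..N}))" for n
        proof (cases "n \<le> N")
          case True
          then have "cmod (z n) \<le> Max ((\<lambda>n. cmod (z n)) ` {..N})" by (intro Max_ge) auto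
          then show ?thesis by simp
        next
          case False
          then have "cmod (z n) < M" using a by (meson nat_le_linear not_le)
          then show ?thesis by simp
        qed
        then show False using False by blast
      qed
      then obtain n where n: "n \<ge> N" "M \<le> cmod (z n)" by blast
      have "z n \<in> cquad" using z(1) quad_simps(5) by blast
      then have "dist (s n) (Complex A (- B)) < dist w (Complex A (- B)) / 2" using M(2) n sF by simp
      then show False using N[OF n(1)] dist_triangle3[of w "Complex A (- B)" "s n"] by simp
    qed
    then show ?thesis using AB_pos by (simp add: crect_def irect_def)
  qed
qed

lemma F_holomorphic: "F holomorphic_on slitplane k"
  using F_deriv open_slitplane[OF k1 k2] by (auto simp: holomorphic_on_open)

text \<open>The Noshiro-Warschawski argument: the quadrant is convex, and along the segment from
  \<open>z\<close> to \<open>w\<close> the real part of \<open>\<i> * F / (w - z)\<close> has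
  derivative \<open>Re (sc_dens k)\<close>, which is positive. So it cannot return to its initial
  value.\<close>

lemma F_inj_quad: "inj_on F quad"
proof (rule inj_onI, rule ccontr)
  fix z w assume zw: "z \<in> quad" "w \<in> quad" "F z = F w" "z \<noteq> w"
  define c where "c = 1 / (w - z)"
  let ?p = "\<lambda>t::real. z + of_real t * (w - z)"
  have q: "?p t \<in> quad" if "0 \<le> t" "t \<le> 1" for t
  proof -
    have "?p t = (1 - t) *\<^sub>R z + t *\<^sub>R w" by (simp add: algebra_simps scaleR_conv_of_real)
    then show ?thesis using convexD[OF quad_simps(2) zw(1,2), of "1 - t" t] that by simp
  qed
  have "(\<lambda>t. Re (\<i> * c * F (?p t))) 0 < (\<lambda>t. Re (\<i> * c * F (?p t))) 1"
  proof (rule DERIV_pos_imp_increasing[of 0 1])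
    fix t :: real assume t: "0 \<le> t" "t \<le> 1"
    have s: "?p t \<in> slitplane k" using q[OF t] quad_subset_slitplane by blast
    have "(?p has_vector_derivative (w - z)) (at t)"
    proof -
      have "((\<lambda>t. z + t *\<^sub>R (w - z)) has_vector_derivative (w - z)) (at t)" by (auto intro!: derivative_eq_intros)
      then show ?thesis by (simp add: scaleR_conv_of_real)
    qed
    from field_vector_diff_chain_at[OF this F_deriv[OF s]]
    have "((\<lambda>t. F (?p t)) has_vector_derivative (w - z) * (- \<i> * sc_dens k (?p t))) (at t)" by (simp add: o_def)
    then have "((\<lambda>t. \<i> * c * F (?p t)) has_vector_derivative \<i> * c * ((w - z) * (- \<i> * sc_dens k (?p t)))) (at t)"
      by (rule has_vector_derivative_mult_right)
    moreover have "\<i> * c * ((w - z) * (- \<i> * sc_dens k (?p t))) = sc_dens k (?p t)"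
      using zw(4) by (simp add: c_def)
    ultimately have "((\<lambda>t. Re (\<i> * c * F (?p t))) has_real_derivative Re (sc_dens k (?p t))) (at t)"
      using has_vector_derivative_Re_Im(1) by metis
    then show "\<exists>y. ((\<lambda>t. Re (\<i> * c * F (?p t))) has_real_derivative y) (at t) \<and> 0 < y"
      using Re_sc_dens_pos[OF k1 k2 s] by blast
  qed simp
  then show False using zw(3) by simp
qed

text \<open>The image is open and bounded, and its frontier lies on the boundary of the rectangle.
  If it met the complement of the closed rectangle, which is connected, it would contain all of it,
  against boundedness. So it lies in the open rectangle, which is connected as well and contains no
  frontier point, hence is filled completely.\<close>

lemma F_image_quad: "F ` quad = irect"
proof -
  have connq: "connected quad" using quad_simps(2) by (rule convex_connected)
  have "\<not> F constant_on quad"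
  proof
    assume "F constant_on quad"
    moreover have "Complex 1 1 \<in> quad" "Complex 2 1 \<in> quad" by (auto simp: quad_def)
    moreover have "F (Complex 1 1) \<noteq> F (Complex 2 1)"
      using inj_onD[OF F_inj_quad, of "Complex 1 1" "Complex 2 1"] \<open>Complex 1 1 \<in> quad\<close> \<open>Complex 2 1 \<in> quad\<close> by auto
    ultimately show False unfolding constant_on_def by metis
  qed
  then have op: "open (F ` quad)"
    using F_holomorphic quad_subset_slitplane
    by (intro open_mapping_thm[OF _ quad_simps(1) connq quad_simps(1) order_refl]) (auto intro: holomorphic_on_subset)
  have fr: "frontier (F ` quad) \<subseteq> crect - irect"
    using F_quad_closure op by (auto simp: frontier_def interior_open)
  have bd: "bounded (F ` quad)"
  proof -
    obtain M where M: "0 < M" "\<And>z. z \<in> cquad \<Longrightarrow> M \<le> cmod z \<Longrightarrow> dist (Fh z) (Complex A (- B)) < 1"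
      using Fh_infinity[of 1] by auto
    have "compact (Fh ` (cquad \<inter> cball 0 M))"
      using quad_simps(3) by (intro compact_continuous_image continuous_on_subset[OF Fh_cont]) (auto intro: closed_Int_compact)
    then have b: "bounded (Fh ` (cquad \<inter> cball 0 M) \<union> ball (Complex A (- B)) 1)"
      by (simp add: compact_imp_bounded)
    have "F ` quad \<subseteq> Fh ` (cquad \<inter> cball 0 M) \<union> ball (Complex A (- B)) 1"
    proof
      fix w assume "w \<in> F ` quad"
      then obtain z where z: "z \<in> quad" "w = Fh z" using Fh_eq by auto
      then have "z \<in> cquad" using quad_simps(5) by blast
      then show "w \<in> Fh ` (cquad \<inter> cball 0 M) \<union> ball (Complex A (- B)) 1"
        using z M(2)[of z] by (cases "M \<le> cmod z") (auto simp: dist_commute)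
    qed
    then show ?thesis using b bounded_subset by blast
  qed
  have ne: "F ` quad \<noteq> {}" using cquad_shift[of 0 1] by (auto simp: cquad_def)
  have sub: "F ` quad \<subseteq> crect"
  proof (rule ccontr)
    assume "\<not> F ` quad \<subseteq> crect"
    then have i: "(- crect) \<inter> F ` quad \<noteq> {}" by blast
    have "connected (- crect)" unfolding crect_box by (intro connected_complement_bounded_convex) auto
    then have "- crect - F ` quad = {}" using connected_Int_frontier[OF _ i] fr by blast
    then have "bounded (- crect)" using bd by (metis Diff_eq_empty_iff bounded_subset)
    moreover have "bounded crect" unfolding crect_box by simp
    ultimately have "bounded (UNIV :: complex set)" by (metis bounded_Un Compl_partition2)
    then show False by simp
  qed
  have ii: "interior crect = irect" unfolding crect_box irect_box by (rule interior_cbox)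
  then have sub2: "F ` quad \<subseteq> irect" using interior_maximal[OF sub op] by simp
  moreover have "irect \<subseteq> F ` quad"
  proof (rule ccontr)
    assume "\<not> irect \<subseteq> F ` quad"
    moreover have "connected irect" unfolding irect_box by (rule convex_connected) (rule convex_box)
    ultimately have "irect \<inter> frontier (F ` quad) \<noteq> {}"
      using connected_Int_frontier[of irect "F ` quad"] sub2 ne by blast
    then show False using fr by blast
  qed
  ultimately show ?thesis by blast
qed


section \<open>Extension to the slit half plane by reflection\<close>

lemma F_eq_Fh:
  assumes "z \<in> slitplane k" "z \<in> cquad"
  shows "F z = Fh z"
proof -
  have "isCont F z" using F_deriv[OF assms(1)] by (rule DERIV_isCont)
  then have "(\<lambda>n. F (z + of_real (inverse (real (Suc n))) * (1 + \<i>))) \<longlonglongrightarrow> F z"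
    using cquad_shift_tendsto by (rule isCont_tendsto_compose)
  then show ?thesis using Fh_limit[OF assms(2)] LIMSEQ_unique by blast
qed

lemma slitplane_reflect: "z \<in> slitplane k \<Longrightarrow> - cnj z \<in> slitplane k"
  by (auto simp: slitplane_def)

lemma slitplane_axis:
  assumes "z \<in> slitplane k" "Re z = 0"
  shows "z = \<i> * of_real (Im z)" "k < Im z" "Im z < 1" "z \<in> cquad"
  using assms k1 by (auto simp: slitplane_def complex_eq_iff cquad_def)

lemma F_axis:
  assumes "z \<in> slitplane k" "Re z = 0"
  shows "F z = of_real (Re (Fh (\<i> * of_real (Im z))))"
proof -
  note ax = slitplane_axis[OF assms]
  have "F z = Fh (\<i> * of_real (Im z))" using F_eq_Fh[OF assms(1) ax(4)] ax(1) by simp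
  moreover have "Im (Fh (\<i> * of_real (Im z))) = 0" by (rule Fh_imag1(1)) (use ax in auto)
  ultimately show ?thesis by (simp only: complex_eq_iff Re_complex_of_real Im_complex_of_real)
qed

text \<open>Both sides have the same derivative after conjugation, and they agree at the midpoint of
  the gap, which the reflection fixes and where \<open>F\<close> is real.\<close>

lemma F_reflect:
  assumes "z \<in> slitplane k"
  shows "F (- cnj z) = cnj (F z)"
proof -
  let ?G = "\<lambda>z. cnj (F (- cnj z)) - F z"
  have d: "(?G has_field_derivative 0) (at z)" if z: "z \<in> slitplane k" for z
  proof -
    have "((\<lambda>w. F (- w)) has_field_derivative (- \<i> * sc_dens k (- cnj z)) * (- 1)) (at (cnj z))"
      by (rule DERIV_chain2[where f = F and g = uminus, OF F_deriv[OF slitplane_reflect[OF z]]])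
         (auto intro!: derivative_eq_intros)
    then have "((cnj \<circ> (\<lambda>w. F (- w)) \<circ> cnj) has_field_derivative cnj ((- \<i> * sc_dens k (- cnj z)) * (- 1))) (at z)"
      by (intro has_field_derivative_cnj_cnj) simp
    then have "((\<lambda>z. cnj (F (- cnj z))) has_field_derivative - \<i> * sc_dens k z) (at z)"
      using sc_dens_reflect[OF k1 k2 z] by (simp add: o_def)
    from DERIV_diff[OF this F_deriv[OF z]] show ?thesis by simp
  qed
  have conn: "connected (slitplane k)" using starlike_slitplane[OF k1 k2] by (rule starlike_imp_connected)
  have "\<exists>c. \<forall>z\<in>slitplane k. ?G z = c"
  proof -
    have "continuous_on (slitplane k) ?G" using d by (meson DERIV_isCont continuous_at_imp_continuous_on)
    then show ?thesis
      using DERIV_zero_connected_constant[OF conn open_slitplane[OF k1 k2] finite.emptyI, of ?G] d by (metis Diff_empty)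
  qed
  then obtain c where c: "\<And>z. z \<in> slitplane k \<Longrightarrow> ?G z = c" by blast
  let ?z = "Complex 0 ((1 + k) / 2)"
  have zs: "?z \<in> slitplane k" using k1 k2 by (simp add: slitplane_def)
  have "- cnj ?z = ?z" by (simp add: complex_eq_iff)
  then have "?G ?z = 0" using F_axis[OF zs] by simp
  then have "c = 0" using c[OF zs] by simp
  then have "cnj (F (- cnj z)) = F z" using c[OF assms] by simp
  then show ?thesis by (metis complex_cnj_cnj)
qed

lemma slitplane_cases:
  assumes "z \<in> slitplane k"
  obtains "z \<in> quad" | "Re z = 0" | "- cnj z \<in> quad"
  using assms by (cases "Re z" "0::real" rule: linorder_cases) (auto simp: slitplane_def quad_def)

lemma F_slit_quad: "z \<in> quad \<Longrightarrow> F z \<in> irect"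
  using F_image_quad by blast

lemma F_slit_left:
  assumes "- cnj z \<in> quad"
  shows "cnj (F z) = F (- cnj z)" "cnj (F z) \<in> irect"
proof -
  have "- cnj (- cnj z) \<in> slitplane k" using assms quad_subset_slitplane slitplane_reflect by blast
  then have z: "z \<in> slitplane k" by simp
  show 1: "cnj (F z) = F (- cnj z)" using F_reflect[OF z] by simp
  show "cnj (F z) \<in> irect" unfolding 1 by (rule F_slit_quad[OF assms])
qed

lemma F_slit_axis:
  assumes "z \<in> slitplane k" "Re z = 0"
  shows "0 < Re (F z)" "Re (F z) < A" "Im (F z) = 0"
  using F_axis[OF assms] slitplane_axis[OF assms] Fh_imag1(2)[of k k "Im z"] Fh_imag1(2)[of k "Im z" 1] Fh_ik Fh_i k2
  by auto

lemma F_image: "F ` slitplane k = rect A B"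
proof (intro equalityI subsetI)
  fix w assume "w \<in> F ` slitplane k"
  then obtain z where z: "z \<in> slitplane k" "w = F z" by blast
  from z(1) show "w \<in> rect A B"
  proof (cases rule: slitplane_cases)
    case 1
    then show ?thesis using F_slit_quad[OF 1] z AB_pos by (auto simp: irect_def rect_def)
  next
    case 2
    then show ?thesis using F_slit_axis[OF z(1)] z AB_pos by (auto simp: rect_def)
  next
    case 3
    then show ?thesis using F_slit_left(2)[OF 3] z AB_pos by (auto simp: irect_def rect_def)
  qed
next
  fix w assume w: "w \<in> rect A B"
  consider "Im w < 0" | "Im w = 0" | "0 < Im w" by linarith
  then show "w \<in> F ` slitplane k"
  proof cases
    case 1
    then have "w \<in> F ` quad" using w unfolding F_image_quad by (auto simp: irect_def rect_def)
    then show ?thesis using quad_subset_slitplane by blast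
  next
    case 3
    then have "cnj w \<in> F ` quad" using w unfolding F_image_quad by (auto simp: irect_def rect_def)
    then obtain z where z: "z \<in> quad" "cnj w = F z" by blast
    then have "z \<in> slitplane k" using quad_subset_slitplane by blast
    then have "F (- cnj z) = w" "- cnj z \<in> slitplane k" using F_reflect slitplane_reflect z(2) by (metis complex_cnj_cnj, blast)
    then show ?thesis by blast
  next
    case 2
    let ?r = "\<lambda>y. Re (Fh (\<i> * of_real y))"
    have c: "continuous_on {k..1} ?r" using k1 by (intro continuous_intros continuous_on_subset[OF Fh_cont_imag]) auto
    have "?r k \<le> Re w" "Re w \<le> ?r 1" using w Fh_ik Fh_i by (auto simp: rect_def)
    then obtain y where y: "k \<le> y" "y \<le> 1" "?r y = Re w" using IVT'[of ?r k "Re w" 1] c k2 by auto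
    have "y \<noteq> k" "y \<noteq> 1" using y(3) w Fh_ik Fh_i by (auto simp: rect_def)
    then have s: "\<i> * of_real y \<in> slitplane k" using y k1 by (simp add: slitplane_def)
    have "F (\<i> * of_real y) = w" using F_axis[OF s] y(3) 2 by (simp add: complex_eq_iff)
    then show ?thesis using s by blast
  qed
qed

text \<open>The sign of \<open>Im (F z)\<close> tells whether \<open>z\<close> lies in the right
  quadrant, in the left one or on the gap. On the quadrants injectivity is known, and on the gap
  \<open>Re (F z)\<close> is strictly increasing.\<close>

lemma F_inj: "inj_on F (slitplane k)"
proof (rule inj_onI)
  fix z w assume zw: "z \<in> slitplane k" "w \<in> slitplane k" "F z = F w"
  have neg: "Im (F z) < 0" if "z \<in> quad" for z using F_slit_quad[OF that] by (simp add: irect_def)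
  have pos: "0 < Im (F z)" if "- cnj z \<in> quad" for z using F_slit_left(2)[OF that] by (simp add: irect_def)
  have zero: "Im (F z) = 0" if "z \<in> slitplane k" "Re z = 0" for z using F_slit_axis[OF that] by simp
  consider "z \<in> quad" "w \<in> quad" | "- cnj z \<in> quad" "- cnj w \<in> quad" | "Re z = 0" "Re w = 0"
    using slitplane_cases[OF zw(1)] slitplane_cases[OF zw(2)] neg[of z] neg[of w] pos[of z] pos[of w] zero[OF zw(1)] zero[OF zw(2)] zw(3)
    by (metis less_asym less_irrefl)
  then show "z = w"
  proof cases
    case 1
    then show ?thesis using inj_onD[OF F_inj_quad zw(3)] by blast
  next
    case 2
    then have "F (- cnj z) = F (- cnj w)" using F_slit_left(1) zw(3) by metis
    then have "- cnj z = - cnj w" using inj_onD[OF F_inj_quad] 2 by blast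
    then show ?thesis by simp
  next
    case 3
    note az = slitplane_axis[OF zw(1) 3(1)] and aw = slitplane_axis[OF zw(2) 3(2)]
    have e: "Re (Fh (\<i> * of_real (Im z))) = Re (Fh (\<i> * of_real (Im w)))"
      using F_axis[OF zw(1) 3(1)] F_axis[OF zw(2) 3(2)] zw(3) by simp
    have "Im z = Im w"
    proof (rule ccontr)
      assume "Im z \<noteq> Im w"
      then consider "Im z < Im w" | "Im w < Im z" by linarith
      then show False
        using Fh_imag1(2)[of k "Im z" "Im w"] Fh_imag1(2)[of k "Im w" "Im z"] az aw e k2 by cases auto
    qed
    then show ?thesis using 3 by (simp add: complex_eq_iff)
  qed
qed

section \<open>Rectangle coordinates on the closed half plane\<close>

text \<open>Folding along the imaginary axis makes \<open>Fh\<close> available on the whole closed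
  half plane. So \<open>U\<close>, the horizontal coordinate, and \<open>V\<close>, the distance to
  the nearer horizontal side, are continuous across the slits, where \<open>F\<close> itself is not
  defined; they are needed there because image curves may cross the slits of the target.\<close>

definition reflect_quad where "reflect_quad z = Complex \<bar>Re z\<bar> (Im z)"
definition U where "U z = Re (Fh (reflect_quad z))"
definition V where "V z = B + Im (Fh (reflect_quad z))"

lemma reflect_quad_cont: "continuous_on S reflect_quad"
  unfolding reflect_quad_def[abs_def] Complex_eq[abs_def] by (intro continuous_intros)

lemma reflect_quad_cquad: "0 \<le> Im z \<Longrightarrow> reflect_quad z \<in> cquad"
  by (simp add: reflect_quad_def cquad_def)

lemma Fh_reflect_quad_cont: "continuous_on {z. 0 \<le> Im z} (\<lambda>z. Fh (reflect_quad z))"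
  by (intro continuous_on_compose2[OF Fh_cont reflect_quad_cont]) (auto intro: reflect_quad_cquad)

lemma U_cont: "continuous_on {z. 0 \<le> Im z} U" and V_cont: "continuous_on {z. 0 \<le> Im z} V"
  unfolding U_def[abs_def] V_def[abs_def] by (intro continuous_intros Fh_reflect_quad_cont)+

lemma UV_slit:
  assumes "z \<in> slitplane k"
  shows "U z = Re (F z)" "V z = B - \<bar>Im (F z)\<bar>"
proof -
  have "U z = Re (F z) \<and> V z = B - \<bar>Im (F z)\<bar>"
    using assms
  proof (cases rule: slitplane_cases)
    case 1
    then have f: "reflect_quad z = z" by (simp add: reflect_quad_def quad_def complex_eq_iff)
    have "Im (F z) < 0" using F_slit_quad[OF 1] by (simp add: irect_def)
    then show ?thesis using Fh_eq[OF 1] f by (simp add: U_def V_def)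
  next
    case 2
    then have f: "reflect_quad z = z" by (simp add: reflect_quad_def complex_eq_iff)
    have "F z = Fh z" using F_eq_Fh[OF assms] slitplane_axis(4)[OF assms 2] by simp
    then show ?thesis using f F_slit_axis(3)[OF assms 2] by (simp add: U_def V_def)
  next
    case 3
    then have f: "reflect_quad z = - cnj z" by (simp add: reflect_quad_def quad_def complex_eq_iff)
    have e: "Fh (reflect_quad z) = cnj (F z)" unfolding f using F_slit_left(1)[OF 3] Fh_eq[OF 3] by simp
    have "0 < Im (F z)" using F_slit_left(2)[OF 3] by (simp add: irect_def)
    then show ?thesis using e by (simp add: U_def V_def)
  qed
  then show "U z = Re (F z)" "V z = B - \<bar>Im (F z)\<bar>" by auto
qed

lemma reflect_quad_axis: "Re z = 0 \<Longrightarrow> reflect_quad z = \<i> * of_real (Im z)"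
  by (simp add: reflect_quad_def complex_eq_iff)

lemma U_cut:
  assumes "0 < Im z" "Re z = 0"
  shows "Im z \<le> k \<Longrightarrow> U z = 0" "1 \<le> Im z \<Longrightarrow> U z = A"
  using reflect_quad_axis[OF assms(2)] Fh_imag0(1)[of "Im z"] Fh_imag2(1)[of "Im z"] Re_Fh_i assms by (auto simp: U_def)

lemma V_segment: "Re z = 0 \<Longrightarrow> k \<le> Im z \<Longrightarrow> Im z \<le> 1 \<Longrightarrow> V z = B"
  using reflect_quad_axis[of z] Fh_imag1(1)[of "Im z"] by (simp add: V_def)

lemma V_real: "Im z = 0 \<Longrightarrow> V z = 0"
proof -
  assume "Im z = 0"
  then have "reflect_quad z = of_real \<bar>Re z\<bar>" by (simp add: reflect_quad_def complex_eq_iff)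
  then show "V z = 0" using Fh_real[of "\<bar>Re z\<bar>"] by (simp add: V_def)
qed

text \<open>\<open>V\<close> vanishes on the real axis, which permits replacing
  \<open>0 < Im z\<close> by \<open>0 \<le> Im z\<close> and gives closedness, and it tends to 0 at
  infinity, which gives boundedness. Curves whose ends leave every compact set must leave this
  one.\<close>

lemma V_superlevel_compact:
  assumes e: "0 < e"
  shows "compact {z. 0 < Im z \<and> e \<le> V z}"
proof -
  have eq: "{z. 0 < Im z \<and> e \<le> V z} = {z. 0 \<le> Im z} \<inter> V -` {e..}"
    using V_real e by (auto simp: less_le)
  have cl: "closed ({z. 0 \<le> Im z} \<inter> V -` {e..})"
    by (intro continuous_closed_preimage V_cont closed_halfspace_Im_ge closed_atLeast)
  obtain M where M: "0 < M" "\<And>z. z \<in> cquad \<Longrightarrow> M \<le> cmod z \<Longrightarrow> dist (Fh z) (Complex A (- B)) < e"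
    using Fh_infinity[OF e] by blast
  have "cmod z \<le> M" if z: "0 \<le> Im z" "e \<le> V z" for z
  proof (rule ccontr)
    assume "\<not> cmod z \<le> M"
    moreover have "cmod (reflect_quad z) = cmod z" by (simp add: reflect_quad_def cmod_def)
    ultimately have "dist (Fh (reflect_quad z)) (Complex A (- B)) < e" using M(2)[OF reflect_quad_cquad[OF z(1)]] by simp
    moreover have "\<bar>V z\<bar> \<le> dist (Fh (reflect_quad z)) (Complex A (- B))"
      using abs_Im_le_cmod[of "Fh (reflect_quad z) - Complex A (- B)"] by (simp add: dist_norm V_def add.commute)
    ultimately show False using z(2) by simp
  qed
  then have "bounded ({z. 0 \<le> Im z} \<inter> V -` {e..})" unfolding bounded_iff by (intro exI[of _ M]) auto
  then show ?thesis unfolding eq using cl by (simp add: compact_eq_bounded_closed)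
qed

lemma sc_norm_reflect_quad: "sc_norm k (reflect_quad z) = sc_norm k z"
proof (cases "0 \<le> Re z")
  case True
  then have "reflect_quad z = z" by (simp add: reflect_quad_def complex_eq_iff)
  then show ?thesis by simp
next
  case False
  then have "reflect_quad z = - cnj z" by (simp add: reflect_quad_def complex_eq_iff)
  then have "(1 + (reflect_quad z)\<^sup>2) * ((reflect_quad z)\<^sup>2 + (of_real k)\<^sup>2) = cnj ((1 + z\<^sup>2) * (z\<^sup>2 + (of_real k)\<^sup>2))" by simp
  then show ?thesis unfolding sc_norm_def by (metis complex_mod_cnj)
qed

lemma sc_norm_isCont:
  assumes z: "0 < Im z" "z \<noteq> \<i>" "z \<noteq> \<i> * of_real k"
  shows "isCont (sc_norm k) z"
proof -
  have "z + \<i> \<noteq> 0" "z + \<i> * of_real k \<noteq> 0" using z(1) k1 by (auto simp: complex_eq_iff)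
  then have "(z - \<i>) * (z + \<i>) \<noteq> 0" "(z - \<i> * of_real k) * (z + \<i> * of_real k) \<noteq> 0" using z by auto
  moreover have "1 + z\<^sup>2 = (z - \<i>) * (z + \<i>)" "z\<^sup>2 + (of_real k)\<^sup>2 = (z - \<i> * of_real k) * (z + \<i> * of_real k)"
    by (simp_all add: algebra_simps power2_eq_square)
  ultimately have "sqrt (cmod ((1 + z\<^sup>2) * (z\<^sup>2 + (of_real k)\<^sup>2))) \<noteq> 0" by simp
  then show ?thesis unfolding sc_norm_def[abs_def] by (intro continuous_intros) auto
qed

text \<open>In the open quadrant near the folded point, the derivative of \<open>F\<close> has
  modulus close to \<open>sc_norm k z0\<close>, and the intersection with a disc is convex. The
  bound passes to the closed quadrant by limits and to the half plane because folding does not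
  increase distances; in this way points of the slits are included.\<close>

lemma V_lipschitz:
  assumes z0: "0 < Im z0" "z0 \<noteq> \<i>" "z0 \<noteq> \<i> * of_real k" and e: "0 < e"
  obtains d where "0 < d" "\<And>z w. 0 < Im z \<Longrightarrow> 0 < Im w \<Longrightarrow> dist z z0 < d \<Longrightarrow> dist w z0 < d \<Longrightarrow>
     \<bar>V z - V w\<bar> \<le> (sc_norm k z0 + e) * dist z w"
proof -
  define p where "p = reflect_quad z0"
  have p: "0 < Im p" "p \<noteq> \<i>" "p \<noteq> \<i> * of_real k"
    using z0 by (auto simp: p_def reflect_quad_def complex_eq_iff)
  obtain d where d: "0 < d" "\<And>z. dist z p < d \<Longrightarrow> dist (sc_norm k z) (sc_norm k p) < e"
    using sc_norm_isCont[OF p] e unfolding continuous_at_eps_delta by (metis dist_commute dist_norm)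
  have np: "sc_norm k p = sc_norm k z0" unfolding p_def by (rule sc_norm_reflect_quad)
  define L where "L = sc_norm k z0 + e"
  have inner: "cmod (Fh a - Fh b) \<le> L * cmod (a - b)" if ab: "a \<in> quad" "b \<in> quad" "dist a p < d" "dist b p < d" for a b
  proof -
    have "cmod (F a - F b) \<le> L * cmod (a - b)"
    proof (rule field_differentiable_bound[of "quad \<inter> ball p d" F "\<lambda>z. - \<i> * sc_dens k z"])
      show "convex (quad \<inter> ball p d)" using quad_simps(2) by (intro convex_Int) auto
      fix z assume z: "z \<in> quad \<inter> ball p d"
      then have s: "z \<in> slitplane k" using quad_subset_slitplane by blast
      show "(F has_field_derivative - \<i> * sc_dens k z) (at z within quad \<inter> ball p d)"
        using F_deriv[OF s] by (rule has_field_derivative_at_within)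
      have "dist (sc_norm k z) (sc_norm k p) < e" using z by (intro d(2)) (simp add: dist_commute)
      then show "cmod (- \<i> * sc_dens k z) \<le> L"
        unfolding F_has_deriv_sc_norm[OF s] L_def np dist_real_def by linarith
    qed (use ab in \<open>auto simp: dist_commute\<close>)
    then show ?thesis using Fh_eq ab by simp
  qed
  have outer: "cmod (Fh a - Fh b) \<le> L * cmod (a - b)" if ab: "a \<in> cquad" "b \<in> cquad" "dist a p < d" "dist b p < d" for a b
  proof (rule LIMSEQ_le)
    let ?s = "\<lambda>z n. z + of_real (inverse (real (Suc n))) * (1 + \<i>)"
    have q: "?s z n \<in> quad" if "z \<in> cquad" for z n by (rule cquad_shift[OF that]) simp
    have l: "(\<lambda>n. Fh (?s z n)) \<longlonglongrightarrow> Fh z" if "z \<in> cquad" for z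
      by (rule continuous_on_tendsto_compose[OF Fh_cont cquad_shift_tendsto that])
        (rule always_eventually, use q[OF that] quad_simps(5) in blast)
    show "(\<lambda>n. cmod (Fh (?s a n) - Fh (?s b n))) \<longlonglongrightarrow> cmod (Fh a - Fh b)"
      by (intro tendsto_norm tendsto_diff l ab)
    show "(\<lambda>n. L * cmod (?s a n - ?s b n)) \<longlonglongrightarrow> L * cmod (a - b)"
      by (intro tendsto_mult_left tendsto_norm tendsto_diff cquad_shift_tendsto)
    have "eventually (\<lambda>n. dist (?s a n) p < d) sequentially" "eventually (\<lambda>n. dist (?s b n) p < d) sequentially"
      using order_tendstoD(2)[OF tendsto_dist[OF cquad_shift_tendsto tendsto_const]] ab by blast+
    then have "eventually (\<lambda>n. cmod (Fh (?s a n) - Fh (?s b n)) \<le> L * cmod (?s a n - ?s b n)) sequentially"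
      by eventually_elim (use inner q ab in blast)
    then show "\<exists>N. \<forall>n\<ge>N. cmod (Fh (?s a n) - Fh (?s b n)) \<le> L * cmod (?s a n - ?s b n)"
      unfolding eventually_sequentially .
  qed
  have fd: "dist (reflect_quad z) (reflect_quad w) \<le> dist z w" for z w
  proof -
    have "(\<bar>Re z\<bar> - \<bar>Re w\<bar>)\<^sup>2 \<le> (Re z - Re w)\<^sup>2" by (rule abs_le_square_iff[THEN iffD1]) auto
    then show ?thesis by (simp add: dist_norm reflect_quad_def cmod_def)
  qed
  have L: "0 \<le> L" using e by (simp add: L_def sc_norm_def)
  show ?thesis
  proof (rule that[OF d(1)])
    fix z w assume zw: "0 < Im z" "0 < Im w" "dist z z0 < d" "dist w z0 < d"
    have "dist (reflect_quad z) p < d" "dist (reflect_quad w) p < d" unfolding p_def using zw fd le_less_trans by blast+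
    then have "cmod (Fh (reflect_quad z) - Fh (reflect_quad w)) \<le> L * cmod (reflect_quad z - reflect_quad w)"
      using zw by (intro outer reflect_quad_cquad) auto
    also have "\<dots> \<le> L * dist z w" using fd[of z w] L by (intro mult_left_mono) (auto simp: dist_norm)
    finally have "cmod (Fh (reflect_quad z) - Fh (reflect_quad w)) \<le> L * dist z w" .
    moreover have "\<bar>V z - V w\<bar> \<le> cmod (Fh (reflect_quad z) - Fh (reflect_quad w))"
      using abs_Im_le_cmod[of "Fh (reflect_quad z) - Fh (reflect_quad w)"] by (simp add: V_def)
    ultimately show "\<bar>V z - V w\<bar> \<le> (sc_norm k z0 + e) * dist z w" by (simp add: L_def)
  qed
qed

lemma deriv_F: "z \<in> slitplane k \<Longrightarrow> cmod (deriv F z) = sc_norm k z"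
  using F_deriv[of z] F_has_deriv_sc_norm[of z] by (simp add: DERIV_imp_deriv)

end

section \<open>Quasiconformal maps between sectors\<close>

definition halfplane :: "complex set" where "halfplane = {z. 0 < Im z}"

definition biholo :: "complex set \<Rightarrow> complex set \<Rightarrow> (complex \<Rightarrow> complex) \<Rightarrow> (complex \<Rightarrow> complex) \<Rightarrow> bool" where
  "biholo S S' T T' \<longleftrightarrow> T holomorphic_on S \<and> T' holomorphic_on S' \<and>
     (\<forall>z\<in>S. T z \<in> S' \<and> T' (T z) = z) \<and> (\<forall>w\<in>S'. T' w \<in> S \<and> T (T' w) = w)"

lemma biholo_sym: "biholo S S' T T' \<Longrightarrow> biholo S' S T' T"
  by (simp add: biholo_def)

lemma biholo_trans:
  assumes "biholo S S' T T'" "biholo S' S'' R R'"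
  shows "biholo S S'' (R \<circ> T) (T' \<circ> R')"
proof -
  have "R \<circ> T holomorphic_on S" using assms by (intro holomorphic_on_compose_gen[where t = S']) (auto simp: biholo_def)
  moreover have "T' \<circ> R' holomorphic_on S''"
    using assms by (intro holomorphic_on_compose_gen[where t = S']) (auto simp: biholo_def)
  ultimately show ?thesis using assms by (simp add: biholo_def)
qed

lemma biholo_inj: "biholo S S' T T' \<Longrightarrow> inj_on T S"
  by (metis biholo_def inj_on_inverseI)

text \<open>The Cayley transform that sends \<open>b\<close> to the centre of the unit disc;
  \<open>of_disc b\<close> is its inverse.\<close>

definition to_disc :: "complex \<Rightarrow> complex \<Rightarrow> complex" where "to_disc b z = (z - b) / (z - cnj b)"
definition of_disc :: "complex \<Rightarrow> complex \<Rightarrow> complex" where "of_disc b w = (b - cnj b * w) / (1 - w)"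

lemma cmod_diff_less_reflect:
  assumes "0 < Im z" "0 < Im b"
  shows "cmod (z - b) < cmod (z - cnj b)"
proof -
  have "(Im z - Im b)\<^sup>2 < (Im z + Im b)\<^sup>2" using assms by (simp add: power2_eq_square algebra_simps)
  then have "(cmod (z - b))\<^sup>2 < (cmod (z - cnj b))\<^sup>2" by (simp add: cmod_power2)
  then show ?thesis by (rule power2_less_imp_less) simp
qed

lemma biholo_to_disc:
  assumes b: "b \<in> halfplane"
  shows "biholo halfplane (ball 0 1) (to_disc b) (of_disc b)"
proof -
  have b': "0 < Im b" using b by (simp add: halfplane_def)
  have nz: "z - cnj b \<noteq> 0" if "z \<in> halfplane" for z using that b' by (auto simp: halfplane_def complex_eq_iff)
  have nw: "1 - w \<noteq> 0" if "w \<in> ball 0 1" for w :: complex using that by auto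
  have nb: "b - cnj b \<noteq> 0" using b' by (auto simp: complex_eq_iff)
  have 1: "to_disc b z \<in> ball 0 1" if "z \<in> halfplane" for z
    using cmod_diff_less_reflect[of z b] that b' nz[OF that] by (simp add: to_disc_def halfplane_def norm_divide divide_simps)
  have 2: "of_disc b (to_disc b z) = z" if "z \<in> halfplane" for z
  proof -
    have "1 - to_disc b z = (b - cnj b) / (z - cnj b)" using nz[OF that] by (simp add: to_disc_def divide_simps)
    moreover have "b - cnj b * to_disc b z = z * (b - cnj b) / (z - cnj b)"
      using nz[OF that] by (simp add: to_disc_def divide_simps) (simp add: algebra_simps)
    ultimately show ?thesis using nz[OF that] nb by (simp add: of_disc_def)
  qed
  have e: "of_disc b w - cnj b = (b - cnj b) / (1 - w)" if "w \<in> ball 0 1" for w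
    using nw[OF that] by (simp add: of_disc_def divide_simps) (simp add: algebra_simps)
  have 3: "to_disc b (of_disc b w) = w" if "w \<in> ball 0 1" for w
  proof -
    have "of_disc b w - b = w * (b - cnj b) / (1 - w)"
      using nw[OF that] by (simp add: of_disc_def divide_simps) (simp add: algebra_simps)
    then show ?thesis unfolding to_disc_def e[OF that] using nw[OF that] nb by simp
  qed
  have 4: "of_disc b w \<in> halfplane" if w: "w \<in> ball 0 1" for w
  proof -
    have "of_disc b w = ((b - cnj b * w) * cnj (1 - w)) / of_real ((cmod (1 - w))\<^sup>2)"
      by (simp only: of_disc_def complex_div_cnj[of _ "1 - w"])
    then have "Im (of_disc b w) = Im ((b - cnj b * w) * cnj (1 - w)) / (cmod (1 - w))\<^sup>2"
      by (simp only: Im_divide_of_real)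
    moreover have "Im ((b - cnj b * w) * cnj (1 - w)) = Im b * (1 - (cmod w)\<^sup>2)"
      unfolding cmod_power2 by (simp add: algebra_simps power2_eq_square)
    moreover have "(cmod w)\<^sup>2 < 1" using w by (simp add: power_less_one_iff)
    ultimately show ?thesis using b' nw[OF w] by (simp add: halfplane_def)
  qed
  have "to_disc b holomorphic_on halfplane" unfolding to_disc_def[abs_def] using nz by (intro holomorphic_intros) auto
  moreover have "of_disc b holomorphic_on ball 0 1" unfolding of_disc_def[abs_def] using nw by (intro holomorphic_intros) auto
  ultimately show ?thesis using 1 2 3 4 by (simp add: biholo_def)
qed

text \<open>In the disc centred at \<open>b\<close> the point \<open>a\<close> has modulus
  \<open>r\<close>. A rotation moves it to \<open>- r\<close>, and the inverse Cayley transform at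
  \<open>\<i>\<close> sends \<open>- r\<close> to \<open>\<i> * (1 - r) / (1 + r)\<close> and 0 to
  \<open>\<i>\<close>.\<close>

lemma biholo_halfplane_normalised:
  assumes a: "a \<in> halfplane" and b: "b \<in> halfplane" and ab: "a \<noteq> b"
  defines "r \<equiv> pseudo_hyp a b"
  shows "0 < r" "r < 1"
    and "\<exists>T T'. biholo halfplane halfplane T T' \<and> T a = \<i> * of_real ((1 - r) / (1 + r)) \<and> T b = \<i>"
proof -
  define \<zeta> where "\<zeta> = to_disc b a"
  have "a - cnj b \<noteq> 0" using a b by (auto simp: halfplane_def complex_eq_iff)
  then have z: "cmod \<zeta> = r" "\<zeta> \<noteq> 0"
    using ab by (auto simp: \<zeta>_def to_disc_def r_def pseudo_hyp_def norm_divide)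
  show r: "0 < r" using z by auto
  have "\<zeta> \<in> ball 0 1" using biholo_to_disc[OF b] a by (simp add: biholo_def \<zeta>_def)
  then show r1: "r < 1" using z by simp
  define c where "c = - of_real r / \<zeta>"
  have c: "cmod c = 1" "c \<noteq> 0" "c * \<zeta> = - of_real r" using z r by (auto simp: c_def norm_divide)
  have rot: "biholo (ball 0 1) (ball 0 1) (\<lambda>w. c * w) (\<lambda>w. w / c)"
    using c by (auto simp: biholo_def norm_mult norm_divide intro!: holomorphic_intros)
  have i: "\<i> \<in> halfplane" by (simp add: halfplane_def)
  have "biholo halfplane halfplane (of_disc \<i> \<circ> ((\<lambda>w. c * w) \<circ> to_disc b)) ((of_disc b \<circ> (\<lambda>w. w / c)) \<circ> to_disc \<i>)"
    by (intro biholo_trans[OF biholo_trans[OF biholo_to_disc[OF b] rot]] biholo_sym[OF biholo_to_disc[OF i]])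
  moreover have "(of_disc \<i> \<circ> ((\<lambda>w. c * w) \<circ> to_disc b)) a = \<i> * of_real ((1 - r) / (1 + r))"
    using c(3) r by (simp add: \<zeta>_def[symmetric] of_disc_def) (simp add: algebra_simps)
  moreover have "(of_disc \<i> \<circ> ((\<lambda>w. c * w) \<circ> to_disc b)) b = \<i>"
    by (simp add: to_disc_def of_disc_def)
  ultimately show "\<exists>T T'. biholo halfplane halfplane T T' \<and> T a = \<i> * of_real ((1 - r) / (1 + r)) \<and> T b = \<i>" by blast
qed

lemma halfplane_sector: "halfplane = sector pi"
  unfolding sector_eq_halfplanes[OF pi_gt_zero order_refl] halfplane_def by auto

lemma zpow_sector:
  assumes p: "0 < p" "p * \<theta> \<le> pi" "0 < \<theta>" "\<theta> \<le> pi" and z: "z \<in> sector \<theta>"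
  shows "zpow p z \<in> sector (p * \<theta>)" "zpow (1 / p) (zpow p z) = z"
proof -
  obtain a t where a: "0 < a" "0 < t" "t < \<theta>" "z = polar a t" using z by (rule sector_polar)
  have t: "0 < p * t" "p * t < p * \<theta>" using a p by auto
  then have t': "- pi < p * t" "p * t \<le> pi" using p by linarith+
  have e: "zpow p z = polar (a powr p) (p * t)" unfolding a(4) using a p by (intro zpow_polar) auto
  show "zpow p z \<in> sector (p * \<theta>)" unfolding e using a t by (intro polar_in_sector) auto
  have "zpow (1 / p) (zpow p z) = polar ((a powr p) powr (1 / p)) (1 / p * (p * t))"
    unfolding e using a t' p by (intro zpow_polar) auto
  then show "zpow (1 / p) (zpow p z) = z" using a p by (simp add: powr_powr)
qed

lemma zpow_holomorphic:
  assumes "0 < \<theta>" "\<theta> \<le> pi"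
  shows "zpow p holomorphic_on sector \<theta>"
proof -
  have "z \<notin> \<real>\<^sub>\<le>\<^sub>0" if "z \<in> sector \<theta>" for z
    using that assms by (auto simp: sector_eq_halfplanes complex_nonpos_Reals_iff)
  then show ?thesis unfolding zpow_def[abs_def] by (intro holomorphic_intros) auto
qed

lemma biholo_zpow:
  assumes "0 < \<theta>" "\<theta> \<le> pi"
  shows "biholo (sector \<theta>) halfplane (zpow (pi / \<theta>)) (zpow (\<theta> / pi))"
  using zpow_sector[of "pi / \<theta>" \<theta>] zpow_sector[of "\<theta> / pi" pi] zpow_holomorphic[OF assms] zpow_holomorphic[of pi] assms
  by (auto simp: biholo_def halfplane_sector)

lemma sector_chart:
  assumes th: "0 < \<theta>" "\<theta> \<le> pi" and x: "x \<in> sector \<theta>" and y: "y \<in> sector \<theta>" and xy: "x \<noteq> y"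
  defines "r \<equiv> pseudo_hyp (zpow (pi / \<theta>) x) (zpow (pi / \<theta>) y)"
  shows "0 < r" "r < 1"
    and "\<exists>\<Phi> P. biholo (sector \<theta>) halfplane \<Phi> P \<and> \<Phi> x = \<i> * of_real ((1 - r) / (1 + r)) \<and> \<Phi> y = \<i>"
proof -
  note bz = biholo_zpow[OF th]
  have h: "zpow (pi / \<theta>) x \<in> halfplane" "zpow (pi / \<theta>) y \<in> halfplane" using bz x y by (auto simp: biholo_def)
  have ne: "zpow (pi / \<theta>) x \<noteq> zpow (pi / \<theta>) y" using biholo_inj[OF bz] x y xy by (auto dest: inj_onD)
  note N = biholo_halfplane_normalised[OF h ne, folded r_def]
  show "0 < r" "r < 1" by (rule N(1), rule N(2))
  obtain T T' where T: "biholo halfplane halfplane T T'" "T (zpow (pi / \<theta>) x) = \<i> * of_real ((1 - r) / (1 + r))"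
    "T (zpow (pi / \<theta>) y) = \<i>" using N(3) by blast
  show "\<exists>\<Phi> P. biholo (sector \<theta>) halfplane \<Phi> P \<and> \<Phi> x = \<i> * of_real ((1 - r) / (1 + r)) \<and> \<Phi> y = \<i>"
    using biholo_trans[OF bz T(1)] T(2,3) by (intro exI[of _ "T \<circ> zpow (pi / \<theta>)"] exI[of _ "zpow (\<theta> / pi) \<circ> T'"]) simp
qed


section \<open>Crosscuts and extremal density in a charted domain\<close>

locale slit_chart = slit_map +
  fixes S :: "complex set" and \<Phi> P :: "complex \<Rightarrow> complex"
  assumes S_open: "open S" and chart: "biholo S halfplane \<Phi> P"
begin

text \<open>The inverse of \<open>F \<circ> \<Phi>\<close> on the rectangle; the crosscuts are its
  values on vertical segments, and \<open>P (\<i> k)\<close>, \<open>P \<i>\<close> are the two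
  points they separate.\<close>

definition ccut :: "complex \<Rightarrow> complex" where "ccut w = P (inv_into (slitplane k) F w)"
text \<open>The Euclidean metric of the rectangle pulled back by \<open>F \<circ> \<Phi>\<close> and
  scaled by \<open>1 / (2 * B)\<close>. Writing it with \<open>sc_norm\<close> defines it on the
  preimages of the slits too, where image curves may run.\<close>

definition dens :: "complex \<Rightarrow> ennreal" where
  "dens z = (if z \<in> S then ennreal (cmod (deriv \<Phi> z) * sc_norm k (\<Phi> z) / (2 * B)) else 0)"

lemma \<Phi>_props: "z \<in> S \<Longrightarrow> 0 < Im (\<Phi> z)" "z \<in> S \<Longrightarrow> P (\<Phi> z) = z" "\<Phi> holomorphic_on S" "inj_on \<Phi> S"
  using chart biholo_inj[OF chart] by (auto simp: biholo_def halfplane_def)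

lemma P_props: "0 < Im w \<Longrightarrow> P w \<in> S" "0 < Im w \<Longrightarrow> \<Phi> (P w) = w" "P holomorphic_on halfplane"
  using chart by (auto simp: biholo_def halfplane_def)

lemma inv_F:
  assumes "w \<in> rect A B"
  shows "inv_into (slitplane k) F w \<in> slitplane k" "F (inv_into (slitplane k) F w) = w"
  using assms by (auto simp: F_image[symmetric] intro: inv_into_into f_inv_into_f)

lemma slitplane_halfplane: "z \<in> slitplane k \<Longrightarrow> 0 < Im z"
  by (simp add: slitplane_def)

lemma ccut_props:
  assumes "w \<in> rect A B"
  shows "ccut w \<in> S" "\<Phi> (ccut w) \<in> slitplane k" "F (\<Phi> (ccut w)) = w"
  using inv_F[OF assms] slitplane_halfplane[OF inv_F(1)[OF assms]] P_props by (simp_all add: ccut_def)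

lemma ccut_F: "z \<in> slitplane k \<Longrightarrow> ccut (F z) = P z"
  using F_inj by (simp add: ccut_def inv_into_f_f)

lemma ccut_inj: "inj_on ccut (rect A B)"
  by (rule inj_on_inverseI[where g = "F \<circ> \<Phi>"]) (simp add: ccut_props)

lemma ccut_holomorphic: "ccut holomorphic_on rect A B"
proof -
  obtain g where g: "g holomorphic_on F ` slitplane k" "\<And>z. z \<in> slitplane k \<Longrightarrow> g (F z) = z"
    using holomorphic_has_inverse[OF F_holomorphic open_slitplane[OF k1 k2] F_inj] by metis
  have "P \<circ> g holomorphic_on rect A B"
    using g slitplane_halfplane by (intro holomorphic_on_compose_gen[OF _ P_props(3)]) (auto simp: F_image[symmetric] halfplane_def)
  moreover have "(P \<circ> g) w = ccut w" if "w \<in> rect A B" for w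
    using g(2)[OF inv_F(1)[OF that]] inv_F(2)[OF that] by (simp add: ccut_def)
  ultimately show ?thesis by (metis (no_types, lifting) holomorphic_cong)
qed

lemma U_strict_slitplane: "0 < Im z \<Longrightarrow> 0 < U z \<Longrightarrow> U z < A \<Longrightarrow> z \<in> slitplane k"
  using U_cut[of z] by (auto simp: slitplane_def not_le[symmetric])

text \<open>This is how the crosscuts separate the marked points: \<open>U \<circ> \<Phi>\<close> is
  0 at one and \<open>A\<close> at the other, so it takes the value \<open>u\<close> on
  \<open>C\<close>. A value strictly between 0 and \<open>A\<close> keeps the point off the slits,
  and then it lies on the crosscut with abscissa \<open>u\<close>.\<close>

lemma ccut_meets_connected:
  assumes C: "connected C" "C \<subseteq> S" "P (\<i> * of_real k) \<in> C" "P \<i> \<in> C" and u: "0 < u" "u < A"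
  shows "\<exists>v. - B < v \<and> v < B \<and> ccut (Complex u v) \<in> C"
proof -
  have c\<Phi>: "continuous_on C \<Phi>" using C(2) \<Phi>_props(3) by (meson continuous_on_subset holomorphic_on_imp_continuous_on)
  have "continuous_on C (\<lambda>z. U (\<Phi> z))"
    by (rule continuous_on_compose2[OF U_cont c\<Phi>]) (use C(2) \<Phi>_props(1) in \<open>auto intro: less_imp_le\<close>)
  then have con: "connected ((\<lambda>z. U (\<Phi> z)) ` C)" using C(1) by (rule connected_continuous_image)
  have "U (\<i> * of_real k) = 0" using k1 by (intro U_cut(1)) auto
  then have "0 \<in> (\<lambda>z. U (\<Phi> z)) ` C" using P_props(2)[of "\<i> * of_real k"] k1 C(3) by (force intro!: image_eqI)
  moreover have "U \<i> = A" by (intro U_cut(2)) auto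
  then have "A \<in> (\<lambda>z. U (\<Phi> z)) ` C" using P_props(2)[of \<i>] C(4) by (force intro!: image_eqI)
  ultimately have "u \<in> (\<lambda>z. U (\<Phi> z)) ` C" using con u by (meson connected_contains_Icc atLeastAtMost_iff less_imp_le subsetD)
  then obtain z where z: "z \<in> C" "U (\<Phi> z) = u" by blast
  have s: "\<Phi> z \<in> slitplane k" using z u C(2) by (intro U_strict_slitplane \<Phi>_props(1)) auto
  have "F (\<Phi> z) = Complex u (Im (F (\<Phi> z)))" using UV_slit(1)[OF s] z by (simp add: complex_eq_iff)
  then have "ccut (Complex u (Im (F (\<Phi> z)))) = z" using ccut_F[OF s] \<Phi>_props(2) z C(2) by auto
  moreover have "F (\<Phi> z) \<in> rect A B" using s F_image by blast
  ultimately show ?thesis using z by (intro exI[of _ "Im (F (\<Phi> z))"]) (auto simp: rect_def)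
qed

lemma ccut_leaves_compact:
  assumes C: "compact C" "C \<subseteq> S" and u: "0 < u" "u < A"
  shows "\<exists>e>0. \<forall>v. - B < v \<longrightarrow> v < B \<longrightarrow> B - \<bar>v\<bar> < e \<longrightarrow> ccut (Complex u v) \<notin> C"
proof -
  define D where "D = \<Phi> ` C \<inter> {z. 0 \<le> Im z} \<inter> U -` {u}"
  have c\<Phi>: "continuous_on C \<Phi>" using C(2) \<Phi>_props(3) by (meson continuous_on_subset holomorphic_on_imp_continuous_on)
  have "compact (\<Phi> ` C)" using c\<Phi> C(1) by (rule compact_continuous_image)
  moreover have "closed ({z. 0 \<le> Im z} \<inter> U -` {u})"
    by (intro continuous_closed_preimage U_cont closed_halfspace_Im_ge closed_singleton)
  ultimately have "compact D" unfolding D_def Int_assoc by (rule compact_Int_closed)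
  have Ds: "D \<subseteq> slitplane k" using C(2) \<Phi>_props(1) u by (auto simp: D_def intro!: U_strict_slitplane)
  have pos: "0 < V z" if "z \<in> slitplane k" for z
    using UV_slit(2)[OF that] F_image that by (force simp: rect_def)
  have "\<exists>e>0. \<forall>z\<in>D. e \<le> V z"
  proof (cases "D = {}")
    case False
    have "continuous_on D V" using V_cont by (rule continuous_on_subset) (auto simp: D_def)
    then obtain z where "z \<in> D" "\<forall>w\<in>D. V z \<le> V w"
      using continuous_attains_inf[OF \<open>compact D\<close> False] by blast
    then show ?thesis using pos Ds by blast
  qed (auto intro: exI[of _ 1])
  then obtain e where e: "0 < e" "\<And>z. z \<in> D \<Longrightarrow> e \<le> V z" by blast
  have "ccut (Complex u v) \<notin> C" if v: "- B < v" "v < B" "B - \<bar>v\<bar> < e" for v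
  proof
    assume c: "ccut (Complex u v) \<in> C"
    have "Complex u v \<in> rect A B" using u v by (simp add: rect_def)
    note cp = ccut_props[OF this]
    have "U (\<Phi> (ccut (Complex u v))) = u" "V (\<Phi> (ccut (Complex u v))) = B - \<bar>v\<bar>"
      using UV_slit[OF cp(2)] cp(3) by simp_all
    then have "\<Phi> (ccut (Complex u v)) \<in> D" "V (\<Phi> (ccut (Complex u v))) < e"
      using c slitplane_halfplane[OF cp(2)] v by (auto simp: D_def intro!: imageI less_imp_le)
    with e(2) show False by fastforce
  qed
  with e(1) show ?thesis by blast
qed

lemma dens_measurable: "dens \<in> borel_measurable borel"
proof -
  have m1: "(\<lambda>z. if z \<in> S then \<Phi> z else 0) \<in> borel_measurable borel"
    using S_open \<Phi>_props(3) by (intro borel_measurable_continuous_on_if holomorphic_on_imp_continuous_on) auto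
  have "deriv \<Phi> holomorphic_on S" using \<Phi>_props(3) S_open by (rule holomorphic_deriv)
  then have m2: "(\<lambda>z. if z \<in> S then deriv \<Phi> z else 0) \<in> borel_measurable borel"
    using S_open by (intro borel_measurable_continuous_on_if holomorphic_on_imp_continuous_on) auto
  have m3: "sc_norm k \<in> borel_measurable borel" unfolding sc_norm_def[abs_def] by measurable
  have "dens = (\<lambda>z. ennreal (cmod (if z \<in> S then deriv \<Phi> z else 0) * sc_norm k (if z \<in> S then \<Phi> z else 0) / (2 * B)))"
    by (rule ext) (simp add: dens_def)
  also have "\<dots> \<in> borel_measurable borel"
    using m2 measurable_compose[OF m1 m3] by measurable
  finally show ?thesis .
qed

text \<open>The preimages of the slits lie in the differentiable image of a half line, hence form a
  null set. Off them the density is \<open>1 / (2 * B)\<close> times the modulus of the derivative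
  of the injective map \<open>F \<circ> \<Phi>\<close> into the rectangle, so the integral is at
  most the area \<open>2 * A * B\<close> divided by \<open>(2 * B)^2\<close>.\<close>

lemma dens_sq_integral: "(\<integral>\<^sup>+ z. (dens z)\<^sup>2 \<partial>lborel) \<le> ennreal (A / (2 * B))"
proof -
  define N where "N = S \<inter> \<Phi> -` slitplane k"
  have c\<Phi>: "continuous_on S \<Phi>" using \<Phi>_props(3) by (rule holomorphic_on_imp_continuous_on)
  have No: "open N" unfolding N_def using c\<Phi> S_open open_slitplane[OF k1 k2] by (rule continuous_open_preimage)
  have NS: "N \<subseteq> S" by (simp add: N_def)
  define T where "T = F \<circ> \<Phi>"
  have TN: "T holomorphic_on N" unfolding T_def
    by (rule holomorphic_on_compose_gen[OF holomorphic_on_subset[OF \<Phi>_props(3) NS] F_holomorphic]) (auto simp: N_def)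
  have Ti: "inj_on T N" unfolding T_def
    by (rule comp_inj_on[OF inj_on_subset[OF \<Phi>_props(4) NS] inj_on_subset[OF F_inj]]) (auto simp: N_def)
  have dT: "cmod (deriv T z) = sc_norm k (\<Phi> z) * cmod (deriv \<Phi> z)" "T z \<in> rect A B" if z: "z \<in> N" for z
  proof -
    have "deriv T z = deriv F (\<Phi> z) * deriv \<Phi> z" unfolding T_def
      using z NS \<Phi>_props(3) S_open F_holomorphic open_slitplane[OF k1 k2]
      by (intro deriv_chain holomorphic_on_imp_differentiable_at[of _ S] holomorphic_on_imp_differentiable_at[of _ "slitplane k"])
         (auto simp: N_def)
    then show "cmod (deriv T z) = sc_norm k (\<Phi> z) * cmod (deriv \<Phi> z)" using deriv_F[of "\<Phi> z"] z by (simp add: norm_mult N_def)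
    show "T z \<in> rect A B" using z F_image by (auto simp: T_def N_def)
  qed
  have "negligible {w. 0 < Im w \<and> Re w = 0}"
  proof (rule negligible_subset[OF negligible_hyperplane[of 1 0]])
    show "{w. 0 < Im w \<and> Re w = 0} \<subseteq> {x. (1::complex) \<bullet> x = 0}" by (auto simp: inner_complex_def)
  qed auto
  moreover have "P differentiable_on {w. 0 < Im w \<and> Re w = 0}"
  proof -
    have "P differentiable_on halfplane"
      using P_props(3) by (metis differentiable_on_def field_differentiable_imp_differentiable holomorphic_on_def)
    then show ?thesis by (rule differentiable_on_subset) (auto simp: halfplane_def)
  qed
  ultimately have neg: "negligible (P ` {w. 0 < Im w \<and> Re w = 0})"
    by (intro negligible_differentiable_image_negligible) auto
  have sub: "S - N \<subseteq> P ` {w. 0 < Im w \<and> Re w = 0}"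
  proof
    fix z assume z: "z \<in> S - N"
    then have "\<Phi> z \<in> {w. 0 < Im w \<and> Re w = 0}" "P (\<Phi> z) = z" using \<Phi>_props by (auto simp: N_def slitplane_def)
    then show "z \<in> P ` {w. 0 < Im w \<and> Re w = 0}" by (metis imageI)
  qed
  have "negligible (S - N)" using neg sub by (rule negligible_subset)
  then have "S - N \<in> null_sets lebesgue" by (simp add: negligible_iff_null_sets)
  moreover have "S - N \<in> sets lborel" using S_open No by auto
  ultimately have null: "S - N \<in> null_sets lborel" by (simp add: null_sets_completion_iff)
  have nn: "0 \<le> sc_norm k z" for z by (simp add: sc_norm_def)
  have "AE z in lborel. z \<notin> S - N" using null by (rule AE_not_in)
  then have "(\<integral>\<^sup>+ z. (dens z)\<^sup>2 \<partial>lborel) \<le>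
      (\<integral>\<^sup>+ z. ennreal (1 / (2 * B)\<^sup>2) * indicator (rect A B) (T z) * ennreal ((cmod (deriv T z))\<^sup>2) * indicator N z \<partial>lborel)"
  proof (intro nn_integral_mono_AE, elim AE_mp, intro AE_I2 impI)
    fix z assume z: "z \<notin> S - N"
    show "(dens z)\<^sup>2 \<le> ennreal (1 / (2 * B)\<^sup>2) * indicator (rect A B) (T z) * ennreal ((cmod (deriv T z))\<^sup>2) * indicator N z"
    proof (cases "z \<in> N")
      case True
      have "(dens z)\<^sup>2 = ennreal ((cmod (deriv \<Phi> z) * sc_norm k (\<Phi> z) / (2 * B))\<^sup>2)"
        using True NS AB_pos nn[of "\<Phi> z"] by (auto simp: dens_def ennreal_power)
      also have "(cmod (deriv \<Phi> z) * sc_norm k (\<Phi> z) / (2 * B))\<^sup>2 = 1 / (2 * B)\<^sup>2 * (cmod (deriv T z))\<^sup>2"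
        unfolding dT(1)[OF True] by (simp add: power_divide power_mult_distrib mult_ac)
      finally show ?thesis using True dT(2)[OF True] AB_pos by (simp add: ennreal_mult[symmetric])
    next
      case False
      then show ?thesis using z by (simp add: dens_def)
    qed
  qed
  also have "\<dots> \<le> (\<integral>\<^sup>+ w. ennreal (1 / (2 * B)\<^sup>2) * indicator (rect A B) w \<partial>lborel)"
    using open_rect[of A B] by (intro nn_integral_holomorphic_image_le[OF No TN Ti]) auto
  also have "\<dots> = ennreal (1 / (2 * B)\<^sup>2) * ennreal (2 * A * B)"
    using open_rect[of A B] AB_pos by (subst nn_integral_cmult_indicator) (auto simp: emeasure_rect)
  also have "\<dots> = ennreal (1 / (2 * B)\<^sup>2 * (2 * A * B))" using AB_pos by (intro ennreal_mult[symmetric]) auto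
  also have "1 / (2 * B)\<^sup>2 * (2 * A * B) = A / (2 * B)" using AB_pos by (simp add: power2_eq_square field_simps)
  finally show ?thesis .
qed

text \<open>The local Lipschitz constants of \<open>V\<close> and of \<open>\<Phi>\<close> multiply;
  a ball inside \<open>S\<close> provides the convexity needed for the latter.\<close>

lemma V\<Phi>_lipschitz:
  assumes z0: "z0 \<in> S" "\<Phi> z0 \<noteq> \<i>" "\<Phi> z0 \<noteq> \<i> * of_real k" and e: "0 < e"
  obtains d where "0 < d" "\<And>z w. z \<in> S \<Longrightarrow> w \<in> S \<Longrightarrow> dist z z0 < d \<Longrightarrow> dist w z0 < d \<Longrightarrow>
     \<bar>V (\<Phi> z) - V (\<Phi> w)\<bar> \<le> (cmod (deriv \<Phi> z0) * sc_norm k (\<Phi> z0) + e) * dist z w"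
proof -
  define D N where "D = cmod (deriv \<Phi> z0)" and "N = sc_norm k (\<Phi> z0)"
  have DN: "0 \<le> D" "0 \<le> N" by (simp_all add: D_def N_def sc_norm_def)
  \<comment> \<open>The error allowed in each factor, chosen such that
    \<open>(N + c) * (D + c) \<le> D * N + e\<close>.\<close>
  define c where "c = min 1 (e / (N + D + 1))"
  have c: "0 < c" "c \<le> 1" "c \<le> e / (N + D + 1)" using DN e by (auto simp: c_def)
  then have c3: "c * (N + D + 1) \<le> e" using DN by (simp add: pos_le_divide_eq)
  have prod: "(N + c) * (D + c) \<le> D * N + e"
  proof -
    have "c * (N + D + c) \<le> c * (N + D + 1)" using c by (intro mult_left_mono) auto
    then show ?thesis using c3 by (simp add: algebra_simps)
  qed
  obtain d1 where d1: "0 < d1" "\<And>z w. 0 < Im z \<Longrightarrow> 0 < Im w \<Longrightarrow> dist z (\<Phi> z0) < d1 \<Longrightarrow> dist w (\<Phi> z0) < d1 \<Longrightarrow>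
     \<bar>V z - V w\<bar> \<le> (N + c) * dist z w"
    using V_lipschitz[OF \<Phi>_props(1)[OF z0(1)] z0(2,3) c(1)] unfolding N_def by blast
  have dh: "deriv \<Phi> holomorphic_on S" using \<Phi>_props(3) S_open by (rule holomorphic_deriv)
  have ic: "isCont (deriv \<Phi>) z0" "isCont \<Phi> z0"
    using dh \<Phi>_props(3) S_open z0(1) by (auto intro!: continuous_on_interior holomorphic_on_imp_continuous_on simp: interior_open)
  obtain d2 where d2: "0 < d2" "\<And>z. dist z z0 < d2 \<Longrightarrow> dist (deriv \<Phi> z) (deriv \<Phi> z0) < c"
    using ic(1) c(1) unfolding continuous_at_eps_delta by (metis dist_norm)
  obtain d3 where d3: "0 < d3" "\<And>z. dist z z0 < d3 \<Longrightarrow> dist (\<Phi> z) (\<Phi> z0) < d1"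
    using ic(2) d1(1) unfolding continuous_at_eps_delta by (metis dist_norm)
  obtain d4 where d4: "0 < d4" "ball z0 d4 \<subseteq> S" using S_open z0(1) by (meson open_contains_ball)
  define d where "d = min d2 (min d3 d4)"
  show ?thesis
  proof
    show "0 < d" using d2 d3 d4 by (simp add: d_def)
    fix z w assume zw: "z \<in> S" "w \<in> S" "dist z z0 < d" "dist w z0 < d"
    have "norm (\<Phi> z - \<Phi> w) \<le> (D + c) * norm (z - w)"
    proof (rule field_differentiable_bound[OF convex_ball[of z0 d]])
      fix x assume x: "x \<in> ball z0 d"
      then have xS: "x \<in> S" using d4 by (auto simp: d_def)
      then show "(\<Phi> has_field_derivative deriv \<Phi> x) (at x within ball z0 d)"
        using \<Phi>_props(3) S_open by (meson has_field_derivative_at_within holomorphic_derivI)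
      have "cmod (deriv \<Phi> x - deriv \<Phi> z0) < c" using d2(2)[of x] x by (simp add: d_def dist_commute dist_norm)
      then show "cmod (deriv \<Phi> x) \<le> D + c" using norm_triangle_sub[of "deriv \<Phi> x" "deriv \<Phi> z0"] by (simp add: D_def)
    qed (use zw in \<open>auto simp: dist_commute\<close>)
    then have "(N + c) * dist (\<Phi> z) (\<Phi> w) \<le> (N + c) * ((D + c) * dist z w)"
      using DN c by (intro mult_left_mono) (auto simp: dist_norm)
    also have "\<dots> = ((N + c) * (D + c)) * dist z w" by simp
    also have "\<dots> \<le> (D * N + e) * dist z w" using prod by (intro mult_right_mono) auto
    finally have "(N + c) * dist (\<Phi> z) (\<Phi> w) \<le> (D * N + e) * dist z w" .
    moreover have "\<bar>V (\<Phi> z) - V (\<Phi> w)\<bar> \<le> (N + c) * dist (\<Phi> z) (\<Phi> w)"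
      using zw d3(2) \<Phi>_props(1) by (intro d1(2)) (auto simp: d_def)
    ultimately show "\<bar>V (\<Phi> z) - V (\<Phi> w)\<bar> \<le> (cmod (deriv \<Phi> z0) * sc_norm k (\<Phi> z0) + e) * dist z w"
      by (simp add: D_def N_def)
  qed
qed


text \<open>Both ends leave the compact set where \<open>V \<ge> \<epsilon> * B\<close>, so the
  height climbs from below \<open>\<epsilon> * B\<close> to \<open>B\<close> at \<open>v0\<close>
  and falls back again. In the metric \<open>dens\<close> this costs at least
  \<open>1 - \<epsilon>\<close>. Avoiding the marked points keeps the density continuous along the
  curve.\<close>

lemma line_integral_dens_ge:
  assumes cont: "continuous_on {- L<..<L} g" and gS: "\<And>t. t \<in> {- L<..<L} \<Longrightarrow> g t \<in> S"
    and avoid: "\<And>t. t \<in> {- L<..<L} \<Longrightarrow> g t \<noteq> P \<i> \<and> g t \<noteq> P (\<i> * of_real k)"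
    and v0: "- L < v0" "v0 < L" "V (\<Phi> (g v0)) = B"
    and ends: "\<And>C. compact C \<Longrightarrow> C \<subseteq> S \<Longrightarrow> \<exists>v1 v2. - L < v1 \<and> v1 < v0 \<and> v0 < v2 \<and> v2 < L \<and> g v1 \<notin> C \<and> g v2 \<notin> C"
    and rect: "loc_rectifiable ({- L<..<L}, g)"
  shows "1 \<le> line_integral_ds dens ({- L<..<L}, g)"
proof -
  have main: "ennreal (1 - \<epsilon>) \<le> line_integral_ds dens ({- L<..<L}, g)" if eps: "0 < \<epsilon>" for \<epsilon>
  proof -
    define C where "C = P ` {w. 0 < Im w \<and> \<epsilon> * B \<le> V w}"
    have "continuous_on {w. 0 < Im w \<and> \<epsilon> * B \<le> V w} P"
      using P_props(3) by (rule continuous_on_subset[OF holomorphic_on_imp_continuous_on]) (auto simp: halfplane_def)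
    then have "compact C" unfolding C_def
      using AB_pos eps by (intro compact_continuous_image V_superlevel_compact) auto
    moreover have "C \<subseteq> S" using P_props(1) by (auto simp: C_def)
    ultimately obtain v1 v2 where v: "- L < v1" "v1 < v0" "v0 < v2" "v2 < L" "g v1 \<notin> C" "g v2 \<notin> C"
      using ends by metis
    have I: "{v1..v2} \<subseteq> {- L<..<L}" using v by auto
    define vv where "vv t = V (\<Phi> (g t))" for t
    have small: "vv t < \<epsilon> * B" if "t \<in> {v1..v2}" "g t \<notin> C" for t
    proof (rule ccontr)
      assume "\<not> vv t < \<epsilon> * B"
      then have "\<Phi> (g t) \<in> {w. 0 < Im w \<and> \<epsilon> * B \<le> V w}" using gS \<Phi>_props(1) that I by (auto simp: vv_def)
      then have "P (\<Phi> (g t)) \<in> C" unfolding C_def by (rule imageI)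
      then show False using that \<Phi>_props(2)[OF gS] I by auto
    qed
    have fin: "var_on g v1 v2 < \<infinity>" using rect I v by (auto simp: loc_rectifiable_def)
    have cg: "continuous_on {v1..v2} g" using cont I by (rule continuous_on_subset)
    have v12: "v1 \<le> v2" using v by simp
    define R where "R t = cmod (deriv \<Phi> (g t)) * sc_norm k (\<Phi> (g t)) / (2 * B)" for t
    have ne: "\<Phi> (g t) \<noteq> \<i>" "\<Phi> (g t) \<noteq> \<i> * of_real k" "g t \<in> S" if "t \<in> {v1..v2}" for t
    proof -
      have t: "t \<in> {- L<..<L}" using I that by blast
      show "g t \<in> S" using gS[OF t] .
      then show "\<Phi> (g t) \<noteq> \<i>" "\<Phi> (g t) \<noteq> \<i> * of_real k" using avoid[OF t] \<Phi>_props(2)[of "g t"] by metis+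
    qed
    have dh: "deriv \<Phi> holomorphic_on S" using \<Phi>_props(3) S_open by (rule holomorphic_deriv)
    have Rc: "continuous_on {v1..v2} R"
    proof -
      have c1: "continuous_on {v1..v2} (\<lambda>t. deriv \<Phi> (g t))" "continuous_on {v1..v2} (\<lambda>t. \<Phi> (g t))"
        using ne(3) by (auto intro!: continuous_on_compose2[OF holomorphic_on_imp_continuous_on[OF dh] cg]
          continuous_on_compose2[OF holomorphic_on_imp_continuous_on[OF \<Phi>_props(3)] cg])
      have "continuous_on ((\<lambda>t. \<Phi> (g t)) ` {v1..v2}) (sc_norm k)"
        using ne \<Phi>_props(1) by (intro continuous_at_imp_continuous_on) (auto intro!: sc_norm_isCont)
      from continuous_on_compose2[OF this c1(2)] have "continuous_on {v1..v2} (\<lambda>t. sc_norm k (\<Phi> (g t)))" by simp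
      then show ?thesis unfolding R_def[abs_def] using c1(1) AB_pos by (intro continuous_intros) auto
    qed
    \<comment> \<open>Unfolding the height at the time \<open>v0\<close> when it is maximal turns the rise and the subsequent fall
      into a single increase by almost \<open>2 * B\<close>.\<close>
    define w where "w t = (if t \<le> v0 then vv t else 2 * B - vv t) / (2 * B)" for t
    have "ennreal (w v2 - w v1) \<le> arc_integral dens g v1 v2"
    proof (rule arc_integral_ge[OF v12 fin cg dens_measurable Rc])
      show "0 \<le> R t" for t using AB_pos by (simp add: R_def sc_norm_def)
      show "dens (g t) = ennreal (R t)" if "t \<in> {v1..v2}" for t using ne[OF that] by (simp add: dens_def R_def)
      fix t0 e :: real assume t0: "t0 \<in> {v1..v2}" and e: "0 < e"
      define M where "M = cmod (deriv \<Phi> (g t0)) * sc_norm k (\<Phi> (g t0)) + e * (2 * B)"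
      have M: "M / (2 * B) = R t0 + e" using AB_pos by (simp add: M_def R_def add_divide_distrib)
      have M0: "0 \<le> M" using AB_pos e by (simp add: M_def sc_norm_def)
      obtain d where d: "0 < d" "\<And>z w. z \<in> S \<Longrightarrow> w \<in> S \<Longrightarrow> dist z (g t0) < d \<Longrightarrow> dist w (g t0) < d \<Longrightarrow>
          \<bar>V (\<Phi> z) - V (\<Phi> w)\<bar> \<le> M * dist z w"
        using V\<Phi>_lipschitz[OF ne(3,1,2)[OF t0], of "e * (2 * B)"] e AB_pos unfolding M_def by auto
      obtain d' where d': "0 < d'" "\<And>t. t \<in> {v1..v2} \<Longrightarrow> dist t t0 < d' \<Longrightarrow> dist (g t) (g t0) < d"
        using cg t0 d(1) unfolding continuous_on_iff by metis
      have "w t - w s \<le> (R t0 + e) * enn2real (var_on g s t)"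
        if st: "v1 \<le> s" "s \<le> t0" "t0 \<le> t" "t \<le> v2" "t - s < d'" for s t
      proof -
        have step: "\<bar>vv p - vv q\<bar> \<le> M * enn2real (var_on g p q)" if pq: "s \<le> p" "p \<le> q" "q \<le> t" for p q
        proof -
          have pI: "p \<in> {v1..v2}" "q \<in> {v1..v2}" "dist p t0 < d'" "dist q t0 < d'"
            using pq st by (auto simp: dist_real_def)
          have "\<bar>vv p - vv q\<bar> \<le> M * dist (g p) (g q)" unfolding vv_def
            using pI by (intro d(2) d'(2) ne(3))
          also have "dist (g p) (g q) \<le> enn2real (var_on g p q)"
          proof -
            have "ennreal (dist (g p) (g q)) \<le> var_on g p q" using pq by (intro dist_le_var) auto
            moreover have "var_on g p q < \<infinity>" using var_fin[OF v12 fin cg, of p q] pI by auto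
            ultimately have "enn2real (ennreal (dist (g p) (g q))) \<le> enn2real (var_on g p q)" by (intro enn2real_mono) auto
            then show ?thesis by simp
          qed
          finally show ?thesis using M0 by (simp add: mult_left_mono)
        qed
        have "w t - w s \<le> M * enn2real (var_on g s t) / (2 * B)"
        \<comment> \<open>The unfolding switches branches strictly after \<open>v0\<close>, so
          \<open>s\<close> and \<open>t\<close> use different branches exactly if
          \<open>s \<le> v0 < t\<close>; then the rise before \<open>v0\<close> and the fall after
          it are estimated separately.\<close>
        proof (cases "v0 \<in> {s..<t}")
          case True
          have "var_on g s t = var_on g s v0 + var_on g v0 t" using True by (intro var_add) auto
          moreover have "var_on g s v0 < \<infinity>" "var_on g v0 t < \<infinity>"
            using var_fin[OF v12 fin cg, of s v0] var_fin[OF v12 fin cg, of v0 t] True st by auto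
          ultimately have "enn2real (var_on g s t) = enn2real (var_on g s v0) + enn2real (var_on g v0 t)"
            by (simp add: enn2real_plus)
          moreover have "w t - w s = ((vv v0 - vv t) + (vv v0 - vv s)) / (2 * B)"
            using True v0(3) AB_pos by (simp add: w_def vv_def field_simps)
          ultimately show ?thesis using step[of s v0] step[of v0 t] True AB_pos
            by (auto simp: distrib_left intro!: divide_right_mono)
        next
          case False
          then have "w t - w s \<le> \<bar>vv s - vv t\<bar> / (2 * B)" using st AB_pos
            by (auto simp: w_def diff_divide_distrib[symmetric] intro!: divide_right_mono)
          also have "\<dots> \<le> M * enn2real (var_on g s t) / (2 * B)" using step[of s t] st AB_pos by (intro divide_right_mono) auto
          finally show ?thesis .
        qed
        then show ?thesis using M by (simp add: times_divide_eq_left[symmetric] del: times_divide_eq_left)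
      qed
      then show "\<exists>d>0. \<forall>s t. v1 \<le> s \<longrightarrow> s \<le> t0 \<longrightarrow> t0 \<le> t \<longrightarrow> t \<le> v2 \<longrightarrow> t - s < d
        \<longrightarrow> w t - w s \<le> (R t0 + e) * enn2real (var_on g s t)" using d'(1) by blast
    qed
    moreover have "1 - \<epsilon> \<le> w v2 - w v1"
    proof -
      have "vv v1 < \<epsilon> * B" "vv v2 < \<epsilon> * B" using small v by auto
      moreover have "w v2 - w v1 = (2 * B - (vv v1 + vv v2)) / (2 * B)" using v by (simp add: w_def diff_divide_distrib add_divide_distrib)
      moreover have "1 - \<epsilon> = (2 * B - (\<epsilon> * B + \<epsilon> * B)) / (2 * B)" using AB_pos by (simp add: diff_divide_distrib)
      ultimately show ?thesis using AB_pos by (auto intro!: divide_right_mono)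
    qed
    ultimately have "ennreal (1 - \<epsilon>) \<le> arc_integral dens g v1 v2" by (meson ennreal_leI order_trans)
    also have "\<dots> \<le> line_integral_ds dens ({- L<..<L}, g)"
      unfolding line_integral_ds_def using I v12 by (intro SUP_upper2[of "(v1, v2)"]) auto
    finally show ?thesis .
  qed
  show ?thesis
  proof (rule ccontr)
    assume "\<not> ?thesis"
    then have l: "line_integral_ds dens ({- L<..<L}, g) < 1" by simp
    then obtain r where r: "0 \<le> r" "line_integral_ds dens ({- L<..<L}, g) = ennreal r"
      by (cases "line_integral_ds dens ({- L<..<L}, g)") auto
    then have "r < 1" using l by simp
    then show False using main[of "(1 - r) / 2"] r by (simp add: field_simps)
  qed
qed

end

section \<open>Comparison of moduli and the resulting distortion bound\<close>

lemma modulus_image_crosscuts_le: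
  assumes X: "slit_chart k F Fh S \<Phi> P" and Y: "slit_chart k' F' Fh' S' \<Phi>' P'"
    and f: "homeomorphism S S' f g"
    and fx: "f (P (\<i> * of_real k)) = P' (\<i> * of_real k')" and fy: "f (P \<i>) = P' \<i>"
  shows "modulus (curve_image f (crosscut (slit_chart.ccut k F P) (slit_map.B k) p ` {0<..<slit_map.A k}))
      \<le> ennreal (slit_map.A k' / (2 * slit_map.B k'))"
proof -
  interpret X: slit_chart k F Fh S \<Phi> P by (rule X)
  interpret Y: slit_chart k' F' Fh' S' \<Phi>' P' by (rule Y)
  have fS: "continuous_on S f" "f ` S = S'" "continuous_on S' g" "g ` S' = S"
    "\<And>z. z \<in> S \<Longrightarrow> g (f z) = z" "\<And>w. w \<in> S' \<Longrightarrow> f (g w) = w"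
    using f by (auto simp: homeomorphism_def)
  have "admissible (curve_image f (crosscut X.ccut X.B p ` {0<..<X.A})) Y.dens"
    unfolding admissible_def
  proof (intro conjI ballI impI)
    show "Y.dens \<in> borel_measurable borel" by (rule Y.dens_measurable)
    fix c assume "c \<in> curve_image f (crosscut X.ccut X.B p ` {0<..<X.A})" and lr: "loc_rectifiable c"
    then obtain u where u: "0 < u" "u < X.A" and c: "c = (fst (crosscut X.ccut X.B p u), f \<circ> snd (crosscut X.ccut X.B p u))"
      by (auto simp: curve_image_def)
    define h where "h = f \<circ> snd (crosscut X.ccut X.B p u)"
    have ch: "c = ({- X.B<..<X.B}, h)" unfolding c h_def by (simp add: crosscut_def)
    have rc: "Complex u t \<in> rect X.A X.B" if "t \<in> {- X.B<..<X.B}" for t using that u by (simp add: rect_def)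
    have h: "h t = f (X.ccut (Complex u t))" if "t \<in> {- X.B<..<X.B}" for t using that by (simp add: h_def crosscut_def)
    have cS: "X.ccut (Complex u t) \<in> S" if "t \<in> {- X.B<..<X.B}" for t using X.ccut_props(1)[OF rc[OF that]] .
    have fin: "f z \<in> S'" if "z \<in> S" for z using that fS(2) by blast
    have gin: "g z \<in> S" if "z \<in> S'" for z using that fS(4) by blast
    \<comment> \<open>The segment joining the marked points of the target, on which the height is
      \<open>B\<close>. Its preimage under \<open>f\<close> is a connected set joining the marked
      points of the source.\<close>
    define J where "J = P' ` closed_segment (\<i> * of_real k') \<i>"
    have seg: "z \<in> closed_segment (\<i> * of_real k') \<i> \<Longrightarrow> Re z = 0 \<and> k' \<le> Im z \<and> Im z \<le> 1" for z
      using Y.k2 by (auto simp: closed_segment_same_Re closed_segment_eq_real_ivl split: if_splits)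
    have "continuous_on (closed_segment (\<i> * of_real k') \<i>) P'"
      using Y.P_props(3) seg Y.k1 by (intro continuous_on_subset[OF holomorphic_on_imp_continuous_on]) (force simp: halfplane_def)+
    then have Jc: "connected J" unfolding J_def by (intro connected_continuous_image connected_segment)
    have JS: "J \<subseteq> S'" using Y.P_props(1) seg Y.k1 by (force simp: J_def)
    have "connected (g ` J)" using Jc fS(3) JS by (meson connected_continuous_image continuous_on_subset)
    moreover have "g ` J \<subseteq> S" using JS gin by blast
    moreover have "P (\<i> * of_real k) \<in> g ` J"
    proof -
      have "P (\<i> * of_real k) = g (P' (\<i> * of_real k'))" using fx fS(5)[of "P (\<i> * of_real k)"] X.P_props(1) X.k1 by simp
      then show ?thesis by (auto simp: J_def)
    qed
    moreover have "P \<i> \<in> g ` J"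
    proof -
      have "P \<i> = g (P' \<i>)" using fy fS(5)[of "P \<i>"] X.P_props(1)[of \<i>] by simp
      then show ?thesis by (auto simp: J_def)
    qed
    ultimately obtain v0 where v0: "- X.B < v0" "v0 < X.B" "X.ccut (Complex u v0) \<in> g ` J"
      using X.ccut_meets_connected[OF _ _ _ _ u] by blast
    then obtain q where q: "q \<in> closed_segment (\<i> * of_real k') \<i>" "X.ccut (Complex u v0) = g (P' q)" by (auto simp: J_def)
    have "h v0 = P' q" using h[of v0] v0 q fS(6)[of "P' q"] JS by (auto simp: J_def)
    moreover have "\<Phi>' (P' q) = q" using Y.P_props(2) seg[OF q(1)] Y.k1 by auto
    ultimately have V0: "Y.V (\<Phi>' (h v0)) = Y.B" using Y.V_segment seg[OF q(1)] by simp
    show "1 \<le> line_integral_ds Y.dens c" unfolding ch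
    proof (rule Y.line_integral_dens_ge[where g = h, OF _ _ _ v0(1,2) V0])
      have "continuous_on {- X.B<..<X.B} (snd (crosscut X.ccut X.B p u))"
        using crosscut_is_curve[OF X.AB_pos X.ccut_holomorphic u] by (simp add: is_curve_def crosscut_def)
      then show "continuous_on {- X.B<..<X.B} h" unfolding h_def
        using cS by (intro continuous_on_compose continuous_on_subset[OF fS(1)]) (auto simp: crosscut_def)
      show "h t \<in> S'" if "t \<in> {- X.B<..<X.B}" for t using h[OF that] fin cS[OF that] by simp
      show "h t \<noteq> P' \<i> \<and> h t \<noteq> P' (\<i> * of_real k')" if t: "t \<in> {- X.B<..<X.B}" for t
      proof -
        have s: "\<Phi> (X.ccut (Complex u t)) \<in> slitplane k" using X.ccut_props(2)[OF rc[OF t]] .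
        have "X.ccut (Complex u t) \<noteq> P \<i>" "X.ccut (Complex u t) \<noteq> P (\<i> * of_real k)"
          using s X.P_props(2)[of \<i>] X.P_props(2)[of "\<i> * of_real k"] X.k1 by (auto simp: slitplane_def)
        then show ?thesis using fS(5)[OF cS[OF t]] fS(5)[of "P \<i>"] fS(5)[of "P (\<i> * of_real k)"]
          X.P_props(1)[of \<i>] X.P_props(1)[of "\<i> * of_real k"] X.k1 h[OF t] fx fy by (metis Im_i_times Re_complex_of_real imaginary_unit.simps(2) zero_less_one)
      qed
      show "loc_rectifiable ({- X.B<..<X.B}, h)" using lr ch by simp
      fix C assume C: "compact C" "C \<subseteq> S'"
      have "compact (g ` C)" using C fS(3) by (meson compact_continuous_image continuous_on_subset)
      moreover have "g ` C \<subseteq> S" using C gin by blast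
      ultimately obtain e where e: "0 < e" "\<And>v. - X.B < v \<Longrightarrow> v < X.B \<Longrightarrow> X.B - \<bar>v\<bar> < e \<Longrightarrow> X.ccut (Complex u v) \<notin> g ` C"
        using X.ccut_leaves_compact[OF _ _ u] by blast
      have out: "h v \<notin> C" if "- X.B < v" "v < X.B" "X.B - \<bar>v\<bar> < e" for v
      proof
        assume "h v \<in> C"
        moreover have "g (h v) = X.ccut (Complex u v)" using h[of v] fS(5)[OF cS[of v]] that by simp
        ultimately show False using e(2)[OF that] by (metis imageI)
      qed
      \<comment> \<open>A parameter above \<open>m\<close> works together with its negative: both
        lie within \<open>e\<close> of the ends and enclose \<open>v0\<close>.\<close>
      define m where "m = max \<bar>v0\<bar> (X.B - e)"
      have "m < X.B" using v0 e by (auto simp: m_def)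
      then obtain v where v: "m < v" "v < X.B" using dense by blast
      then have "\<bar>v0\<bar> < v" "X.B - v < e" by (auto simp: m_def)
      then show "\<exists>v1 v2. - X.B < v1 \<and> v1 < v0 \<and> v0 < v2 \<and> v2 < X.B \<and> h v1 \<notin> C \<and> h v2 \<notin> C"
        using out[of v] out[of "- v"] v by (intro exI[of _ "- v"] exI[of _ v]) auto
    qed
  qed
  then have "modulus (curve_image f (crosscut X.ccut X.B p ` {0<..<X.A})) \<le> (\<integral>\<^sup>+ z. (Y.dens z)\<^sup>2 \<partial>lborel)"
    unfolding modulus_def by (intro INF_lower) simp
  also have "\<dots> \<le> ennreal (Y.A / (2 * Y.B))" by (rule Y.dens_sq_integral)
  finally show ?thesis .
qed

lemma slit_chart_exists:
  assumes "0 < k" "k < 1" "open S" "biholo S halfplane \<Phi> P"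
  obtains F Fh where "slit_chart k F Fh S \<Phi> P"
proof -
  obtain F Fh where "slit_map k F Fh"
    using sc_primitive_exists[OF assms(1,2)] assms(1,2) unfolding slit_map_def by metis
  then show ?thesis using that assms by (simp add: slit_chart_def slit_chart_axioms_def)
qed

text \<open>\<open>A\<close> is the complete elliptic integral for the modulus
  \<open>sqrt (1 - k\<^sup>2)\<close> and \<open>B\<close> the one for \<open>k\<close>, so their
  quotient is the one in \<open>mu\<close>.\<close>

lemma (in slit_map) aspect_eq_mu: "A / (2 * B) = mu k / pi"
proof -
  have "k\<^sup>2 < 1" using k1 k2 by (simp add: power_less_one_iff)
  then have k: "0 < sqrt (1 - k\<^sup>2)" "sqrt (1 - k\<^sup>2) < 1" using k1 by auto
  have "ellK (sqrt (1 - k\<^sup>2)) = A" using ellK_eq_agmI(1)[OF k] k1 \<open>k\<^sup>2 < 1\<close> by (simp add: A_def)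
  then show ?thesis by (simp add: mu_def B_def)
qed

context
  fixes K :: real and S S' :: "complex set" and f g :: "complex \<Rightarrow> complex"
    and k k' :: real and F Fh F' Fh' \<Phi> P \<Phi>' P' :: "complex \<Rightarrow> complex"
  assumes K: "1 \<le> K" and qc: "quasiconformal K S S' f" and homeo: "homeomorphism S S' f g"
    and X: "slit_chart k F Fh S \<Phi> P" and Y: "slit_chart k' F' Fh' S' \<Phi>' P'"
    and fx: "f (P (\<i> * of_real k)) = P' (\<i> * of_real k')" and fy: "f (P \<i>) = P' \<i>"
begin

interpretation X: slit_chart k F Fh S \<Phi> P by (rule X)
interpretation Y: slit_chart k' F' Fh' S' \<Phi>' P' by (rule Y)

lemma qc_modulus:
  assumes "\<And>c. c \<in> \<Gamma> \<Longrightarrow> is_curve c \<and> snd c ` fst c \<subseteq> S"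
  shows "modulus \<Gamma> / ennreal K \<le> modulus (curve_image f \<Gamma>)" "modulus (curve_image f \<Gamma>) \<le> ennreal K * modulus \<Gamma>"
  using qc assms unfolding quasiconformal_def by auto

text \<open>The lower bound for the crosscuts of the source and the upper bound for their images
  enclose the left inequality in the definition of \<open>quasiconformal\<close>.\<close>

lemma qc_mu_le_source: "mu k \<le> K * mu k'"
proof -
  let ?\<Gamma> = "crosscut X.ccut X.B (P \<i>) ` {0<..<X.A}"
  have c: "is_curve c \<and> snd c ` fst c \<subseteq> S" if "c \<in> ?\<Gamma>" for c
  proof -
    obtain u where u: "0 < u" "u < X.A" "c = crosscut X.ccut X.B (P \<i>) u" using \<open>c \<in> ?\<Gamma>\<close> by auto
    show ?thesis using crosscut_is_curve[OF X.AB_pos X.ccut_holomorphic u(1,2)] u X.ccut_props(1)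
      by (auto simp: crosscut_def rect_def)
  qed
  have "ennreal (mu k / pi) \<le> modulus ?\<Gamma>"
    using modulus_crosscuts_ge[OF X.AB_pos X.ccut_holomorphic X.ccut_inj] X.aspect_eq_mu by simp
  then have "ennreal (mu k / pi) / ennreal K \<le> modulus ?\<Gamma> / ennreal K" by (rule divide_right_mono_ennreal)
  also have "\<dots> \<le> modulus (curve_image f ?\<Gamma>)" by (rule qc_modulus(1)) (rule c)
  also have "\<dots> \<le> ennreal (mu k' / pi)"
    using modulus_image_crosscuts_le[OF X Y homeo fx fy] Y.aspect_eq_mu by simp
  finally have "ennreal (mu k / pi / K) \<le> ennreal (mu k' / pi)"
    using K mu_pos[OF X.k1 X.k2] by (simp add: divide_ennreal)
  then have "mu k / pi / K \<le> mu k' / pi" using mu_pos[OF Y.k1 Y.k2] by (simp add: ennreal_le_iff)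
  then show ?thesis using K by (simp add: field_simps)
qed

text \<open>The same argument for \<open>g\<close>. The definition speaks of curve families in the
  source only, so the crosscuts of the target are pulled back by \<open>g\<close>; \<open>f\<close>
  maps this family exactly onto the original one, to which the right inequality of the definition
  applies.\<close>

lemma qc_mu_le_target: "mu k' \<le> K * mu k"
proof -
  let ?\<Gamma> = "crosscut Y.ccut Y.B (P' \<i>) ` {0<..<Y.A}"
  have hm: "continuous_on S' g" "g ` S' = S" "\<And>w. w \<in> S' \<Longrightarrow> f (g w) = w" "\<And>z. z \<in> S \<Longrightarrow> g (f z) = z"
    using homeo by (auto simp: homeomorphism_def)
  have inS': "snd (crosscut Y.ccut Y.B (P' \<i>) u) t \<in> S'" if "0 < u" "u < Y.A" for u t
    using that Y.ccut_props(1)[of "Complex u t"] Y.P_props(1)[of \<i>] by (simp add: crosscut_def rect_def)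
  have c: "is_curve c \<and> snd c ` fst c \<subseteq> S" if "c \<in> curve_image g ?\<Gamma>" for c
  proof -
    obtain u where u: "0 < u" "u < Y.A"
      and ce: "c = (fst (crosscut Y.ccut Y.B (P' \<i>) u), g \<circ> snd (crosscut Y.ccut Y.B (P' \<i>) u))"
      using \<open>c \<in> _\<close> by (auto simp: curve_image_def)
    note cr = crosscut_is_curve[OF Y.AB_pos Y.ccut_holomorphic u, of "P' \<i>"]
    have "continuous_on (fst c) (snd c)" unfolding ce fst_conv snd_conv
      using cr inS'[OF u] by (intro continuous_on_compose continuous_on_subset[OF hm(1)]) (auto simp: is_curve_def)
    then show ?thesis using cr inS'[OF u] hm(2) by (auto simp: ce is_curve_def)
  qed
  have "curve_image f (curve_image g ?\<Gamma>) = ?\<Gamma>"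
  proof -
    have "(fst c, f \<circ> (g \<circ> snd c)) = c" if "c \<in> ?\<Gamma>" for c
      using that inS' hm(3) by (auto simp: prod_eq_iff fun_eq_iff)
    then have "(\<lambda>c. (fst c, f \<circ> (g \<circ> snd c))) ` ?\<Gamma> = (\<lambda>c. c) ` ?\<Gamma>" by (rule image_cong[OF refl])
    then show ?thesis by (simp add: curve_image_def image_image)
  qed
  have "ennreal (mu k' / pi) \<le> modulus ?\<Gamma>"
    using modulus_crosscuts_ge[OF Y.AB_pos Y.ccut_holomorphic Y.ccut_inj] Y.aspect_eq_mu by simp
  also have "modulus ?\<Gamma> \<le> ennreal K * modulus (curve_image g ?\<Gamma>)"
    using qc_modulus(2)[of "curve_image g ?\<Gamma>", OF c] \<open>curve_image f (curve_image g ?\<Gamma>) = ?\<Gamma>\<close> by simp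
  also have "\<dots> \<le> ennreal K * ennreal (mu k / pi)"
  proof (rule mult_left_mono)
    have "g (P' (\<i> * of_real k')) = P (\<i> * of_real k)" "g (P' \<i>) = P \<i>"
      using hm(4)[of "P (\<i> * of_real k)"] hm(4)[of "P \<i>"] X.P_props(1) X.k1 fx fy by auto
    then show "modulus (curve_image g ?\<Gamma>) \<le> ennreal (mu k / pi)"
      using modulus_image_crosscuts_le[OF Y X homeomorphism_symD[OF homeo]] X.aspect_eq_mu by simp
  qed simp
  also have "\<dots> = ennreal (K * (mu k / pi))" using K mu_pos[OF X.k1 X.k2] by (intro ennreal_mult[symmetric]) auto
  finally have "mu k' / pi \<le> K * (mu k / pi)" using K mu_pos[OF X.k1 X.k2] by (simp add: ennreal_le_iff)
  then show ?thesis by (simp add: divide_simps)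
qed

end

lemma qc_schwarz:
  fixes \<alpha> \<beta> K :: real
  assumes ab: "0 < \<alpha>" "\<alpha> \<le> pi" "0 < \<beta>" "\<beta> \<le> pi" and K: "1 \<le> K"
    and qc: "quasiconformal K (sector \<alpha>) (sector \<beta>) f"
    and x: "x \<in> sector \<alpha>" and y: "y \<in> sector \<alpha>" and xy: "x \<noteq> y"
  defines "r \<equiv> pseudo_hyp (zpow (pi / \<alpha>) x) (zpow (pi / \<alpha>) y)"
    and "r' \<equiv> pseudo_hyp (zpow (pi / \<beta>) (f x)) (zpow (pi / \<beta>) (f y))"
  shows "0 < r" "0 < r'" "r' \<le> cK K * r powr (1 / K)" "r \<le> cK K * r' powr (1 / K)"
proof -
  obtain g where homeo: "homeomorphism (sector \<alpha>) (sector \<beta>) f g" using qc by (auto simp: quasiconformal_def)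
  then have f: "f x \<in> sector \<beta>" "f y \<in> sector \<beta>" "f x \<noteq> f y" using x y xy unfolding homeomorphism_def by (blast, blast, metis)
  note cx = sector_chart[OF ab(1,2) x y xy, folded r_def] and cy = sector_chart[OF ab(3,4) f, folded r'_def]
  show r: "0 < r" and r': "0 < r'" by (rule cx(1), rule cy(1))
  define k k' where "k = (1 - r) / (1 + r)" and "k' = (1 - r') / (1 + r')"
  have k: "0 < k" "k < 1" "0 < k'" "k' < 1" using cx(1,2) cy(1,2) by (auto simp: k_def k'_def)
  obtain \<Phi> P where P: "biholo (sector \<alpha>) halfplane \<Phi> P" "\<Phi> x = \<i> * of_real k" "\<Phi> y = \<i>" using cx(3) unfolding k_def by blast
  obtain \<Phi>' P' where P': "biholo (sector \<beta>) halfplane \<Phi>' P'" "\<Phi>' (f x) = \<i> * of_real k'" "\<Phi>' (f y) = \<i>"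
    using cy(3) unfolding k'_def by blast
  obtain F Fh where X: "slit_chart k F Fh (sector \<alpha>) \<Phi> P" using slit_chart_exists[OF k(1,2) open_sector[OF ab(1,2)] P(1)] .
  obtain F' Fh' where Y: "slit_chart k' F' Fh' (sector \<beta>) \<Phi>' P'"
    using slit_chart_exists[OF k(3,4) open_sector[OF ab(3,4)] P'(1)] .
  have e: "P (\<i> * of_real k) = x" "P \<i> = y" "P' (\<i> * of_real k') = f x" "P' \<i> = f y"
    using P P' x y f(1,2) unfolding biholo_def by metis+
  have fx: "f (P (\<i> * of_real k)) = P' (\<i> * of_real k')" "f (P \<i>) = P' \<i>" by (simp_all add: e)
  have m: "mu k \<le> K * mu k'" "mu k' \<le> K * mu k"
    by (rule qc_mu_le_source[OF K qc homeo X Y fx], rule qc_mu_le_target[OF K qc homeo X Y fx])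
  have pos: "0 < mu r" "0 < mu r'" using mu_pos cx(1,2) cy(1,2) by auto
  \<comment> \<open>Passing to complements inverts \<open>mu\<close> up to a common factor, so
    \<open>mu k' \<le> K * mu k\<close> becomes \<open>mu r \<le> K * mu r'\<close>, the inequality
    that bounds \<open>r'\<close> by \<open>r\<close>.\<close>
  have mk: "mu k = (pi\<^sup>2 / 2) / mu r" "mu k' = (pi\<^sup>2 / 2) / mu r'"
    using mu_complement[OF cx(1,2)] mu_complement[OF cy(1,2)] pos unfolding k_def k'_def
    by (metis less_irrefl nonzero_mult_div_cancel_left)+
  have "mu r' \<le> K * mu r" "mu r \<le> K * mu r'"
    using m pos unfolding mk by (simp_all add: divide_simps)
  then show "r' \<le> cK K * r powr (1 / K)" "r \<le> cK K * r' powr (1 / K)"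
    using schwarz_bound_of_mu_le[OF K] cx(1,2) cy(1,2) by blast+
qed

theorem theorem5p10:
  fixes \<alpha> \<beta> K :: real and f :: "complex \<Rightarrow> complex" and x y :: complex
  assumes "0 < \<alpha>" "\<alpha> \<le> pi" "0 < \<beta>" "\<beta> \<le> pi" "1 \<le> K"
    and "quasiconformal K (sector \<alpha>) (sector \<beta>) f"
    and "f ` sector \<alpha> = sector \<beta>"
    and "x \<in> sector \<alpha>" "y \<in> sector \<alpha>"
  shows "\<beta> / (cK K powr K * pi * sin (\<beta> / 2)) * wmetric (sector \<alpha>) x y powr K
           \<le> wmetric (sector \<beta>) (f x) (f y) \<and>
         wmetric (sector \<beta>) (f x) (f y)
           \<le> cK K * ((pi / \<alpha>) * sin (\<alpha> / 2)) powr (1 / K) * wmetric (sector \<alpha>) x y powr (1 / K)"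
proof (cases "x = y")
  case True
  \<comment> \<open>For equal points both distances are 0, and \<open>0 powr a = 0\<close> makes the
    two inequalities trivial.\<close>
  then show ?thesis by (simp add: wmetric_def)
next
  case False
  define r where "r = pseudo_hyp (zpow (pi / \<alpha>) x) (zpow (pi / \<alpha>) y)"
  define r' where "r' = pseudo_hyp (zpow (pi / \<beta>) (f x)) (zpow (pi / \<beta>) (f y))"
  define w w' where "w = wmetric (sector \<alpha>) x y" and "w' = wmetric (sector \<beta>) (f x) (f y)"
  define c c' where "c = pi / \<alpha> * sin (\<alpha> / 2)" and "c' = pi / \<beta> * sin (\<beta> / 2)"
  have f: "f x \<in> sector \<beta>" "f y \<in> sector \<beta>" using assms by auto
  note S = qc_schwarz[OF assms(1-6,8,9) False, folded r_def r'_def]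
  note W = wmetric_sector_bounds[OF assms(1,2,8,9), folded r_def w_def c_def]
  note W' = wmetric_sector_bounds[OF assms(3,4) f, folded r'_def w'_def c'_def]
  have c: "0 < c" "0 < c'" unfolding c_def c'_def
    using assms(1-4) by (auto intro!: divide_pos_pos mult_pos_pos sin_gt_zero)
  \<comment> \<open>Positivity is inherited from \<open>0 < r \<le> c * w\<close> and from the same
    inequality in the target.\<close>
  have w: "0 < w" "0 < w'"
    using less_le_trans[OF S(1) W(2)] less_le_trans[OF S(2) W'(2)] c by (simp_all add: zero_less_mult_iff)
  have C: "0 < cK K" using cK_char(1)[OF assms(5)] by simp
  have K: "0 \<le> 1 / K" "0 < K" using assms(5) by auto
  have "w' \<le> cK K * r powr (1 / K)" using W'(1) S(3) by simp
  also have "\<dots> \<le> cK K * (c * w) powr (1 / K)" using W(2) S(1) C K by (intro mult_left_mono powr_mono2) auto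
  also have "\<dots> = cK K * c powr (1 / K) * w powr (1 / K)" using c w by (simp add: powr_mult)
  finally have upper: "w' \<le> cK K * c powr (1 / K) * w powr (1 / K)" .
  \<comment> \<open>The lower bound is the estimate with the roles of the two sectors exchanged,
    raised to the power \<open>K\<close> and solved for \<open>w'\<close>.\<close>
  have "w \<le> cK K * r' powr (1 / K)" using W(1) S(4) by simp
  also have "\<dots> \<le> cK K * (c' * w') powr (1 / K)" using W'(2) S(2) C K by (intro mult_left_mono powr_mono2) auto
  finally have "w powr K \<le> (cK K * (c' * w') powr (1 / K)) powr K" using w K by (intro powr_mono2) auto
  also have "\<dots> = cK K powr K * (c' * w')" using C c w K by (simp add: powr_mult powr_powr)
  finally have "w powr K / (cK K powr K * c') \<le> w'" using C c by (simp add: divide_le_eq mult_ac)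
  moreover have "\<beta> / (cK K powr K * pi * sin (\<beta> / 2)) * w powr K = w powr K / (cK K powr K * c')"
    using assms(3) by (simp add: c'_def mult_ac)
  ultimately show ?thesis using upper by (simp add: w_def w'_def c_def)
qed

end
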